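(* The diversity-multiplexing tradeoff of the half-duplex parallel relay network with two relays, in which the average SNRs of the four orthogonal links are all equal to each other, with receive CSI only, is given by $$d^*(r)=\begin{cases}2-\dfrac{r}{1-r}, & 0\le r<\frac12,\\ 2(1-r), & \frac12\le r\le 1,\end{cases}$$ where in the first case the optimal tradeoff is achieved by a dynamic quantize-map-forward (QMF) scheme and in the second case it is achieved by a static QMF scheme with a half-transmit half-receive schedule. In both regimes dynamic decode-and-forward (DDF) is sub-optimal.
   Context: Network. A source S communicates with a destination D through two half-duplex relays $R_1,R_2$ over four orthogonal point-to-point links (no broadcast, no superposition, no direct S-D link). For $i=1,2$: when relay $i$ listens, $y_{r_i}=h_{sr_i}\rho^{1/2}x_{s_i}+z_{r_i}$ and $y_{d_i}=0$; when relay $i$ transmits, $y_{r_i}=0$ and $y_{d_i}=h_{r_id}\rho^{1/2}x_{r_i}+z_{d_i}$. The destination observes $(y_{d_1},y_{d_2})$. The coefficients $h_{sr_1},h_{sr_2},h_{r_1d},h_{r_2d}$ are i.i.d. $\mathcal{CN}(0,1)$, constant over a codeword (quasi-static fading) and independent across codewords, so each link has average SNR $\rho$. Noises are i.i.d. $\mathcal{CN}(0,1)$ over time and independent across receivers; transmit signals satisfy a unit power constraint. Codeword lengths are assumed large enough that an error occurs only when the channel is in outage. Receive CSI: nodes know only their incoming channel states: the source knows no channel realization; relay $i$ knows only $h_{sr_i}$ (its listen/transmit schedule may be random and may depend on its receive CSI and received signals); the destination knows the realizations (the relays can communicate theirs to it). All nodes know $\rho$ and $r$. DMT. A sequence of codes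 indexed by $\rho$, with rate $R(\rho)$ and error probability $P_e(\rho)$, achieves multiplexing gain $r$ and diversity gain $d$ if $\lim_{\rho\to\infty}R(\rho)/\log\rho=r$ and $\lim_{\rho\to\infty}\log P_e(\rho)/\log\rho=-d$. For each $r$, $d^*(r)$ is the supremum of diversity gains achievable over all families of codes. QMF schemes: relay $i$ listens for a fraction $t_i\in[0,1]$ of the block, quantizes its received signal, maps it to a random codeword, and transmits this in the remaining time (without necessarily being able to decode). For given realizations the achieved rate is at least $C-\kappa$, with $\kappa$ a constant independent of $\rho$ and of the realizations, and $$C=\sum_{i=1}^2\min\{t_i\log(1+|h_{sr_i}|^2\rho),\ (1-t_i)\log(1+|h_{r_id}|^2\rho)\}.$$ Dynamic QMF: $t_i$ is a function of relay $i$'s receive CSI $h_{sr_i}$ (and of $\rho,r$). Static QMF with half-transmit half-receive schedule: $t_1=t_2=\frac12$. DDF: each relay waits until it can decode the transmitted message, then re-encodes and transmits it in the remaining time. With $\alpha=\log(|h_{sr_1}|^2\rho)/\log\rho$ and $\gamma=\log(|h_{sr_2}|^2\rho)/\log\rho$, the listening fractions are $t_1=r/\alpha$, $t_2=r/\gamma$ (a relay whose fraction exceeds 1 never transmits). An alternative DDF strategy, also considered, splits the information into two streams of multiplexing gain $r/2$ each, sent over the two orthogonal paths, with each relay performing DDF on its own stream, i.e. $t_1=r/(2\alpha)$, $t_2=r/(2\gamma)$; communication is then in outage if even one path is in outage.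
   Formalization: Code families must keep the rate bounded away from zero (automatic for r>0; otherwise d*(0)=2 fails, by one bit over blocks of length a power of the SNR), and DDF is shown strictly sub-optimal for 0<r<1 only, since at r=0 and r=1 it attains d*(r). *)

theory Defs
  imports "HOL-Probability.Probability"
begin

section \<open>Fading and noise\<close>

datatype relay = R1 | R2

type_synonym cseq = "nat \<Rightarrow> complex"

definition seqM :: "cseq measure" where
  "seqM = Pi\<^sub>M UNIV (\<lambda>_. borel)"

definition CN01 :: "complex measure" where
  "CN01 = density lborel (\<lambda>z. ennreal (exp (- (cmod z)\<^sup>2) / pi))"

definition fading :: "(relay \<Rightarrow> complex) measure" where
  "fading = Pi\<^sub>M UNIV (\<lambda>_. CN01)"

definition noise :: "(relay \<Rightarrow> cseq) measure" where
  "noise = Pi\<^sub>M UNIV (\<lambda>_. Pi\<^sub>M UNIV (\<lambda>_. CN01))"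


section \<open>Codes\<close>

text \<open>
  A block code for the network with receive CSI. Time slots are \<open>0, \<dots>, blen - 1\<close>, messages are
  \<open>0, \<dots>, msgs - 1\<close>. The arguments of the coding functions are exactly what the respective node knows:
    \<^item> \<open>u\<close>: common randomness (the random choice of the code), known to all nodes;
    \<^item> \<open>v\<close>: private randomness of a relay;
    \<^item> \<open>enc i u w k\<close>: the symbol the source sends to relay \<open>i\<close> in slot \<open>k\<close> for message \<open>w\<close>;
    \<^item> \<open>listens i h u v k y\<close>: whether relay \<open>i\<close> listens in slot \<open>k\<close>, and \<open>tx i h u v k y\<close>: the symbol it
      sends there otherwise, where \<open>h\<close> is its incoming channel coefficient and \<open>y\<close> is what it
      received before slot \<open>k\<close> (padded with zeros from slot \<open>k\<close> on);
    \<^item> \<open>dec hs hr u y\<close>: the decoded message, where \<open>hs\<close>, \<open>hr\<close> are the source-relay and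
      relay-destination coefficients, and \<open>y i\<close> is the block received from relay \<open>i\<close>.
  A code has no access to the SNR except through being chosen depending on it.
\<close>

record code =
  blen :: nat
  msgs :: nat
  cseed :: "cseq measure"
  rseed :: "relay \<Rightarrow> cseq measure"
  enc :: "relay \<Rightarrow> cseq \<Rightarrow> nat \<Rightarrow> nat \<Rightarrow> complex"
  listens :: "relay \<Rightarrow> complex \<Rightarrow> cseq \<Rightarrow> cseq \<Rightarrow> nat \<Rightarrow> cseq \<Rightarrow> bool"
  tx :: "relay \<Rightarrow> complex \<Rightarrow> cseq \<Rightarrow> cseq \<Rightarrow> nat \<Rightarrow> cseq \<Rightarrow> complex"
  dec :: "(relay \<Rightarrow> complex) \<Rightarrow> (relay \<Rightarrow> complex) \<Rightarrow> cseq \<Rightarrow> (relay \<Rightarrow> cseq) \<Rightarrow> nat"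

text \<open>
  \<open>relay_rx L s k\<close> is what a relay with listening rule \<open>L\<close> has received before slot \<open>k\<close>,
  when \<open>s j\<close> is the signal (including noise) present at its antenna in slot \<open>j\<close>.
\<close>

primrec relay_rx :: "(nat \<Rightarrow> cseq \<Rightarrow> bool) \<Rightarrow> cseq \<Rightarrow> nat \<Rightarrow> cseq" where
  "relay_rx L s 0 = (\<lambda>_. 0)"
| "relay_rx L s (Suc k) =
     (relay_rx L s k)(k := if L k (relay_rx L s k) then s k else 0)"

definition relay_in :: "real \<Rightarrow> code \<Rightarrow> relay \<Rightarrow> nat \<Rightarrow> complex \<Rightarrow> cseq \<Rightarrow> cseq \<Rightarrow> cseq" where
  "relay_in \<rho> c i w h u z = (\<lambda>k. h * of_real (sqrt \<rho>) * enc c i u w k + z k)"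

definition dest_rx :: "real \<Rightarrow> code \<Rightarrow> nat \<Rightarrow> cseq \<Rightarrow> (relay \<Rightarrow> cseq) \<Rightarrow> (relay \<Rightarrow> complex) \<Rightarrow>
    (relay \<Rightarrow> complex) \<Rightarrow> (relay \<Rightarrow> cseq) \<Rightarrow> (relay \<Rightarrow> cseq) \<Rightarrow> relay \<Rightarrow> cseq" where
  "dest_rx \<rho> c w u v hs hr zr zd i = (\<lambda>k.
     let L = listens c i (hs i) u (v i);
         y = relay_rx L (relay_in \<rho> c i w (hs i) u (zr i)) k
     in if k < blen c \<and> \<not> L k y
        then hr i * of_real (sqrt \<rho>) * tx c i (hs i) u (v i) k y + zd i k
        else 0)"

text \<open>
  The unit power constraint is imposed on every transmitted block, i.e. for all messages, channel
  realizations, seeds and received signals; a relay cannot average its power over fading states.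
\<close>

definition valid_code :: "code \<Rightarrow> bool" where
  "valid_code c \<longleftrightarrow>
     blen c > 0 \<and> msgs c > 0 \<and>
     prob_space (cseed c) \<and> sets (cseed c) = sets seqM \<and>
     (\<forall>i. prob_space (rseed c i) \<and> sets (rseed c i) = sets seqM) \<and>
     (\<forall>i w k. (\<lambda>u. enc c i u w k) \<in> borel_measurable seqM) \<and>
     (\<forall>i k. (\<lambda>(h, u, v, y). listens c i h u v k y)
        \<in> borel \<Otimes>\<^sub>M seqM \<Otimes>\<^sub>M seqM \<Otimes>\<^sub>M seqM \<rightarrow>\<^sub>M count_space UNIV) \<and>
     (\<forall>i k. (\<lambda>(h, u, v, y). tx c i h u v k y)
        \<in> borel_measurable (borel \<Otimes>\<^sub>M seqM \<Otimes>\<^sub>M seqM \<Otimes>\<^sub>M seqM)) \<and>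
     (\<lambda>(hs, hr, u, y). dec c hs hr u y)
        \<in> Pi\<^sub>M UNIV (\<lambda>_. borel) \<Otimes>\<^sub>M Pi\<^sub>M UNIV (\<lambda>_. borel) \<Otimes>\<^sub>M seqM \<Otimes>\<^sub>M Pi\<^sub>M UNIV (\<lambda>_. seqM)
          \<rightarrow>\<^sub>M count_space UNIV \<and>
     (\<forall>i u w. w < msgs c \<longrightarrow> (\<Sum>k<blen c. (cmod (enc c i u w k))\<^sup>2) \<le> real (blen c)) \<and>
     (\<forall>i h u v s. let L = listens c i h u v; y = relay_rx L s in
        (\<Sum>k | k < blen c \<and> \<not> L k (y k). (cmod (tx c i h u v k (y k)))\<^sup>2) \<le> real (blen c))"

definition rate :: "code \<Rightarrow> real" where
  "rate c = ln (real (msgs c)) / real (blen c)"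

definition net_space :: "code \<Rightarrow> (cseq \<times> (relay \<Rightarrow> cseq) \<times> (relay \<Rightarrow> complex) \<times>
    (relay \<Rightarrow> complex) \<times> (relay \<Rightarrow> cseq) \<times> (relay \<Rightarrow> cseq)) measure" where
  "net_space c = cseed c \<Otimes>\<^sub>M Pi\<^sub>M UNIV (rseed c) \<Otimes>\<^sub>M fading \<Otimes>\<^sub>M fading \<Otimes>\<^sub>M noise \<Otimes>\<^sub>M noise"

definition err_prob :: "real \<Rightarrow> code \<Rightarrow> real" where
  "err_prob \<rho> c =
     (\<Sum>w<msgs c. measure (net_space c)
        {(u, v, hs, hr, zr, zd) \<in> space (net_space c).
           dec c hs hr u (dest_rx \<rho> c w u v hs hr zr zd) \<noteq> w}) / real (msgs c)"


section \<open>Diversity-multiplexing tradeoff\<close>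

text \<open>
  The rate has to stay bounded away from zero. For \<open>r > 0\<close> this follows from the multiplexing gain;
  for \<open>r = 0\<close> it excludes families which send, say, one bit over a block whose length is a power of
  \<open>\<rho>\<close>, and which would have arbitrarily large diversity. Positivity of the error
  probability is required because of \<open>ln 0 = 0\<close>.
\<close>

definition achieves :: "(real \<Rightarrow> code) \<Rightarrow> real \<Rightarrow> real \<Rightarrow> bool" where
  "achieves c r d \<longleftrightarrow>
     (\<forall>\<rho>. valid_code (c \<rho>)) \<and>
     ((\<lambda>\<rho>. rate (c \<rho>) / ln \<rho>) \<longlongrightarrow> r) at_top \<and>
     (\<exists>R0>0. \<forall>\<^sub>F \<rho> in at_top. R0 \<le> rate (c \<rho>)) \<and>
     (\<forall>\<^sub>F \<rho> in at_top. 0 < err_prob \<rho> (c \<rho>)) \<and>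
     ((\<lambda>\<rho>. ln (err_prob \<rho> (c \<rho>)) / ln \<rho>) \<longlongrightarrow> - d) at_top"

definition dmt_over :: "((real \<Rightarrow> code) \<Rightarrow> bool) \<Rightarrow> real \<Rightarrow> ereal" where
  "dmt_over P r = Sup {ereal d | d. \<exists>c. P c \<and> achieves c r d}"

definition dmt :: "real \<Rightarrow> ereal" where
  "dmt = dmt_over (\<lambda>_. True)"


section \<open>Relaying strategies\<close>

definition prefix :: "nat \<Rightarrow> cseq \<Rightarrow> cseq" where
  "prefix n y = (\<lambda>k. if k < n then y k else 0)"

text \<open>
  Quantize-map-forward with listening fractions \<open>t i h\<close>. A relay which has listened for \<open>n\<close> slots
  quantizes them to the index \<open>qz i n\<close>, with reconstruction \<open>rc i n\<close> at distortion at most \<open>\<Delta>\<close> per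
  symbol, and sends the codeword \<open>cb i n j\<close> of this index \<open>j\<close> in the remaining slots. The relay
  codebooks are random, with i.i.d. symbols, and independent of the source codebook. In a family
  of codes \<open>\<Delta>\<close> does not depend on the SNR, i.e. quantization is at the noise level.
\<close>

definition qmf_code :: "real \<Rightarrow> (relay \<Rightarrow> complex \<Rightarrow> real) \<Rightarrow> code \<Rightarrow> bool" where
  "qmf_code \<Delta> t c \<longleftrightarrow>
     (\<exists>(qz :: relay \<Rightarrow> nat \<Rightarrow> cseq \<Rightarrow> nat) (rc :: relay \<Rightarrow> nat \<Rightarrow> nat \<Rightarrow> cseq)
        (cb :: relay \<Rightarrow> nat \<Rightarrow> nat \<Rightarrow> nat \<Rightarrow> cseq \<Rightarrow> complex) D.
        (\<forall>i n. qz i n \<in> seqM \<rightarrow>\<^sub>M count_space UNIV) \<and>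
        (\<forall>i n y. (\<Sum>k<n. (cmod (y k - rc i n (qz i n (prefix n y)) k))\<^sup>2) \<le> \<Delta> * real n) \<and>
        prob_space.indep_vars (cseed c) (\<lambda>_. borel) (\<lambda>(i, n, j, k). cb i n j k) UNIV \<and>
        (\<forall>i n j k. distr (cseed c) borel (cb i n j k) = D) \<and>
        prob_space.indep_set (cseed c)
          (sets (vimage_algebra (space (cseed c))
             (\<lambda>u (i, n, j, k). cb i n j k u) (Pi\<^sub>M UNIV (\<lambda>_. borel))))
          (sets (vimage_algebra (space (cseed c))
             (\<lambda>u (i, w, k). enc c i u w k) (Pi\<^sub>M UNIV (\<lambda>_. borel)))) \<and>
        (\<forall>i h u v k y. let n = nat \<lfloor>t i h * real (blen c)\<rfloor> in
           (listens c i h u v k y \<longleftrightarrow> k < n) \<and>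
           (n \<le> k \<longrightarrow> tx c i h u v k y = cb i n (qz i n (prefix n y)) k u)))"

definition dynamic_qmf :: "(real \<Rightarrow> code) \<Rightarrow> bool" where
  "dynamic_qmf c \<longleftrightarrow>
     (\<exists>\<Delta> t. (\<forall>\<rho> i. t \<rho> i \<in> borel_measurable borel) \<and> (\<forall>\<rho> i h. t \<rho> i h \<in> {0..1}) \<and>
            (\<forall>\<rho>. qmf_code \<Delta> (t \<rho>) (c \<rho>)))"

definition static_half_qmf :: "(real \<Rightarrow> code) \<Rightarrow> bool" where
  "static_half_qmf c \<longleftrightarrow> (\<exists>\<Delta>. \<forall>\<rho>. qmf_code \<Delta> (\<lambda>_ _. 1/2) (c \<rho>))"

text \<open>
  Number of slots for which a DDF relay listens to a message of multiplexing gain \<open>r\<close>: the fraction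
  \<open>r / \<alpha>\<close> of the block, and the whole block if \<open>\<alpha> \<le> 0\<close> or \<open>r / \<alpha> > 1\<close>.
\<close>

definition ddf_slots :: "real \<Rightarrow> real \<Rightarrow> nat \<Rightarrow> complex \<Rightarrow> nat" where
  "ddf_slots \<rho> r T h =
     (let \<alpha> = ln ((cmod h)\<^sup>2 * \<rho>) / ln \<rho>
      in if 0 < \<alpha> \<and> r / \<alpha> \<le> 1 then nat \<lceil>r / \<alpha> * real T\<rceil> else T)"

text \<open>
  Relay \<open>i\<close> performs DDF on one of \<open>M\<close> messages of multiplexing gain \<open>r\<close>: it decodes (\<open>wd\<close>) after the
  listening phase and sends a re-encoding (\<open>renc\<close>) of its decision.
\<close>

definition ddf_relay :: "real \<Rightarrow> real \<Rightarrow> nat \<Rightarrow> relay \<Rightarrow> code \<Rightarrow> bool" where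
  "ddf_relay \<rho> r M i c \<longleftrightarrow>
     (\<exists>(wd :: complex \<Rightarrow> cseq \<Rightarrow> cseq \<Rightarrow> nat) (renc :: nat \<Rightarrow> cseq \<Rightarrow> nat \<Rightarrow> nat \<Rightarrow> complex).
        (\<forall>h u y. wd h u y < M) \<and>
        (\<forall>h u v k y. let n = ddf_slots \<rho> r (blen c) h in
           (listens c i h u v k y \<longleftrightarrow> k < n) \<and>
           (n \<le> k \<longrightarrow> tx c i h u v k y = renc n u (wd h u (prefix n y)) k)))"

definition ddf :: "real \<Rightarrow> (real \<Rightarrow> code) \<Rightarrow> bool" where
  "ddf r c \<longleftrightarrow> (\<forall>\<rho>>1. \<forall>i. ddf_relay \<rho> r (msgs (c \<rho>)) i (c \<rho>))"

text \<open>
  The alternative strategy: the message is a pair of streams, with \<open>M \<rho> i\<close> messages in the stream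
  sent via relay \<open>i\<close>.
\<close>

primrec stream :: "nat \<Rightarrow> relay \<Rightarrow> nat \<Rightarrow> nat" where
  "stream m R1 w = w div m"
| "stream m R2 w = w mod m"

definition split_ddf :: "real \<Rightarrow> (real \<Rightarrow> code) \<Rightarrow> bool" where
  "split_ddf r c \<longleftrightarrow>
     (\<exists>M. (\<forall>i. ((\<lambda>\<rho>. ln (real (M \<rho> i)) / real (blen (c \<rho>)) / ln \<rho>) \<longlongrightarrow> r / 2) at_top) \<and>
          (\<forall>\<rho>>1. msgs (c \<rho>) = M \<rho> R1 * M \<rho> R2 \<and>
             (\<forall>i. (\<forall>u k. \<forall>w<msgs (c \<rho>). \<forall>w'<msgs (c \<rho>).
                     stream (M \<rho> R2) i w = stream (M \<rho> R2) i w' \<longrightarrow>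
                     enc (c \<rho>) i u w k = enc (c \<rho>) i u w' k) \<and>
                  ddf_relay \<rho> (r / 2) (M \<rho> i) i (c \<rho>))))"

end

theory Submission
  imports Defs "HOL-Real_Asymp.Real_Asymp"
begin

text \<open>
  Upper bound. Fix the channel realizations. Replacing the noise of a relay's input by noise of the
  strength of the received signal makes the law of its output independent of the message, at a
  log-likelihood cost of \<open>ln SNR\<close> per listened slot; the same can be done in the transmit slots at
  the destination. So each path carries at most the smaller of the source-side and
  destination-side cuts, and a weak converse bounds the probability of correct decoding by the total
  cost over the two paths. The mean listening fraction of a relay is a function of its own
  source-relay channel only. Hence for typical source-relay channels the relay-destination channels
  may be faded adversarially after the fractions are known, and the cheapest fade that causes an
  outage has the exponent of the tradeoff curve. A DDF relay can in addition be made to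
  listen for too long by a mild fade of its source-relay channel, with exponent \<open>1 - \<alpha>\<close>; since its
  fraction is then \<open>r / \<alpha>\<close>, the cut at the destination becomes too narrow at a strictly
  smaller total exponent.

  Achievability. With i.i.d. codebooks on the unit disc, quantization to the integer grid and a
  decoder that accepts every message compatible up to the noise level \<open>\<rho>\<^sup>\<epsilon>\<close>, the pairwise error
  probability is about \<open>\<rho>\<close> to the power minus the block length times the sum of the path rates
  \<open>min (t \<alpha>) ((1 - t) \<beta>)\<close>. The error probability is therefore governed by the event that this sum is below
  the multiplexing gain. All parameters are adapted to \<open>\<rho>\<close> by diagonalization, because for any fixed
  block length and \<open>\<epsilon>\<close> the exponent is reached only up to a small gap.
\<close>

section \<open>Product measures and Gaussian integrals\<close>

text \<open>The obstacle in the upper bound is that a relay's schedule may be random and may depend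
  on what it hears, so the pattern of listening slots itself carries information and a cut-set bound
  with deterministic fractions does not apply. Comparing measures slot by slot respects this
  causality, and because the converse is linear in the expected cost, only the mean fraction enters.
  A weak converse suffices: an outage must merely force an error probability bounded away from 0,
  since the polynomial decay comes from the probability of the fade. Constants per slot are
  negligible against \<open>ln \<rho>\<close>, which makes crude moments and a factor 2 per slot for
  the patterns harmless; for multiplexing gain 0 the rate may stay bounded, and a separate argument
  keeps all costs small. In the achievability the blocks stay short: the pairwise error already
  decays as a power of \<open>\<rho>\<close> at fixed length, so a length of order
  \<open>1 / g\<close> beats every fading exponent up to the gap \<open>g\<close>. The exact limit
  in \<open>achieves\<close> and the positivity of the error come from applying the converse to the
  constructed codes.\<close>

lemma borel_measurable_fun_upd_UNIV [measurable (raw)]: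
  assumes "f \<in> M \<rightarrow>\<^sub>M Pi\<^sub>M UNIV N" "g \<in> M \<rightarrow>\<^sub>M N i"
  shows "(\<lambda>x. (f x)(i := g x)) \<in> M \<rightarrow>\<^sub>M Pi\<^sub>M UNIV N"
proof (rule measurable_PiM_single')
  show "(\<lambda>x. ((f x)(i := g x)) j) \<in> M \<rightarrow>\<^sub>M N j" for j
    using assms by (cases "j = i") (auto intro: measurable_compose[OF assms(1) measurable_component_singleton])
  show "(\<lambda>x. (f x)(i := g x)) \<in> space M \<rightarrow> (\<Pi>\<^sub>E i\<in>UNIV. space (N i))"
    using measurable_space[OF assms(1)] measurable_space[OF assms(2)]
    by (auto simp: space_PiM PiE_def Pi_iff)
qed

lemma measurable_merge_UNIV [measurable]:
  "(\<lambda>(u, u'). \<lambda>s. if s \<in> J then u' s else u s) \<in> Pi\<^sub>M UNIV N \<Otimes>\<^sub>M Pi\<^sub>M UNIV N \<rightarrow>\<^sub>M Pi\<^sub>M UNIV N"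
proof (rule measurable_PiM_single')
  fix j show "(\<lambda>x. (case x of (u, u') \<Rightarrow> \<lambda>s. if s \<in> J then u' s else u s) j)
      \<in> Pi\<^sub>M UNIV N \<Otimes>\<^sub>M Pi\<^sub>M UNIV N \<rightarrow>\<^sub>M N j"
    by (cases "j \<in> J") (simp_all add: case_prod_beta)
qed (auto simp: space_PiM space_pair_measure PiE_iff)

text \<open>The coordinates are independent, so overwriting those in \<open>J\<close> by an
  independent copy does not change the law. With the copy seen as fresh and the rest as fixed, this
  serves as conditioning on the coordinates outside \<open>J\<close>; \<open>J\<close> may be
  infinite.\<close>

lemma nn_integral_PiM_resample:
  assumes N: "\<And>i. prob_space (N i)" and [measurable]: "f \<in> borel_measurable (Pi\<^sub>M UNIV N)"
  shows "(\<integral>\<^sup>+u. f u \<partial>Pi\<^sub>M UNIV N) =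
    (\<integral>\<^sup>+u. \<integral>\<^sup>+u'. f (\<lambda>s. if s \<in> J then u' s else u s) \<partial>Pi\<^sub>M UNIV N \<partial>Pi\<^sub>M UNIV N)"
proof -
  interpret P: prob_space "Pi\<^sub>M UNIV N" by (intro prob_space_PiM N)
  interpret PP: pair_prob_space "Pi\<^sub>M UNIV N" "Pi\<^sub>M UNIV N" ..
  let ?t = "\<lambda>(u, u'). \<lambda>s. if s \<in> J then u' s else u s"
  have "Pi\<^sub>M UNIV N = distr (Pi\<^sub>M UNIV N \<Otimes>\<^sub>M Pi\<^sub>M UNIV N) (Pi\<^sub>M UNIV N) ?t"
  proof (rule measure_eqI_PiM_infinite[OF refl])
    fix K A assume K: "finite K" "K \<subseteq> UNIV" and A: "\<And>i. i \<in> K \<Longrightarrow> A i \<in> sets (N i)"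
    \<comment> \<open>The preimage of a cylinder is a rectangle: constraints indexed by
      \<open>K - J\<close> fall on the first copy, those indexed by \<open>K \<inter> J\<close> on
      the second.\<close>
    have "?t -` prod_emb UNIV N K (Pi\<^sub>E K A) \<inter> space (Pi\<^sub>M UNIV N \<Otimes>\<^sub>M Pi\<^sub>M UNIV N) =
      prod_emb UNIV N (K - J) (Pi\<^sub>E (K - J) A) \<times> prod_emb UNIV N (K \<inter> J) (Pi\<^sub>E (K \<inter> J) A)"
      using A[THEN sets.sets_into_space]
      by (auto simp: prod_emb_def space_PiM space_pair_measure PiE_iff Pi_iff split: if_splits)
    then have "distr (Pi\<^sub>M UNIV N \<Otimes>\<^sub>M Pi\<^sub>M UNIV N) (Pi\<^sub>M UNIV N) ?t (prod_emb UNIV N K (Pi\<^sub>E K A)) =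
       (\<Prod>i\<in>K - J. N i (A i)) * (\<Prod>i\<in>K \<inter> J. N i (A i))"
      using K A emeasure_PiM_emb[of UNIV N "K - J" A] emeasure_PiM_emb[of UNIV N "K \<inter> J" A]
      by (subst emeasure_distr)
        (auto intro!: sets_PiM_I simp: P.emeasure_pair_measure_Times N)
    also have "\<dots> = (\<Prod>i\<in>(K - J) \<union> (K \<inter> J). N i (A i))"
      using K by (intro prod.union_disjoint[symmetric]) auto
    also have "(K - J) \<union> (K \<inter> J) = K" by auto
    also have "(\<Prod>i\<in>K. N i (A i)) = Pi\<^sub>M UNIV N (prod_emb UNIV N K (Pi\<^sub>E K A))"
      using K A by (intro emeasure_PiM_emb[symmetric] N) auto
    finally show "Pi\<^sub>M UNIV N (prod_emb UNIV N K (Pi\<^sub>E K A)) =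
      distr (Pi\<^sub>M UNIV N \<Otimes>\<^sub>M Pi\<^sub>M UNIV N) (Pi\<^sub>M UNIV N) ?t (prod_emb UNIV N K (Pi\<^sub>E K A))" ..
  qed (simp, unfold_locales)
  then have "(\<integral>\<^sup>+u. f u \<partial>Pi\<^sub>M UNIV N) = (\<integral>\<^sup>+u. f u \<partial>distr (Pi\<^sub>M UNIV N \<Otimes>\<^sub>M Pi\<^sub>M UNIV N) (Pi\<^sub>M UNIV N) ?t)"
    by simp
  also have "\<dots> = (\<integral>\<^sup>+x. f (?t x) \<partial>(Pi\<^sub>M UNIV N \<Otimes>\<^sub>M Pi\<^sub>M UNIV N))"
    by (rule nn_integral_distr) simp_all
  also have "\<dots> = (\<integral>\<^sup>+u. \<integral>\<^sup>+u'. f (?t (u, u')) \<partial>Pi\<^sub>M UNIV N \<partial>Pi\<^sub>M UNIV N)"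
    by (rule P.nn_integral_fst[symmetric]) measurable
  finally show ?thesis by simp
qed

lemma nn_integral_PiM_component:
  assumes N: "\<And>i. prob_space (N i)" and [measurable]: "f \<in> borel_measurable (N i)"
  shows "(\<integral>\<^sup>+u. f (u i) \<partial>Pi\<^sub>M UNIV N) = (\<integral>\<^sup>+x. f x \<partial>N i)"
proof -
  have "(\<integral>\<^sup>+x. f x \<partial>N i) = (\<integral>\<^sup>+x. f x \<partial>distr (Pi\<^sub>M UNIV N) (N i) (\<lambda>u. u i))"
    by (subst distr_PiM_component) (auto simp: N)
  also have "\<dots> = (\<integral>\<^sup>+u. f (u i) \<partial>Pi\<^sub>M UNIV N)"
    by (rule nn_integral_distr) auto
  finally show ?thesis ..
qed

text \<open>Resampling of a single coordinate; it provides the fresh noise symbol of the current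
  slot in the induction over time.\<close>

lemma nn_integral_PiM_fun_upd:
  assumes N: "\<And>i. prob_space (N i)" and [measurable]: "f \<in> borel_measurable (Pi\<^sub>M UNIV N)"
  shows "(\<integral>\<^sup>+u. f u \<partial>Pi\<^sub>M UNIV N) = (\<integral>\<^sup>+u. \<integral>\<^sup>+x. f (u(i := x)) \<partial>N i \<partial>Pi\<^sub>M UNIV N)"
proof -
  have "(\<integral>\<^sup>+u. f u \<partial>Pi\<^sub>M UNIV N) = (\<integral>\<^sup>+u. \<integral>\<^sup>+u'. f (u(i := u' i)) \<partial>Pi\<^sub>M UNIV N \<partial>Pi\<^sub>M UNIV N)"
    by (subst nn_integral_PiM_resample[OF assms, of "{i}"])
      (auto intro!: nn_integral_cong arg_cong[where f=f])
  also have "\<dots> = (\<integral>\<^sup>+u. \<integral>\<^sup>+x. f (u(i := x)) \<partial>N i \<partial>Pi\<^sub>M UNIV N)"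
  proof (rule nn_integral_cong)
    fix u assume [measurable]: "u \<in> space (Pi\<^sub>M UNIV N)"
    show "(\<integral>\<^sup>+u'. f (u(i := u' i)) \<partial>Pi\<^sub>M UNIV N) = (\<integral>\<^sup>+x. f (u(i := x)) \<partial>N i)"
      by (rule nn_integral_PiM_component[OF N]) measurable
  qed
  finally show ?thesis .
qed

lemma UNIV_relay: "(UNIV :: relay set) = {R1, R2}"
  using relay.exhaust by auto

instance relay :: countable
  by countable_datatype

instance relay :: finite
  by standard (simp add: UNIV_relay)

lemma nn_integral_PiM_relay:
  fixes N :: "relay \<Rightarrow> 'a measure"
  assumes N: "\<And>i. prob_space (N i)" and [measurable]: "f \<in> borel_measurable (Pi\<^sub>M UNIV N)"
  shows "(\<integral>\<^sup>+u. f u \<partial>Pi\<^sub>M UNIV N) = (\<integral>\<^sup>+a. \<integral>\<^sup>+b. f (case_relay a b) \<partial>N R2 \<partial>N R1)"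
proof -
  interpret N: product_sigma_finite N
    using N by (auto simp: product_sigma_finite_def intro: prob_space_imp_sigma_finite)
  have [simp]: "case_relay (u R1) (u R2) = u" for u :: "relay \<Rightarrow> 'a"
    by (auto simp: fun_eq_iff split: relay.split)
  have m[measurable]: "(\<lambda>(a, b). case_relay a b) \<in> N R1 \<Otimes>\<^sub>M N R2 \<rightarrow>\<^sub>M Pi\<^sub>M UNIV N"
  proof (rule measurable_PiM_single')
    fix i show "(\<lambda>x. (case x of (a, b) \<Rightarrow> case_relay a b) i) \<in> N R1 \<Otimes>\<^sub>M N R2 \<rightarrow>\<^sub>M N i"
      by (cases i) (simp_all add: case_prod_beta)
  qed (auto simp: space_PiM space_pair_measure PiE_iff split: relay.split)
  have "(\<integral>\<^sup>+u. f u \<partial>Pi\<^sub>M UNIV N) = (\<integral>\<^sup>+u. f (case_relay (u R1) (u R2)) \<partial>Pi\<^sub>M {R1, R2} N)"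
    by (simp add: UNIV_relay)
  also have "\<dots> = (\<integral>\<^sup>+z. f (case_relay (fst z) (snd z)) \<partial>(N R1 \<Otimes>\<^sub>M N R2))"
    by (rule N.product_nn_integral_pair) (use measurable_compose[OF m, of f] in \<open>simp_all add: case_prod_beta\<close>)
  also have "\<dots> = (\<integral>\<^sup>+a. \<integral>\<^sup>+b. f (case_relay a b) \<partial>N R2 \<partial>N R1)"
    by (subst sigma_finite_measure.nn_integral_fst[symmetric, OF prob_space_imp_sigma_finite[OF N]])
      (use measurable_compose[OF m, of f] in \<open>simp_all add: case_prod_beta\<close>)
  finally show ?thesis .
qed

section \<open>Gaussian integrals, moments and disc probabilities\<close>

lemma nn_integral_gauss_real:
  assumes "c > 0"
  shows "(\<integral>\<^sup>+x. ennreal (exp (- c * x\<^sup>2)) \<partial>lborel) = ennreal (sqrt (pi / c))"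
proof -
  \<comment> \<open>Chosen so that the coefficient \<open>1 / (2 * \<sigma>\<^sup>2)\<close> in the
    exponent of the normal density is \<open>c\<close>.\<close>
  define \<sigma> where "\<sigma> = 1 / sqrt (2 * c)"
  have s: "\<sigma> > 0" "\<sigma>\<^sup>2 = 1 / (2 * c)" using assms by (auto simp: \<sigma>_def power_divide)
  have "exp (- c * x\<^sup>2) = sqrt (pi / c) * normal_density 0 \<sigma> x" for x
    using assms by (simp add: normal_density_def s field_simps real_sqrt_divide)
  then have "(\<integral>\<^sup>+x. ennreal (exp (- c * x\<^sup>2)) \<partial>lborel) =
      ennreal (sqrt (pi / c)) * (\<integral>\<^sup>+x. ennreal (normal_density 0 \<sigma> x) \<partial>lborel)"
    using assms by (simp add: ennreal_mult' nn_integral_cmult)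
  also have "(\<integral>\<^sup>+x. ennreal (normal_density 0 \<sigma> x) \<partial>lborel) = 1"
    using s by (subst nn_integral_eq_integral) auto
  finally show ?thesis by simp
qed

lemma nn_integral_gauss:
  assumes "c > 0"
  shows "(\<integral>\<^sup>+z. ennreal (exp (- c * (cmod z)\<^sup>2)) \<partial>lborel) = ennreal (pi / c)"
proof -
  have "(\<integral>\<^sup>+z. ennreal (exp (- c * (cmod z)\<^sup>2)) \<partial>lborel) =
      (\<integral>\<^sup>+z. (\<Prod>b\<in>Basis. ennreal (exp (- c * ((z::complex) \<bullet> b)\<^sup>2))) \<partial>lborel)"
  proof (rule nn_integral_cong)
    fix z :: complex
    have "(\<Prod>b\<in>Basis. ennreal (exp (- c * (z \<bullet> b)\<^sup>2))) =
        ennreal (exp (- c * (Re z)\<^sup>2)) * ennreal (exp (- c * (Im z)\<^sup>2))"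
      by (simp add: Basis_complex_def complex_eq_iff)
    also have "\<dots> = ennreal (exp (- c * (cmod z)\<^sup>2))"
      by (simp add: cmod_power2 exp_add[symmetric] ennreal_mult'[symmetric] algebra_simps)
    finally show "ennreal (exp (- c * (cmod z)\<^sup>2)) = (\<Prod>b\<in>Basis. ennreal (exp (- c * (z \<bullet> b)\<^sup>2)))" ..
  qed
  also have "\<dots> = (\<Prod>b\<in>(Basis :: complex set). ennreal (sqrt (pi / c)))"
    using assms by (subst nn_integral_lborel_prod) (auto simp del: prod_constant simp: nn_integral_gauss_real[simplified])
  also have "\<dots> = ennreal (pi / c)"
    using assms by (simp add: power2_eq_square ennreal_mult'[symmetric])
  finally show ?thesis .
qed

lemma sets_CN01 [simp, measurable_cong]: "sets CN01 = sets borel"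
  and space_CN01 [simp]: "space CN01 = UNIV"
  by (simp_all add: CN01_def)

lemma nn_integral_CN01:
  assumes [measurable]: "f \<in> borel_measurable borel"
  shows "(\<integral>\<^sup>+z. f z \<partial>CN01) = (\<integral>\<^sup>+z. ennreal (exp (- (cmod z)\<^sup>2) / pi) * f z \<partial>lborel)"
  unfolding CN01_def by (rule nn_integral_density) auto

lemma prob_space_CN01 [simp]: "prob_space CN01"
proof
  have "emeasure CN01 (space CN01) = (\<integral>\<^sup>+z. ennreal (exp (- (1::real) * (cmod z)\<^sup>2) / pi) \<partial>lborel)"
    unfolding CN01_def by (subst emeasure_density) auto
  also have "\<dots> = ennreal (1 / pi) * (\<integral>\<^sup>+z. ennreal (exp (- (1::real) * (cmod z)\<^sup>2)) \<partial>lborel)"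
    by (subst nn_integral_cmult[symmetric]) (auto simp: ennreal_mult'[symmetric] intro!: nn_integral_cong)
  also have "\<dots> = 1"
    by (subst nn_integral_gauss) (auto simp: ennreal_mult'[symmetric])
  finally show "emeasure CN01 (space CN01) = 1" .
qed

text \<open>The exponent 1/2 uses up half of the Gaussian decay, so the integral is finite; this
  single moment yields both the second moment and the tail of the noise.\<close>

lemma nn_integral_CN01_exp: "(\<integral>\<^sup>+z. ennreal (exp ((cmod z)\<^sup>2 / 2)) \<partial>CN01) = 2"
proof -
  have "(\<integral>\<^sup>+z. ennreal (exp ((cmod z)\<^sup>2 / 2)) \<partial>CN01) =
     (\<integral>\<^sup>+z. ennreal (1 / pi) * ennreal (exp (- (1/2) * (cmod z)\<^sup>2)) \<partial>lborel)"
    by (subst nn_integral_CN01) (auto intro!: nn_integral_cong simp: ennreal_mult'[symmetric] exp_add[symmetric] mult_exp_exp)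
  also have "\<dots> = ennreal (1 / pi) * ennreal (pi / (1/2))"
    by (subst nn_integral_cmult, simp) (subst nn_integral_gauss, simp_all)
  also have "\<dots> = 2"
    by (simp add: ennreal_mult'[symmetric])
  finally show ?thesis .
qed

text \<open>From \<open>x \<le> 2 * exp (x / 2)\<close>. The crude constant only changes a constant
  term in the cost per slot.\<close>

lemma nn_integral_CN01_square: "(\<integral>\<^sup>+z. ennreal ((cmod z)\<^sup>2) \<partial>CN01) \<le> 4"
proof -
  have "(\<integral>\<^sup>+z. ennreal ((cmod z)\<^sup>2) \<partial>CN01) \<le> (\<integral>\<^sup>+z. 2 * ennreal (exp ((cmod z)\<^sup>2 / 2)) \<partial>CN01)"
  proof (rule nn_integral_mono)
    fix z :: complex
    have "(cmod z)\<^sup>2 \<le> 2 * exp ((cmod z)\<^sup>2 / 2)"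
      using exp_ge_add_one_self[of "(cmod z)\<^sup>2 / 2"] by linarith
    then have "ennreal ((cmod z)\<^sup>2) \<le> ennreal (2 * exp ((cmod z)\<^sup>2 / 2))" by (rule ennreal_leI)
    then show "ennreal ((cmod z)\<^sup>2) \<le> 2 * ennreal (exp ((cmod z)\<^sup>2 / 2))"
      by (simp add: ennreal_mult')
  qed
  also have "\<dots> = 4"
    by (subst nn_integral_cmult) (auto simp: nn_integral_CN01_exp)
  finally show ?thesis .
qed

lemma emeasure_lborel_disc:
  assumes "r \<ge> 0"
  shows "emeasure lborel (cball (a::complex) r) = ennreal (pi * r\<^sup>2)"
  using assms by (subst emeasure_cball) (simp_all add: eval_unit_ball_vol)

lemma disc_eq_cball: "x \<ge> 0 \<Longrightarrow> {z::complex. (cmod z)\<^sup>2 \<le> x} = cball 0 (sqrt x)"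
  using power_mono[of "cmod _" "sqrt x" 2] by (auto simp: real_le_rsqrt)

text \<open>The density is at most \<open>1 / pi\<close> and the disc has area
  \<open>pi * x\<close>.\<close>

lemma CN01_disc_le:
  assumes "x \<ge> 0"
  shows "emeasure CN01 {z. (cmod z)\<^sup>2 \<le> x} \<le> ennreal x"
proof -
  have "emeasure CN01 {z. (cmod z)\<^sup>2 \<le> x} =
      (\<integral>\<^sup>+z. ennreal (exp (- (cmod z)\<^sup>2) / pi) * indicator {z. (cmod z)\<^sup>2 \<le> x} z \<partial>lborel)"
    unfolding CN01_def by (rule emeasure_density) auto
  also have "\<dots> \<le> (\<integral>\<^sup>+z. ennreal (1 / pi) * indicator {z. (cmod z)\<^sup>2 \<le> x} z \<partial>lborel)"
    by (intro nn_integral_mono mult_right_mono ennreal_leI) (auto simp: divide_simps)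
  also have "\<dots> = ennreal (1 / pi) * emeasure lborel {z::complex. (cmod z)\<^sup>2 \<le> x}"
    by (rule nn_integral_cmult_indicator) auto
  also have "\<dots> = ennreal x"
    using assms by (simp add: disc_eq_cball emeasure_lborel_disc ennreal_mult'[symmetric])
  finally show ?thesis .
qed

text \<open>On the unit disc the density is at least \<open>exp (- 1) / pi\<close>, and
  \<open>exp 1 < 3\<close>. Together with the upper bound, the probability of a fade has the exact
  order of the squared radius.\<close>

lemma CN01_disc_ge:
  assumes "x \<ge> 0" "x \<le> 1"
  shows "ennreal (x / 3) \<le> emeasure CN01 {z. (cmod z)\<^sup>2 \<le> x}"
proof -
  have e: "1 / 3 \<le> exp (- (1::real))"
    using e_less_272 by (simp add: exp_minus field_simps)
  have "ennreal (x / 3) = ennreal (1 / (3 * pi)) * emeasure lborel {z::complex. (cmod z)\<^sup>2 \<le> x}"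
    using assms by (simp add: disc_eq_cball emeasure_lborel_disc ennreal_mult'[symmetric])
  also have "\<dots> = (\<integral>\<^sup>+z. ennreal (1 / (3 * pi)) * indicator {z. (cmod z)\<^sup>2 \<le> x} z \<partial>lborel)"
    by (rule nn_integral_cmult_indicator[symmetric]) auto
  also have "\<dots> \<le> (\<integral>\<^sup>+z. ennreal (exp (- (cmod z)\<^sup>2) / pi) * indicator {z. (cmod z)\<^sup>2 \<le> x} z \<partial>lborel)"
  proof (rule nn_integral_mono)
    fix z :: complex
    show "ennreal (1 / (3 * pi)) * indicator {z. (cmod z)\<^sup>2 \<le> x} z
       \<le> ennreal (exp (- (cmod z)\<^sup>2) / pi) * indicator {z. (cmod z)\<^sup>2 \<le> x} z"
    proof (cases "(cmod z)\<^sup>2 \<le> x")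
      case True
      then have "exp (- 1) \<le> exp (- (cmod z)\<^sup>2)" using assms by simp
      with e have "1 / 3 \<le> exp (- (cmod z)\<^sup>2)" by linarith
      then show ?thesis using True by (simp add: ennreal_leI divide_simps)
    qed simp
  qed
  also have "\<dots> = emeasure CN01 {z. (cmod z)\<^sup>2 \<le> x}"
    unfolding CN01_def by (rule emeasure_density[symmetric]) auto
  finally show ?thesis .
qed

text \<open>The exponential factor is the density of complex Gaussian noise of variance
  \<open>\<sigma>\<^sup>2\<close> at \<open>m + z\<close>, divided by the \<open>CN01\<close>
  density at \<open>z\<close>. Weighting by it turns signal plus noise into noise stretched by
  \<open>\<sigma>\<close>, whatever the signal \<open>m\<close>.\<close>

lemma nn_integral_CN01_shift_scale:
  assumes s: "\<sigma> > 0" and [measurable]: "g \<in> borel_measurable borel"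
  shows "(\<integral>\<^sup>+z. g (m + z) * ennreal (exp ((cmod z)\<^sup>2 - (cmod (m + z))\<^sup>2 / \<sigma>\<^sup>2) / \<sigma>\<^sup>2) \<partial>CN01) =
    (\<integral>\<^sup>+z. g (of_real \<sigma> * z) \<partial>CN01)"
proof -
  let ?h = "\<lambda>y. g y * ennreal (exp (- (cmod y)\<^sup>2 / \<sigma>\<^sup>2) / (pi * \<sigma>\<^sup>2))"
  have "(\<integral>\<^sup>+z. g (m + z) * ennreal (exp ((cmod z)\<^sup>2 - (cmod (m + z))\<^sup>2 / \<sigma>\<^sup>2) / \<sigma>\<^sup>2) \<partial>CN01) =
     (\<integral>\<^sup>+z. ?h (m + z) \<partial>lborel)"
  proof (subst nn_integral_CN01, measurable, rule nn_integral_cong)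
    fix z
    have "ennreal (exp (- (cmod z)\<^sup>2) / pi) *
        ennreal (exp ((cmod z)\<^sup>2 - (cmod (m + z))\<^sup>2 / \<sigma>\<^sup>2) / \<sigma>\<^sup>2) =
      ennreal (exp (- (cmod (m + z))\<^sup>2 / \<sigma>\<^sup>2) / (pi * \<sigma>\<^sup>2))"
      by (simp add: ennreal_mult'[symmetric] mult_exp_exp)
    then show "ennreal (exp (- (cmod z)\<^sup>2) / pi) *
        (g (m + z) * ennreal (exp ((cmod z)\<^sup>2 - (cmod (m + z))\<^sup>2 / \<sigma>\<^sup>2) / \<sigma>\<^sup>2)) = ?h (m + z)"
      by (metis mult.left_commute)
  qed
  also have "\<dots> = (\<integral>\<^sup>+z. ?h z \<partial>lborel)"
    by (subst (2) lborel_distr_plus[symmetric, of m]) (subst nn_integral_distr; simp)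
  also have "\<dots> = (\<integral>\<^sup>+z. ennreal (\<sigma>\<^sup>2) * ?h (of_real \<sigma> * z) \<partial>lborel)"
    using s by (subst lborel_affine[of \<sigma> 0])
      (simp_all add: nn_integral_density nn_integral_distr scaleR_conv_of_real)
  also have "\<dots> = (\<integral>\<^sup>+z. g (of_real \<sigma> * z) \<partial>CN01)"
  proof (subst nn_integral_CN01, measurable, rule nn_integral_cong)
    fix z :: complex
    have "ennreal (\<sigma>\<^sup>2) * ?h (of_real \<sigma> * z) = g (of_real \<sigma> * z) *
       (ennreal (\<sigma>\<^sup>2) * ennreal (exp (- (cmod (of_real \<sigma> * z))\<^sup>2 / \<sigma>\<^sup>2) / (pi * \<sigma>\<^sup>2)))"
      by (simp add: mult_ac)
    also have "ennreal (\<sigma>\<^sup>2) * ennreal (exp (- (cmod (of_real \<sigma> * z))\<^sup>2 / \<sigma>\<^sup>2) / (pi * \<sigma>\<^sup>2)) =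
       ennreal (exp (- (cmod z)\<^sup>2) / pi)"
      using s by (subst ennreal_mult'[symmetric])
        (auto simp: norm_mult power_mult_distrib field_simps intro!: arg_cong[where f=ennreal])
    finally show "ennreal (\<sigma>\<^sup>2) * ?h (of_real \<sigma> * z) =
        ennreal (exp (- (cmod z)\<^sup>2) / pi) * g (of_real \<sigma> * z)"
      by (simp add: mult_ac)
  qed
  finally show ?thesis .
qed

section \<open>Changing the noise measure along a causal schedule\<close>

abbreviation cnM :: "cseq measure" where
  "cnM \<equiv> Pi\<^sub>M UNIV (\<lambda>_. CN01)"

lemma sets_cnM [simp, measurable_cong]: "sets cnM = sets seqM"
  unfolding seqM_def by (rule sets_PiM_cong) simp_all

lemma space_seqM [simp]: "space seqM = UNIV"
  by (simp add: seqM_def space_PiM)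

lemma space_cnM [simp]: "space cnM = UNIV"
  by (simp add: space_PiM)

lemma prob_space_cnM [simp]: "prob_space cnM"
  by (intro prob_space_PiM) simp

section \<open>Measurability and causality of received sequences\<close>

lemma measurable_seqM_component:
  "f \<in> M \<rightarrow>\<^sub>M seqM \<Longrightarrow> (\<lambda>x. f x k) \<in> borel_measurable M"
  unfolding seqM_def by (rule measurable_compose[OF _ measurable_component_singleton]) auto

lemma measurable_seqM_component' [measurable_dest]:
  "f \<in> M \<rightarrow>\<^sub>M seqM \<Longrightarrow> g \<in> L \<rightarrow>\<^sub>M M \<Longrightarrow> (\<lambda>x. f (g x) k) \<in> borel_measurable L"
  by (rule measurable_seqM_component) (rule measurable_compose)

lemma measurable_seqM_apply [measurable (raw)]: "(\<lambda>y. y k) \<in> borel_measurable seqM"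
  by (rule measurable_seqM_component) simp

lemma measurable_seqM_fun:
  "(\<And>k. (\<lambda>x. f x k) \<in> borel_measurable M) \<Longrightarrow> f \<in> M \<rightarrow>\<^sub>M seqM"
  unfolding seqM_def by (rule measurable_PiM_single') (auto simp: space_PiM)

lemma measurable_seqM_upd [measurable (raw)]:
  "f \<in> M \<rightarrow>\<^sub>M seqM \<Longrightarrow> g \<in> borel_measurable M \<Longrightarrow> (\<lambda>x. (f x)(k := g x)) \<in> M \<rightarrow>\<^sub>M seqM"
  unfolding seqM_def by (rule borel_measurable_fun_upd_UNIV)

lemma relay_rx_beyond: "n \<le> k \<Longrightarrow> relay_rx L s n k = 0"
  by (induction n) auto

lemma relay_rx_fun_upd: "n \<le> j \<Longrightarrow> relay_rx L (s(j := x)) n = relay_rx L s n"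
  by (induction n) auto

text \<open>A relay's final received block contains every earlier state of its knowledge. Hence its
  whole transmission is a function of that block, which the source cut exploits.\<close>

lemma prefix_relay_rx: "k \<le> n \<Longrightarrow> prefix k (relay_rx L s n) = relay_rx L s k"
proof (induction n)
  case 0
  then show ?case by (auto simp: prefix_def)
next
  case (Suc n)
  show ?case
  proof (cases "k \<le> n")
    case True
    then have "prefix k (relay_rx L s (Suc n)) = prefix k (relay_rx L s n)"
      by (auto simp: prefix_def)
    with Suc.IH[OF True] show ?thesis by (simp del: relay_rx.simps)
  next
    case False
    with Suc.prems have k: "k = Suc n" by simp
    have "relay_rx L s (Suc n) j = 0" if "Suc n \<le> j" for j
      by (rule relay_rx_beyond[OF that])
    then show ?thesis unfolding k prefix_def by (metis not_less)
  qed
qed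

lemma measurable_prefix [measurable]: "prefix n \<in> seqM \<rightarrow>\<^sub>M seqM"
  by (rule measurable_seqM_fun) (simp add: prefix_def)

lemma measurable_relay_rx:
  assumes L: "\<And>k. (\<lambda>(x, y). L x k y) \<in> M \<Otimes>\<^sub>M seqM \<rightarrow>\<^sub>M count_space UNIV"
    and [measurable]: "s \<in> M \<rightarrow>\<^sub>M seqM"
  shows "(\<lambda>x. relay_rx (L x) (s x) n) \<in> M \<rightarrow>\<^sub>M seqM"
proof (induction n)
  case 0
  then show ?case by (simp add: measurable_seqM_fun)
next
  case (Suc n)
  note [measurable] = Suc
  have [measurable]: "Measurable.pred M (\<lambda>x. L x n (relay_rx (L x) (s x) n))"
    using measurable_compose[of "\<lambda>x. (x, relay_rx (L x) (s x) n)" M "M \<Otimes>\<^sub>M seqM", OF _ L] by simp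
  show ?case unfolding relay_rx.simps by (intro measurable_seqM_upd) measurable
qed

text \<open>
  Bounds the log-likelihood ratio of the received sequence with signal \<open>m\<close> against noise stretched by
  \<open>\<sigma>\<close> in the listened slots: \<open>2 * ln \<sigma>\<close> is the Jacobian of a complex coordinate, and
  \<open>a\<close> is the parameter of \<open>square_norm_add_le\<close>.
\<close>

definition rx_cost :: "real \<Rightarrow> real \<Rightarrow> (nat \<Rightarrow> cseq \<Rightarrow> bool) \<Rightarrow> cseq \<Rightarrow> nat \<Rightarrow> cseq \<Rightarrow> real" where
  "rx_cost a \<sigma> L m n z = (\<Sum>k<n.
     (if L k (relay_rx L (\<lambda>k. m k + z k) k) then 2 * ln \<sigma> else 0) +
     (a * (cmod (z k))\<^sup>2 + (1 + 1 / a) * (cmod (m k))\<^sup>2 / \<sigma>\<^sup>2))"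

text \<open>Young's inequality for the mixed term. The parameter \<open>a\<close> is 1 where
  constants per slot are negligible, and small for multiplexing gain 0.\<close>

lemma square_norm_add_le:
  assumes "a > 0"
  shows "(cmod (m + z))\<^sup>2 \<le> (1 + a) * (cmod z)\<^sup>2 + (1 + 1 / a) * (cmod m)\<^sup>2"
proof -
  have "(cmod (m + z))\<^sup>2 \<le> (cmod m + cmod z)\<^sup>2"
    by (intro power_mono norm_triangle_ineq) auto
  also have "\<dots> = (cmod m)\<^sup>2 + (cmod z)\<^sup>2 + 2 * cmod m * cmod z"
    by (simp add: power2_sum)
  also have "2 * cmod m * cmod z \<le> a * (cmod z)\<^sup>2 + (cmod m)\<^sup>2 / a"
  proof -
    have "0 \<le> (a * cmod z - cmod m)\<^sup>2 / a" using assms by simp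
    also have "\<dots> = a * (cmod z)\<^sup>2 + (cmod m)\<^sup>2 / a - 2 * cmod m * cmod z"
      using assms by (simp add: field_simps power2_eq_square)
    finally show ?thesis by simp
  qed
  finally show ?thesis by (simp add: algebra_simps)
qed

text \<open>Dividing \<open>(1 + a) * (cmod z)\<^sup>2\<close> by
  \<open>\<sigma>\<^sup>2 \<ge> 1\<close> can only decrease it, and the 1 in \<open>1 + a\<close>
  cancels against the Gaussian weight of \<open>z\<close>.\<close>

lemma gaussian_density_ratio_le:
  assumes "a > 0" "\<sigma> \<ge> 1"
  shows "exp (- (2 * ln \<sigma> + (a * (cmod z)\<^sup>2 + (1 + 1 / a) * (cmod m)\<^sup>2 / \<sigma>\<^sup>2)))
     \<le> exp ((cmod z)\<^sup>2 - (cmod (m + z))\<^sup>2 / \<sigma>\<^sup>2) / \<sigma>\<^sup>2"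
proof -
  have s: "\<sigma> > 0" "\<sigma>\<^sup>2 \<ge> 1" using assms by auto
  have "(cmod (m + z))\<^sup>2 / \<sigma>\<^sup>2 \<le> ((1 + a) * (cmod z)\<^sup>2 + (1 + 1 / a) * (cmod m)\<^sup>2) / \<sigma>\<^sup>2"
    using square_norm_add_le[OF assms(1)] s by (intro divide_right_mono) auto
  also have "\<dots> = (1 + a) * (cmod z)\<^sup>2 / \<sigma>\<^sup>2 + (1 + 1 / a) * (cmod m)\<^sup>2 / \<sigma>\<^sup>2"
    by (simp add: add_divide_distrib)
  also have "(1 + a) * (cmod z)\<^sup>2 / \<sigma>\<^sup>2 \<le> (1 + a) * (cmod z)\<^sup>2 / 1"
    using s assms by (intro divide_left_mono) auto
  finally have *: "(cmod (m + z))\<^sup>2 / \<sigma>\<^sup>2 - (cmod z)\<^sup>2 \<le> a * (cmod z)\<^sup>2 + (1 + 1 / a) * (cmod m)\<^sup>2 / \<sigma>\<^sup>2"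
    by (simp add: algebra_simps)
  have "exp (2 * ln \<sigma>) = \<sigma>\<^sup>2"
    using s by (simp add: exp_double)
  then have "exp ((cmod z)\<^sup>2 - (cmod (m + z))\<^sup>2 / \<sigma>\<^sup>2) / \<sigma>\<^sup>2 =
      exp (- (2 * ln \<sigma> + ((cmod (m + z))\<^sup>2 / \<sigma>\<^sup>2 - (cmod z)\<^sup>2)))"
    by (simp add: exp_diff exp_minus exp_add field_simps)
  with * show ?thesis by simp
qed

lemma rx_cost_nonneg:
  assumes "a > 0" "\<sigma> \<ge> 1"
  shows "0 \<le> rx_cost a \<sigma> L m n z"
  unfolding rx_cost_def
proof (rule sum_nonneg)
  fix k
  have "0 \<le> (1 + 1 / a) * (cmod (m k))\<^sup>2 / \<sigma>\<^sup>2"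
    using assms by simp
  moreover have "0 \<le> a * (cmod (z k))\<^sup>2" "0 \<le> 2 * ln \<sigma>"
    using assms by simp_all
  ultimately show "0 \<le> (if L k (relay_rx L (\<lambda>k. m k + z k) k) then 2 * ln \<sigma> else 0) +
     (a * (cmod (z k))\<^sup>2 + (1 + 1 / a) * (cmod (m k))\<^sup>2 / \<sigma>\<^sup>2)"
    by (simp only: split: if_split) linarith
qed

lemma measurable_add_seqM:
  "f \<in> M \<rightarrow>\<^sub>M seqM \<Longrightarrow> g \<in> M \<rightarrow>\<^sub>M seqM \<Longrightarrow> (\<lambda>x k. f x k + g x k) \<in> M \<rightarrow>\<^sub>M seqM"
  by (rule measurable_seqM_fun, rule borel_measurable_add) (rule measurable_seqM_component, assumption)+

lemma measurable_scale_seqM: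
  "f \<in> M \<rightarrow>\<^sub>M seqM \<Longrightarrow> (\<lambda>x k. c * f x k) \<in> M \<rightarrow>\<^sub>M seqM"
  by (rule measurable_seqM_fun, rule borel_measurable_times, simp) (rule measurable_seqM_component, assumption)

lemma measurable_relay_rx_const [measurable (raw)]:
  assumes [measurable]: "\<And>k. Measurable.pred seqM (L k)"
    and [measurable]: "s \<in> M \<rightarrow>\<^sub>M seqM"
  shows "(\<lambda>x. relay_rx L (s x) n) \<in> M \<rightarrow>\<^sub>M seqM"
  by (rule measurable_relay_rx) simp_all

lemma measurable_rx [measurable]:
  assumes [measurable]: "\<And>k. Measurable.pred seqM (L k)"
  shows "(\<lambda>z. relay_rx L (\<lambda>k. m k + z k) n) \<in> seqM \<rightarrow>\<^sub>M seqM"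
  by (rule measurable_relay_rx_const[OF assms]) (rule measurable_add_seqM; simp)

lemma measurable_rx_scale [measurable]:
  assumes [measurable]: "\<And>k. Measurable.pred seqM (L k)"
  shows "(\<lambda>z. relay_rx L (\<lambda>k. c * z k) n) \<in> seqM \<rightarrow>\<^sub>M seqM"
  by (rule measurable_relay_rx_const[OF assms]) (rule measurable_scale_seqM; simp)

lemma rx_cost_measurable [measurable]:
  assumes [measurable]: "\<And>k. Measurable.pred seqM (L k)"
  shows "rx_cost a \<sigma> L m n \<in> borel_measurable seqM"
  unfolding rx_cost_def by measurable

text \<open>Induction over time. Whether slot \<open>n\<close> is listened to is decided by the
  past, from which the noise symbol of slot \<open>n\<close> is independent, so the change of
  variables for one symbol applies with the past frozen. This is where the causality of adaptive
  schedules enters.\<close>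

lemma relay_rx_change_of_measure:
  assumes a: "a > 0" and s: "\<sigma> \<ge> 1"
    and L[measurable]: "\<And>k. Measurable.pred seqM (L k)"
    and "g \<in> borel_measurable seqM"
  shows "(\<integral>\<^sup>+z. g (relay_rx L (\<lambda>k. m k + z k) n) * ennreal (exp (- rx_cost a \<sigma> L m n z)) \<partial>cnM)
     \<le> (\<integral>\<^sup>+z. g (relay_rx L (\<lambda>k. of_real \<sigma> * z k) n) \<partial>cnM)"
  using assms(4)
proof (induction n arbitrary: g)
  case 0
  then show ?case by (simp add: rx_cost_def)
next
  case (Suc n)
  note [measurable] = Suc.prems
  interpret cn: prob_space CN01 by simp
  let ?X = "\<lambda>z. relay_rx L (\<lambda>k. m k + z k) n" and ?Y = "\<lambda>z. relay_rx L (\<lambda>k. of_real \<sigma> * z k) n"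
  let ?b = "\<lambda>x. a * (cmod x)\<^sup>2 + (1 + 1 / a) * (cmod (m n))\<^sup>2 / \<sigma>\<^sup>2"
  \<comment> \<open>\<open>g\<close> with slot \<open>n\<close> already averaged under the reference
    law: the test function for the induction hypothesis.\<close>
  define g' where "g' y = (if L n y then \<integral>\<^sup>+x. g (y(n := of_real \<sigma> * x)) \<partial>CN01 else g (y(n := 0)))" for y
  have g'[measurable]: "g' \<in> borel_measurable seqM" unfolding g'_def by measurable
  have upd: "(\<lambda>k. f k + (z(n := x)) k) = (\<lambda>k. f k + z k)(n := f n + x)"
    "(\<lambda>k. c * (z(n := x)) k) = (\<lambda>k. c * z k)(n := c * x)" for f z :: cseq and x c
    by auto
  have mX: "(\<lambda>z. relay_rx L (\<lambda>k. m k + z k) (Suc n)) \<in> cnM \<rightarrow>\<^sub>M seqM"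
    by measurable
  have mY: "(\<lambda>z. relay_rx L (\<lambda>k. of_real \<sigma> * z k) (Suc n)) \<in> cnM \<rightarrow>\<^sub>M seqM"
    by measurable
  have mC: "(\<lambda>z. rx_cost a \<sigma> L m (Suc n) z) \<in> borel_measurable cnM"
    by measurable
  have cost: "rx_cost a \<sigma> L m (Suc n) (z(n := x)) =
      rx_cost a \<sigma> L m n z + ((if L n (?X z) then 2 * ln \<sigma> else 0) + ?b x)" for z x
    unfolding rx_cost_def upd by (simp add: relay_rx_fun_upd)
  have step: "(\<integral>\<^sup>+x. g (if L n y then y(n := m n + x) else y(n := 0)) *
      ennreal (exp (- ((if L n y then 2 * ln \<sigma> else 0) + ?b x))) \<partial>CN01) \<le> g' y" for y
  proof (cases "L n y")
    case True
    have "(\<integral>\<^sup>+x. g (y(n := m n + x)) * ennreal (exp (- (2 * ln \<sigma> + ?b x))) \<partial>CN01) \<le>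
      (\<integral>\<^sup>+x. g (y(n := m n + x)) * ennreal (exp ((cmod x)\<^sup>2 - (cmod (m n + x))\<^sup>2 / \<sigma>\<^sup>2) / \<sigma>\<^sup>2) \<partial>CN01)"
      by (intro nn_integral_mono mult_left_mono ennreal_leI gaussian_density_ratio_le a s) auto
    also have "\<dots> = (\<integral>\<^sup>+x. g (y(n := of_real \<sigma> * x)) \<partial>CN01)"
      using s by (intro nn_integral_CN01_shift_scale) (simp, measurable)
    finally show ?thesis using True by (simp add: g'_def del: fun_upd_apply)
  next
    \<comment> \<open>In a silent slot the output ignores \<open>x\<close>, and the cost, being
      nonnegative, only lowers the left-hand side.\<close>
    case False
    have "(\<integral>\<^sup>+x. g (y(n := 0)) * ennreal (exp (- ?b x)) \<partial>CN01) \<le> (\<integral>\<^sup>+x. g (y(n := 0)) \<partial>CN01)"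
    proof (rule nn_integral_mono)
      fix x
      have "0 \<le> ?b x" using a by simp
      then have "exp (- ?b x) \<le> 1" by simp
      then have "ennreal (exp (- ?b x)) \<le> 1" by (simp only: ennreal_le_1)
      then have "g (y(n := 0)) * ennreal (exp (- ?b x)) \<le> g (y(n := 0)) * 1"
        by (rule mult_left_mono) simp
      then show "g (y(n := 0)) * ennreal (exp (- ?b x)) \<le> g (y(n := 0))"
        by (simp only: mult_1_right)
    qed
    then show ?thesis using False cn.emeasure_space_1 by (simp add: g'_def del: fun_upd_apply)
  qed
  define F where "F z = g (relay_rx L (\<lambda>k. m k + z k) (Suc n)) *
      ennreal (exp (- rx_cost a \<sigma> L m (Suc n) z))" for z
  have mF: "F \<in> borel_measurable cnM"
    unfolding F_def by (intro borel_measurable_times_ennreal measurable_compose[OF mX Suc.prems]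
        measurable_compose[OF mC, of "\<lambda>x. ennreal (exp (- x))"]) simp
  define G where "G z = g (relay_rx L (\<lambda>k. of_real \<sigma> * z k) (Suc n))" for z
  have mG: "G \<in> borel_measurable cnM"
    unfolding G_def by (rule measurable_compose[OF mY Suc.prems])
  have "(\<integral>\<^sup>+z. F z \<partial>cnM) = (\<integral>\<^sup>+z. \<integral>\<^sup>+x. F (z(n := x)) \<partial>CN01 \<partial>cnM)"
    by (rule nn_integral_PiM_fun_upd) (simp, rule mF)
  also have "\<dots> = (\<integral>\<^sup>+z. ennreal (exp (- rx_cost a \<sigma> L m n z)) *
      (\<integral>\<^sup>+x. g (if L n (?X z) then (?X z)(n := m n + x) else (?X z)(n := 0)) *
        ennreal (exp (- ((if L n (?X z) then 2 * ln \<sigma> else 0) + ?b x))) \<partial>CN01) \<partial>cnM)"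
  proof (rule nn_integral_cong)
    fix z
    let ?c = "\<lambda>x. (if L n (?X z) then 2 * ln \<sigma> else 0) + ?b x"
    define H where "H x = g (if L n (?X z) then (?X z)(n := m n + x) else (?X z)(n := 0)) *
        ennreal (exp (- ?c x))" for x
    have mH: "H \<in> borel_measurable CN01"
      unfolding H_def by measurable
    have "F (z(n := x)) = ennreal (exp (- rx_cost a \<sigma> L m n z)) * H x" for x
    proof -
      have rx: "relay_rx L (\<lambda>k. m k + (z(n := x)) k) (Suc n) =
          (if L n (?X z) then (?X z)(n := m n + x) else (?X z)(n := 0))"
        unfolding upd by (simp add: relay_rx_fun_upd)
      have "exp (- (rx_cost a \<sigma> L m n z + ?c x)) = exp (- rx_cost a \<sigma> L m n z) * exp (- ?c x)"
        by (simp only: minus_add_distrib exp_add)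
      then have "ennreal (exp (- rx_cost a \<sigma> L m (Suc n) (z(n := x)))) =
          ennreal (exp (- rx_cost a \<sigma> L m n z)) * ennreal (exp (- ?c x))"
        unfolding cost by (simp only: ennreal_mult'[symmetric, OF exp_ge_zero])
      then show ?thesis
        unfolding F_def H_def rx by (simp only: mult.left_commute)
    qed
    then show "(\<integral>\<^sup>+x. F (z(n := x)) \<partial>CN01) =
      ennreal (exp (- rx_cost a \<sigma> L m n z)) *
      (\<integral>\<^sup>+x. g (if L n (?X z) then (?X z)(n := m n + x) else (?X z)(n := 0)) *
        ennreal (exp (- ((if L n (?X z) then 2 * ln \<sigma> else 0) + ?b x))) \<partial>CN01)"
      using nn_integral_cmult[OF mH] unfolding H_def by simp
  qed
  also have "\<dots> \<le> (\<integral>\<^sup>+z. ennreal (exp (- rx_cost a \<sigma> L m n z)) * g' (?X z) \<partial>cnM)"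
    by (intro nn_integral_mono mult_left_mono step) auto
  also have "\<dots> = (\<integral>\<^sup>+z. g' (?X z) * ennreal (exp (- rx_cost a \<sigma> L m n z)) \<partial>cnM)"
    by (simp add: mult.commute)
  also have "\<dots> \<le> (\<integral>\<^sup>+z. g' (?Y z) \<partial>cnM)"
    by (rule Suc.IH) measurable
  also have "\<dots> = (\<integral>\<^sup>+z. \<integral>\<^sup>+x. G (z(n := x)) \<partial>CN01 \<partial>cnM)"
    unfolding G_def upd by (intro nn_integral_cong)
      (auto simp: g'_def relay_rx_fun_upd cn.emeasure_space_1[simplified])
  also have "\<dots> = (\<integral>\<^sup>+z. G z \<partial>cnM)"
    by (rule nn_integral_PiM_fun_upd[symmetric]) (simp, rule mG)
  finally show ?case unfolding F_def G_def .
qed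

section \<open>A weak converse for two parallel channels\<close>

text \<open>
  The interface between a channel and the converse: \<open>X w\<close> is the output for message \<open>w\<close>, and the
  cost \<open>\<Lambda> w\<close> bounds the log-likelihood ratio of its law against a reference law \<open>Q\<close> which does not
  depend on the message.
\<close>

definition dominated :: "'a measure \<Rightarrow> (nat \<Rightarrow> 'a \<Rightarrow> 'b) \<Rightarrow> (nat \<Rightarrow> 'a \<Rightarrow> real) \<Rightarrow> 'b measure \<Rightarrow> nat \<Rightarrow> bool" where
  "dominated N X \<Lambda> Q w \<longleftrightarrow>
     (\<forall>g\<in>borel_measurable Q. (\<integral>\<^sup>+\<omega>. g (X w \<omega>) * ennreal (exp (- \<Lambda> w \<omega>)) \<partial>N) \<le> (\<integral>\<^sup>+y. g y \<partial>Q))"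

text \<open>Either \<open>l \<le> \<gamma>\<close>, and \<open>exp \<gamma>\<close> compensates the
  tilt, or \<open>l / \<gamma> \<ge> 1\<close>. The second term is Markov's inequality in pointwise
  form; it makes the converse linear in the cost.\<close>

lemma indicator_le_tilt:
  assumes "0 \<le> l" "\<gamma> > 0"
  shows "indicator E x \<le> ennreal (exp \<gamma>) * (indicator E x * ennreal (exp (- l))) + ennreal (l / \<gamma>)"
proof (cases "l \<le> \<gamma>")
  case True
  have "1 \<le> exp (\<gamma> - l)" using True by simp
  then have "1 \<le> ennreal (exp \<gamma>) * ennreal (exp (- l))"
    by (simp add: ennreal_mult'[symmetric] mult_exp_exp)
  then have "indicator E x \<le> ennreal (exp \<gamma>) * (indicator E x * ennreal (exp (- l)))"
    by (auto simp: indicator_def)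
  then show ?thesis by (rule order_trans) simp
next
  case False
  then have "1 \<le> l / \<gamma>" using assms by (simp add: field_simps)
  then have "1 \<le> ennreal (l / \<gamma>)" by simp
  moreover have "indicator E x \<le> (1::ennreal)" by (simp add: indicator_def)
  ultimately have "indicator E x \<le> ennreal (l / \<gamma>)" by (rule order_trans[rotated])
  then show ?thesis by (rule order_trans) simp
qed

text \<open>Under the product reference law the output is independent of the message, so the correct
  decisions have total mass at most 1 and contribute \<open>exp \<gamma>\<close>. Independence of
  the noises lets the two paths be compared with their references one after the other, and the costs
  add.\<close>

lemma weak_converse_two:
  fixes X1 :: "nat \<Rightarrow> 'a \<Rightarrow> 'b" and X2 :: "nat \<Rightarrow> 'c \<Rightarrow> 'd" and \<phi> :: "nat \<Rightarrow> nat"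
  assumes "prob_space N1" "prob_space N2" "prob_space Q1" "prob_space Q2"
    and W: "finite W" "inj_on \<phi> W" and \<gamma>: "\<gamma> > 0"
    and [measurable]: "\<And>w. X1 w \<in> N1 \<rightarrow>\<^sub>M Q1" "\<And>w. X2 w \<in> N2 \<rightarrow>\<^sub>M Q2"
    and [measurable]: "\<And>w. \<Lambda>1 w \<in> borel_measurable N1" "\<And>w. \<Lambda>2 w \<in> borel_measurable N2"
    and \<Lambda>: "\<And>w \<omega>. 0 \<le> \<Lambda>1 w \<omega>" "\<And>w \<omega>. 0 \<le> \<Lambda>2 w \<omega>"
    and dom: "\<And>w. w \<in> W \<Longrightarrow> dominated N1 X1 \<Lambda>1 Q1 w" "\<And>w. w \<in> W \<Longrightarrow> dominated N2 X2 \<Lambda>2 Q2 w"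
    and \<delta>[measurable]: "\<delta> \<in> Q1 \<Otimes>\<^sub>M Q2 \<rightarrow>\<^sub>M count_space UNIV"
  shows "(\<Sum>w\<in>W. \<integral>\<^sup>+\<omega>1. \<integral>\<^sup>+\<omega>2. indicator {\<phi> w} (\<delta> (X1 w \<omega>1, X2 w \<omega>2)) \<partial>N2 \<partial>N1)
    \<le> ennreal (exp \<gamma>) + (\<Sum>w\<in>W. (\<integral>\<^sup>+\<omega>. \<Lambda>1 w \<omega> \<partial>N1) + (\<integral>\<^sup>+\<omega>. \<Lambda>2 w \<omega> \<partial>N2)) / ennreal \<gamma>"
proof -
  interpret N1: prob_space N1 by fact
  interpret N2: prob_space N2 by fact
  interpret Q1: prob_space Q1 by fact
  interpret Q2: prob_space Q2 by fact
  interpret Q: pair_prob_space Q1 Q2 ..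
  define h :: "nat \<Rightarrow> 'b \<times> 'd \<Rightarrow> ennreal" where "h w p = indicator {\<phi> w} (\<delta> p)" for w p
  have [measurable]: "h w \<in> borel_measurable (Q1 \<Otimes>\<^sub>M Q2)" for w
    unfolding h_def by (rule measurable_compose[OF \<delta>]) simp
  have one: "(\<integral>\<^sup>+\<omega>1. \<integral>\<^sup>+\<omega>2. h w (X1 w \<omega>1, X2 w \<omega>2) \<partial>N2 \<partial>N1) \<le>
     ennreal (exp \<gamma>) * (\<integral>\<^sup>+y1. \<integral>\<^sup>+y2. h w (y1, y2) \<partial>Q2 \<partial>Q1) +
     ((\<integral>\<^sup>+\<omega>. \<Lambda>1 w \<omega> \<partial>N1) + (\<integral>\<^sup>+\<omega>. \<Lambda>2 w \<omega> \<partial>N2)) / ennreal \<gamma>" if w: "w \<in> W" for w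
  proof -
    let ?I = "\<lambda>y1 y2. h w (y1, y2)"
    have tilt: "?I (X1 w \<omega>1) (X2 w \<omega>2) \<le> ennreal (exp \<gamma>) *
        (ennreal (exp (- \<Lambda>1 w \<omega>1)) * (?I (X1 w \<omega>1) (X2 w \<omega>2) * ennreal (exp (- \<Lambda>2 w \<omega>2)))) +
        (ennreal (\<Lambda>1 w \<omega>1) + ennreal (\<Lambda>2 w \<omega>2)) / ennreal \<gamma>" for \<omega>1 \<omega>2
      using indicator_le_tilt[of "\<Lambda>1 w \<omega>1 + \<Lambda>2 w \<omega>2" \<gamma> "{\<phi> w}" "\<delta> (X1 w \<omega>1, X2 w \<omega>2)"] \<Lambda> \<gamma>
      unfolding h_def
      by (simp add: divide_ennreal ennreal_plus[symmetric] ennreal_mult'[symmetric] exp_diff exp_minus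
          exp_add mult_ac divide_inverse del: ennreal_plus)
         (simp add: ennreal_mult' mult_ac)
    have "(\<integral>\<^sup>+\<omega>1. \<integral>\<^sup>+\<omega>2. ?I (X1 w \<omega>1) (X2 w \<omega>2) \<partial>N2 \<partial>N1) \<le>
      (\<integral>\<^sup>+\<omega>1. \<integral>\<^sup>+\<omega>2. ennreal (exp \<gamma>) *
        (ennreal (exp (- \<Lambda>1 w \<omega>1)) * (?I (X1 w \<omega>1) (X2 w \<omega>2) * ennreal (exp (- \<Lambda>2 w \<omega>2)))) +
        (ennreal (\<Lambda>1 w \<omega>1) + ennreal (\<Lambda>2 w \<omega>2)) / ennreal \<gamma> \<partial>N2 \<partial>N1)"
      by (intro nn_integral_mono tilt)
    also have "\<dots> = (\<integral>\<^sup>+\<omega>1. ennreal (exp \<gamma>) * (ennreal (exp (- \<Lambda>1 w \<omega>1)) *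
         (\<integral>\<^sup>+\<omega>2. ?I (X1 w \<omega>1) (X2 w \<omega>2) * ennreal (exp (- \<Lambda>2 w \<omega>2)) \<partial>N2)) +
        (ennreal (\<Lambda>1 w \<omega>1) + (\<integral>\<^sup>+\<omega>. \<Lambda>2 w \<omega> \<partial>N2)) / ennreal \<gamma> \<partial>N1)"
    proof (rule nn_integral_cong)
      fix \<omega>1 assume [measurable]: "\<omega>1 \<in> space N1"
      show "(\<integral>\<^sup>+\<omega>2. ennreal (exp \<gamma>) *
        (ennreal (exp (- \<Lambda>1 w \<omega>1)) * (?I (X1 w \<omega>1) (X2 w \<omega>2) * ennreal (exp (- \<Lambda>2 w \<omega>2)))) +
        (ennreal (\<Lambda>1 w \<omega>1) + ennreal (\<Lambda>2 w \<omega>2)) / ennreal \<gamma> \<partial>N2) =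
        ennreal (exp \<gamma>) * (ennreal (exp (- \<Lambda>1 w \<omega>1)) *
         (\<integral>\<^sup>+\<omega>2. ?I (X1 w \<omega>1) (X2 w \<omega>2) * ennreal (exp (- \<Lambda>2 w \<omega>2)) \<partial>N2)) +
        (ennreal (\<Lambda>1 w \<omega>1) + (\<integral>\<^sup>+\<omega>. \<Lambda>2 w \<omega> \<partial>N2)) / ennreal \<gamma>"
      proof -
        define f where "f \<omega>2 = ?I (X1 w \<omega>1) (X2 w \<omega>2)" for \<omega>2
        have [measurable]: "f \<in> borel_measurable N2" unfolding f_def by measurable
        show ?thesis unfolding f_def[symmetric]
          by (simp add: nn_integral_add nn_integral_cmult nn_integral_divide N2.emeasure_space_1)
      qed
    qed
    also have "\<dots> = ennreal (exp \<gamma>) * (\<integral>\<^sup>+\<omega>1. ennreal (exp (- \<Lambda>1 w \<omega>1)) *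
         (\<integral>\<^sup>+\<omega>2. ?I (X1 w \<omega>1) (X2 w \<omega>2) * ennreal (exp (- \<Lambda>2 w \<omega>2)) \<partial>N2) \<partial>N1) +
       ((\<integral>\<^sup>+\<omega>. \<Lambda>1 w \<omega> \<partial>N1) + (\<integral>\<^sup>+\<omega>. \<Lambda>2 w \<omega> \<partial>N2)) / ennreal \<gamma>"
      by (simp add: nn_integral_add nn_integral_cmult nn_integral_divide N1.emeasure_space_1)
    also have "(\<integral>\<^sup>+\<omega>1. ennreal (exp (- \<Lambda>1 w \<omega>1)) *
         (\<integral>\<^sup>+\<omega>2. ?I (X1 w \<omega>1) (X2 w \<omega>2) * ennreal (exp (- \<Lambda>2 w \<omega>2)) \<partial>N2) \<partial>N1) \<le>
      (\<integral>\<^sup>+\<omega>1. ennreal (exp (- \<Lambda>1 w \<omega>1)) * (\<integral>\<^sup>+y2. ?I (X1 w \<omega>1) y2 \<partial>Q2) \<partial>N1)"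
    \<comment> \<open>With the output of path 1 frozen, path 2 is replaced by its reference law;
      path 1 follows in the next step.\<close>
    proof (intro nn_integral_mono mult_left_mono)
      fix \<omega>1 assume [measurable]: "\<omega>1 \<in> space N1"
      have "(\<lambda>y. ?I (X1 w \<omega>1) y) \<in> borel_measurable Q2" by measurable
      then show "(\<integral>\<^sup>+\<omega>2. ?I (X1 w \<omega>1) (X2 w \<omega>2) * ennreal (exp (- \<Lambda>2 w \<omega>2)) \<partial>N2) \<le>
        (\<integral>\<^sup>+y2. ?I (X1 w \<omega>1) y2 \<partial>Q2)"
        using dom(2)[OF w] unfolding dominated_def by (rule bspec[rotated])
    qed simp
    also have "\<dots> \<le> (\<integral>\<^sup>+y1. \<integral>\<^sup>+y2. ?I y1 y2 \<partial>Q2 \<partial>Q1)"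
    proof -
      have "(\<lambda>y. \<integral>\<^sup>+y2. ?I y y2 \<partial>Q2) \<in> borel_measurable Q1" by measurable
      with dom(1)[OF w] have "(\<integral>\<^sup>+\<omega>. (\<integral>\<^sup>+y2. ?I (X1 w \<omega>) y2 \<partial>Q2) * ennreal (exp (- \<Lambda>1 w \<omega>)) \<partial>N1)
          \<le> (\<integral>\<^sup>+y1. \<integral>\<^sup>+y2. ?I y1 y2 \<partial>Q2 \<partial>Q1)"
        unfolding dominated_def by (rule bspec)
      then show ?thesis by (simp only: mult.commute)
    qed
    finally show ?thesis by (simp add: mult_left_mono add_right_mono)
  qed
  have "(\<Sum>w\<in>W. \<integral>\<^sup>+y1. \<integral>\<^sup>+y2. h w (y1, y2) \<partial>Q2 \<partial>Q1) =
     (\<integral>\<^sup>+y1. (\<Sum>w\<in>W. \<integral>\<^sup>+y2. h w (y1, y2) \<partial>Q2) \<partial>Q1)"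
    by (simp add: nn_integral_sum)
  also have "\<dots> = (\<integral>\<^sup>+y1. \<integral>\<^sup>+y2. (\<Sum>w\<in>W. h w (y1, y2)) \<partial>Q2 \<partial>Q1)"
    by (intro nn_integral_cong nn_integral_sum[symmetric]) measurable
  also have "\<dots> \<le> (\<integral>\<^sup>+y1. \<integral>\<^sup>+y2. 1 \<partial>Q2 \<partial>Q1)"
  proof (intro nn_integral_mono)
    fix y1 y2
    \<comment> \<open>Injectivity of \<open>\<phi>\<close> on \<open>W\<close>: at most one summand
      is 1.\<close>
    have "(\<Sum>w\<in>W. h w (y1, y2)) = (\<Sum>j\<in>\<phi> ` W. indicator {j} (\<delta> (y1, y2)) :: ennreal)"
      using W by (simp add: sum.reindex h_def)
    also have "\<dots> = indicator (\<phi> ` W) (\<delta> (y1, y2))"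
      using W by (auto simp: indicator_def)
    also have "\<dots> \<le> 1" by (simp add: indicator_def)
    finally show "(\<Sum>w\<in>W. h w (y1, y2)) \<le> 1" .
  qed
  also have "\<dots> = 1" by (simp add: Q1.emeasure_space_1 Q2.emeasure_space_1)
  finally have total: "(\<Sum>w\<in>W. \<integral>\<^sup>+y1. \<integral>\<^sup>+y2. h w (y1, y2) \<partial>Q2 \<partial>Q1) \<le> 1" .
  have "(\<Sum>w\<in>W. \<integral>\<^sup>+\<omega>1. \<integral>\<^sup>+\<omega>2. h w (X1 w \<omega>1, X2 w \<omega>2) \<partial>N2 \<partial>N1) \<le>
    (\<Sum>w\<in>W. ennreal (exp \<gamma>) * (\<integral>\<^sup>+y1. \<integral>\<^sup>+y2. h w (y1, y2) \<partial>Q2 \<partial>Q1) +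
     ((\<integral>\<^sup>+\<omega>. \<Lambda>1 w \<omega> \<partial>N1) + (\<integral>\<^sup>+\<omega>. \<Lambda>2 w \<omega> \<partial>N2)) / ennreal \<gamma>)"
    by (intro sum_mono one)
  also have "\<dots> = ennreal (exp \<gamma>) * (\<Sum>w\<in>W. \<integral>\<^sup>+y1. \<integral>\<^sup>+y2. h w (y1, y2) \<partial>Q2 \<partial>Q1) +
     (\<Sum>w\<in>W. (\<integral>\<^sup>+\<omega>. \<Lambda>1 w \<omega> \<partial>N1) + (\<integral>\<^sup>+\<omega>. \<Lambda>2 w \<omega> \<partial>N2)) / ennreal \<gamma>"
    by (simp add: sum.distrib sum_distrib_left divide_ennreal_def sum_distrib_right distrib_right)
  also have "\<dots> \<le> ennreal (exp \<gamma>) * 1 +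
     (\<Sum>w\<in>W. (\<integral>\<^sup>+\<omega>. \<Lambda>1 w \<omega> \<partial>N1) + (\<integral>\<^sup>+\<omega>. \<Lambda>2 w \<omega> \<partial>N2)) / ennreal \<gamma>"
    by (intro add_right_mono mult_left_mono total) simp
  finally show ?thesis by (simp add: h_def)
qed

section \<open>Relay channels and cuts\<close>

lemma valid_codeD:
  assumes "valid_code c"
  shows "blen c > 0" "msgs c > 0" "prob_space (cseed c)" "sets (cseed c) = sets seqM"
    "prob_space (rseed c i)" "sets (rseed c i) = sets seqM"
    "(\<lambda>u. enc c i u w k) \<in> borel_measurable seqM"
    "(\<lambda>(h, u, v, y). listens c i h u v k y) \<in> borel \<Otimes>\<^sub>M seqM \<Otimes>\<^sub>M seqM \<Otimes>\<^sub>M seqM \<rightarrow>\<^sub>M count_space UNIV"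
    "(\<lambda>(h, u, v, y). tx c i h u v k y) \<in> borel_measurable (borel \<Otimes>\<^sub>M seqM \<Otimes>\<^sub>M seqM \<Otimes>\<^sub>M seqM)"
    "(\<lambda>(hs, hr, u, y). dec c hs hr u y)
        \<in> Pi\<^sub>M UNIV (\<lambda>_. borel) \<Otimes>\<^sub>M Pi\<^sub>M UNIV (\<lambda>_. borel) \<Otimes>\<^sub>M seqM \<Otimes>\<^sub>M Pi\<^sub>M UNIV (\<lambda>_. seqM)
          \<rightarrow>\<^sub>M count_space UNIV"
    "w < msgs c \<Longrightarrow> (\<Sum>k<blen c. (cmod (enc c i u w k))\<^sup>2) \<le> real (blen c)"
    "(\<Sum>k | k < blen c \<and> \<not> listens c i h u v k (relay_rx (listens c i h u v) s k).
        (cmod (tx c i h u v k (relay_rx (listens c i h u v) s k)))\<^sup>2) \<le> real (blen c)"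
  using assms unfolding valid_code_def Let_def by blast+

lemma measurable_enc:
  assumes "valid_code c" and [measurable]: "u \<in> M \<rightarrow>\<^sub>M seqM"
  shows "(\<lambda>x. enc c i (u x) w k) \<in> borel_measurable M"
  by (rule measurable_compose[OF assms(2) valid_codeD(7)[OF assms(1)]])

lemma measurable_listens:
  assumes "valid_code c"
    and [measurable]: "h \<in> borel_measurable M" "u \<in> M \<rightarrow>\<^sub>M seqM" "v \<in> M \<rightarrow>\<^sub>M seqM" "y \<in> M \<rightarrow>\<^sub>M seqM"
  shows "Measurable.pred M (\<lambda>x. listens c i (h x) (u x) (v x) k (y x))"
  using measurable_compose[of "\<lambda>x. (h x, u x, v x, y x)", OF _ valid_codeD(8)[OF assms(1)], of M] by simp

lemma measurable_tx:
  assumes "valid_code c"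
    and [measurable]: "h \<in> borel_measurable M" "u \<in> M \<rightarrow>\<^sub>M seqM" "v \<in> M \<rightarrow>\<^sub>M seqM" "y \<in> M \<rightarrow>\<^sub>M seqM"
  shows "(\<lambda>x. tx c i (h x) (u x) (v x) k (y x)) \<in> borel_measurable M"
  using measurable_compose[of "\<lambda>x. (h x, u x, v x, y x)", OF _ valid_codeD(9)[OF assms(1)], of M] by simp

lemma measurable_dec:
  assumes "valid_code c"
    and [measurable]: "hs \<in> M \<rightarrow>\<^sub>M Pi\<^sub>M UNIV (\<lambda>_. borel)" "hr \<in> M \<rightarrow>\<^sub>M Pi\<^sub>M UNIV (\<lambda>_. borel)" "u \<in> M \<rightarrow>\<^sub>M seqM"
      "y \<in> M \<rightarrow>\<^sub>M Pi\<^sub>M UNIV (\<lambda>_. seqM)"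
  shows "(\<lambda>x. dec c (hs x) (hr x) (u x) (y x)) \<in> M \<rightarrow>\<^sub>M count_space UNIV"
  using measurable_compose[of "\<lambda>x. (hs x, hr x, u x, y x)", OF _ valid_codeD(10)[OF assms(1)], of M] by simp

definition relay_obs :: "real \<Rightarrow> code \<Rightarrow> relay \<Rightarrow> nat \<Rightarrow> cseq \<Rightarrow> cseq \<Rightarrow> complex \<Rightarrow> cseq \<Rightarrow> nat \<Rightarrow> cseq" where
  "relay_obs \<rho> c i w u v hs zr k = relay_rx (listens c i hs u v) (relay_in \<rho> c i w hs u zr) k"

definition relay_listens :: "real \<Rightarrow> code \<Rightarrow> relay \<Rightarrow> nat \<Rightarrow> cseq \<Rightarrow> cseq \<Rightarrow> complex \<Rightarrow> cseq \<Rightarrow> nat \<Rightarrow> bool" where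
  "relay_listens \<rho> c i w u v hs zr k = listens c i hs u v k (relay_obs \<rho> c i w u v hs zr k)"

definition relay_tx :: "real \<Rightarrow> code \<Rightarrow> relay \<Rightarrow> nat \<Rightarrow> cseq \<Rightarrow> cseq \<Rightarrow> complex \<Rightarrow> cseq \<Rightarrow> nat \<Rightarrow> complex" where
  "relay_tx \<rho> c i w u v hs zr k = tx c i hs u v k (relay_obs \<rho> c i w u v hs zr k)"

definition dest_obs :: "real \<Rightarrow> code \<Rightarrow> relay \<Rightarrow> nat \<Rightarrow> cseq \<Rightarrow> cseq \<Rightarrow> complex \<Rightarrow> complex \<Rightarrow> cseq \<Rightarrow> cseq \<Rightarrow> cseq" where
  "dest_obs \<rho> c i w u v hs hr zr zd = (\<lambda>k.
     if k < blen c \<and> \<not> relay_listens \<rho> c i w u v hs zr k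
     then hr * of_real (sqrt \<rho>) * relay_tx \<rho> c i w u v hs zr k + zd k else 0)"

text \<open>Path \<open>i\<close> reads only its own channels, private seed and noises; the two
  paths are coupled through the message and the common seed alone.\<close>

lemma dest_rx_eq: "dest_rx \<rho> c w u v hs hr zr zd i = dest_obs \<rho> c i w u (v i) (hs i) (hr i) (zr i) (zd i)"
  unfolding dest_rx_def dest_obs_def relay_listens_def relay_tx_def relay_obs_def Let_def ..

definition listen_count :: "real \<Rightarrow> code \<Rightarrow> relay \<Rightarrow> nat \<Rightarrow> cseq \<Rightarrow> cseq \<Rightarrow> complex \<Rightarrow> cseq \<Rightarrow> real" where
  "listen_count \<rho> c i w u v hs zr = (\<Sum>k<blen c. if relay_listens \<rho> c i w u v hs zr k then 1 else 0)"

context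
  fixes c :: code and M :: "'a measure" and h :: "'a \<Rightarrow> complex" and u v zr :: "'a \<Rightarrow> cseq"
  assumes c: "valid_code c"
    and m[measurable]: "h \<in> borel_measurable M" "u \<in> M \<rightarrow>\<^sub>M seqM" "v \<in> M \<rightarrow>\<^sub>M seqM" "zr \<in> M \<rightarrow>\<^sub>M seqM"
begin

lemma measurable_relay_obs: "(\<lambda>x. relay_obs \<rho> c i w (u x) (v x) (h x) (zr x) k) \<in> M \<rightarrow>\<^sub>M seqM"
  unfolding relay_obs_def
proof (rule measurable_relay_rx)
  show "(\<lambda>(x, y). listens c i (h x) (u x) (v x) k y) \<in> M \<Otimes>\<^sub>M seqM \<rightarrow>\<^sub>M count_space UNIV" for k
    unfolding case_prod_beta by (rule measurable_listens[OF c]) measurable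
  note [measurable] = measurable_enc[OF c m(2)]
  show "(\<lambda>x. relay_in \<rho> c i w (h x) (u x) (zr x)) \<in> M \<rightarrow>\<^sub>M seqM"
    unfolding relay_in_def by (rule measurable_seqM_fun) measurable
qed

lemma measurable_relay_listens: "Measurable.pred M (\<lambda>x. relay_listens \<rho> c i w (u x) (v x) (h x) (zr x) k)"
  unfolding relay_listens_def by (intro measurable_listens measurable_relay_obs m c)

lemma measurable_relay_tx: "(\<lambda>x. relay_tx \<rho> c i w (u x) (v x) (h x) (zr x) k) \<in> borel_measurable M"
  unfolding relay_tx_def by (intro measurable_tx measurable_relay_obs m c)

lemma measurable_listen_count: "(\<lambda>x. listen_count \<rho> c i w (u x) (v x) (h x) (zr x)) \<in> borel_measurable M"
proof -
  note [measurable] = measurable_relay_listens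
  show ?thesis unfolding listen_count_def by measurable
qed

lemma measurable_dest_obs:
  assumes [measurable]: "hr \<in> borel_measurable M" "zd \<in> M \<rightarrow>\<^sub>M seqM"
  shows "(\<lambda>x. dest_obs \<rho> c i w (u x) (v x) (h x) (hr x) (zr x) (zd x)) \<in> M \<rightarrow>\<^sub>M seqM"
proof -
  note [measurable] = measurable_relay_listens measurable_relay_tx
  show ?thesis unfolding dest_obs_def by (rule measurable_seqM_fun) measurable
qed

end

lemma listen_count_bounds: "0 \<le> listen_count \<rho> c i w u v hs zr" "listen_count \<rho> c i w u v hs zr \<le> blen c"
proof -
  show "0 \<le> listen_count \<rho> c i w u v hs zr" unfolding listen_count_def by (intro sum_nonneg) auto
  have "listen_count \<rho> c i w u v hs zr \<le> (\<Sum>k<blen c. 1)"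
    unfolding listen_count_def by (intro sum_mono) auto
  then show "listen_count \<rho> c i w u v hs zr \<le> blen c" by simp
qed

lemma nn_integral_cnM_square: "(\<integral>\<^sup>+z. ennreal ((cmod (z k))\<^sup>2) \<partial>cnM) \<le> 4"
  using nn_integral_CN01_square
  by (subst nn_integral_PiM_component[of "\<lambda>_. CN01" "\<lambda>x. ennreal ((cmod x)\<^sup>2)"]) auto

text \<open>
  \<open>b\<close> selects the cut at the source side. At the destination side, the reference law is an average over
  the \<open>2 ^ blen c\<close> listening patterns, which costs the term \<open>ln 2\<close>.
\<close>

definition cut_cost :: "bool \<Rightarrow> real \<Rightarrow> real \<Rightarrow> real \<Rightarrow> code \<Rightarrow> relay \<Rightarrow> nat \<Rightarrow> cseq \<Rightarrow> cseq \<Rightarrow> complex \<Rightarrow> complex \<Rightarrow> ennreal" where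
  "cut_cost b a \<sigma> \<rho> c i w u v hs hr =
     (if b then ennreal (2 * ln \<sigma>) * (\<integral>\<^sup>+z. ennreal (listen_count \<rho> c i w u v hs z) \<partial>cnM) +
        ennreal (real (blen c) * (4 * a + (1 + 1 / a) * ((cmod hs)\<^sup>2 * \<rho>) / \<sigma>\<^sup>2))
      else ennreal (2 * ln \<sigma>) * (\<integral>\<^sup>+z. ennreal (real (blen c) - listen_count \<rho> c i w u v hs z) \<partial>cnM) +
        ennreal (real (blen c) * (4 * a + (1 + 1 / a) * ((cmod hr)\<^sup>2 * \<rho>) / \<sigma>\<^sup>2 + ln 2)))"

text \<open>Shared by both cuts. The power constraint holds for every block and not merely on
  average, so the signal energy can be replaced by the constant \<open>P\<close> before
  integration.\<close>

lemma nn_integral_cost_le: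
  assumes a: "a > 0" and s: "\<sigma> \<ge> 1" and P: "P \<ge> 0"
    and m: "\<And>\<omega>. (\<Sum>k<n. (cmod (m \<omega> k))\<^sup>2) \<le> P"
    and [measurable]: "B \<in> borel_measurable N" "\<And>k. (\<lambda>\<omega>. m \<omega> k) \<in> borel_measurable N"
      "z \<in> N \<rightarrow>\<^sub>M seqM"
    and B: "\<And>\<omega>. 0 \<le> B \<omega>" and C: "C \<ge> 0" and N: "prob_space N"
    and z: "\<And>k. (\<integral>\<^sup>+\<omega>. ennreal ((cmod (z \<omega> k))\<^sup>2) \<partial>N) \<le> 4"
  shows "(\<integral>\<^sup>+\<omega>. ennreal (2 * ln \<sigma> * B \<omega> +
      (\<Sum>k<n. a * (cmod (z \<omega> k))\<^sup>2 + (1 + 1 / a) * (cmod (m \<omega> k))\<^sup>2 / \<sigma>\<^sup>2) + C) \<partial>N) \<le>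
    ennreal (2 * ln \<sigma>) * (\<integral>\<^sup>+\<omega>. ennreal (B \<omega>) \<partial>N) + ennreal (real n * (4 * a) + (1 + 1 / a) * P / \<sigma>\<^sup>2 + C)"
proof -
  interpret prob_space N by fact
  have zm[measurable]: "(\<lambda>\<omega>. z \<omega> k) \<in> borel_measurable N" for k
    by (rule measurable_seqM_component) simp
  let ?D = "(1 + 1 / a) * P / \<sigma>\<^sup>2"
  have D: "0 \<le> ?D" using a P by simp
  have ptw: "ennreal (2 * ln \<sigma> * B \<omega> +
      (\<Sum>k<n. a * (cmod (z \<omega> k))\<^sup>2 + (1 + 1 / a) * (cmod (m \<omega> k))\<^sup>2 / \<sigma>\<^sup>2) + C) \<le>
    ennreal (2 * ln \<sigma>) * ennreal (B \<omega>) + (\<Sum>k<n. ennreal a * ennreal ((cmod (z \<omega> k))\<^sup>2)) + ennreal (?D + C)" for \<omega>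
  proof -
    have "(\<Sum>k<n. a * (cmod (z \<omega> k))\<^sup>2 + (1 + 1 / a) * (cmod (m \<omega> k))\<^sup>2 / \<sigma>\<^sup>2) =
      (\<Sum>k<n. a * (cmod (z \<omega> k))\<^sup>2) + (1 + 1 / a) * (\<Sum>k<n. (cmod (m \<omega> k))\<^sup>2) / \<sigma>\<^sup>2"
      by (simp add: sum.distrib sum_distrib_left sum_divide_distrib)
    also have "\<dots> \<le> (\<Sum>k<n. a * (cmod (z \<omega> k))\<^sup>2) + ?D"
      using a m[of \<omega>] by (intro add_left_mono divide_right_mono mult_left_mono) auto
    finally have "ennreal (2 * ln \<sigma> * B \<omega> +
      (\<Sum>k<n. a * (cmod (z \<omega> k))\<^sup>2 + (1 + 1 / a) * (cmod (m \<omega> k))\<^sup>2 / \<sigma>\<^sup>2) + C) \<le>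
      ennreal (2 * ln \<sigma> * B \<omega> + (\<Sum>k<n. a * (cmod (z \<omega> k))\<^sup>2) + (?D + C))"
      by (intro ennreal_leI) linarith
    also have "\<dots> = ennreal (2 * ln \<sigma>) * ennreal (B \<omega>) +
        (\<Sum>k<n. ennreal a * ennreal ((cmod (z \<omega> k))\<^sup>2)) + ennreal (?D + C)"
    proof -
      have "0 \<le> 2 * ln \<sigma> * B \<omega>" using s B by simp
      moreover have "0 \<le> (\<Sum>k<n. a * (cmod (z \<omega> k))\<^sup>2)" using a by (intro sum_nonneg) auto
      moreover have "ennreal (\<Sum>k<n. a * (cmod (z \<omega> k))\<^sup>2) = (\<Sum>k<n. ennreal a * ennreal ((cmod (z \<omega> k))\<^sup>2))"
        using a by (subst sum_ennreal[symmetric]) (auto simp: ennreal_mult)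
      ultimately show ?thesis using D C s B
        by (simp add: ennreal_mult)
    qed
    finally show ?thesis .
  qed
  have "(\<integral>\<^sup>+\<omega>. ennreal (2 * ln \<sigma> * B \<omega> +
      (\<Sum>k<n. a * (cmod (z \<omega> k))\<^sup>2 + (1 + 1 / a) * (cmod (m \<omega> k))\<^sup>2 / \<sigma>\<^sup>2) + C) \<partial>N) \<le>
    (\<integral>\<^sup>+\<omega>. ennreal (2 * ln \<sigma>) * ennreal (B \<omega>) + (\<Sum>k<n. ennreal a * ennreal ((cmod (z \<omega> k))\<^sup>2)) + ennreal (?D + C) \<partial>N)"
    by (intro nn_integral_mono ptw)
  also have "\<dots> = ennreal (2 * ln \<sigma>) * (\<integral>\<^sup>+\<omega>. ennreal (B \<omega>) \<partial>N) +
      (\<Sum>k<n. ennreal a * (\<integral>\<^sup>+\<omega>. ennreal ((cmod (z \<omega> k))\<^sup>2) \<partial>N)) + ennreal (?D + C)"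
    by (simp add: nn_integral_add nn_integral_cmult nn_integral_sum emeasure_space_1)
  also have "\<dots> \<le> ennreal (2 * ln \<sigma>) * (\<integral>\<^sup>+\<omega>. ennreal (B \<omega>) \<partial>N) +
      (\<Sum>k<n. ennreal a * 4) + ennreal (?D + C)"
    by (intro add_mono sum_mono mult_left_mono z order_refl) auto
  also have "(\<Sum>k<n. ennreal a * 4) = ennreal (real n * (4 * a))"
    using a by (simp add: ennreal_mult ennreal_of_nat_eq_real_of_nat mult_ac)
  finally show ?thesis
    using a D C by (simp add: add.assoc flip: ennreal_plus)
qed

lemma rx_cost_eq:
  "rx_cost a \<sigma> L m n z = 2 * ln \<sigma> * (\<Sum>k<n. if L k (relay_rx L (\<lambda>k. m k + z k) k) then 1 else 0) +
     (\<Sum>k<n. a * (cmod (z k))\<^sup>2 + (1 + 1 / a) * (cmod (m k))\<^sup>2 / \<sigma>\<^sup>2)"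
  unfolding rx_cost_def sum_distrib_left sum.distrib[symmetric] by (intro sum.cong) auto

text \<open>Data processing: given the destination noise, what the destination sees is a function of
  the relay's received block. It is enough to compare the laws of that block and to push the
  reference law, that of noise stretched by \<open>\<sigma>\<close>, through the same map.\<close>

lemma source_cut:
  assumes c: "valid_code c" and \<rho>: "\<rho> \<ge> 0" and a: "a > 0" and s: "\<sigma> \<ge> 1"
  obtains Q \<Lambda> where "prob_space Q" "sets Q = sets seqM"
    "\<And>w. \<Lambda> w \<in> borel_measurable (cnM \<Otimes>\<^sub>M cnM)" "\<And>w \<omega>. 0 \<le> \<Lambda> w \<omega>"
    "\<And>w. dominated (cnM \<Otimes>\<^sub>M cnM) (\<lambda>w (zr, zd). dest_obs \<rho> c i w u v hs hr zr zd) \<Lambda> Q w"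
    "\<And>w. w < msgs c \<Longrightarrow> (\<integral>\<^sup>+\<omega>. \<Lambda> w \<omega> \<partial>(cnM \<Otimes>\<^sub>M cnM)) \<le> cut_cost True a \<sigma> \<rho> c i w u v hs hr"
proof -
  interpret cn: prob_space cnM by simp
  interpret pp: pair_prob_space cnM cnM ..
  define L where "L = listens c i hs u v"
  define m where "m w k = hs * of_real (sqrt \<rho>) * enc c i u w k" for w k
  \<comment> \<open>\<open>prefix k y\<close> gives the relay in slot \<open>k\<close> only what it
    had received before; \<open>prefix_relay_rx\<close> identifies it with the actual
    observation.\<close>
  define D where "D y zd = (\<lambda>k. if k < blen c \<and> \<not> L k (prefix k y)
     then hr * of_real (sqrt \<rho>) * tx c i hs u v k (prefix k y) + zd k else 0)" for y zd :: cseq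
  have L[measurable]: "Measurable.pred seqM (L k)" for k
    unfolding L_def by (rule measurable_listens[OF c]) simp_all
  have D[measurable]: "(\<lambda>(y, zd). D y zd) \<in> seqM \<Otimes>\<^sub>M seqM \<rightarrow>\<^sub>M seqM"
  proof -
    have [measurable]: "(\<lambda>y. tx c i hs u v k y) \<in> borel_measurable seqM" for k
      by (rule measurable_tx[OF c]) simp_all
    show ?thesis unfolding D_def case_prod_beta by (rule measurable_seqM_fun) measurable
  qed
  have Dpair: "(\<lambda>x. D (f x) (g x)) \<in> M \<rightarrow>\<^sub>M seqM" if "f \<in> M \<rightarrow>\<^sub>M seqM" "g \<in> M \<rightarrow>\<^sub>M seqM"
    for f g and M :: "(cseq \<times> cseq) measure"
    using measurable_compose[of "\<lambda>x. (f x, g x)" M "seqM \<Otimes>\<^sub>M seqM", OF _ D] that by simp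
  have obs: "dest_obs \<rho> c i w u v hs hr zr zd = D (relay_rx L (\<lambda>k. m w k + zr k) (blen c)) zd" for w zr zd
    by (auto simp: dest_obs_def D_def relay_listens_def relay_tx_def relay_obs_def relay_in_def L_def m_def
        prefix_relay_rx fun_eq_iff)
  define Q where "Q = distr (cnM \<Otimes>\<^sub>M cnM) seqM (\<lambda>(zr, zd). D (relay_rx L (\<lambda>k. of_real \<sigma> * zr k) (blen c)) zd)"
  define \<Lambda> where "\<Lambda> w \<omega> = rx_cost a \<sigma> L (m w) (blen c) (fst \<omega>)" for w and \<omega> :: "cseq \<times> cseq"
  have mQ: "(\<lambda>(zr, zd). D (relay_rx L (\<lambda>k. of_real \<sigma> * zr k) (blen c)) zd) \<in> cnM \<Otimes>\<^sub>M cnM \<rightarrow>\<^sub>M seqM"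
    unfolding case_prod_beta by (rule Dpair) measurable
  show thesis
  proof (rule that[of Q \<Lambda>])
    show "prob_space Q" unfolding Q_def by (rule pp.prob_space_distr[OF mQ])
    show "sets Q = sets seqM" by (simp add: Q_def)
    show "\<Lambda> w \<in> borel_measurable (cnM \<Otimes>\<^sub>M cnM)" for w unfolding \<Lambda>_def by measurable
    show "0 \<le> \<Lambda> w \<omega>" for w \<omega> unfolding \<Lambda>_def by (rule rx_cost_nonneg[OF a s])
    show "dominated (cnM \<Otimes>\<^sub>M cnM) (\<lambda>w (zr, zd). dest_obs \<rho> c i w u v hs hr zr zd) \<Lambda> Q w" for w
      unfolding dominated_def
    proof
      fix g :: "cseq \<Rightarrow> ennreal" assume "g \<in> borel_measurable Q"
      then have [measurable]: "g \<in> borel_measurable seqM" by (simp add: Q_def)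
      \<comment> \<open>The destination noise is integrated out first, so that
        \<open>relay_rx_change_of_measure\<close> is applied to a function of the relay's block
        only.\<close>
      define G where "G y = (\<integral>\<^sup>+zd. g (D y zd) \<partial>cnM)" for y
      have mG1: "(\<lambda>(y, zd). g (D y zd)) \<in> borel_measurable (seqM \<Otimes>\<^sub>M cnM)"
        unfolding case_prod_beta by (rule measurable_compose[OF Dpair, of "fst" _ "snd"]) simp_all
      then have [measurable]: "G \<in> borel_measurable seqM" unfolding G_def
        by (intro cn.borel_measurable_nn_integral) simp
      have m1: "(\<lambda>(zr, zd). g (D (relay_rx L (\<lambda>k. m w k + zr k) (blen c)) zd) *
          ennreal (exp (- rx_cost a \<sigma> L (m w) (blen c) zr))) \<in> borel_measurable (cnM \<Otimes>\<^sub>M cnM)"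
        unfolding case_prod_beta
        by (intro borel_measurable_times_ennreal measurable_compose[OF Dpair, where g=g]) measurable
      have "(\<integral>\<^sup>+\<omega>. g (case \<omega> of (zr, zd) \<Rightarrow> dest_obs \<rho> c i w u v hs hr zr zd) * ennreal (exp (- \<Lambda> w \<omega>)) \<partial>(cnM \<Otimes>\<^sub>M cnM)) =
        (\<integral>\<^sup>+zr. \<integral>\<^sup>+zd. g (D (relay_rx L (\<lambda>k. m w k + zr k) (blen c)) zd) *
          ennreal (exp (- rx_cost a \<sigma> L (m w) (blen c) zr)) \<partial>cnM \<partial>cnM)"
        using cn.nn_integral_fst[OF m1] by (simp add: obs \<Lambda>_def case_prod_unfold)
      also have "\<dots> = (\<integral>\<^sup>+zr. G (relay_rx L (\<lambda>k. m w k + zr k) (blen c)) *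
          ennreal (exp (- rx_cost a \<sigma> L (m w) (blen c) zr)) \<partial>cnM)"
        unfolding G_def
      proof (intro nn_integral_cong nn_integral_multc)
        fix zr :: cseq
        show "(\<lambda>zd. g (D (relay_rx L (\<lambda>k. m w k + zr k) (blen c)) zd)) \<in> borel_measurable cnM"
          using measurable_compose[OF measurable_Pair1' mG1, of "relay_rx L (\<lambda>k. m w k + zr k) (blen c)"] by simp
      qed
      also have "\<dots> \<le> (\<integral>\<^sup>+zr. G (relay_rx L (\<lambda>k. of_real \<sigma> * zr k) (blen c)) \<partial>cnM)"
        by (rule relay_rx_change_of_measure[OF a s]) measurable
      also have "\<dots> = (\<integral>\<^sup>+\<omega>. g (case \<omega> of (zr, zd) \<Rightarrow> D (relay_rx L (\<lambda>k. of_real \<sigma> * zr k) (blen c)) zd) \<partial>(cnM \<Otimes>\<^sub>M cnM))"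
        unfolding G_def using cn.nn_integral_fst[of "\<lambda>\<omega>. g (case \<omega> of (zr, zd) \<Rightarrow> D (relay_rx L (\<lambda>k. of_real \<sigma> * zr k) (blen c)) zd)" cnM]
          measurable_compose[OF mQ, of g] by simp
      also have "\<dots> = (\<integral>\<^sup>+y. g y \<partial>Q)"
        unfolding Q_def by (rule nn_integral_distr[symmetric, OF mQ]) simp
      finally show "(\<integral>\<^sup>+\<omega>. g (case \<omega> of (zr, zd) \<Rightarrow> dest_obs \<rho> c i w u v hs hr zr zd) *
          ennreal (exp (- \<Lambda> w \<omega>)) \<partial>(cnM \<Otimes>\<^sub>M cnM)) \<le> (\<integral>\<^sup>+y. g y \<partial>Q)" .
    qed
  next
    fix w assume w: "w < msgs c"
    have "(\<Sum>k<blen c. (cmod (m w k))\<^sup>2) = (cmod hs)\<^sup>2 * \<rho> * (\<Sum>k<blen c. (cmod (enc c i u w k))\<^sup>2)"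
      using \<rho> by (simp add: m_def norm_mult power_mult_distrib sum_distrib_left)
    also have "\<dots> \<le> (cmod hs)\<^sup>2 * \<rho> * real (blen c)"
      using \<rho> valid_codeD(11)[OF c w] by (intro mult_left_mono) auto
    finally have pow: "(\<Sum>k<blen c. (cmod (m w k))\<^sup>2) \<le> (cmod hs)\<^sup>2 * \<rho> * real (blen c)" .
    let ?B = "\<lambda>zr. listen_count \<rho> c i w u v hs zr"
    have cost: "rx_cost a \<sigma> L (m w) (blen c) zr = 2 * ln \<sigma> * ?B zr +
      (\<Sum>k<blen c. a * (cmod (zr k))\<^sup>2 + (1 + 1 / a) * (cmod (m w k))\<^sup>2 / \<sigma>\<^sup>2) + 0" for zr
      unfolding rx_cost_eq
      by (simp add: listen_count_def relay_listens_def relay_obs_def relay_in_def L_def m_def)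
    have "(\<integral>\<^sup>+\<omega>. \<Lambda> w \<omega> \<partial>(cnM \<Otimes>\<^sub>M cnM)) = (\<integral>\<^sup>+zr. ennreal (rx_cost a \<sigma> L (m w) (blen c) zr) \<partial>cnM)"
      unfolding \<Lambda>_def by (subst cn.nn_integral_fst[symmetric]) (simp_all add: cn.emeasure_space_1[simplified])
    also have "\<dots> \<le> ennreal (2 * ln \<sigma>) * (\<integral>\<^sup>+zr. ennreal (?B zr) \<partial>cnM) +
        ennreal (real (blen c) * (4 * a) + (1 + 1 / a) * ((cmod hs)\<^sup>2 * \<rho> * real (blen c)) / \<sigma>\<^sup>2 + 0)"
      unfolding cost
      by (rule nn_integral_cost_le[OF a s _ pow])
        (use \<rho> in \<open>auto intro!: measurable_listen_count[OF c] listen_count_bounds nn_integral_cnM_square\<close>)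
    also have "\<dots> = cut_cost True a \<sigma> \<rho> c i w u v hs hr"
      by (simp add: cut_cost_def algebra_simps)
    finally show "(\<integral>\<^sup>+\<omega>. \<Lambda> w \<omega> \<partial>(cnM \<Otimes>\<^sub>M cnM)) \<le> cut_cost True a \<sigma> \<rho> c i w u v hs hr" .
  qed
qed

text \<open>For fixed relay noise the destination is a receiver with a fixed signal and a schedule
  \<open>S w zr\<close> known in advance. Since this schedule varies with the message, no single
  pattern can serve as reference; the uniform mixture dominates every pattern at the price of a
  factor \<open>2 ^ n\<close>, and the bound is then uniform in the relay noise.\<close>

lemma dest_cut:
  assumes c: "valid_code c" and \<rho>: "\<rho> \<ge> 0" and a: "a > 0" and s: "\<sigma> \<ge> 1"
  obtains Q \<Lambda> where "prob_space Q" "sets Q = sets seqM"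
    "\<And>w. \<Lambda> w \<in> borel_measurable (cnM \<Otimes>\<^sub>M cnM)" "\<And>w \<omega>. 0 \<le> \<Lambda> w \<omega>"
    "\<And>w. dominated (cnM \<Otimes>\<^sub>M cnM) (\<lambda>w (zr, zd). dest_obs \<rho> c i w u v hs hr zr zd) \<Lambda> Q w"
    "\<And>w. w < msgs c \<Longrightarrow> (\<integral>\<^sup>+\<omega>. \<Lambda> w \<omega> \<partial>(cnM \<Otimes>\<^sub>M cnM)) \<le> cut_cost False a \<sigma> \<rho> c i w u v hs hr"
proof -
  interpret cn: prob_space cnM by simp
  interpret pp: pair_prob_space cnM cnM ..
  define n where "n = blen c"
  define S where "S w zr = {k. k < n \<and> \<not> relay_listens \<rho> c i w u v hs zr k}" for w zr
  define m where "m w zr k = (if k \<in> S w zr then hr * of_real (sqrt \<rho>) * relay_tx \<rho> c i w u v hs zr k else 0)" for w zr k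
  \<comment> \<open>Listening and transmitting are exchanged: the destination hears exactly in the
    slots in which the relay does not listen.\<close>
  have obs: "dest_obs \<rho> c i w u v hs hr zr zd = relay_rx (\<lambda>k _. k \<in> S w zr) (\<lambda>k. m w zr k + zd k) n" for w zr zd
  proof -
    have "relay_rx (\<lambda>k _. P k) s j = (\<lambda>k. if k < j \<and> P k then s k else 0)" for P s j
      by (induction j) (auto simp: fun_eq_iff less_Suc_eq)
    then show ?thesis by (auto simp: dest_obs_def S_def m_def n_def fun_eq_iff)
  qed
  have [measurable]: "Measurable.pred seqM (\<lambda>zr. relay_listens \<rho> c i w u v hs zr k)" for w k
    by (rule measurable_relay_listens[OF c]) simp_all
  have [measurable]: "(\<lambda>zr. relay_tx \<rho> c i w u v hs zr k) \<in> borel_measurable seqM" for w k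
    by (rule measurable_relay_tx[OF c]) simp_all
  have [measurable]: "Measurable.pred seqM (\<lambda>zr. k \<in> S w zr)" for k w
    unfolding S_def mem_Collect_eq by measurable
  have [measurable]: "(\<lambda>zr. m w zr k) \<in> borel_measurable seqM" for k w
    unfolding m_def by measurable
  define pm where "pm = measure_pmf (pmf_of_set (Pow {..<n}))"
  have pm_fin: "finite (Pow {..<n})" "Pow {..<n} \<noteq> {}" by auto
  interpret pm: prob_space pm unfolding pm_def by (rule prob_space_measure_pmf)
  interpret pq: pair_prob_space pm cnM ..
  define R where "R A z = relay_rx (\<lambda>k _. k \<in> A) (\<lambda>k. of_real \<sigma> * z k) n" for A z
  have mR[measurable]: "R A \<in> seqM \<rightarrow>\<^sub>M seqM" for A
    unfolding R_def by measurable
  have mR2: "(\<lambda>(A, z). R A z) \<in> pm \<Otimes>\<^sub>M cnM \<rightarrow>\<^sub>M seqM"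
  proof (rule measurable_seqM_fun)
    fix k
    have "R A z k = (if k < n \<and> k \<in> A then of_real \<sigma> * z k else 0)" for A z
    proof -
      have "relay_rx (\<lambda>k _. P k) s j = (\<lambda>k. if k < j \<and> P k then s k else 0)" for P s j
        by (induction j) (auto simp: fun_eq_iff less_Suc_eq)
      then show ?thesis by (simp add: R_def)
    qed
    moreover have "Measurable.pred (pm \<Otimes>\<^sub>M cnM) (\<lambda>x. k \<in> fst x)"
      by (rule measurable_compose[OF measurable_fst]) (simp add: pm_def)
    moreover have "(\<lambda>x. snd x k) \<in> borel_measurable (pm \<Otimes>\<^sub>M cnM)"
      by (rule measurable_seqM_component) simp
    ultimately show "(\<lambda>x. (case x of (A, z) \<Rightarrow> R A z) k) \<in> borel_measurable (pm \<Otimes>\<^sub>M cnM)"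
      by (simp add: case_prod_beta)
  qed
  define Q where "Q = distr (pm \<Otimes>\<^sub>M cnM) seqM (\<lambda>(A, z). R A z)"
  define \<Lambda> where "\<Lambda> w \<omega> = rx_cost a \<sigma> (\<lambda>k _. k \<in> S w (fst \<omega>)) (m w (fst \<omega>)) n (snd \<omega>) + real n * ln 2"
    for w and \<omega> :: "cseq \<times> cseq"
  have \<Lambda>_eq: "\<Lambda> w \<omega> = 2 * ln \<sigma> * (real n - listen_count \<rho> c i w u v hs (fst \<omega>)) +
      (\<Sum>k<n. a * (cmod (snd \<omega> k))\<^sup>2 + (1 + 1 / a) * (cmod (m w (fst \<omega>) k))\<^sup>2 / \<sigma>\<^sup>2) + real n * ln 2" for w \<omega>
  proof -
    have "(\<Sum>k<n. if k \<in> S w zr then 1 else 0) = real n - listen_count \<rho> c i w u v hs zr" for zr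
    proof -
      have "(\<Sum>k<n. if k \<in> S w zr then 1 else 0) + listen_count \<rho> c i w u v hs zr = (\<Sum>k<n. 1::real)"
        unfolding listen_count_def n_def[symmetric] sum.distrib[symmetric]
        by (intro sum.cong) (auto simp: S_def)
      then show ?thesis by simp
    qed
    then show ?thesis
      unfolding \<Lambda>_def rx_cost_eq by simp
  qed
  have m\<Lambda>: "\<Lambda> w \<in> borel_measurable (cnM \<Otimes>\<^sub>M cnM)" for w
    unfolding \<Lambda>_def rx_cost_def by measurable
  show thesis
  proof (rule that[of Q \<Lambda>])
    show "prob_space Q" unfolding Q_def by (rule pq.prob_space_distr[OF mR2])
    show "sets Q = sets seqM" by (simp add: Q_def)
    show "\<Lambda> w \<in> borel_measurable (cnM \<Otimes>\<^sub>M cnM)" for w by fact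
    show "0 \<le> \<Lambda> w \<omega>" for w \<omega>
      unfolding \<Lambda>_def using rx_cost_nonneg[OF a s] by simp
    show "dominated (cnM \<Otimes>\<^sub>M cnM) (\<lambda>w (zr, zd). dest_obs \<rho> c i w u v hs hr zr zd) \<Lambda> Q w" for w
      unfolding dominated_def
    proof
      fix g :: "cseq \<Rightarrow> ennreal" assume "g \<in> borel_measurable Q"
      then have [measurable]: "g \<in> borel_measurable seqM" by (simp add: Q_def)
      have gQ: "(\<integral>\<^sup>+y. g y \<partial>Q) = (\<Sum>A\<in>Pow {..<n}. \<integral>\<^sup>+z. g (R A z) \<partial>cnM) / ennreal (2 ^ n)"
      proof -
        have "(\<integral>\<^sup>+y. g y \<partial>Q) = (\<integral>\<^sup>+x. g (case x of (A, z) \<Rightarrow> R A z) \<partial>(pm \<Otimes>\<^sub>M cnM))"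
          unfolding Q_def by (rule nn_integral_distr[OF mR2]) simp
        also have "\<dots> = (\<integral>\<^sup>+A. \<integral>\<^sup>+z. g (R A z) \<partial>cnM \<partial>pm)"
          using cn.nn_integral_fst[of "\<lambda>x. g (case x of (A, z) \<Rightarrow> R A z)" pm] measurable_compose[OF mR2, of g] by simp
        also have "\<dots> = (\<Sum>A\<in>Pow {..<n}. \<integral>\<^sup>+z. g (R A z) \<partial>cnM) / ennreal (2 ^ n)"
          unfolding pm_def by (subst nn_integral_pmf_of_set[OF pm_fin(2,1)]) (simp add: card_Pow ennreal_of_nat_eq_real_of_nat)
        finally show ?thesis .
      qed
      have "(\<integral>\<^sup>+\<omega>. g (case \<omega> of (zr, zd) \<Rightarrow> dest_obs \<rho> c i w u v hs hr zr zd) * ennreal (exp (- \<Lambda> w \<omega>)) \<partial>(cnM \<Otimes>\<^sub>M cnM)) =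
        (\<integral>\<^sup>+zr. \<integral>\<^sup>+zd. g (dest_obs \<rho> c i w u v hs hr zr zd) * ennreal (exp (- \<Lambda> w (zr, zd))) \<partial>cnM \<partial>cnM)"
      proof -
        have "(\<lambda>\<omega>. dest_obs \<rho> c i w u v hs hr (fst \<omega>) (snd \<omega>)) \<in> cnM \<Otimes>\<^sub>M cnM \<rightarrow>\<^sub>M seqM"
          by (rule measurable_dest_obs[OF c]) simp_all
        then have "(\<lambda>\<omega>. g (case \<omega> of (zr, zd) \<Rightarrow> dest_obs \<rho> c i w u v hs hr zr zd) * ennreal (exp (- \<Lambda> w \<omega>)))
            \<in> borel_measurable (cnM \<Otimes>\<^sub>M cnM)"
          using m\<Lambda>[of w] by (simp add: case_prod_beta)
        from cn.nn_integral_fst[OF this] show ?thesis by simp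
      qed
      also have "\<dots> \<le> (\<integral>\<^sup>+zr. (\<integral>\<^sup>+y. g y \<partial>Q) \<partial>cnM)"
      proof (rule nn_integral_mono)
        fix zr
        let ?S = "S w zr"
        have E: "ennreal (exp (- \<Lambda> w (zr, zd))) =
            ennreal (exp (- rx_cost a \<sigma> (\<lambda>k _. k \<in> ?S) (m w zr) n zd)) * ennreal (1 / 2 ^ n)" for zd
        proof -
          have "exp (- (real n * ln 2)) = 1 / (2::real) ^ n"
            by (simp add: exp_minus exp_of_nat_mult inverse_eq_divide)
          then have "exp (- \<Lambda> w (zr, zd)) = exp (- rx_cost a \<sigma> (\<lambda>k _. k \<in> ?S) (m w zr) n zd) * (1 / 2 ^ n)"
            by (simp only: \<Lambda>_def minus_add_distrib exp_add fst_conv snd_conv)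
          then show ?thesis by (simp only: ennreal_mult'[OF exp_ge_zero])
        qed
        have "(\<integral>\<^sup>+zd. g (dest_obs \<rho> c i w u v hs hr zr zd) * ennreal (exp (- \<Lambda> w (zr, zd))) \<partial>cnM) =
          (\<integral>\<^sup>+zd. g (relay_rx (\<lambda>k _. k \<in> ?S) (\<lambda>k. m w zr k + zd k) n) *
             ennreal (exp (- rx_cost a \<sigma> (\<lambda>k _. k \<in> ?S) (m w zr) n zd)) \<partial>cnM) * ennreal (1 / 2 ^ n)"
          unfolding E obs mult.assoc[symmetric] by (rule nn_integral_multc) measurable
        also have "\<dots> \<le> (\<integral>\<^sup>+z. g (R ?S z) \<partial>cnM) * ennreal (1 / 2 ^ n)"
          unfolding R_def by (intro mult_right_mono relay_rx_change_of_measure[OF a s]) simp_all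
        \<comment> \<open>The actual pattern is one of the summands; divided by
          \<open>2 ^ n\<close>, the sum is the mixture.\<close>
        also have "\<dots> \<le> (\<Sum>A\<in>Pow {..<n}. \<integral>\<^sup>+z. g (R A z) \<partial>cnM) * ennreal (1 / 2 ^ n)"
          using pm_fin by (intro mult_right_mono member_le_sum) (auto simp: S_def)
        also have "\<dots> = (\<integral>\<^sup>+y. g y \<partial>Q)"
          unfolding gQ by (simp add: divide_ennreal_def inverse_ennreal inverse_eq_divide)
        finally show "(\<integral>\<^sup>+zd. g (dest_obs \<rho> c i w u v hs hr zr zd) * ennreal (exp (- \<Lambda> w (zr, zd))) \<partial>cnM) \<le> (\<integral>\<^sup>+y. g y \<partial>Q)" .
      qed
      also have "\<dots> = (\<integral>\<^sup>+y. g y \<partial>Q)" by (simp add: cn.emeasure_space_1[simplified])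
      finally show "(\<integral>\<^sup>+\<omega>. g (case \<omega> of (zr, zd) \<Rightarrow> dest_obs \<rho> c i w u v hs hr zr zd) *
          ennreal (exp (- \<Lambda> w \<omega>)) \<partial>(cnM \<Otimes>\<^sub>M cnM)) \<le> (\<integral>\<^sup>+y. g y \<partial>Q)" .
    qed
  next
    fix w assume w: "w < msgs c"
    have pow: "(\<Sum>k<n. (cmod (m w (fst \<omega>) k))\<^sup>2) \<le> (cmod hr)\<^sup>2 * \<rho> * real n" for \<omega> :: "cseq \<times> cseq"
    proof -
      let ?zr = "fst \<omega>" and ?L = "listens c i hs u v"
      let ?s = "relay_in \<rho> c i w hs u ?zr"
      have "(\<Sum>k<n. (cmod (m w ?zr k))\<^sup>2) = (\<Sum>k | k < n \<and> \<not> relay_listens \<rho> c i w u v hs ?zr k.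
          (cmod hr)\<^sup>2 * \<rho> * (cmod (relay_tx \<rho> c i w u v hs ?zr k))\<^sup>2)"
        using \<rho> by (intro sum.mono_neutral_cong_right)
          (auto simp: m_def S_def norm_mult power_mult_distrib)
      also have "\<dots> = (cmod hr)\<^sup>2 * \<rho> * (\<Sum>k | k < n \<and> \<not> ?L k (relay_rx ?L ?s k). (cmod (tx c i hs u v k (relay_rx ?L ?s k)))\<^sup>2)"
        by (simp add: sum_distrib_left relay_listens_def relay_tx_def relay_obs_def)
      also have "\<dots> \<le> (cmod hr)\<^sup>2 * \<rho> * real n"
        using \<rho> valid_codeD(12)[OF c] unfolding n_def by (intro mult_left_mono) auto
      finally show ?thesis .
    qed
    have [measurable]: "(\<lambda>z. listen_count \<rho> c i w u v hs z) \<in> borel_measurable seqM"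
      by (rule measurable_listen_count[OF c]) simp_all
    have "(\<integral>\<^sup>+\<omega>. \<Lambda> w \<omega> \<partial>(cnM \<Otimes>\<^sub>M cnM)) \<le>
      ennreal (2 * ln \<sigma>) * (\<integral>\<^sup>+\<omega>. ennreal (real n - listen_count \<rho> c i w u v hs (fst \<omega>)) \<partial>(cnM \<Otimes>\<^sub>M cnM)) +
        ennreal (real n * (4 * a) + (1 + 1 / a) * ((cmod hr)\<^sup>2 * \<rho> * real n) / \<sigma>\<^sup>2 + real n * ln 2)"
      unfolding \<Lambda>_eq
    proof (rule nn_integral_cost_le[OF a s _ pow])
      show "(\<integral>\<^sup>+\<omega>. ennreal ((cmod (snd \<omega> k))\<^sup>2) \<partial>(cnM \<Otimes>\<^sub>M cnM)) \<le> 4" for k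
        using nn_integral_cnM_square[of k]
        by (subst cn.nn_integral_fst[symmetric]) (simp_all add: cn.emeasure_space_1[simplified])
    qed (use \<rho> listen_count_bounds(2)[of \<rho> c] in \<open>auto simp: n_def intro: pp.prob_space_axioms\<close>)
    also have "(\<integral>\<^sup>+\<omega>. ennreal (real n - listen_count \<rho> c i w u v hs (fst \<omega>)) \<partial>(cnM \<Otimes>\<^sub>M cnM)) =
        (\<integral>\<^sup>+z. ennreal (real n - listen_count \<rho> c i w u v hs z) \<partial>cnM)"
      by (subst cn.nn_integral_fst[symmetric]) (simp_all add: cn.emeasure_space_1[simplified])
    also have "ennreal (2 * ln \<sigma>) * \<dots> +
        ennreal (real n * (4 * a) + (1 + 1 / a) * ((cmod hr)\<^sup>2 * \<rho> * real n) / \<sigma>\<^sup>2 + real n * ln 2)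
       = cut_cost False a \<sigma> \<rho> c i w u v hs hr"
      by (simp add: cut_cost_def n_def algebra_simps)
    finally show "(\<integral>\<^sup>+\<omega>. \<Lambda> w \<omega> \<partial>(cnM \<Otimes>\<^sub>M cnM)) \<le> cut_cost False a \<sigma> \<rho> c i w u v hs hr" .
  qed
qed

section \<open>The error probability as an iterated integral\<close>

lemma nn_integral_swap:
  assumes "sigma_finite_measure M" "sigma_finite_measure N"
    and "(\<lambda>(x, y). f x y) \<in> borel_measurable (M \<Otimes>\<^sub>M N)"
  shows "(\<integral>\<^sup>+x. \<integral>\<^sup>+y. f x y \<partial>N \<partial>M) = (\<integral>\<^sup>+y. \<integral>\<^sup>+x. f x y \<partial>M \<partial>N)"
proof -
  interpret pair_sigma_finite M N using assms by (simp add: pair_sigma_finite_def)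
  show ?thesis using Fubini'[of f] assms(3) by simp
qed

context
  fixes A :: "'a measure" and B :: "'b measure" and C :: "'c measure" and D :: "'d measure" and E :: "'e measure"
    and f :: "'a \<times> 'b \<times> 'c \<times> 'd \<times> 'e \<Rightarrow> ennreal"
  assumes P: "prob_space A" "prob_space B" "prob_space C" "prob_space D" "prob_space E"
    and U: "space A = UNIV" "space B = UNIV" "space C = UNIV" "space D = UNIV" "space E = UNIV"
    and f[measurable]: "f \<in> borel_measurable (A \<Otimes>\<^sub>M B \<Otimes>\<^sub>M C \<Otimes>\<^sub>M D \<Otimes>\<^sub>M E)"
begin

interpretation A: prob_space A by fact
interpretation B: prob_space B by fact
interpretation C: prob_space C by fact
interpretation D: prob_space D by fact
interpretation E: prob_space E by fact
interpretation DE: pair_prob_space D E ..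
interpretation CDE: pair_prob_space C "D \<Otimes>\<^sub>M E" ..
interpretation BCDE: pair_prob_space B "C \<Otimes>\<^sub>M D \<Otimes>\<^sub>M E" ..

lemmas sf = A.sigma_finite_measure_axioms B.sigma_finite_measure_axioms C.sigma_finite_measure_axioms
  D.sigma_finite_measure_axioms E.sigma_finite_measure_axioms

lemma nn_integral_five:
  "(\<integral>\<^sup>+p. f p \<partial>(A \<Otimes>\<^sub>M B \<Otimes>\<^sub>M C \<Otimes>\<^sub>M D \<Otimes>\<^sub>M E)) =
    (\<integral>\<^sup>+a. \<integral>\<^sup>+b. \<integral>\<^sup>+c. \<integral>\<^sup>+d. \<integral>\<^sup>+e. f (a, b, c, d, e) \<partial>E \<partial>D \<partial>C \<partial>B \<partial>A)"
  apply (subst BCDE.P.nn_integral_fst[symmetric], simp)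
  apply (intro nn_integral_cong)
  apply (subst CDE.P.nn_integral_fst[symmetric], measurable)
  apply (intro nn_integral_cong)
  apply (subst DE.P.nn_integral_fst[symmetric], measurable)
  apply (intro nn_integral_cong)
  apply (subst E.nn_integral_fst[symmetric], measurable)
  done

text \<open>The order for the converse, where \<open>c\<close> holds the source-relay and
  \<open>d\<close> the relay-destination channels: seeds and noise are averaged for fixed channels,
  and a fade of \<open>d\<close> may be chosen depending on \<open>c\<close>.\<close>

lemma nn_integral_five_channels_first:
  "(\<integral>\<^sup>+p. f p \<partial>(A \<Otimes>\<^sub>M B \<Otimes>\<^sub>M C \<Otimes>\<^sub>M D \<Otimes>\<^sub>M E)) =
    (\<integral>\<^sup>+c. \<integral>\<^sup>+d. \<integral>\<^sup>+a. \<integral>\<^sup>+b. \<integral>\<^sup>+e. f (a, b, c, d, e) \<partial>E \<partial>B \<partial>A \<partial>D \<partial>C)"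
proof -
  have "(\<integral>\<^sup>+p. f p \<partial>(A \<Otimes>\<^sub>M B \<Otimes>\<^sub>M C \<Otimes>\<^sub>M D \<Otimes>\<^sub>M E)) =
      (\<integral>\<^sup>+a. \<integral>\<^sup>+c. \<integral>\<^sup>+b. \<integral>\<^sup>+d. \<integral>\<^sup>+e. f (a, b, c, d, e) \<partial>E \<partial>D \<partial>B \<partial>C \<partial>A)"
    unfolding nn_integral_five by (intro nn_integral_cong nn_integral_swap sf) measurable
  also have "\<dots> = (\<integral>\<^sup>+c. \<integral>\<^sup>+a. \<integral>\<^sup>+b. \<integral>\<^sup>+d. \<integral>\<^sup>+e. f (a, b, c, d, e) \<partial>E \<partial>D \<partial>B \<partial>A \<partial>C)"
    by (intro nn_integral_swap sf) measurable
  also have "\<dots> = (\<integral>\<^sup>+c. \<integral>\<^sup>+a. \<integral>\<^sup>+d. \<integral>\<^sup>+b. \<integral>\<^sup>+e. f (a, b, c, d, e) \<partial>E \<partial>B \<partial>D \<partial>A \<partial>C)"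
    by (intro nn_integral_cong nn_integral_swap sf) measurable
  also have "\<dots> = (\<integral>\<^sup>+c. \<integral>\<^sup>+d. \<integral>\<^sup>+a. \<integral>\<^sup>+b. \<integral>\<^sup>+e. f (a, b, c, d, e) \<partial>E \<partial>B \<partial>A \<partial>D \<partial>C)"
    by (intro nn_integral_cong nn_integral_swap sf) measurable
  finally show ?thesis .
qed

text \<open>The order for random coding: channels and noise are fixed while the codebooks in the
  common seed are averaged.\<close>

lemma nn_integral_five_seed_last:
  "(\<integral>\<^sup>+p. f p \<partial>(A \<Otimes>\<^sub>M B \<Otimes>\<^sub>M C \<Otimes>\<^sub>M D \<Otimes>\<^sub>M E)) =
    (\<integral>\<^sup>+c. \<integral>\<^sup>+d. \<integral>\<^sup>+b. \<integral>\<^sup>+e. \<integral>\<^sup>+a. f (a, b, c, d, e) \<partial>A \<partial>E \<partial>B \<partial>D \<partial>C)"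
proof -
  have "(\<integral>\<^sup>+p. f p \<partial>(A \<Otimes>\<^sub>M B \<Otimes>\<^sub>M C \<Otimes>\<^sub>M D \<Otimes>\<^sub>M E)) =
      (\<integral>\<^sup>+c. \<integral>\<^sup>+d. \<integral>\<^sup>+b. \<integral>\<^sup>+a. \<integral>\<^sup>+e. f (a, b, c, d, e) \<partial>E \<partial>A \<partial>B \<partial>D \<partial>C)"
    unfolding nn_integral_five_channels_first by (intro nn_integral_cong nn_integral_swap sf) measurable
  also have "\<dots> = (\<integral>\<^sup>+c. \<integral>\<^sup>+d. \<integral>\<^sup>+b. \<integral>\<^sup>+e. \<integral>\<^sup>+a. f (a, b, c, d, e) \<partial>A \<partial>E \<partial>B \<partial>D \<partial>C)"
    by (intro nn_integral_cong nn_integral_swap sf) measurable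
  finally show ?thesis .
qed

end

abbreviation noise2 :: "((relay \<Rightarrow> cseq) \<times> (relay \<Rightarrow> cseq)) measure" where
  "noise2 \<equiv> noise \<Otimes>\<^sub>M noise"

abbreviation rseeds :: "code \<Rightarrow> (relay \<Rightarrow> cseq) measure" where
  "rseeds c \<equiv> Pi\<^sub>M UNIV (rseed c)"

lemma space_fading [simp]: "space fading = UNIV"
  by (simp add: fading_def space_PiM)

lemma space_noise [simp]: "space noise = UNIV"
  by (simp add: noise_def space_PiM)

lemma prob_space_fading [simp]: "prob_space fading"
  unfolding fading_def by (intro prob_space_PiM) simp

lemma prob_space_noise [simp]: "prob_space noise"
  unfolding noise_def by (intro prob_space_PiM) simp

lemma sets_fading [measurable_cong]: "sets fading = sets (Pi\<^sub>M UNIV (\<lambda>_. borel))"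
  unfolding fading_def by (intro sets_PiM_cong) simp_all

lemma sets_noise [measurable_cong]: "sets noise = sets (Pi\<^sub>M UNIV (\<lambda>_. seqM))"
  unfolding noise_def by (intro sets_PiM_cong) simp_all

lemma prob_space_noise2: "prob_space noise2"
proof -
  interpret pair_prob_space noise noise by (simp add: pair_prob_space_def pair_sigma_finite_def prob_space_imp_sigma_finite)
  show ?thesis by (rule prob_space_axioms)
qed

lemma space_seeds:
  assumes "valid_code c"
  shows "space (cseed c) = UNIV" "space (rseeds c) = UNIV" "prob_space (rseeds c)"
    "sets (rseeds c) = sets (Pi\<^sub>M UNIV (\<lambda>_. seqM))"
proof -
  show "space (cseed c) = UNIV" using sets_eq_imp_space_eq[OF valid_codeD(4)[OF assms]] by simp
  have "space (rseed c i) = UNIV" for i using sets_eq_imp_space_eq[OF valid_codeD(6)[OF assms]] by simp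
  then show "space (rseeds c) = UNIV" by (simp add: space_PiM)
  show "prob_space (rseeds c)" by (intro prob_space_PiM valid_codeD[OF assms])
  show "sets (rseeds c) = sets (Pi\<^sub>M UNIV (\<lambda>_. seqM))" by (intro sets_PiM_cong valid_codeD[OF assms]) simp
qed

lemma measurable_PiM_UNIV_component:
  assumes "f \<in> M \<rightarrow>\<^sub>M Pi\<^sub>M UNIV (\<lambda>_. N)"
  shows "(\<lambda>x. f x i) \<in> M \<rightarrow>\<^sub>M N"
  by (rule measurable_compose[OF assms measurable_component_singleton]) simp

lemma measurable_dest_rx:
  assumes c: "valid_code c"
    and [measurable]: "u \<in> M \<rightarrow>\<^sub>M seqM" "v \<in> M \<rightarrow>\<^sub>M Pi\<^sub>M UNIV (\<lambda>_. seqM)"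
      "hs \<in> M \<rightarrow>\<^sub>M Pi\<^sub>M UNIV (\<lambda>_. borel)" "hr \<in> M \<rightarrow>\<^sub>M Pi\<^sub>M UNIV (\<lambda>_. borel)"
      "zr \<in> M \<rightarrow>\<^sub>M Pi\<^sub>M UNIV (\<lambda>_. seqM)" "zd \<in> M \<rightarrow>\<^sub>M Pi\<^sub>M UNIV (\<lambda>_. seqM)"
  shows "(\<lambda>x. dest_rx \<rho> c w (u x) (v x) (hs x) (hr x) (zr x) (zd x)) \<in> M \<rightarrow>\<^sub>M Pi\<^sub>M UNIV (\<lambda>_. seqM)"
proof (rule measurable_PiM_single')
  fix i
  show "(\<lambda>x. dest_rx \<rho> c w (u x) (v x) (hs x) (hr x) (zr x) (zd x) i) \<in> M \<rightarrow>\<^sub>M seqM"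
    unfolding dest_rx_eq
    by (rule measurable_dest_obs[OF c]) (rule assms measurable_PiM_UNIV_component)+
qed (auto simp: space_PiM)

definition decided :: "real \<Rightarrow> code \<Rightarrow> nat \<Rightarrow> cseq \<Rightarrow> (relay \<Rightarrow> cseq) \<Rightarrow> (relay \<Rightarrow> complex) \<Rightarrow> (relay \<Rightarrow> complex) \<Rightarrow>
    (relay \<Rightarrow> cseq) \<times> (relay \<Rightarrow> cseq) \<Rightarrow> nat" where
  "decided \<rho> c w u v hs hr z = dec c hs hr u (dest_rx \<rho> c w u v hs hr (fst z) (snd z))"

lemma measurable_decided:
  assumes c: "valid_code c"
    and [measurable]: "u \<in> M \<rightarrow>\<^sub>M seqM" "v \<in> M \<rightarrow>\<^sub>M Pi\<^sub>M UNIV (\<lambda>_. seqM)"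
      "hs \<in> M \<rightarrow>\<^sub>M Pi\<^sub>M UNIV (\<lambda>_. borel)" "hr \<in> M \<rightarrow>\<^sub>M Pi\<^sub>M UNIV (\<lambda>_. borel)"
      "z \<in> M \<rightarrow>\<^sub>M Pi\<^sub>M UNIV (\<lambda>_. seqM) \<Otimes>\<^sub>M Pi\<^sub>M UNIV (\<lambda>_. seqM)"
  shows "(\<lambda>x. decided \<rho> c w (u x) (v x) (hs x) (hr x) (z x)) \<in> M \<rightarrow>\<^sub>M count_space UNIV"
  unfolding decided_def
proof (rule measurable_dec[OF c])
  show "(\<lambda>x. dest_rx \<rho> c w (u x) (v x) (hs x) (hr x) (fst (z x)) (snd (z x))) \<in> M \<rightarrow>\<^sub>M Pi\<^sub>M UNIV (\<lambda>_. seqM)"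
    by (rule measurable_dest_rx[OF c])
      (rule assms measurable_compose[OF assms(6) measurable_fst] measurable_compose[OF assms(6) measurable_snd])+
qed (rule assms)+

lemma emeasure_error:
  assumes c: "valid_code c"
  defines "F \<equiv> \<lambda>\<rho> w (u, v, hs, hr, z). indicator (- {w}) (decided \<rho> c w u v hs hr z) :: ennreal"
  shows "ennreal (err_prob \<rho> c) =
      (\<Sum>w<msgs c. \<integral>\<^sup>+p. F \<rho> w p \<partial>(cseed c \<Otimes>\<^sub>M rseeds c \<Otimes>\<^sub>M fading \<Otimes>\<^sub>M fading \<Otimes>\<^sub>M noise2)) / of_nat (msgs c)"
    and "F \<rho> w \<in> borel_measurable (cseed c \<Otimes>\<^sub>M rseeds c \<Otimes>\<^sub>M fading \<Otimes>\<^sub>M fading \<Otimes>\<^sub>M noise2)"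
proof -
  note [measurable_cong] = valid_codeD(4)[OF c] space_seeds(4)[OF c]
  show m: "F \<rho> w \<in> borel_measurable (cseed c \<Otimes>\<^sub>M rseeds c \<Otimes>\<^sub>M fading \<Otimes>\<^sub>M fading \<Otimes>\<^sub>M noise2)" for w
  proof -
    have "(\<lambda>p. decided \<rho> c w (fst p) (fst (snd p)) (fst (snd (snd p)))
        (fst (snd (snd (snd p)))) (snd (snd (snd (snd p)))))
      \<in> cseed c \<Otimes>\<^sub>M rseeds c \<Otimes>\<^sub>M fading \<Otimes>\<^sub>M fading \<Otimes>\<^sub>M noise2 \<rightarrow>\<^sub>M count_space UNIV"
      by (rule measurable_decided[OF c]) measurable
    from measurable_compose[OF this, of "indicator (- {w})" borel] show ?thesis
      unfolding F_def case_prod_unfold by simp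
  qed
  interpret U: prob_space "cseed c" by (rule valid_codeD[OF c])
  interpret V: prob_space "rseeds c" by (rule space_seeds[OF c])
  interpret fad: prob_space fading by simp
  interpret noi: prob_space noise2 by (rule prob_space_noise2)
  interpret q1: pair_prob_space fading noise2 ..
  interpret q2: pair_prob_space fading "fading \<Otimes>\<^sub>M noise2" ..
  interpret q3: pair_prob_space "rseeds c" "fading \<Otimes>\<^sub>M fading \<Otimes>\<^sub>M noise2" ..
  interpret q4: pair_prob_space "cseed c" "rseeds c \<Otimes>\<^sub>M fading \<Otimes>\<^sub>M fading \<Otimes>\<^sub>M noise2" ..
  have net: "net_space c = cseed c \<Otimes>\<^sub>M rseeds c \<Otimes>\<^sub>M fading \<Otimes>\<^sub>M fading \<Otimes>\<^sub>M noise2"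
    by (simp add: net_space_def)
  have "ennreal (measure (net_space c) {(u, v, hs, hr, zr, zd) \<in> space (net_space c).
           dec c hs hr u (dest_rx \<rho> c w u v hs hr zr zd) \<noteq> w}) =
     (\<integral>\<^sup>+p. F \<rho> w p \<partial>(cseed c \<Otimes>\<^sub>M rseeds c \<Otimes>\<^sub>M fading \<Otimes>\<^sub>M fading \<Otimes>\<^sub>M noise2))" for w
  proof -
    let ?N = "cseed c \<Otimes>\<^sub>M rseeds c \<Otimes>\<^sub>M fading \<Otimes>\<^sub>M fading \<Otimes>\<^sub>M noise2"
    let ?E = "{(u, v, hs, hr, zr, zd) \<in> space ?N. dec c hs hr u (dest_rx \<rho> c w u v hs hr zr zd) \<noteq> w}"
    have E: "?E = F \<rho> w -` {1} \<inter> space ?N"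
      by (auto simp: F_def decided_def indicator_def)
    have "?E \<in> sets ?N" unfolding E by (rule measurable_sets[OF m]) simp
    then have "emeasure ?N ?E = (\<integral>\<^sup>+p. indicator ?E p \<partial>?N)" by simp
    also have "\<dots> = (\<integral>\<^sup>+p. F \<rho> w p \<partial>?N)"
      by (intro nn_integral_cong) (auto simp: F_def decided_def indicator_def)
    finally show ?thesis unfolding net by (simp add: q4.emeasure_eq_measure)
  qed
  then have "ennreal (\<Sum>w<msgs c. measure (net_space c) {(u, v, hs, hr, zr, zd) \<in> space (net_space c).
           dec c hs hr u (dest_rx \<rho> c w u v hs hr zr zd) \<noteq> w}) =
     (\<Sum>w<msgs c. \<integral>\<^sup>+p. F \<rho> w p \<partial>(cseed c \<Otimes>\<^sub>M rseeds c \<Otimes>\<^sub>M fading \<Otimes>\<^sub>M fading \<Otimes>\<^sub>M noise2))"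
    by (simp flip: sum_ennreal)
  then show "ennreal (err_prob \<rho> c) =
      (\<Sum>w<msgs c. \<integral>\<^sup>+p. F \<rho> w p \<partial>(cseed c \<Otimes>\<^sub>M rseeds c \<Otimes>\<^sub>M fading \<Otimes>\<^sub>M fading \<Otimes>\<^sub>M noise2)) / of_nat (msgs c)"
    using valid_codeD(2)[OF c] unfolding err_prob_def
    by (subst divide_ennreal[symmetric]) (auto intro!: sum_nonneg simp: ennreal_of_nat_eq_real_of_nat)
qed

definition correct_given :: "real \<Rightarrow> code \<Rightarrow> (relay \<Rightarrow> complex) \<Rightarrow> (relay \<Rightarrow> complex) \<Rightarrow> ennreal" where
  "correct_given \<rho> c hs hr = (\<Sum>w<msgs c. \<integral>\<^sup>+u. \<integral>\<^sup>+v. \<integral>\<^sup>+z. indicator {w} (decided \<rho> c w u v hs hr z)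
     \<partial>noise2 \<partial>rseeds c \<partial>cseed c) / of_nat (msgs c)"

text \<open>A product of three probabilities: typical source-relay channels, a fade of the
  relay-destination channels, and an error given both. The integral over \<open>hr\<close> is
  bounded by a constant for each \<open>hs\<close> separately, so the fade \<open>H hs\<close> may
  react in an arbitrary way to the listening fractions that \<open>hs\<close> induces.\<close>

lemma err_prob_ge:
  assumes c: "valid_code c" and G: "G \<in> sets fading" and \<eta>: "\<eta> \<ge> 0" "\<eta> \<le> 1"
    and H: "\<And>hs. hs \<in> G \<Longrightarrow> H hs \<in> sets fading" "\<And>hs. hs \<in> G \<Longrightarrow> ennreal \<beta> \<le> emeasure fading (H hs)"
    and \<alpha>: "ennreal \<alpha> \<le> emeasure fading G" "\<alpha> \<ge> 0" "\<beta> \<ge> 0"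
    and corr: "\<And>hs hr. hs \<in> G \<Longrightarrow> hr \<in> H hs \<Longrightarrow> correct_given \<rho> c hs hr \<le> ennreal (1 - \<eta>)"
  shows "\<eta> * \<alpha> * \<beta> \<le> err_prob \<rho> c"
proof -
  note [measurable_cong] = valid_codeD(4)[OF c] space_seeds(4)[OF c]
  let ?M = "of_nat (msgs c) :: ennreal"
  have M: "?M \<noteq> 0" "?M \<noteq> \<top>" using valid_codeD(2)[OF c] by auto
  have MM: "?M / ?M = 1" by (rule ennreal_divide_self[OF M(1)]) (simp only: less_top[symmetric] M(2) not_False_eq_True)
  interpret U: prob_space "cseed c" by (rule valid_codeD[OF c])
  interpret V: prob_space "rseeds c" by (rule space_seeds[OF c])
  interpret noi: prob_space noise2 by (rule prob_space_noise2)
  interpret fad: prob_space fading by simp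
  let ?e = "\<lambda>w hs hr. \<integral>\<^sup>+u. \<integral>\<^sup>+v. \<integral>\<^sup>+z. indicator (- {w}) (decided \<rho> c w u v hs hr z) \<partial>noise2 \<partial>rseeds c \<partial>cseed c"
  let ?k = "\<lambda>w hs hr. \<integral>\<^sup>+u. \<integral>\<^sup>+v. \<integral>\<^sup>+z. indicator {w} (decided \<rho> c w u v hs hr z) \<partial>noise2 \<partial>rseeds c \<partial>cseed c"
  have em: "(\<lambda>(hs, hr). ?e w hs hr) \<in> borel_measurable (fading \<Otimes>\<^sub>M fading)" for w
  proof -
    have [measurable]: "(\<lambda>p. indicator (- {w}) (decided \<rho> c w (fst p) (fst (snd p)) (fst (snd (snd p)))
        (fst (snd (snd (snd p)))) (snd (snd (snd (snd p))))) :: ennreal)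
      \<in> borel_measurable (cseed c \<Otimes>\<^sub>M rseeds c \<Otimes>\<^sub>M fading \<Otimes>\<^sub>M fading \<Otimes>\<^sub>M noise2)"
      using emeasure_error(2)[OF c, where w=w and \<rho>=\<rho>] by (simp add: case_prod_unfold)
    define F where "F p = (indicator (- {w}) (decided \<rho> c w (fst p) (fst (snd p)) (fst (snd (snd p)))
        (fst (snd (snd (snd p)))) (snd (snd (snd (snd p))))) :: ennreal)" for p
    have [measurable]: "F \<in> borel_measurable (cseed c \<Otimes>\<^sub>M rseeds c \<Otimes>\<^sub>M fading \<Otimes>\<^sub>M fading \<Otimes>\<^sub>M noise2)"
      unfolding F_def by measurable
    have "(\<lambda>(hs, hr). \<integral>\<^sup>+u. \<integral>\<^sup>+v. \<integral>\<^sup>+z. F (u, v, hs, hr, z) \<partial>noise2 \<partial>rseeds c \<partial>cseed c) \<in> borel_measurable (fading \<Otimes>\<^sub>M fading)"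
      by measurable
    then show ?thesis by (simp add: F_def)
  qed
  have ek: "?e w hs hr + ?k w hs hr = 1" for w hs hr
  proof -
    have [measurable]: "(\<lambda>p. decided \<rho> c w (fst p) (fst (snd p)) hs hr (snd (snd p)))
       \<in> cseed c \<Otimes>\<^sub>M rseeds c \<Otimes>\<^sub>M noise2 \<rightarrow>\<^sub>M count_space UNIV"
      by (rule measurable_decided[OF c]) (simp_all add: space_PiM)
    define I J where "I p = (indicator (- {w}) (decided \<rho> c w (fst p) (fst (snd p)) hs hr (snd (snd p))) :: ennreal)"
      and "J p = (indicator {w} (decided \<rho> c w (fst p) (fst (snd p)) hs hr (snd (snd p))) :: ennreal)" for p
    have IJ[measurable]: "I \<in> borel_measurable (cseed c \<Otimes>\<^sub>M rseeds c \<Otimes>\<^sub>M noise2)"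
      "J \<in> borel_measurable (cseed c \<Otimes>\<^sub>M rseeds c \<Otimes>\<^sub>M noise2)"
      unfolding I_def J_def by (rule measurable_compose[OF \<open>_ \<in> _ \<rightarrow>\<^sub>M count_space UNIV\<close>]; simp)+
    have sp[measurable]: "u \<in> space (cseed c)" "v \<in> space (rseeds c)" for u v
      using space_seeds[OF c] by auto
    have "?e w hs hr + ?k w hs hr = (\<integral>\<^sup>+u. \<integral>\<^sup>+v. \<integral>\<^sup>+z. I (u, v, z) \<partial>noise2 \<partial>rseeds c \<partial>cseed c) +
        (\<integral>\<^sup>+u. \<integral>\<^sup>+v. \<integral>\<^sup>+z. J (u, v, z) \<partial>noise2 \<partial>rseeds c \<partial>cseed c)"
      by (simp add: I_def J_def)
    also have "\<dots> = (\<integral>\<^sup>+u. (\<integral>\<^sup>+v. \<integral>\<^sup>+z. I (u, v, z) \<partial>noise2 \<partial>rseeds c) + (\<integral>\<^sup>+v. \<integral>\<^sup>+z. J (u, v, z) \<partial>noise2 \<partial>rseeds c) \<partial>cseed c)"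
      by (rule nn_integral_add[symmetric]) measurable
    also have "\<dots> = (\<integral>\<^sup>+u. \<integral>\<^sup>+v. (\<integral>\<^sup>+z. I (u, v, z) \<partial>noise2) + (\<integral>\<^sup>+z. J (u, v, z) \<partial>noise2) \<partial>rseeds c \<partial>cseed c)"
      by (intro nn_integral_cong nn_integral_add[symmetric]) measurable
    also have "\<dots> = (\<integral>\<^sup>+u. \<integral>\<^sup>+v. \<integral>\<^sup>+z. I (u, v, z) + J (u, v, z) \<partial>noise2 \<partial>rseeds c \<partial>cseed c)"
      by (intro nn_integral_cong nn_integral_add[symmetric]) measurable
    also have "\<dots> = (\<integral>\<^sup>+u. \<integral>\<^sup>+v. \<integral>\<^sup>+z. 1 \<partial>noise2 \<partial>rseeds c \<partial>cseed c)"
      by (intro nn_integral_cong) (auto simp: I_def J_def indicator_def)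
    also have "\<dots> = 1" by (simp add: U.emeasure_space_1 V.emeasure_space_1 noi.emeasure_space_1)
    finally show ?thesis .
  qed
  have bad: "ennreal \<eta> * ?M \<le> (\<Sum>w<msgs c. ?e w hs hr)" if "hs \<in> G" "hr \<in> H hs" for hs hr
  proof -
    have "(\<Sum>w<msgs c. ?k w hs hr) / ?M \<le> ennreal (1 - \<eta>)"
      using corr[OF that] by (simp add: correct_given_def)
    then have "(\<Sum>w<msgs c. ?k w hs hr) / ?M * ?M \<le> ennreal (1 - \<eta>) * ?M"
      by (rule mult_right_mono) simp
    then have k: "(\<Sum>w<msgs c. ?k w hs hr) \<le> ennreal (1 - \<eta>) * ?M"
      by (simp only: ennreal_divide_times MM mult_1_right)
    have "ennreal \<eta> * ?M + ennreal (1 - \<eta>) * ?M = ?M"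
      using \<eta> by (simp flip: distrib_right ennreal_plus)
    also have "\<dots> = (\<Sum>w<msgs c. ?e w hs hr + ?k w hs hr)" by (simp add: ek)
    also have "\<dots> = (\<Sum>w<msgs c. ?e w hs hr) + (\<Sum>w<msgs c. ?k w hs hr)" by (rule sum.distrib)
    also have "\<dots> \<le> (\<Sum>w<msgs c. ?e w hs hr) + ennreal (1 - \<eta>) * ?M" using k by (rule add_left_mono)
    finally have fin: "ennreal \<eta> * ?M + ennreal (1 - \<eta>) * ?M \<le> (\<Sum>w<msgs c. ?e w hs hr) + ennreal (1 - \<eta>) * ?M" .
    show ?thesis
    proof -
      have "ennreal (1 - \<eta>) * ?M \<noteq> \<infinity>"
        using M(2) by (simp add: ennreal_mult_eq_top_iff)
      with fin show ?thesis
        unfolding add.commute[of _ "ennreal (1 - \<eta>) * ?M"] ennreal_add_left_cancel_le by simp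
    qed
  qed
  have "ennreal (\<eta> * \<alpha> * \<beta>) * ?M = ennreal \<alpha> * (ennreal \<eta> * ?M * ennreal \<beta>)"
    using \<alpha> \<eta> by (simp add: ennreal_mult mult_ac)
  also have "\<dots> \<le> emeasure fading G * (ennreal \<eta> * ?M * ennreal \<beta>)"
    using \<alpha> by (intro mult_right_mono) auto
  also have "\<dots> = (\<integral>\<^sup>+hs. (ennreal \<eta> * ?M * ennreal \<beta>) * indicator G hs \<partial>fading)"
    using G by (subst nn_integral_cmult_indicator) (simp_all add: mult.commute)
  also have "\<dots> \<le> (\<integral>\<^sup>+hs. \<integral>\<^sup>+hr. (\<Sum>w<msgs c. ?e w hs hr) \<partial>fading \<partial>fading)"
  proof (rule nn_integral_mono)
    fix hs
    show "(ennreal \<eta> * ?M * ennreal \<beta>) * indicator G hs \<le> (\<integral>\<^sup>+hr. (\<Sum>w<msgs c. ?e w hs hr) \<partial>fading)"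
    proof (cases "hs \<in> G")
      case True
      have "ennreal \<eta> * ?M * ennreal \<beta> \<le> ennreal \<eta> * ?M * emeasure fading (H hs)"
        using H(2)[OF True] by (intro mult_left_mono) auto
      also have "\<dots> = (\<integral>\<^sup>+hr. ennreal \<eta> * ?M * indicator (H hs) hr \<partial>fading)"
        using H(1)[OF True] by (subst nn_integral_cmult_indicator) simp_all
      also have "\<dots> \<le> (\<integral>\<^sup>+hr. (\<Sum>w<msgs c. ?e w hs hr) \<partial>fading)"
      proof (rule nn_integral_mono)
        fix hr
        show "ennreal \<eta> * ?M * indicator (H hs) hr \<le> (\<Sum>w<msgs c. ?e w hs hr)"
        proof (cases "hr \<in> H hs")
          case hr: True
          show ?thesis using bad[OF True hr] by (simp only: indicator_simps(1)[OF hr] mult_1_right)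
        qed simp
      qed
      finally show ?thesis using True by simp
    qed simp
  qed
  also have "\<dots> = (\<Sum>w<msgs c. \<integral>\<^sup>+hs. \<integral>\<^sup>+hr. ?e w hs hr \<partial>fading \<partial>fading)"
  proof -
    have e1: "(\<lambda>hr. ?e w hs hr) \<in> borel_measurable fading" for w hs
      using measurable_compose[OF measurable_Pair1' em, of hs] by simp
    have e2: "(\<lambda>hs. \<integral>\<^sup>+hr. ?e w hs hr \<partial>fading) \<in> borel_measurable fading" for w
      using fad.borel_measurable_nn_integral_fst[OF em] by simp
    show ?thesis by (simp only: nn_integral_sum[OF e1] nn_integral_sum[OF e2])
  qed
  also have "\<dots> = ennreal (err_prob \<rho> c) * ?M"
  proof -
    have "(\<integral>\<^sup>+p. (case p of (u, v, hs, hr, z) \<Rightarrow> indicator (- {w}) (decided \<rho> c w u v hs hr z))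
        \<partial>(cseed c \<Otimes>\<^sub>M rseeds c \<Otimes>\<^sub>M fading \<Otimes>\<^sub>M fading \<Otimes>\<^sub>M noise2)) = (\<integral>\<^sup>+hs. \<integral>\<^sup>+hr. ?e w hs hr \<partial>fading \<partial>fading)" for w
      by (subst nn_integral_five_channels_first[OF _ _ _ _ _ _ _ _ _ _ emeasure_error(2)[OF c]])
        (simp_all add: space_seeds[OF c] valid_codeD[OF c] prob_space_noise2 space_pair_measure)
    then have "ennreal (err_prob \<rho> c) = (\<Sum>w<msgs c. \<integral>\<^sup>+hs. \<integral>\<^sup>+hr. ?e w hs hr \<partial>fading \<partial>fading) / ?M"
      by (simp add: emeasure_error(1)[OF c])
    then show ?thesis
      by (simp only: ennreal_divide_times MM mult_1_right)
  qed
  finally have "ennreal (\<eta> * \<alpha> * \<beta>) \<le> ennreal (err_prob \<rho> c)"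
    using M by (simp add: mult.commute[of _ ?M] ennreal_mult_le_mult_iff)
  moreover have "0 \<le> err_prob \<rho> c" unfolding err_prob_def by (intro divide_nonneg_nonneg sum_nonneg) auto
  ultimately show ?thesis by simp
qed

section \<open>The converse for fixed channel realizations\<close>

lemma measurable_case_relay [measurable (raw)]:
  assumes "f \<in> M \<rightarrow>\<^sub>M N R1" "g \<in> M \<rightarrow>\<^sub>M N R2"
  shows "(\<lambda>x. case_relay (f x) (g x)) \<in> M \<rightarrow>\<^sub>M Pi\<^sub>M UNIV N"
proof (rule measurable_PiM_single')
  fix i show "(\<lambda>x. case_relay (f x) (g x) i) \<in> M \<rightarrow>\<^sub>M N i" using assms by (cases i) auto
qed (use assms[THEN measurable_space] in \<open>auto simp: space_PiM PiE_iff split: relay.split\<close>)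

lemma sf_cnM: "sigma_finite_measure cnM"
  by (simp add: prob_space_imp_sigma_finite)

text \<open>Regroups the noises from node by node to path by path, so that the network becomes two
  independent channels as in \<open>weak_converse_two\<close>.\<close>

lemma nn_integral_noise2:
  assumes f[measurable]: "f \<in> borel_measurable noise2"
  shows "(\<integral>\<^sup>+z. f z \<partial>noise2) = (\<integral>\<^sup>+\<omega>1. \<integral>\<^sup>+\<omega>2. f (case_relay (fst \<omega>1) (fst \<omega>2), case_relay (snd \<omega>1) (snd \<omega>2))
     \<partial>(cnM \<Otimes>\<^sub>M cnM) \<partial>(cnM \<Otimes>\<^sub>M cnM))"
proof -
  interpret cn: prob_space cnM by simp
  interpret pp: pair_prob_space cnM cnM ..
  interpret noi: prob_space noise by simp
  have sp[measurable]: "x \<in> space cnM" "y \<in> space noise" for x y by simp_all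
  have cr[measurable]: "(\<lambda>x. case_relay (f x) (g x)) \<in> M \<rightarrow>\<^sub>M noise" if "f \<in> M \<rightarrow>\<^sub>M cnM" "g \<in> M \<rightarrow>\<^sub>M cnM"
    for f g and M :: "'z measure"
    unfolding noise_def using that by (rule measurable_case_relay)
  have "(\<integral>\<^sup>+z. f z \<partial>noise2) = (\<integral>\<^sup>+zr. \<integral>\<^sup>+zd. f (zr, zd) \<partial>noise \<partial>noise)"
    by (rule noi.nn_integral_fst[symmetric]) measurable
  also have "\<dots> = (\<integral>\<^sup>+zr. \<integral>\<^sup>+b1. \<integral>\<^sup>+b2. f (zr, case_relay b1 b2) \<partial>cnM \<partial>cnM \<partial>noise)"
  proof (rule nn_integral_cong)
    fix zr :: "relay \<Rightarrow> cseq"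
    show "(\<integral>\<^sup>+zd. f (zr, zd) \<partial>noise) = (\<integral>\<^sup>+b1. \<integral>\<^sup>+b2. f (zr, case_relay b1 b2) \<partial>cnM \<partial>cnM)"
      using measurable_compose[OF measurable_Pair1' f, of zr] unfolding noise_def
      by (intro nn_integral_PiM_relay) (simp_all add: noise_def[symmetric])
  qed
  also have "\<dots> = (\<integral>\<^sup>+a1. \<integral>\<^sup>+a2. \<integral>\<^sup>+b1. \<integral>\<^sup>+b2. f (case_relay a1 a2, case_relay b1 b2) \<partial>cnM \<partial>cnM \<partial>cnM \<partial>cnM)"
  proof -
    have "(\<lambda>zr. \<integral>\<^sup>+b1. \<integral>\<^sup>+b2. f (zr, case_relay b1 b2) \<partial>cnM \<partial>cnM) \<in> borel_measurable noise"
    proof -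
      have "(\<lambda>p. f (fst (fst p), case_relay (snd (fst p)) (snd p))) \<in> borel_measurable ((noise \<Otimes>\<^sub>M cnM) \<Otimes>\<^sub>M cnM)"
        unfolding noise_def by (rule measurable_compose[OF _ f]) (simp add: noise_def)
      then have "(\<lambda>p. \<integral>\<^sup>+b2. f (fst p, case_relay (snd p) b2) \<partial>cnM) \<in> borel_measurable (noise \<Otimes>\<^sub>M cnM)"
        using cn.borel_measurable_nn_integral_fst by fastforce
      then show ?thesis using cn.borel_measurable_nn_integral_fst by fastforce
    qed
    then show ?thesis unfolding noise_def by (intro nn_integral_PiM_relay) simp_all
  qed
  also have "\<dots> = (\<integral>\<^sup>+a1. \<integral>\<^sup>+b1. \<integral>\<^sup>+a2. \<integral>\<^sup>+b2. f (case_relay a1 a2, case_relay b1 b2) \<partial>cnM \<partial>cnM \<partial>cnM \<partial>cnM)"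
  proof (rule nn_integral_cong, rule nn_integral_swap[OF sf_cnM sf_cnM])
    fix a1 :: cseq
    have "(\<lambda>p. f (case_relay a1 (fst (fst p)), case_relay (snd (fst p)) (snd p))) \<in> borel_measurable ((cnM \<Otimes>\<^sub>M cnM) \<Otimes>\<^sub>M cnM)"
      by (rule measurable_compose[OF _ f]) (simp add: noise_def)
    from cn.borel_measurable_nn_integral_fst[OF this]
    show "(\<lambda>(a2, b1). \<integral>\<^sup>+b2. f (case_relay a1 a2, case_relay b1 b2) \<partial>cnM) \<in> borel_measurable (cnM \<Otimes>\<^sub>M cnM)"
      by (simp add: case_prod_beta)
  qed
  also have "\<dots> = (\<integral>\<^sup>+a1. \<integral>\<^sup>+b1. \<integral>\<^sup>+\<omega>2. f (case_relay a1 (fst \<omega>2), case_relay b1 (snd \<omega>2)) \<partial>(cnM \<Otimes>\<^sub>M cnM) \<partial>cnM \<partial>cnM)"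
  proof (rule nn_integral_cong, rule nn_integral_cong)
    fix a1 b1 :: cseq
    have "(\<lambda>p. f (case_relay a1 (fst p), case_relay b1 (snd p))) \<in> borel_measurable (cnM \<Otimes>\<^sub>M cnM)"
      by (rule measurable_compose[OF _ f]) (simp add: noise_def)
    from cn.nn_integral_fst[OF this]
    show "(\<integral>\<^sup>+a2. \<integral>\<^sup>+b2. f (case_relay a1 a2, case_relay b1 b2) \<partial>cnM \<partial>cnM) =
      (\<integral>\<^sup>+\<omega>2. f (case_relay a1 (fst \<omega>2), case_relay b1 (snd \<omega>2)) \<partial>(cnM \<Otimes>\<^sub>M cnM))" by simp
  qed
  also have "\<dots> = (\<integral>\<^sup>+\<omega>1. \<integral>\<^sup>+\<omega>2. f (case_relay (fst \<omega>1) (fst \<omega>2), case_relay (snd \<omega>1) (snd \<omega>2))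
     \<partial>(cnM \<Otimes>\<^sub>M cnM) \<partial>(cnM \<Otimes>\<^sub>M cnM))"
  proof -
    have "(\<lambda>p. f (case_relay (fst (fst p)) (fst (snd p)), case_relay (snd (fst p)) (snd (snd p))))
        \<in> borel_measurable ((cnM \<Otimes>\<^sub>M cnM) \<Otimes>\<^sub>M (cnM \<Otimes>\<^sub>M cnM))"
      by (rule measurable_compose[OF _ f]) (simp add: noise_def)
    from cn.nn_integral_fst[OF pp.P.borel_measurable_nn_integral_fst[OF this]]
    show ?thesis by simp
  qed
  finally show ?thesis .
qed

text \<open>Hides the reference law and keeps the bound \<open>K\<close> on the expected cost. Each
  path can then be cut in its own way: at the source, at the destination or, for a constant signal,
  for free.\<close>

definition cuttable :: "real \<Rightarrow> code \<Rightarrow> relay \<Rightarrow> cseq \<Rightarrow> cseq \<Rightarrow> complex \<Rightarrow> complex \<Rightarrow> nat set \<Rightarrow> (nat \<Rightarrow> ennreal) \<Rightarrow> bool" where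
  "cuttable \<rho> c i u v hs hr W K \<longleftrightarrow> (\<exists>Q \<Lambda>. prob_space Q \<and> sets Q = sets seqM \<and>
     (\<forall>w. \<Lambda> w \<in> borel_measurable (cnM \<Otimes>\<^sub>M cnM)) \<and> (\<forall>w \<omega>. 0 \<le> \<Lambda> w \<omega>) \<and>
     (\<forall>w\<in>W. dominated (cnM \<Otimes>\<^sub>M cnM) (\<lambda>w (zr, zd). dest_obs \<rho> c i w u v hs hr zr zd) \<Lambda> Q w) \<and>
     (\<forall>w\<in>W. (\<integral>\<^sup>+\<omega>. \<Lambda> w \<omega> \<partial>(cnM \<Otimes>\<^sub>M cnM)) \<le> K w))"

lemma cuttable_cut_cost:
  assumes "valid_code c" "\<rho> \<ge> 0" "a > 0" "\<sigma> \<ge> 1" "W \<subseteq> {..<msgs c}"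
  shows "cuttable \<rho> c i u v hs hr W (\<lambda>w. cut_cost b a \<sigma> \<rho> c i w u v hs hr)"
proof (cases b)
  case True
  obtain Q \<Lambda> where "prob_space Q" "sets Q = sets seqM"
    "\<And>w. \<Lambda> w \<in> borel_measurable (cnM \<Otimes>\<^sub>M cnM)" "\<And>w \<omega>. 0 \<le> \<Lambda> w \<omega>"
    "\<And>w. dominated (cnM \<Otimes>\<^sub>M cnM) (\<lambda>w (zr, zd). dest_obs \<rho> c i w u v hs hr zr zd) \<Lambda> Q w"
    "\<And>w. w < msgs c \<Longrightarrow> (\<integral>\<^sup>+\<omega>. \<Lambda> w \<omega> \<partial>(cnM \<Otimes>\<^sub>M cnM)) \<le> cut_cost True a \<sigma> \<rho> c i w u v hs hr"
    by (rule source_cut[OF assms(1-4), of i u v hs hr]) (rule that, assumption+)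
  with True assms(5) show ?thesis unfolding cuttable_def by (intro exI[of _ Q] exI[of _ \<Lambda>]) auto
next
  case False
  obtain Q \<Lambda> where "prob_space Q" "sets Q = sets seqM"
    "\<And>w. \<Lambda> w \<in> borel_measurable (cnM \<Otimes>\<^sub>M cnM)" "\<And>w \<omega>. 0 \<le> \<Lambda> w \<omega>"
    "\<And>w. dominated (cnM \<Otimes>\<^sub>M cnM) (\<lambda>w (zr, zd). dest_obs \<rho> c i w u v hs hr zr zd) \<Lambda> Q w"
    "\<And>w. w < msgs c \<Longrightarrow> (\<integral>\<^sup>+\<omega>. \<Lambda> w \<omega> \<partial>(cnM \<Otimes>\<^sub>M cnM)) \<le> cut_cost False a \<sigma> \<rho> c i w u v hs hr"
    by (rule dest_cut[OF assms(1-4), of i u v hs hr]) (rule that, assumption+)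
  with False assms(5) show ?thesis unfolding cuttable_def by (intro exI[of _ Q] exI[of _ \<Lambda>]) auto
qed

text \<open>If the source sends the same for all messages of \<open>W\<close>, the output law itself
  is the reference and costs nothing. This removes the path of the revealed stream in the split
  strategy.\<close>

lemma cuttable_const:
  assumes c: "valid_code c" and const: "\<And>w w' k. w \<in> W \<Longrightarrow> w' \<in> W \<Longrightarrow> enc c i u w k = enc c i u w' k"
  shows "cuttable \<rho> c i u v hs hr W (\<lambda>_. 0)"
proof -
  interpret cn: prob_space cnM by simp
  interpret pp: pair_prob_space cnM cnM ..
  obtain w0 where w0: "W \<noteq> {} \<Longrightarrow> w0 \<in> W" by auto
  define X where "X = (\<lambda>(zr, zd). dest_obs \<rho> c i w0 u v hs hr zr zd)"
  have mX: "X \<in> cnM \<Otimes>\<^sub>M cnM \<rightarrow>\<^sub>M seqM"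
    unfolding X_def case_prod_beta by (rule measurable_dest_obs[OF c]) simp_all
  have eq: "(\<lambda>(zr, zd). dest_obs \<rho> c i w u v hs hr zr zd) = X" if "w \<in> W" for w
  proof -
    have "enc c i u w = enc c i u w0" using that w0 const by blast
    then show ?thesis
      unfolding X_def dest_obs_def relay_listens_def relay_tx_def relay_obs_def relay_in_def by (simp only:)
  qed
  show ?thesis unfolding cuttable_def
  proof (intro exI[of _ "distr (cnM \<Otimes>\<^sub>M cnM) seqM X"] exI[of _ "\<lambda>_ _. 0"] conjI allI ballI)
    show "prob_space (distr (cnM \<Otimes>\<^sub>M cnM) seqM X)" by (rule pp.prob_space_distr[OF mX])
    fix w assume "w \<in> W"
    then show "dominated (cnM \<Otimes>\<^sub>M cnM) (\<lambda>w (zr, zd). dest_obs \<rho> c i w u v hs hr zr zd) (\<lambda>_ _. 0)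
        (distr (cnM \<Otimes>\<^sub>M cnM) seqM X) w"
      unfolding dominated_def eq[OF \<open>w \<in> W\<close>] by (auto simp: nn_integral_distr[OF mX])
  qed simp_all
qed

lemma conditional_converse:
  fixes \<phi> :: "nat \<Rightarrow> nat"
  assumes c: "valid_code c" and W: "finite W" "inj_on \<phi> W" and \<gamma>: "\<gamma> > 0"
    and cut: "\<And>i. cuttable \<rho> c i u (v i) (hs i) (hr i) W (K i)"
  shows "(\<Sum>w\<in>W. \<integral>\<^sup>+z. indicator {\<phi> w} (\<phi> (decided \<rho> c w u v hs hr z)) \<partial>noise2) \<le>
    ennreal (exp \<gamma>) + (\<Sum>w\<in>W. K R1 w + K R2 w) / ennreal \<gamma>"
proof -
  let ?X = "\<lambda>i w (zr, zd). dest_obs \<rho> c i w u (v i) (hs i) (hr i) zr zd"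
  obtain Q1 \<Lambda>1 where 1: "prob_space Q1" "sets Q1 = sets seqM"
     "\<And>w. \<Lambda>1 w \<in> borel_measurable (cnM \<Otimes>\<^sub>M cnM)" "\<And>w \<omega>. 0 \<le> \<Lambda>1 w \<omega>"
     "\<And>w. w \<in> W \<Longrightarrow> dominated (cnM \<Otimes>\<^sub>M cnM) (?X R1) \<Lambda>1 Q1 w"
     "\<And>w. w \<in> W \<Longrightarrow> (\<integral>\<^sup>+\<omega>. \<Lambda>1 w \<omega> \<partial>(cnM \<Otimes>\<^sub>M cnM)) \<le> K R1 w"
    using cut[of R1] unfolding cuttable_def by blast
  obtain Q2 \<Lambda>2 where 2: "prob_space Q2" "sets Q2 = sets seqM"
     "\<And>w. \<Lambda>2 w \<in> borel_measurable (cnM \<Otimes>\<^sub>M cnM)" "\<And>w \<omega>. 0 \<le> \<Lambda>2 w \<omega>"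
     "\<And>w. w \<in> W \<Longrightarrow> dominated (cnM \<Otimes>\<^sub>M cnM) (?X R2) \<Lambda>2 Q2 w"
     "\<And>w. w \<in> W \<Longrightarrow> (\<integral>\<^sup>+\<omega>. \<Lambda>2 w \<omega> \<partial>(cnM \<Otimes>\<^sub>M cnM)) \<le> K R2 w"
    using cut[of R2] unfolding cuttable_def by blast
  note [measurable_cong] = 1(2) 2(2)
  interpret cn: prob_space cnM by simp
  interpret pp: pair_prob_space cnM cnM ..
  have mX: "?X i w \<in> cnM \<Otimes>\<^sub>M cnM \<rightarrow>\<^sub>M seqM" for i w
    unfolding case_prod_beta by (rule measurable_dest_obs[OF c]) simp_all
  define \<delta> where "\<delta> = (\<lambda>(y1, y2). \<phi> (dec c hs hr u (case_relay y1 y2)))"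
  have "(\<lambda>y. dec c hs hr u (case_relay (fst y) (snd y))) \<in> Q1 \<Otimes>\<^sub>M Q2 \<rightarrow>\<^sub>M count_space UNIV"
    by (rule measurable_dec[OF c]) (simp_all add: space_PiM)
  then have \<delta>: "\<delta> \<in> Q1 \<Otimes>\<^sub>M Q2 \<rightarrow>\<^sub>M count_space UNIV"
    unfolding \<delta>_def case_prod_beta by (rule measurable_compose) simp
  have obs: "dest_rx \<rho> c w u v hs hr (case_relay a1 a2) (case_relay b1 b2) =
      case_relay (?X R1 w (a1, b1)) (?X R2 w (a2, b2))" for w a1 a2 b1 b2
    by (rule ext) (simp add: dest_rx_eq split: relay.split)
  have "(\<Sum>w\<in>W. \<integral>\<^sup>+z. indicator {\<phi> w} (\<phi> (decided \<rho> c w u v hs hr z)) \<partial>noise2) =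
    (\<Sum>w\<in>W. \<integral>\<^sup>+\<omega>1. \<integral>\<^sup>+\<omega>2. indicator {\<phi> w} (\<delta> (?X R1 w \<omega>1, ?X R2 w \<omega>2)) \<partial>(cnM \<Otimes>\<^sub>M cnM) \<partial>(cnM \<Otimes>\<^sub>M cnM))"
  proof (rule sum.cong[OF refl])
    fix w
    have "(\<lambda>z. decided \<rho> c w u v hs hr z) \<in> noise2 \<rightarrow>\<^sub>M count_space UNIV"
      by (rule measurable_decided[OF c]) (simp_all add: space_PiM)
    then have "(\<lambda>z. indicator {\<phi> w} (\<phi> (decided \<rho> c w u v hs hr z)) :: ennreal) \<in> borel_measurable noise2"
      by (rule measurable_compose) simp
    from nn_integral_noise2[OF this]
    show "(\<integral>\<^sup>+z. indicator {\<phi> w} (\<phi> (decided \<rho> c w u v hs hr z)) \<partial>noise2) =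
      (\<integral>\<^sup>+\<omega>1. \<integral>\<^sup>+\<omega>2. indicator {\<phi> w} (\<delta> (?X R1 w \<omega>1, ?X R2 w \<omega>2)) \<partial>(cnM \<Otimes>\<^sub>M cnM) \<partial>(cnM \<Otimes>\<^sub>M cnM))"
      by (simp add: \<delta>_def decided_def obs case_prod_beta)
  qed
  also have "\<dots> \<le> ennreal (exp \<gamma>) + (\<Sum>w\<in>W. (\<integral>\<^sup>+\<omega>. \<Lambda>1 w \<omega> \<partial>(cnM \<Otimes>\<^sub>M cnM)) + (\<integral>\<^sup>+\<omega>. \<Lambda>2 w \<omega> \<partial>(cnM \<Otimes>\<^sub>M cnM))) / ennreal \<gamma>"
    by (rule weak_converse_two) (use 1 2 W \<gamma> \<delta> mX pp.prob_space_axioms in \<open>auto cong: measurable_cong_sets\<close>)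
  also have "\<dots> \<le> ennreal (exp \<gamma>) + (\<Sum>w\<in>W. K R1 w + K R2 w) / ennreal \<gamma>"
    using 1(6) 2(6) by (intro add_left_mono divide_right_mono_ennreal sum_mono add_mono)
  finally show ?thesis .
qed

text \<open>Since the source knows no channel, averaging over messages, seeds and relay noise leaves
  a function of the relay's own incoming coefficient. This is where receive CSI limits the
  relay.\<close>

definition mean_listen :: "real \<Rightarrow> code \<Rightarrow> relay \<Rightarrow> complex \<Rightarrow> real" where
  "mean_listen \<rho> c i h = enn2real (\<Sum>w<msgs c. \<integral>\<^sup>+p. \<integral>\<^sup>+z. ennreal (listen_count \<rho> c i w (fst p) (snd p i) h z)
     \<partial>cnM \<partial>(cseed c \<Otimes>\<^sub>M rseeds c)) / (real (msgs c) * real (blen c))"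

text \<open>The mean of \<open>cut_cost\<close> per message and slot, for listening fraction
  \<open>t\<close> and received SNRs \<open>gs\<close>, \<open>gr\<close>.\<close>

definition cut_rate :: "bool \<Rightarrow> real \<Rightarrow> real \<Rightarrow> real \<Rightarrow> real \<Rightarrow> real \<Rightarrow> real" where
  "cut_rate b a \<sigma> t gs gr =
     (if b then 2 * ln \<sigma> * t + (4 * a + (1 + 1 / a) * gs / \<sigma>\<^sup>2)
      else 2 * ln \<sigma> * (1 - t) + (4 * a + (1 + 1 / a) * gr / \<sigma>\<^sup>2 + ln 2))"

context
  fixes c :: code
  assumes c: "valid_code c"
begin

interpretation U: prob_space "cseed c" by (rule valid_codeD[OF c])
interpretation V: prob_space "rseeds c" by (rule space_seeds[OF c])
interpretation UV: pair_prob_space "cseed c" "rseeds c" ..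
interpretation cn: prob_space cnM by simp

lemma seeds_measurable:
  "fst \<in> cseed c \<Otimes>\<^sub>M rseeds c \<rightarrow>\<^sub>M seqM" "(\<lambda>p. snd p i) \<in> cseed c \<Otimes>\<^sub>M rseeds c \<rightarrow>\<^sub>M seqM"
  "snd \<in> cseed c \<Otimes>\<^sub>M rseeds c \<rightarrow>\<^sub>M Pi\<^sub>M UNIV (\<lambda>_. seqM)"
proof -
  note [measurable_cong] = valid_codeD(4)[OF c] space_seeds(4)[OF c]
  show "fst \<in> cseed c \<Otimes>\<^sub>M rseeds c \<rightarrow>\<^sub>M seqM" by measurable
  show s: "snd \<in> cseed c \<Otimes>\<^sub>M rseeds c \<rightarrow>\<^sub>M Pi\<^sub>M UNIV (\<lambda>_. seqM)" by measurable
  show "(\<lambda>p. snd p i) \<in> cseed c \<Otimes>\<^sub>M rseeds c \<rightarrow>\<^sub>M seqM"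
    by (rule measurable_PiM_UNIV_component[OF s])
qed

lemma listen_count_joint:
  "(\<lambda>x. listen_count \<rho> c i w (fst (fst x)) (snd (fst x) i) h (snd x)) \<in> borel_measurable ((cseed c \<Otimes>\<^sub>M rseeds c) \<Otimes>\<^sub>M cnM)"
proof (rule measurable_listen_count[OF c])
  show "(\<lambda>x. fst (fst x)) \<in> (cseed c \<Otimes>\<^sub>M rseeds c) \<Otimes>\<^sub>M cnM \<rightarrow>\<^sub>M seqM"
    by (rule measurable_compose[OF measurable_fst seeds_measurable(1)])
  show "(\<lambda>x. snd (fst x) i) \<in> (cseed c \<Otimes>\<^sub>M rseeds c) \<Otimes>\<^sub>M cnM \<rightarrow>\<^sub>M seqM"
    by (rule measurable_compose[OF measurable_fst seeds_measurable(2)])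
  show "snd \<in> (cseed c \<Otimes>\<^sub>M rseeds c) \<Otimes>\<^sub>M cnM \<rightarrow>\<^sub>M seqM"
    by simp
qed simp

lemma listen_integrals:
  assumes [measurable]: "f \<in> borel_measurable borel"
  shows "(\<lambda>p. \<integral>\<^sup>+z. ennreal (f (listen_count \<rho> c i w (fst p) (snd p i) h z)) \<partial>cnM)
     \<in> borel_measurable (cseed c \<Otimes>\<^sub>M rseeds c)"
proof -
  have "(\<lambda>x. ennreal (f (listen_count \<rho> c i w (fst (fst x)) (snd (fst x) i) h (snd x))))
      \<in> borel_measurable ((cseed c \<Otimes>\<^sub>M rseeds c) \<Otimes>\<^sub>M cnM)"
    by (rule measurable_compose[OF listen_count_joint]) simp
  from cn.borel_measurable_nn_integral_fst[OF this] show ?thesis by simp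
qed

lemma listen_plus_transmit:
  "(\<integral>\<^sup>+p. \<integral>\<^sup>+z. ennreal (listen_count \<rho> c i w (fst p) (snd p i) h z) \<partial>cnM \<partial>(cseed c \<Otimes>\<^sub>M rseeds c)) +
   (\<integral>\<^sup>+p. \<integral>\<^sup>+z. ennreal (real (blen c) - listen_count \<rho> c i w (fst p) (snd p i) h z) \<partial>cnM \<partial>(cseed c \<Otimes>\<^sub>M rseeds c))
   = ennreal (real (blen c))"
proof -
  let ?l = "\<lambda>p z. listen_count \<rho> c i w (fst p) (snd p i) h z"
  have m: "(\<lambda>z. ?l p z) \<in> borel_measurable cnM" for p
    by (rule measurable_listen_count[OF c]) simp_all
  have mp: "(\<lambda>p. \<integral>\<^sup>+z. ennreal (real (blen c) - ?l p z) \<partial>cnM) \<in> borel_measurable (cseed c \<Otimes>\<^sub>M rseeds c)"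
    by (rule listen_integrals[of "\<lambda>x. real (blen c) - x"]) simp
  have ml: "(\<lambda>p. \<integral>\<^sup>+z. ennreal (?l p z) \<partial>cnM) \<in> borel_measurable (cseed c \<Otimes>\<^sub>M rseeds c)"
    by (rule listen_integrals[of "\<lambda>x. x"]) simp
  have "(\<integral>\<^sup>+p. \<integral>\<^sup>+z. ennreal (?l p z) \<partial>cnM \<partial>(cseed c \<Otimes>\<^sub>M rseeds c)) +
      (\<integral>\<^sup>+p. \<integral>\<^sup>+z. ennreal (real (blen c) - ?l p z) \<partial>cnM \<partial>(cseed c \<Otimes>\<^sub>M rseeds c)) =
    (\<integral>\<^sup>+p. (\<integral>\<^sup>+z. ennreal (?l p z) \<partial>cnM) + (\<integral>\<^sup>+z. ennreal (real (blen c) - ?l p z) \<partial>cnM) \<partial>(cseed c \<Otimes>\<^sub>M rseeds c))"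
    by (rule nn_integral_add[symmetric, OF ml mp])
  also have "\<dots> = (\<integral>\<^sup>+p. \<integral>\<^sup>+z. ennreal (real (blen c)) \<partial>cnM \<partial>(cseed c \<Otimes>\<^sub>M rseeds c))"
  proof (rule nn_integral_cong)
    fix p
    have "(\<integral>\<^sup>+z. ennreal (?l p z) \<partial>cnM) + (\<integral>\<^sup>+z. ennreal (real (blen c) - ?l p z) \<partial>cnM) =
      (\<integral>\<^sup>+z. ennreal (?l p z) + ennreal (real (blen c) - ?l p z) \<partial>cnM)"
      by (rule nn_integral_add[symmetric]) (use m[of p] in measurable)
    also have "\<dots> = (\<integral>\<^sup>+z. ennreal (real (blen c)) \<partial>cnM)"
      using listen_count_bounds[of \<rho> c i w] by (intro nn_integral_cong) (simp flip: ennreal_plus)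
    finally show "(\<integral>\<^sup>+z. ennreal (?l p z) \<partial>cnM) + (\<integral>\<^sup>+z. ennreal (real (blen c) - ?l p z) \<partial>cnM) =
      (\<integral>\<^sup>+z. ennreal (real (blen c)) \<partial>cnM)" .
  qed
  also have "\<dots> = ennreal (real (blen c))"
    by (simp add: cn.emeasure_space_1[simplified] UV.emeasure_space_1)
  finally show ?thesis .
qed

lemma mean_listen_sums:
  shows "(\<Sum>w<msgs c. \<integral>\<^sup>+p. \<integral>\<^sup>+z. ennreal (listen_count \<rho> c i w (fst p) (snd p i) h z) \<partial>cnM \<partial>(cseed c \<Otimes>\<^sub>M rseeds c))
      = ennreal (real (msgs c) * real (blen c) * mean_listen \<rho> c i h)" (is "?L = _")
    and "(\<Sum>w<msgs c. \<integral>\<^sup>+p. \<integral>\<^sup>+z. ennreal (real (blen c) - listen_count \<rho> c i w (fst p) (snd p i) h z) \<partial>cnM \<partial>(cseed c \<Otimes>\<^sub>M rseeds c))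
      = ennreal (real (msgs c) * real (blen c) * (1 - mean_listen \<rho> c i h))" (is "?T = _")
    and "0 \<le> mean_listen \<rho> c i h" "mean_listen \<rho> c i h \<le> 1"
proof -
  let ?n = "real (msgs c) * real (blen c)"
  have n: "?n > 0" using valid_codeD(1,2)[OF c] by simp
  have sum: "?L + ?T = ennreal ?n"
    unfolding sum.distrib[symmetric] listen_plus_transmit
    by (simp add: ennreal_mult ennreal_of_nat_eq_real_of_nat)
  then have fin: "?L \<noteq> \<top>" "?T \<noteq> \<top>" by (metis ennreal_neq_top ennreal_add_eq_top)+
  have L: "?L = ennreal (enn2real ?L)" and T: "?T = ennreal (enn2real ?T)"
    using fin by (simp_all add: less_top)
  have s: "enn2real ?L + enn2real ?T = ?n"
    using sum n by (subst (asm) L, subst (asm) T) (simp flip: ennreal_plus)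
  have m: "enn2real ?L = ?n * mean_listen \<rho> c i h"
    using valid_codeD(1,2)[OF c] by (simp add: mean_listen_def)
  show "?L = ennreal (?n * mean_listen \<rho> c i h)"
    by (subst L) (simp add: m)
  have "enn2real ?T = ?n * (1 - mean_listen \<rho> c i h)"
    using s m by (simp add: algebra_simps)
  then show "?T = ennreal (?n * (1 - mean_listen \<rho> c i h))"
    by (subst T) simp
  show "0 \<le> mean_listen \<rho> c i h" unfolding mean_listen_def by simp
  have "?n * mean_listen \<rho> c i h \<le> ?n * 1" using m s enn2real_nonneg[of ?T] by linarith
  then show "mean_listen \<rho> c i h \<le> 1" using n by (rule mult_left_le_imp_le)
qed

lemma cut_cost_measurable:
  "(\<lambda>p. cut_cost b a \<sigma> \<rho> c i w (fst p) (snd p i) hs hr) \<in> borel_measurable (cseed c \<Otimes>\<^sub>M rseeds c)"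
proof -
  let ?l = "\<lambda>p z. listen_count \<rho> c i w (fst p) (snd p i) hs z"
  have [measurable]: "(\<lambda>p. \<integral>\<^sup>+z. ennreal (?l p z) \<partial>cnM) \<in> borel_measurable (cseed c \<Otimes>\<^sub>M rseeds c)"
    "(\<lambda>p. \<integral>\<^sup>+z. ennreal (real (blen c) - ?l p z) \<partial>cnM) \<in> borel_measurable (cseed c \<Otimes>\<^sub>M rseeds c)"
    by (rule listen_integrals[of "\<lambda>x. x"] listen_integrals[of "\<lambda>x. real (blen c) - x"]; simp)+
  show ?thesis unfolding cut_cost_def by (cases b) simp_all
qed

lemma sum_cut_cost:
  assumes "a > 0" "\<sigma> \<ge> 1" "\<rho> \<ge> 0"
  shows "(\<Sum>w<msgs c. \<integral>\<^sup>+p. cut_cost b a \<sigma> \<rho> c i w (fst p) (snd p i) hs hr \<partial>(cseed c \<Otimes>\<^sub>M rseeds c)) =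
    ennreal (real (msgs c) * real (blen c) *
      cut_rate b a \<sigma> (mean_listen \<rho> c i hs) ((cmod hs)\<^sup>2 * \<rho>) ((cmod hr)\<^sup>2 * \<rho>))"
proof -
  let ?l = "\<lambda>w p z. listen_count \<rho> c i w (fst p) (snd p i) hs z"
  have [measurable]: "(\<lambda>p. \<integral>\<^sup>+z. ennreal (?l w p z) \<partial>cnM) \<in> borel_measurable (cseed c \<Otimes>\<^sub>M rseeds c)"
    "(\<lambda>p. \<integral>\<^sup>+z. ennreal (real (blen c) - ?l w p z) \<partial>cnM) \<in> borel_measurable (cseed c \<Otimes>\<^sub>M rseeds c)" for w
    by (rule listen_integrals[of "\<lambda>x. x"] listen_integrals[of "\<lambda>x. real (blen c) - x"]; simp)+
  have key: "ennreal (2 * ln \<sigma>) * ennreal (real (msgs c) * real (blen c) * t) + of_nat (msgs c) * ennreal (real (blen c) * D) =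
      ennreal (real (msgs c) * real (blen c) * (2 * ln \<sigma> * t + D))" if "0 \<le> t" "0 \<le> D" for t D
  proof -
    have "ennreal (2 * ln \<sigma>) * ennreal (real (msgs c) * real (blen c) * t) + of_nat (msgs c) * ennreal (real (blen c) * D) =
      ennreal (2 * ln \<sigma> * (real (msgs c) * real (blen c) * t) + real (msgs c) * (real (blen c) * D))"
      using assms that by (simp add: ennreal_mult ennreal_of_nat_eq_real_of_nat)
    then show ?thesis by (simp add: algebra_simps)
  qed
  show ?thesis
  proof (cases b)
    case True
    have "(\<Sum>w<msgs c. \<integral>\<^sup>+p. cut_cost b a \<sigma> \<rho> c i w (fst p) (snd p i) hs hr \<partial>(cseed c \<Otimes>\<^sub>M rseeds c)) =
       ennreal (2 * ln \<sigma>) * (\<Sum>w<msgs c. \<integral>\<^sup>+p. \<integral>\<^sup>+z. ennreal (?l w p z) \<partial>cnM \<partial>(cseed c \<Otimes>\<^sub>M rseeds c)) +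
       of_nat (msgs c) * ennreal (real (blen c) * (4 * a + (1 + 1 / a) * ((cmod hs)\<^sup>2 * \<rho>) / \<sigma>\<^sup>2))"
      using True by (simp add: cut_cost_def nn_integral_add nn_integral_cmult UV.emeasure_space_1 sum.distrib sum_distrib_left)
    then show ?thesis unfolding mean_listen_sums(1)
      using assms mean_listen_sums(3)[of \<rho> i hs] True by (subst (asm) key) (auto simp: cut_rate_def)
  next
    case False
    have "(\<Sum>w<msgs c. \<integral>\<^sup>+p. cut_cost b a \<sigma> \<rho> c i w (fst p) (snd p i) hs hr \<partial>(cseed c \<Otimes>\<^sub>M rseeds c)) =
       ennreal (2 * ln \<sigma>) * (\<Sum>w<msgs c. \<integral>\<^sup>+p. \<integral>\<^sup>+z. ennreal (real (blen c) - ?l w p z) \<partial>cnM \<partial>(cseed c \<Otimes>\<^sub>M rseeds c)) +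
       of_nat (msgs c) * ennreal (real (blen c) * (4 * a + (1 + 1 / a) * ((cmod hr)\<^sup>2 * \<rho>) / \<sigma>\<^sup>2 + ln 2))"
      using False by (simp add: cut_cost_def nn_integral_add nn_integral_cmult UV.emeasure_space_1 sum.distrib sum_distrib_left)
    then show ?thesis unfolding mean_listen_sums(2)
      using assms mean_listen_sums(4)[of \<rho> i hs] False by (subst (asm) key) (auto simp: cut_rate_def)
  qed
qed

text \<open>
  The map \<open>\<phi>\<close> is the part of the message whose decoding is examined, and \<open>\<psi>\<close> the part which is
  revealed for free; \<open>\<phi> = id\<close> and constant \<open>\<psi>\<close> give the plain cut-set bound.
\<close>

lemma correct_given_le:
  fixes \<phi> \<psi> :: "nat \<Rightarrow> nat"
  assumes \<gamma>: "\<gamma> > 0" and \<psi>: "\<And>w. w < msgs c \<Longrightarrow> \<psi> w < N"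
    and \<phi>: "\<And>j. inj_on \<phi> {w. w < msgs c \<and> \<psi> w = j}"
    and cut: "\<And>i u v j. cuttable \<rho> c i u (v i) (hs i) (hr i) {w. w < msgs c \<and> \<psi> w = j} (\<lambda>w. K i w (u, v))"
    and K: "\<And>i w. K i w \<in> borel_measurable (cseed c \<Otimes>\<^sub>M rseeds c)"
    and R: "\<And>i. (\<Sum>w<msgs c. \<integral>\<^sup>+p. K i w p \<partial>(cseed c \<Otimes>\<^sub>M rseeds c)) \<le> ennreal (real (msgs c) * real (blen c) * R i)"
      "\<And>i. 0 \<le> R i"
  shows "correct_given \<rho> c hs hr \<le> ennreal (real N * exp \<gamma> / real (msgs c) + real (blen c) * (R R1 + R R2) / \<gamma>)"
proof -
  note [measurable] = K
  have sp: "space (cseed c) = UNIV" "space (rseeds c) = UNIV" using space_seeds[OF c] by auto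
  let ?UV = "cseed c \<Otimes>\<^sub>M rseeds c"
  let ?M = "of_nat (msgs c) :: ennreal"
  interpret noi: prob_space noise2 by (rule prob_space_noise2)
  define D where "D w p z = (indicator {\<phi> w} (\<phi> (decided \<rho> c w (fst p) (snd p) hs hr z)) :: ennreal)" for w p z
  have mD2: "(\<lambda>x. decided \<rho> c w (fst (fst x)) (snd (fst x)) hs hr (snd x)) \<in> ?UV \<Otimes>\<^sub>M noise2 \<rightarrow>\<^sub>M count_space UNIV" for w
  proof (rule measurable_decided[OF c])
    show "(\<lambda>x. fst (fst x)) \<in> ?UV \<Otimes>\<^sub>M noise2 \<rightarrow>\<^sub>M seqM"
      by (rule measurable_compose[OF measurable_fst seeds_measurable(1)])
    show "(\<lambda>x. snd (fst x)) \<in> ?UV \<Otimes>\<^sub>M noise2 \<rightarrow>\<^sub>M Pi\<^sub>M UNIV (\<lambda>_. seqM)"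
      by (rule measurable_compose[OF measurable_fst seeds_measurable(3)])
  qed (simp_all add: space_PiM)
  have mDx: "(\<lambda>x. h (decided \<rho> c w (fst (fst x)) (snd (fst x)) hs hr (snd x)) :: ennreal) \<in> borel_measurable (?UV \<Otimes>\<^sub>M noise2)" for w h
    by (rule measurable_compose[OF mD2]) simp
  have mh: "(\<lambda>p. \<integral>\<^sup>+z. h (decided \<rho> c w (fst p) (snd p) hs hr z) \<partial>noise2) \<in> borel_measurable ?UV"
    for w and h :: "nat \<Rightarrow> ennreal"
    using noi.borel_measurable_nn_integral_fst[OF mDx[of h w]] by simp
  have mD[measurable]: "(\<lambda>p. \<integral>\<^sup>+z. D w p z \<partial>noise2) \<in> borel_measurable ?UV" for w
    unfolding D_def by (rule mh)
  have "(\<integral>\<^sup>+u. \<integral>\<^sup>+v. \<integral>\<^sup>+z. indicator {w} (decided \<rho> c w u v hs hr z) \<partial>noise2 \<partial>rseeds c \<partial>cseed c) =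
      (\<integral>\<^sup>+p. \<integral>\<^sup>+z. indicator {w} (decided \<rho> c w (fst p) (snd p) hs hr z) \<partial>noise2 \<partial>?UV)" for w
    using V.nn_integral_fst[OF mh[of "indicator {w}" w]] by simp
  \<comment> \<open>A correct decision is in particular correct in the part
    \<open>\<phi>\<close>.\<close>
  then have "(\<Sum>w<msgs c. \<integral>\<^sup>+u. \<integral>\<^sup>+v. \<integral>\<^sup>+z. indicator {w} (decided \<rho> c w u v hs hr z) \<partial>noise2 \<partial>rseeds c \<partial>cseed c) \<le>
      (\<Sum>w<msgs c. \<integral>\<^sup>+p. \<integral>\<^sup>+z. D w p z \<partial>noise2 \<partial>?UV)"
    by (auto intro!: sum_mono nn_integral_mono simp: D_def indicator_def)
  also have "\<dots> = (\<integral>\<^sup>+p. (\<Sum>w<msgs c. \<integral>\<^sup>+z. D w p z \<partial>noise2) \<partial>?UV)"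
    by (rule nn_integral_sum[symmetric]) measurable
  also have "\<dots> \<le> (\<integral>\<^sup>+p. of_nat N * ennreal (exp \<gamma>) + (\<Sum>w<msgs c. K R1 w p + K R2 w p) / ennreal \<gamma> \<partial>?UV)"
  proof (rule nn_integral_mono)
    fix p :: "cseq \<times> (relay \<Rightarrow> cseq)"
    obtain u v where p: "p = (u, v)" by (cases p)
    \<comment> \<open>Within one class of \<open>\<psi>\<close> the map \<open>\<phi>\<close> is
      injective, so the converse applies to each class; each of the \<open>N\<close> classes pays
      \<open>exp \<gamma>\<close> once.\<close>
    have part: "(\<Sum>w<msgs c. f w) = (\<Sum>j<N. \<Sum>w | w < msgs c \<and> \<psi> w = j. f w)" for f :: "nat \<Rightarrow> ennreal"
      using sum.group[of "{..<msgs c}" "{..<N}" \<psi> f] \<psi> by (simp add: image_subset_iff)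
    have "(\<Sum>w<msgs c. \<integral>\<^sup>+z. D w p z \<partial>noise2) \<le>
       (\<Sum>j<N. ennreal (exp \<gamma>) + (\<Sum>w | w < msgs c \<and> \<psi> w = j. K R1 w p + K R2 w p) / ennreal \<gamma>)"
    proof (subst part, rule sum_mono)
      fix j
      show "(\<Sum>w | w < msgs c \<and> \<psi> w = j. \<integral>\<^sup>+z. D w p z \<partial>noise2) \<le>
          ennreal (exp \<gamma>) + (\<Sum>w | w < msgs c \<and> \<psi> w = j. K R1 w p + K R2 w p) / ennreal \<gamma>"
        unfolding D_def p fst_conv snd_conv
        by (rule conditional_converse[OF c _ \<phi> \<gamma> cut]) simp
    qed
    also have "\<dots> = of_nat N * ennreal (exp \<gamma>) + (\<Sum>w<msgs c. K R1 w p + K R2 w p) / ennreal \<gamma>"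
      unfolding part[of "\<lambda>w. K R1 w p + K R2 w p"]
      by (simp only: sum.distrib divide_ennreal_def sum_distrib_right[symmetric] sum_constant card_lessThan)
    finally show "(\<Sum>w<msgs c. \<integral>\<^sup>+z. D w p z \<partial>noise2) \<le> of_nat N * ennreal (exp \<gamma>) + (\<Sum>w<msgs c. K R1 w p + K R2 w p) / ennreal \<gamma>" .
  qed
  also have "\<dots> = of_nat N * ennreal (exp \<gamma>) +
      ((\<Sum>w<msgs c. \<integral>\<^sup>+p. K R1 w p \<partial>?UV) + (\<Sum>w<msgs c. \<integral>\<^sup>+p. K R2 w p \<partial>?UV)) / ennreal \<gamma>"
    by (simp add: nn_integral_add nn_integral_divide nn_integral_sum UV.emeasure_space_1 sum.distrib)
  also have "\<dots> \<le> of_nat N * ennreal (exp \<gamma>) +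
      (ennreal (real (msgs c) * real (blen c) * R R1) + ennreal (real (msgs c) * real (blen c) * R R2)) / ennreal \<gamma>"
    by (intro add_left_mono divide_right_mono_ennreal add_mono R)
  also have "\<dots> = ennreal (real N * exp \<gamma> + (real (msgs c) * real (blen c) * R R1 + real (msgs c) * real (blen c) * R R2) / \<gamma>)"
    using \<gamma> R(2) by (simp add: ennreal_of_nat_eq_real_of_nat ennreal_mult divide_ennreal[symmetric])
  finally have "correct_given \<rho> c hs hr \<le>
    ennreal (real N * exp \<gamma> + (real (msgs c) * real (blen c) * R R1 + real (msgs c) * real (blen c) * R R2) / \<gamma>) / ?M"
    unfolding correct_given_def by (rule divide_right_mono_ennreal)
  also have "\<dots> = ennreal ((real N * exp \<gamma> + (real (msgs c) * real (blen c) * R R1 + real (msgs c) * real (blen c) * R R2) / \<gamma>) / real (msgs c))"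
    using \<gamma> R(2) valid_codeD(2)[OF c]
    by (subst divide_ennreal[symmetric]) (auto simp: ennreal_of_nat_eq_real_of_nat intro!: add_nonneg_nonneg divide_nonneg_pos)
  also have "(real N * exp \<gamma> + (real (msgs c) * real (blen c) * R R1 + real (msgs c) * real (blen c) * R R2) / \<gamma>) / real (msgs c)
     = real N * exp \<gamma> / real (msgs c) + real (blen c) * (R R1 + R R2) / \<gamma>"
    using \<gamma> valid_codeD(2)[OF c] by (simp add: field_simps)
  finally show ?thesis .
qed

lemma cut_rate_nonneg:
  "a > 0 \<Longrightarrow> \<sigma> \<ge> 1 \<Longrightarrow> 0 \<le> t \<Longrightarrow> t \<le> 1 \<Longrightarrow> 0 \<le> gs \<Longrightarrow> 0 \<le> gr \<Longrightarrow> 0 \<le> cut_rate b a \<sigma> t gs gr"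
  by (auto simp: cut_rate_def intro!: add_nonneg_nonneg mult_nonneg_nonneg divide_nonneg_nonneg)

lemma correct_given_cut_set:
  fixes b :: "relay \<Rightarrow> bool" and \<sigma> :: "relay \<Rightarrow> real" and hs hr :: "relay \<Rightarrow> complex"
  assumes "\<gamma> > 0" "\<rho> \<ge> 0" "a > 0" "\<And>i. \<sigma> i \<ge> 1"
  defines "R \<equiv> \<lambda>i. cut_rate (b i) a (\<sigma> i) (mean_listen \<rho> c i (hs i)) ((cmod (hs i))\<^sup>2 * \<rho>) ((cmod (hr i))\<^sup>2 * \<rho>)"
  shows "correct_given \<rho> c hs hr \<le> ennreal (exp \<gamma> / real (msgs c) + real (blen c) * (R R1 + R R2) / \<gamma>)"
proof -
  have "correct_given \<rho> c hs hr \<le> ennreal (real 1 * exp \<gamma> / real (msgs c) + real (blen c) * (R R1 + R R2) / \<gamma>)"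
  proof (rule correct_given_le[where \<phi>="\<lambda>w. w" and \<psi>="\<lambda>_. 0" and
        K="\<lambda>i w p. cut_cost (b i) a (\<sigma> i) \<rho> c i w (fst p) (snd p i) (hs i) (hr i)"])
    show "cuttable \<rho> c i u (v i) (hs i) (hr i) {w. w < msgs c \<and> 0 = j}
        (\<lambda>w. cut_cost (b i) a (\<sigma> i) \<rho> c i w (fst (u, v)) (snd (u, v) i) (hs i) (hr i))" for i u v and j :: nat
      unfolding fst_conv snd_conv by (rule cuttable_cut_cost[OF c]) (use assms in auto)
    show "0 \<le> R i" for i unfolding R_def
      using assms mean_listen_sums(3,4) by (intro cut_rate_nonneg) auto
  qed (use assms in \<open>auto simp: sum_cut_cost R_def cut_cost_measurable\<close>)
  then show ?thesis by simp
qed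

end

section \<open>The converse\<close>

definition dmt_curve :: "real \<Rightarrow> real" where
  "dmt_curve r = (if r < 1/2 then 2 - r / (1 - r) else 2 * (1 - r))"

text \<open>
  For listening fractions \<open>t1\<close>, \<open>t2\<close> and source-relay exponents 1, these lemmas pick relay-destination
  exponents \<open>\<beta>1\<close>, \<open>\<beta>2\<close> and one side of each path such that the resulting cut is narrower than \<open>r\<close>.
\<close>

lemma choose_cut_low:
  fixes t1 t2 :: real
  assumes t: "0 \<le> t1" "t1 \<le> 1" "0 \<le> t2" "t2 \<le> 1" and r: "0 < \<delta>" "\<delta> \<le> r" "r < 1/2"
  shows "\<exists>b2 \<beta>1 \<beta>2. 0 \<le> \<beta>1 \<and> \<beta>1 \<le> 1 \<and> 0 \<le> \<beta>2 \<and> \<beta>2 \<le> 1 \<and>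
    (1 - t1) * \<beta>1 + (if b2 then t2 else (1 - t2) * \<beta>2) \<le> r - \<delta> \<and>
    (1 - \<beta>1) + (1 - \<beta>2) \<le> dmt_curve r + 6 * \<delta>"
\<comment> \<open>If relay 2 listens for at most \<open>r - \<delta>\<close>, its source cut is
  narrow enough, and erasing the second hop of path 1 costs exponent 1 only.\<close>
proof (cases "t2 \<le> r - \<delta>")
  case True
  have q: "r / (1 - r) \<le> 1" using r by (simp add: field_simps)
  have "dmt_curve r = 2 - r / (1 - r)" using r by (simp add: dmt_curve_def)
  with q r have "1 \<le> dmt_curve r + 6 * \<delta>" by linarith
  then show ?thesis using True
    by (intro exI[of _ True] exI[of _ 0] exI[of _ 1]) auto
next
  case False
  \<comment> \<open>Relay 2 listens for more than \<open>r - \<delta>\<close>, so it transmits for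
    less than \<open>1 - r + \<delta>\<close>; \<open>\<beta>\<close> is the exponent at which that
    fraction carries exactly \<open>r - \<delta>\<close>. With path 1 erased, the fades have total
    exponent \<open>2 - \<beta>\<close>.\<close>
  define \<beta> where "\<beta> = (r - \<delta>) / (1 - r + \<delta>)"
  have \<beta>: "0 \<le> \<beta>" "\<beta> \<le> 1" using r by (auto simp: \<beta>_def field_simps)
  have "(1 - t2) * \<beta> \<le> (1 - r + \<delta>) * \<beta>" using False \<beta> by (intro mult_right_mono) auto
  also have "\<dots> = r - \<delta>" using r by (simp add: \<beta>_def)
  finally have 1: "(1 - t2) * \<beta> \<le> r - \<delta>" .
  have "r / (1 - r) - \<beta> = \<delta> / ((1 - r) * (1 - r + \<delta>))"
    using r by (simp add: \<beta>_def field_simps)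
  \<comment> \<open>Both factors of the denominator exceed 1/2 because \<open>r < 1/2\<close>; the
    resulting 4 fits into the slack \<open>6 * \<delta>\<close>.\<close>
  also have "\<dots> \<le> \<delta> / ((1/2) * (1/2))"
    using r by (intro divide_left_mono mult_mono) auto
  finally have 2: "r / (1 - r) - \<beta> \<le> 4 * \<delta>" by simp
  show ?thesis
    using 1 2 r \<beta> by (intro exI[of _ False] exI[of _ 0] exI[of _ \<beta>]) (auto simp: dmt_curve_def)
qed

lemma choose_cut_high_aux:
  fixes t1 t2 :: real
  assumes t: "0 \<le> t1" "t1 \<le> t2" "t2 \<le> 1" and r: "0 < \<delta>" "\<delta> < 1/4" "1/2 \<le> r" "r \<le> 1"
    and sum: "t1 + t2 < 1 - 2 * \<delta>"
  shows "\<exists>\<beta>. 0 \<le> \<beta> \<and> \<beta> \<le> 1 \<and> t1 + (1 - t2) * \<beta> \<le> r - \<delta> \<and> 1 - \<beta> \<le> dmt_curve r + 6 * \<delta>"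
proof -
  \<comment> \<open>The weakest fade for which source cut 1 and destination cut 2 together do not
    exceed \<open>r - \<delta>\<close>.\<close>
  define \<beta> where "\<beta> = min 1 ((r - \<delta> - t1) / (1 - t2))"
  have t2: "1 - t2 > 0" using sum t r by linarith
  have t1: "r - \<delta> - t1 > 0" using sum t r by linarith
  have \<beta>: "0 \<le> \<beta>" "\<beta> \<le> 1" using t1 t2 by (auto simp: \<beta>_def)
  have "(1 - t2) * \<beta> \<le> (1 - t2) * ((r - \<delta> - t1) / (1 - t2))"
    using t2 by (intro mult_left_mono) (auto simp: \<beta>_def)
  then have 1: "t1 + (1 - t2) * \<beta> \<le> r - \<delta>" using t2 by simp
  have 2: "1 - \<beta> \<le> 2 * (1 - r) + 6 * \<delta>"
  proof (cases "1 - t2 \<le> r - \<delta> - t1")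
    case True
    then have "\<beta> = 1" using t2 by (simp add: \<beta>_def)
    then show ?thesis using r by simp
  next
    case False
    then have b: "\<beta> = (r - \<delta> - t1) / (1 - t2)" using t2 by (simp add: \<beta>_def)
    have t2': "t2 \<le> 3/4" using False sum r by linarith
    \<comment> \<open>Equivalent to the desired bound \<open>1 - \<beta> \<le> 2 * (1 - r)\<close>
      when the slack \<open>\<delta>\<close> is ignored. For \<open>t2 \<le> 1/2\<close> it follows
      from \<open>t1 \<le> t2\<close>, otherwise from \<open>t1 + t2 < 1\<close>.\<close>
    have "t1 - t2 \<le> (1 - r) * (1 - 2 * t2)"
    proof (cases "t2 \<le> 1/2")
      case True
      then have "0 \<le> (1 - r) * (1 - 2 * t2)" using r by simp
      then show ?thesis using t by linarith
    next
      case f: False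
      have "(1 - r) * (2 * t2 - 1) \<le> 1 * (2 * t2 - 1)" using f r by (intro mult_right_mono) auto
      then have "- (2 * t2 - 1) \<le> (1 - r) * (1 - 2 * t2)" by (simp add: algebra_simps)
      then show ?thesis using sum r by linarith
    qed
    moreover have "(1 - r) * (1 - 2 * t2) = 2 * (1 - r) * (1 - t2) - (1 - r)" by (simp add: algebra_simps)
    \<comment> \<open>\<open>1 - t2 \<ge> 1/4\<close> is bounded away from 0, so the slack survives
      the division.\<close>
    moreover have "\<delta> \<le> 6 * \<delta> * (1 - t2)"
    proof -
      have "6 * \<delta> * (1/4) \<le> 6 * \<delta> * (1 - t2)" using r t2' by (intro mult_left_mono) auto
      then show ?thesis using r by simp
    qed
    ultimately have "1 - t2 - (r - \<delta> - t1) \<le> (2 * (1 - r) + 6 * \<delta>) * (1 - t2)"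
      by (simp add: algebra_simps)
    then have "(1 - t2 - (r - \<delta> - t1)) / (1 - t2) \<le> 2 * (1 - r) + 6 * \<delta>"
      using t2 by (simp add: pos_divide_le_eq)
    moreover have "(1 - t2 - (r - \<delta> - t1)) / (1 - t2) = 1 - \<beta>"
      using t2 by (simp add: b diff_divide_distrib)
    ultimately show ?thesis by simp
  qed
  show ?thesis using \<beta> 1 2 r by (intro exI[of _ \<beta>]) (simp add: dmt_curve_def)
qed

lemma choose_cut:
  fixes t :: "relay \<Rightarrow> real"
  assumes t: "\<And>i. 0 \<le> t i" "\<And>i. t i \<le> 1" and r: "0 < \<delta>" "\<delta> < 1/4" "\<delta> \<le> r" "r \<le> 1"
  shows "\<exists>b \<beta>. (\<forall>i. 0 \<le> \<beta> i \<and> \<beta> i \<le> 1) \<and>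
    (if b R1 then t R1 else (1 - t R1) * \<beta> R1) + (if b R2 then t R2 else (1 - t R2) * \<beta> R2) \<le> r - \<delta> \<and>
    (1 - \<beta> R1) + (1 - \<beta> R2) \<le> dmt_curve r + 6 * \<delta>"
proof (cases "r < 1/2")
  case True
  from choose_cut_low[OF t(1)[of R1] t(2)[of R1] t(1)[of R2] t(2)[of R2] r(1,3) True]
  obtain b2 \<beta>1 \<beta>2 where "0 \<le> \<beta>1 \<and> \<beta>1 \<le> 1 \<and> 0 \<le> \<beta>2 \<and> \<beta>2 \<le> 1 \<and>
    (1 - t R1) * \<beta>1 + (if b2 then t R2 else (1 - t R2) * \<beta>2) \<le> r - \<delta> \<and>
    (1 - \<beta>1) + (1 - \<beta>2) \<le> dmt_curve r + 6 * \<delta>" by blast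
  then show ?thesis
    by (intro exI[of _ "case_relay False b2"] exI[of _ "case_relay \<beta>1 \<beta>2"]) (auto split: relay.split)
next
  case r2: False
  show ?thesis
  \<comment> \<open>If the fractions sum to less than 1, the relay that listens less is cut at the
    source and the other one at the destination. Otherwise the transmit fractions sum to little more
    than 1 at most, and both second hops are faded equally.\<close>
  proof (cases "t R1 + t R2 < 1 - 2 * \<delta>")
    case True
    show ?thesis
    proof (cases "t R1 \<le> t R2")
      case le: True
      from choose_cut_high_aux[OF t(1) le t(2) r(1,2) _ r(4) True] r2
      obtain \<beta> where "0 \<le> \<beta>" "\<beta> \<le> 1" "t R1 + (1 - t R2) * \<beta> \<le> r - \<delta>" "1 - \<beta> \<le> dmt_curve r + 6 * \<delta>"
        by auto
      then show ?thesis
        by (intro exI[of _ "case_relay True False"] exI[of _ "case_relay 1 \<beta>"]) (auto split: relay.split)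
    next
      case False
      then have le: "t R2 \<le> t R1" by simp
      from choose_cut_high_aux[OF t(1) le t(2) r(1,2) _ r(4)] r2 True
      obtain \<beta> where "0 \<le> \<beta>" "\<beta> \<le> 1" "t R2 + (1 - t R1) * \<beta> \<le> r - \<delta>" "1 - \<beta> \<le> dmt_curve r + 6 * \<delta>"
        by (auto simp: add.commute)
      then show ?thesis
        by (intro exI[of _ "case_relay False True"] exI[of _ "case_relay \<beta> 1"]) (auto split: relay.split)
    qed
  next
    case False
    \<comment> \<open>The common exponent at which transmit fractions of sum
      \<open>1 + 2 * \<delta>\<close> carry \<open>r - \<delta>\<close>.\<close>
    define \<beta> where "\<beta> = (r - \<delta>) / (1 + 2 * \<delta>)"
    have \<beta>: "0 \<le> \<beta>" "\<beta> \<le> 1" using r by (auto simp: \<beta>_def field_simps)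
    have "(1 - t R1) * \<beta> + (1 - t R2) * \<beta> = (2 - (t R1 + t R2)) * \<beta>" by (simp add: algebra_simps)
    also have "\<dots> \<le> (1 + 2 * \<delta>) * \<beta>" using False \<beta> by (intro mult_right_mono) auto
    also have "\<dots> = r - \<delta>" using r by (simp add: \<beta>_def)
    finally have 1: "(1 - t R1) * \<beta> + (1 - t R2) * \<beta> \<le> r - \<delta>" .
    have "r - 3 * \<delta> \<le> \<beta>"
    proof -
      have "\<delta> * r \<le> \<delta> * 1" using r by (intro mult_left_mono) auto
      moreover have "0 \<le> \<delta> * \<delta>" by simp
      moreover have "(r - 3 * \<delta>) * (1 + 2 * \<delta>) = r - 3 * \<delta> + 2 * (\<delta> * r) - 6 * (\<delta> * \<delta>)"
        by (simp add: algebra_simps)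
      ultimately have "(r - 3 * \<delta>) * (1 + 2 * \<delta>) \<le> r - \<delta>" by linarith
      then show ?thesis using r by (simp add: \<beta>_def pos_le_divide_eq)
    qed
    then show ?thesis using \<beta> 1 r r2
      by (intro exI[of _ "\<lambda>_. False"] exI[of _ "\<lambda>_. \<beta>"]) (auto simp: dmt_curve_def)
  qed
qed

text \<open>\<open>X\<close> stands for \<open>ln \<rho>\<close>. The threshold
  \<open>(r - \<delta>/2) * X * T\<close> lies between the cost, about
  \<open>(r - \<delta>) * X * T\<close>, and the logarithm of the number of messages, at least
  \<open>(r - \<delta>/4) * X * T\<close>. The upper gap makes the exponential term small, the lower
  gap keeps the Markov ratio at most \<open>1 - \<delta>/4\<close>;
  \<open>64 \<le> \<delta> * X\<close> absorbs the additive 16.\<close>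

lemma outage_threshold:
  fixes T :: nat and X M R r \<delta> :: real
  assumes \<delta>: "0 < \<delta>" "\<delta> \<le> r" "r \<le> 1" and T: "T \<ge> 1" and M: "M > 0" "(r - \<delta>/4) * X * T \<le> ln M"
    and R: "R \<le> (r - \<delta>) * X + 16" "0 \<le> R"
    and X: "64 \<le> \<delta> * X" "exp (- (\<delta> * X / 4)) \<le> \<delta> / 8"
  shows "\<exists>\<gamma>>0. exp \<gamma> / M + real T * R / \<gamma> \<le> 1 - \<delta> / 8"
proof (intro exI conjI)
  have "0 < \<delta> * X" using X by linarith
  then have X0: "X > 0" using \<delta>(1) by (rule zero_less_mult_pos)
  let ?\<gamma> = "(r - \<delta>/2) * X * real T"
  have rd: "r - \<delta>/2 > 0" using \<delta> by linarith
  show g: "?\<gamma> > 0" using X0 T rd by simp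
  have "exp ?\<gamma> / M = exp (?\<gamma> - ln M)" using M by (simp add: exp_diff)
  also have "\<dots> \<le> exp (- (\<delta> * X / 4))"
  proof -
    have "?\<gamma> - ln M \<le> - (\<delta> * X / 4 * real T)" using M by (simp add: algebra_simps)
    also have "\<dots> \<le> - (\<delta> * X / 4 * 1)"
      using T X0 \<delta> by (intro le_imp_neg_le mult_left_mono) auto
    finally show ?thesis by simp
  qed
  also have "\<dots> \<le> \<delta> / 8" by fact
  finally have 1: "exp ?\<gamma> / M \<le> \<delta> / 8" .
  have "real T * R / ?\<gamma> = R / ((r - \<delta>/2) * X)" using T by simp
  also have "\<dots> \<le> ((r - \<delta>) * X + 16) / ((r - \<delta>/2) * X)"
    using R rd X0 by (intro divide_right_mono) auto
  also have "\<dots> \<le> ((r - \<delta>/2) * X - \<delta> / 4 * X) / ((r - \<delta>/2) * X)"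
    using X rd X0 by (intro divide_right_mono) (auto simp: algebra_simps)
  also have "\<dots> = 1 - (\<delta> / 4) / (r - \<delta>/2)"
    using rd X0 by (simp add: field_simps)
  also have "\<dots> \<le> 1 - (\<delta> / 4) / 1"
    using rd \<delta> by (intro diff_left_mono divide_left_mono) auto
  finally show "exp ?\<gamma> / M + real T * R / ?\<gamma> \<le> 1 - \<delta> / 8" using 1 \<delta>(1) by linarith
qed

text \<open>\<open>\<sigma>\<^sup>2\<close> is set to the largest total received power, so that the
  energy term stays bounded while \<open>2 * ln \<sigma>\<close> is \<open>ln \<rho>\<close> or
  \<open>\<beta> * ln \<rho>\<close> up to 1. The 8 covers this 1, 4 for the noise, 2 for the signal
  and \<open>ln 2\<close> for the patterns.\<close>

lemma cut_rate_le:
  assumes X: "\<rho> > 1" and \<beta>: "0 \<le> \<beta>" "\<beta> \<le> 1" and t: "0 \<le> t" "t \<le> 1"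
    and g: "0 \<le> gs" "0 \<le> gr" "b \<Longrightarrow> gs \<le> \<rho>" "\<not> b \<Longrightarrow> gr \<le> \<rho> powr \<beta>"
  defines "\<sigma> \<equiv> sqrt (1 + (if b then \<rho> else \<rho> powr \<beta>))"
  shows "cut_rate b 1 \<sigma> t gs gr \<le> (if b then t else (1 - t) * \<beta>) * ln \<rho> + 8"
proof -
  have l2: "ln 2 \<le> (1::real)" using ln_2_less_1 by simp
  have lnle: "ln (1 + \<rho> powr x) \<le> x * ln \<rho> + 1" if "0 \<le> x" for x
  proof -
    have p: "1 \<le> \<rho> powr x" using X that by (simp add: ge_one_powr_ge_zero)
    then have "ln (1 + \<rho> powr x) \<le> ln (2 * \<rho> powr x)" by (subst ln_le_cancel_iff) auto
    also have "\<dots> = ln 2 + x * ln \<rho>" using X by (simp add: ln_mult ln_powr)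
    finally show ?thesis using l2 by simp
  qed
  show "cut_rate b 1 \<sigma> t gs gr \<le> (if b then t else (1 - t) * \<beta>) * ln \<rho> + 8"
  proof (cases b)
    case True
    have s: "\<sigma>\<^sup>2 = 1 + \<rho>" "2 * ln \<sigma> = ln (1 + \<rho>)" using True X by (simp_all add: \<sigma>_def ln_sqrt)
    have "ln (1 + \<rho>) * t \<le> (ln \<rho> + 1) * t" using lnle[of 1] X t by (intro mult_right_mono) auto
    also have "\<dots> \<le> t * ln \<rho> + 1" using t by (simp add: algebra_simps)
    finally have "ln (1 + \<rho>) * t \<le> t * ln \<rho> + 1" .
    moreover have "2 * gs / (1 + \<rho>) \<le> 2" using g True X by (simp add: field_simps)
    ultimately show ?thesis using True by (simp add: cut_rate_def s)
  next
    case False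
    have s: "\<sigma>\<^sup>2 = 1 + \<rho> powr \<beta>" "2 * ln \<sigma> = ln (1 + \<rho> powr \<beta>)"
      using False X by (simp_all add: \<sigma>_def ln_sqrt add_pos_nonneg)
    have "ln (1 + \<rho> powr \<beta>) * (1 - t) \<le> (\<beta> * ln \<rho> + 1) * (1 - t)" using lnle[of \<beta>] \<beta> t by (intro mult_right_mono) auto
    also have "\<dots> \<le> (1 - t) * \<beta> * ln \<rho> + 1" using t by (simp add: algebra_simps)
    finally have "ln (1 + \<rho> powr \<beta>) * (1 - t) \<le> (1 - t) * \<beta> * ln \<rho> + 1" .
    moreover have "2 * gr / (1 + \<rho> powr \<beta>) \<le> 2"
      using g False X by (simp add: pos_divide_le_eq add_pos_nonneg)
    ultimately show ?thesis using False l2 by (simp add: cut_rate_def s)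
  qed
qed

lemma correct_given_outage:
  fixes b :: "relay \<Rightarrow> bool" and \<beta> :: "relay \<Rightarrow> real" and hs hr :: "relay \<Rightarrow> complex"
  assumes c: "valid_code c" and \<rho>: "\<rho> > 1" and \<delta>: "0 < \<delta>" "\<delta> \<le> r" "r \<le> 1"
    and rate: "(r - \<delta>/4) * ln \<rho> \<le> rate c"
    and X: "64 \<le> \<delta> * ln \<rho>" "exp (- (\<delta> * ln \<rho> / 4)) \<le> \<delta> / 8"
    and \<beta>: "\<And>i. 0 \<le> \<beta> i" "\<And>i. \<beta> i \<le> 1"
    and hs: "\<And>i. (cmod (hs i))\<^sup>2 \<le> 1" and hr: "\<And>i. (cmod (hr i))\<^sup>2 \<le> \<rho> powr (\<beta> i - 1)"
    and out: "(if b R1 then t R1 else (1 - t R1) * \<beta> R1) + (if b R2 then t R2 else (1 - t R2) * \<beta> R2) \<le> r - \<delta>"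
    and t: "\<And>i. t i = mean_listen \<rho> c i (hs i)"
  shows "correct_given \<rho> c hs hr \<le> ennreal (1 - \<delta> / 8)"
proof -
  define \<sigma> where "\<sigma> i = sqrt (1 + (if b i then \<rho> else \<rho> powr \<beta> i))" for i
  define R where "R i = cut_rate (b i) 1 (\<sigma> i) (mean_listen \<rho> c i (hs i)) ((cmod (hs i))\<^sup>2 * \<rho>) ((cmod (hr i))\<^sup>2 * \<rho>)" for i
  have hr': "(cmod (hr i))\<^sup>2 * \<rho> \<le> \<rho> powr \<beta> i" for i
  proof -
    have "(cmod (hr i))\<^sup>2 * \<rho> \<le> \<rho> powr (\<beta> i - 1) * \<rho>" using hr \<rho> by (intro mult_right_mono) auto
    also have "\<dots> = \<rho> powr \<beta> i" using \<rho> by (simp add: powr_diff)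
    finally show ?thesis .
  qed
  have hs': "(cmod (hs i))\<^sup>2 * \<rho> \<le> \<rho>" for i using hs[of i] \<rho> by (simp add: mult_left_le_one_le)
  have R: "R i \<le> (if b i then t i else (1 - t i) * \<beta> i) * ln \<rho> + 8" for i
    unfolding R_def \<sigma>_def t
    using \<rho> \<beta> mean_listen_sums(3,4)[OF c, of \<rho> i "hs i"] hs' hr'
    by (intro cut_rate_le) auto
  have s: "\<sigma> i \<ge> 1" for i using \<rho> by (simp add: \<sigma>_def)
  have R0: "0 \<le> R i" for i unfolding R_def
    using s \<rho> mean_listen_sums(3,4)[OF c, of \<rho> i "hs i"] by (intro cut_rate_nonneg[OF c]) auto
  have "R R1 + R R2 \<le> ((if b R1 then t R1 else (1 - t R1) * \<beta> R1) + (if b R2 then t R2 else (1 - t R2) * \<beta> R2)) * ln \<rho> + 16"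
    using R[of R1] R[of R2] by (simp add: distrib_right)
  also have "\<dots> \<le> (r - \<delta>) * ln \<rho> + 16" using out \<rho> by (intro add_right_mono mult_right_mono) auto
  finally have sumR: "R R1 + R R2 \<le> (r - \<delta>) * ln \<rho> + 16" .
  have T: "blen c \<ge> 1" using valid_codeD(1)[OF c] by simp
  have M: "real (msgs c) > 0" using valid_codeD(2)[OF c] by simp
  have "(r - \<delta>/4) * ln \<rho> * real (blen c) \<le> ln (real (msgs c))"
    using rate T by (simp add: rate_def pos_le_divide_eq)
  from outage_threshold[OF \<delta> T M this sumR _ X] R0
  obtain \<gamma> where \<gamma>: "\<gamma> > 0" "exp \<gamma> / real (msgs c) + real (blen c) * (R R1 + R R2) / \<gamma> \<le> 1 - \<delta> / 8"
    by (auto simp: add_nonneg_nonneg)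
  have "correct_given \<rho> c hs hr \<le> ennreal (exp \<gamma> / real (msgs c) + real (blen c) * (R R1 + R R2) / \<gamma>)"
    unfolding R_def using correct_given_cut_set[OF c \<gamma>(1), where \<rho>=\<rho> and a=1 and \<sigma>=\<sigma> and b=b and hs=hs and hr=hr] s \<rho> by simp
  also have "\<dots> \<le> ennreal (1 - \<delta> / 8)" using \<gamma>(2) by (rule ennreal_leI)
  finally show ?thesis .
qed

lemma fading_box:
  fixes x :: "relay \<Rightarrow> real"
  shows "{h. \<forall>i. (cmod (h i))\<^sup>2 \<le> x i} \<in> sets fading"
    and "(\<And>i. 0 \<le> x i) \<Longrightarrow> (\<And>i. x i \<le> 1) \<Longrightarrow>
      ennreal (x R1 * x R2 / 9) \<le> emeasure fading {h. \<forall>i. (cmod (h i))\<^sup>2 \<le> x i}"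
proof -
  let ?A = "\<lambda>i. {z::complex. (cmod z)\<^sup>2 \<le> x i}"
  have eq: "{h. \<forall>i. (cmod (h i))\<^sup>2 \<le> x i} = prod_emb UNIV (\<lambda>_. CN01) UNIV (Pi\<^sub>E UNIV ?A)"
    by (auto simp: prod_emb_def PiE_iff)
  show "{h. \<forall>i. (cmod (h i))\<^sup>2 \<le> x i} \<in> sets fading"
    unfolding eq fading_def by (intro sets_PiM_I) auto
  assume x: "\<And>i. 0 \<le> x i" "\<And>i. x i \<le> 1"
  have "emeasure fading {h. \<forall>i. (cmod (h i))\<^sup>2 \<le> x i} = (\<Prod>i\<in>UNIV. emeasure CN01 (?A i))"
    unfolding eq fading_def by (rule emeasure_PiM_emb) auto
  also have "\<dots> = emeasure CN01 (?A R1) * emeasure CN01 (?A R2)"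
    by (simp add: UNIV_relay)
  also have "\<dots> \<ge> ennreal (x R1 / 3) * ennreal (x R2 / 3)"
    using x by (intro mult_mono CN01_disc_ge) auto
  finally show "ennreal (x R1 * x R2 / 9) \<le> emeasure fading {h. \<forall>i. (cmod (h i))\<^sup>2 \<le> x i}"
    using x by (simp add: ennreal_mult'[symmetric])
qed

lemma diversity_le:
  assumes a: "achieves c r d" and K: "K > 0"
    and ev: "\<forall>\<^sub>F \<rho> in at_top. K * \<rho> powr (- e) \<le> err_prob \<rho> (c \<rho>)"
  shows "d \<le> e"
proof -
  have lim: "((\<lambda>\<rho>. ln (err_prob \<rho> (c \<rho>)) / ln \<rho>) \<longlongrightarrow> - d) at_top"
    using a by (simp add: achieves_def)
  have lim2: "((\<lambda>\<rho>::real. ln K / ln \<rho> - e) \<longlongrightarrow> 0 - e) at_top"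
    by (intro tendsto_diff tendsto_const tendsto_divide_0[OF tendsto_const] filterlim_at_top_imp_at_infinity ln_at_top)
  have "0 - e \<le> - d"
  proof (rule tendsto_le[OF _ lim lim2])
    show "\<forall>\<^sub>F \<rho> in at_top. ln K / ln \<rho> - e \<le> ln (err_prob \<rho> (c \<rho>)) / ln \<rho>"
      using ev eventually_gt_at_top[of 1]
    proof eventually_elim
      case (elim \<rho>)
      have "ln (K * \<rho> powr (- e)) \<le> ln (err_prob \<rho> (c \<rho>))"
        using elim K by (subst ln_le_cancel_iff) (auto intro: less_le_trans[of 0 "K * \<rho> powr (- e)"])
      then have "ln K - e * ln \<rho> \<le> ln (err_prob \<rho> (c \<rho>))"
        using elim K by (simp add: ln_mult ln_powr)
      then have "(ln K - e * ln \<rho>) / ln \<rho> \<le> ln (err_prob \<rho> (c \<rho>)) / ln \<rho>"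
        using elim by (intro divide_right_mono) auto
      then show ?case using elim by (simp add: diff_divide_distrib)
    qed
  qed simp
  then show ?thesis by simp
qed

lemma eventually_snr_large:
  assumes "\<delta> > (0::real)"
  shows "\<forall>\<^sub>F \<rho> in at_top. \<rho> > 1 \<and> 64 \<le> \<delta> * ln \<rho> \<and> exp (- (\<delta> * ln \<rho> / 4)) \<le> \<delta> / 8"
proof -
  have "\<forall>\<^sub>F \<rho> in at_top. max (64 / \<delta>) (4 * (- ln (\<delta> / 8)) / \<delta>) \<le> ln (\<rho>::real)"
    using ln_at_top[unfolded filterlim_at_top] by blast
  with eventually_gt_at_top[of "1::real"] show ?thesis
  proof eventually_elim
    case (elim \<rho>)
    then have 1: "64 / \<delta> \<le> ln \<rho>" "4 * (- ln (\<delta> / 8)) / \<delta> \<le> ln \<rho>" by auto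
    have "4 * (- ln (\<delta> / 8)) \<le> ln \<rho> * \<delta>" using 1(2) assms by (simp only: pos_divide_le_eq)
    then have "- (\<delta> * ln \<rho> / 4) \<le> ln (\<delta> / 8)" by (simp add: mult.commute)
    then have "exp (- (\<delta> * ln \<rho> / 4)) \<le> exp (ln (\<delta> / 8))" by simp
    then show ?case using 1 assms elim by (simp add: pos_divide_le_eq mult.commute)
  qed
qed

text \<open>\<open>achieves\<close> without the conditions on the error probability. Lower bounds on
  the error are proved under this hypothesis, so that they apply to the constructed codes before
  their error is known to be positive.\<close>

definition admissible :: "(real \<Rightarrow> code) \<Rightarrow> real \<Rightarrow> bool" where
  "admissible c r \<longleftrightarrow> (\<forall>\<rho>. valid_code (c \<rho>)) \<and> ((\<lambda>\<rho>. rate (c \<rho>) / ln \<rho>) \<longlongrightarrow> r) at_top \<and>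
     (\<exists>R0>0. \<forall>\<^sub>F \<rho> in at_top. R0 \<le> rate (c \<rho>))"

lemma achieves_admissible: "achieves c r d \<Longrightarrow> admissible c r"
  by (simp add: achieves_def admissible_def)

lemma eventually_rate:
  assumes "admissible c r" "\<delta> > 0"
  shows "\<forall>\<^sub>F \<rho> in at_top. (r - \<delta>) * ln \<rho> \<le> rate (c \<rho>)"
proof -
  have "\<forall>\<^sub>F \<rho> in at_top. r - \<delta> < rate (c \<rho>) / ln \<rho>"
    using assms by (intro order_tendstoD(1)[of _ r]) (auto simp: admissible_def)
  with eventually_gt_at_top[of "1::real"] show ?thesis
    by eventually_elim (simp add: pos_less_divide_eq)
qed

lemma err_prob_outage:
  assumes a: "admissible c r" and r: "0 < r" "r \<le> 1" and \<delta>: "0 < \<delta>" "\<delta> < 1/4" "\<delta> \<le> r"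
  shows "\<forall>\<^sub>F \<rho> in at_top. (\<delta> / 648) * \<rho> powr (- (dmt_curve r + 6 * \<delta>)) \<le> err_prob \<rho> (c \<rho>)"
proof -
  have "\<forall>\<^sub>F \<rho> in at_top. (r - \<delta> / 4) * ln \<rho> \<le> rate (c \<rho>)"
    using \<delta> by (intro eventually_rate[OF a]) simp
  with eventually_snr_large[OF \<delta>(1)] show ?thesis
  proof eventually_elim
  case (elim \<rho>)
  then have \<rho>: "\<rho> > 1" by simp
  have c: "valid_code (c \<rho>)" using a by (simp add: admissible_def)
  define t where "t hs i = mean_listen \<rho> (c \<rho>) i (hs i)" for hs :: "relay \<Rightarrow> complex" and i
  let ?P = "\<lambda>hs b \<beta>. (\<forall>i. 0 \<le> \<beta> i \<and> \<beta> i \<le> 1) \<and>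
    (if b R1 then t hs R1 else (1 - t hs R1) * \<beta> R1) + (if b R2 then t hs R2 else (1 - t hs R2) * \<beta> R2) \<le> r - \<delta> \<and>
    (1 - \<beta> R1) + (1 - \<beta> R2) \<le> dmt_curve r + 6 * \<delta>"
  have "\<exists>b \<beta>. ?P hs b \<beta>" for hs
    using mean_listen_sums(3,4)[OF c] by (intro choose_cut \<delta> r) (auto simp: t_def)
  \<comment> \<open>The cuts and the fades are functions of \<open>hs\<close>, chosen after the
    listening fractions are known.\<close>
  then obtain b \<beta> where P: "\<And>hs. ?P hs (b hs) (\<beta> hs)" by metis
  define H where "H hs = {h. \<forall>i. (cmod (h i))\<^sup>2 \<le> \<rho> powr (\<beta> hs i - 1)}" for hs
  let ?G = "{h. \<forall>i::relay. (cmod (h i))\<^sup>2 \<le> 1}"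
  \<comment> \<open>The factors stand for the error given the outage, for source-relay gains at most
    1, and for the fade; their constants give \<open>\<delta> / 648\<close>.\<close>
  have "\<delta> / 8 * (1 / 9) * (\<rho> powr (- (dmt_curve r + 6 * \<delta>)) / 9) \<le> err_prob \<rho> (c \<rho>)"
  proof (rule err_prob_ge[OF c, where G="?G" and H=H])
    show "?G \<in> sets fading" "ennreal (1 / 9) \<le> emeasure fading ?G"
      using fading_box[of "\<lambda>_. 1"] by simp_all
    fix hs :: "relay \<Rightarrow> complex" assume hs: "hs \<in> ?G"
    show "H hs \<in> sets fading" unfolding H_def by (rule fading_box)
    have "ennreal (\<rho> powr (- (dmt_curve r + 6 * \<delta>)) / 9) \<le> ennreal (\<rho> powr (\<beta> hs R1 - 1) * \<rho> powr (\<beta> hs R2 - 1) / 9)"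
      using P[of hs] \<rho> by (intro ennreal_leI divide_right_mono) (auto simp: powr_add[symmetric])
    also have "\<dots> \<le> emeasure fading (H hs)"
      unfolding H_def using P[of hs] \<rho> powr_mono[of "\<beta> hs _ - 1" 0 \<rho>] by (intro fading_box(2)) auto
    finally show "ennreal (\<rho> powr (- (dmt_curve r + 6 * \<delta>)) / 9) \<le> emeasure fading (H hs)" .
    fix hr :: "relay \<Rightarrow> complex" assume hr: "hr \<in> H hs"
    show "correct_given \<rho> (c \<rho>) hs hr \<le> ennreal (1 - \<delta> / 8)"
      by (rule correct_given_outage[OF c \<rho> \<delta>(1,3) r(2), where b="b hs" and \<beta>="\<beta> hs" and t="t hs"])
        (use elim P[of hs] hs hr in \<open>auto simp: H_def t_def\<close>)
  qed (use \<delta> \<rho> in auto)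
  then show ?case by simp
  qed
qed

text \<open>With gain 0 the rate may be bounded, so costs of order 1 per slot, such as
  \<open>ln 2\<close> for the patterns, are too large. Both paths are cut at the source with
  \<open>\<sigma> = 1\<close>, where listening costs nothing, and the source-relay channels are
  faded to the small received SNR \<open>x\<^sup>2\<close>; the probability of this is of order
  \<open>\<rho> powr (- 2)\<close>.\<close>

lemma err_prob_no_rate:
  assumes a: "admissible c 0"
  shows "\<exists>K>0. \<forall>\<^sub>F \<rho> in at_top. K * \<rho> powr (- 2) \<le> err_prob \<rho> (c \<rho>)"
proof -
  from a obtain R0 where R0: "R0 > 0" "\<forall>\<^sub>F \<rho> in at_top. R0 \<le> rate (c \<rho>)"
    by (auto simp: admissible_def)
  \<comment> \<open>The cost per slot will be at most \<open>6 * x\<close> on each path, and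
    \<open>12 * x \<le> R0 / 20\<close>.\<close>
  define x where "x = min 1 (R0 / 240)"
  have x: "0 < x" "x \<le> 1" "240 * x \<le> R0" using R0(1) by (auto simp: x_def)
  have "\<forall>\<^sub>F \<rho> in at_top. (3 / 20 * (x ^ 4 / 9)) * \<rho> powr (- 2) \<le> err_prob \<rho> (c \<rho>)"
    using R0(2) eventually_gt_at_top[of 1]
  proof eventually_elim
    case (elim \<rho>)
    have c: "valid_code (c \<rho>)" using a by (simp add: admissible_def)
    let ?G = "{h. \<forall>i::relay. (cmod (h i))\<^sup>2 \<le> x\<^sup>2 / \<rho>}"
    let ?M = "real (msgs (c \<rho>))" and ?T = "real (blen (c \<rho>))"
    have T: "?T \<ge> 1" using valid_codeD(1)[OF c] by simp
    have lnM: "R0 * ?T \<le> ln ?M" using elim(1) T by (simp add: rate_def pos_le_divide_eq)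
    then have "ln ?M > 0" using R0(1) T by (smt (verit) mult_pos_pos)
    then have M: "?M \<ge> 2" using valid_codeD(2)[OF c] by (cases "msgs (c \<rho>) = 1") auto
    \<comment> \<open>Makes \<open>exp \<gamma>\<close> three quarters of the number of messages; as
      there are at least two messages and \<open>(4/3)\<^sup>2 \<le> 2\<close>, at least half of
      \<open>ln ?M\<close> is kept.\<close>
    define \<gamma> where "\<gamma> = ln ?M - ln (4/3)"
    have "2 * ln (4/3) = ln ((4/3)\<^sup>2 :: real)" by (simp add: ln_realpow)
    also have "\<dots> \<le> ln ?M" using M by (subst ln_le_cancel_iff) (auto simp: power2_eq_square)
    finally have \<gamma>: "ln ?M / 2 \<le> \<gamma>" by (simp add: \<gamma>_def)
    have "\<gamma> > 0" using \<gamma> \<open>ln ?M > 0\<close> by simp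
    have "3 / 20 * (x ^ 4 * \<rho> powr (- 2) / 9) * 1 \<le> err_prob \<rho> (c \<rho>)"
    proof (rule err_prob_ge[OF c, where G="?G" and H="\<lambda>_. UNIV"])
      show "?G \<in> sets fading" by (rule fading_box)
      have "x\<^sup>2 \<le> 1" using x by (simp add: power_le_one)
      have "x ^ 4 * \<rho> powr (- 2) = (x\<^sup>2 / \<rho>) * (x\<^sup>2 / \<rho>)"
        using elim by (simp add: powr_minus powr_numeral power2_eq_square field_simps power4_eq_xxxx)
      moreover have "x\<^sup>2 / \<rho> \<le> 1" using elim \<open>x\<^sup>2 \<le> 1\<close> by (simp add: field_simps)
      ultimately show "ennreal (x ^ 4 * \<rho> powr (- 2) / 9) \<le> emeasure fading ?G"
        using fading_box(2)[of "\<lambda>_. x\<^sup>2 / \<rho>"] elim by simp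
      show "ennreal 1 \<le> emeasure fading UNIV"
        using prob_space.emeasure_space_1[OF prob_space_fading] by simp
      show "UNIV \<in> sets fading" using sets.top[of fading] by simp
      fix hs hr :: "relay \<Rightarrow> complex" assume hs: "hs \<in> ?G"
      let ?R = "\<lambda>i. cut_rate True x 1 (mean_listen \<rho> (c \<rho>) i (hs i)) ((cmod (hs i))\<^sup>2 * \<rho>) ((cmod (hr i))\<^sup>2 * \<rho>)"
      have R: "?R i \<le> 6 * x" for i
      proof -
        have "(cmod (hs i))\<^sup>2 * \<rho> \<le> x\<^sup>2" using hs elim by (simp add: pos_le_divide_eq)
        then have "(1 + 1 / x) * ((cmod (hs i))\<^sup>2 * \<rho>) \<le> (1 + 1 / x) * x\<^sup>2"
          using x by (intro mult_left_mono) auto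
        also have "\<dots> = x\<^sup>2 + x" using x by (simp add: field_simps power2_eq_square)
        also have "\<dots> \<le> 2 * x" using x by (simp add: power2_eq_square)
        finally show ?thesis by (simp add: cut_rate_def)
      qed
      have "correct_given \<rho> (c \<rho>) hs hr \<le> ennreal (exp \<gamma> / ?M + ?T * (?R R1 + ?R R2) / \<gamma>)"
        using correct_given_cut_set[OF c \<open>\<gamma> > 0\<close>, where \<rho>=\<rho> and a=x and \<sigma>="\<lambda>_. 1" and b="\<lambda>_. True" and hs=hs and hr=hr] x elim by simp
      also have "\<dots> \<le> ennreal (1 - 3 / 20)"
      proof (rule ennreal_leI)
        have "exp \<gamma> / ?M = 3 / 4" using M by (simp add: \<gamma>_def exp_diff)
        moreover have "?T * (?R R1 + ?R R2) / \<gamma> \<le> 1 / 10"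
        proof -
          have "?T * (?R R1 + ?R R2) \<le> ?T * (12 * x)" using R[of R1] R[of R2] T by (intro mult_left_mono) auto
          also have "\<dots> \<le> ?T * (R0 / 20)" using x T by (intro mult_left_mono) auto
          also have "\<dots> \<le> \<gamma> / 10" using lnM \<gamma> by (simp add: mult.commute)
          finally show ?thesis using \<open>\<gamma> > 0\<close> by (simp add: pos_divide_le_eq)
        qed
        ultimately show "exp \<gamma> / ?M + ?T * (?R R1 + ?R R2) / \<gamma> \<le> 1 - 3 / 20" by linarith
      qed
      finally show "correct_given \<rho> (c \<rho>) hs hr \<le> ennreal (1 - 3 / 20)" .
    qed (use x in auto)
    then show ?case by simp
  qed
  moreover have "0 < 3 / 20 * (x ^ 4 / 9)" using x by simp
  ultimately show ?thesis by blast
qed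

lemma err_prob_lower:
  assumes a: "admissible c r" and r: "0 \<le> r" "r \<le> 1" and e: "e > 0"
  shows "\<exists>K>0. \<forall>\<^sub>F \<rho> in at_top. K * \<rho> powr (- (dmt_curve r + e)) \<le> err_prob \<rho> (c \<rho>)"
proof (cases "r = 0")
  case True
  with a obtain K where K: "K > 0" "\<forall>\<^sub>F \<rho> in at_top. K * \<rho> powr (- 2) \<le> err_prob \<rho> (c \<rho>)"
    using err_prob_no_rate by blast
  have "\<forall>\<^sub>F \<rho> in at_top. K * \<rho> powr (- (dmt_curve r + e)) \<le> err_prob \<rho> (c \<rho>)"
    using K(2) eventually_gt_at_top[of 1]
  proof eventually_elim
    case (elim \<rho>)
    have "\<rho> powr (- (dmt_curve r + e)) \<le> \<rho> powr (- 2)"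
      using elim e True by (intro powr_mono) (auto simp: dmt_curve_def)
    then have "K * \<rho> powr (- (dmt_curve r + e)) \<le> K * \<rho> powr (- 2)"
      using K(1) by (intro mult_left_mono) auto
    then show ?case using elim by linarith
  qed
  then show ?thesis using K(1) by blast
next
  case False
  define \<delta> where "\<delta> = min (min (1/5) r) (e / 6)"
  have \<delta>: "0 < \<delta>" "\<delta> < 1/4" "\<delta> \<le> r" "6 * \<delta> \<le> e" using e r False by (auto simp: \<delta>_def)
  have r0: "0 < r" using r False by simp
  have "\<forall>\<^sub>F \<rho> in at_top. (\<delta> / 648) * \<rho> powr (- (dmt_curve r + e)) \<le> err_prob \<rho> (c \<rho>)"
    using err_prob_outage[OF a r0 r(2) \<delta>(1-3)] eventually_gt_at_top[of 1]
  proof eventually_elim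
    case (elim \<rho>)
    have "\<rho> powr (- (dmt_curve r + e)) \<le> \<rho> powr (- (dmt_curve r + 6 * \<delta>))"
      using elim \<delta> by (intro powr_mono) auto
    then have "(\<delta> / 648) * \<rho> powr (- (dmt_curve r + e)) \<le> (\<delta> / 648) * \<rho> powr (- (dmt_curve r + 6 * \<delta>))"
      using \<delta> by (intro mult_left_mono) auto
    then show ?case using elim by linarith
  qed
  then show ?thesis using \<delta> by (intro exI[of _ "\<delta> / 648"]) auto
qed

theorem dmt_converse:
  assumes a: "achieves c r d" and r: "0 \<le> r" "r \<le> 1"
  shows "d \<le> dmt_curve r"
proof (rule field_le_epsilon)
  fix e :: real assume e: "e > 0"
  from err_prob_lower[OF achieves_admissible[OF a] r e] diversity_le[OF a]
  show "d \<le> dmt_curve r + e" by blast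
qed

section \<open>Decode-and-forward\<close>

lemma mean_listen_ge:
  assumes c: "valid_code c" and x: "0 \<le> x"
    and ge: "\<And>w u v z. x * real (blen c) \<le> listen_count \<rho> c i w u v h z"
  shows "x \<le> mean_listen \<rho> c i h"
proof -
  interpret U: prob_space "cseed c" by (rule valid_codeD[OF c])
  interpret V: prob_space "rseeds c" by (rule space_seeds[OF c])
  interpret UV: pair_prob_space "cseed c" "rseeds c" ..
  interpret cn: prob_space cnM by simp
  let ?n = "real (msgs c) * real (blen c)"
  have n: "?n > 0" using valid_codeD(1,2)[OF c] by simp
  have "ennreal (?n * x) = (\<Sum>w<msgs c. \<integral>\<^sup>+p. \<integral>\<^sup>+z. ennreal (x * real (blen c)) \<partial>cnM \<partial>(cseed c \<Otimes>\<^sub>M rseeds c))"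
    using x by (simp add: cn.emeasure_space_1[simplified] UV.emeasure_space_1 ennreal_mult ennreal_of_nat_eq_real_of_nat mult_ac)
  also have "\<dots> \<le> (\<Sum>w<msgs c. \<integral>\<^sup>+p. \<integral>\<^sup>+z. ennreal (listen_count \<rho> c i w (fst p) (snd p i) h z) \<partial>cnM \<partial>(cseed c \<Otimes>\<^sub>M rseeds c))"
    by (intro sum_mono nn_integral_mono ennreal_leI ge)
  also have "\<dots> = ennreal (?n * mean_listen \<rho> c i h)" by (rule mean_listen_sums(1)[OF c])
  finally have "?n * x \<le> ?n * mean_listen \<rho> c i h"
    using n mean_listen_sums(3)[OF c, of \<rho> i h] by simp
  then show ?thesis using n by (rule mult_left_le_imp_le)
qed

text \<open>A weaker channel makes DDF wait longer; listening to the whole block when the relay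
  never transmits fits this because \<open>r / a \<le> 1\<close>.\<close>

lemma ddf_slots_ge:
  assumes \<rho>: "\<rho> > 1" and r: "0 \<le> r" "r \<le> a" "0 < a" and h: "(cmod h)\<^sup>2 \<le> \<rho> powr (a - 1)"
  shows "r / a * real T \<le> real (ddf_slots \<rho> r T h)"
proof -
  define \<alpha> where "\<alpha> = ln ((cmod h)\<^sup>2 * \<rho>) / ln \<rho>"
  have ra: "r / a * real T \<le> 1 * real T" using r by (intro mult_right_mono) auto
  show ?thesis
  proof (cases "0 < \<alpha> \<and> r / \<alpha> \<le> 1")
    case True
    then have "h \<noteq> 0" by (auto simp: \<alpha>_def)
    have "(cmod h)\<^sup>2 * \<rho> \<le> \<rho> powr (a - 1) * \<rho>" using h \<rho> by (intro mult_right_mono) auto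
    also have "\<dots> = \<rho> powr a" using \<rho> by (simp add: powr_diff)
    finally have "ln ((cmod h)\<^sup>2 * \<rho>) \<le> ln (\<rho> powr a)"
      using \<open>h \<noteq> 0\<close> \<rho> by (subst ln_le_cancel_iff) auto
    then have "\<alpha> \<le> a" using \<rho> by (simp add: \<alpha>_def ln_powr pos_divide_le_eq)
    then have "r / a * real T \<le> r / \<alpha> * real T"
      using True r by (intro mult_right_mono divide_left_mono) auto
    also have "\<dots> \<le> real (nat \<lceil>r / \<alpha> * real T\<rceil>)" by (rule real_nat_ceiling_ge)
    also have "\<dots> = real (ddf_slots \<rho> r T h)"
      using True by (simp add: ddf_slots_def \<alpha>_def Let_def)
    finally show ?thesis .
  next
    case False
    then have "ddf_slots \<rho> r T h = T" by (auto simp: ddf_slots_def \<alpha>_def Let_def)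
    then show ?thesis using ra by simp
  qed
qed

lemma ddf_mean_listen:
  assumes c: "valid_code c" and d: "ddf_relay \<rho> r M i c"
    and \<rho>: "\<rho> > 1" and r: "0 \<le> r" "r \<le> a" "0 < a" and h: "(cmod h)\<^sup>2 \<le> \<rho> powr (a - 1)"
  shows "r / a \<le> mean_listen \<rho> c i h"
proof (rule mean_listen_ge[OF c])
  show "0 \<le> r / a" using r by simp
  fix w u v z
  let ?n = "ddf_slots \<rho> r (blen c) h"
  have L: "listens c i h u v k y \<longleftrightarrow> k < ?n" for k y
    using d unfolding ddf_relay_def Let_def by blast
  have "listen_count \<rho> c i w u v h z = real (card {k. k < blen c \<and> k < ?n})"
    unfolding listen_count_def relay_listens_def L by (simp add: sum.If_cases Int_def)
  also have "{k. k < blen c \<and> k < ?n} = {..<min (blen c) ?n}" by auto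
  finally have eq: "listen_count \<rho> c i w u v h z = min (real (blen c)) (real ?n)" by simp
  have "r / a * real (blen c) \<le> 1 * real (blen c)" using r by (intro mult_right_mono) auto
  then show "r / a * real (blen c) \<le> listen_count \<rho> c i w u v h z"
    unfolding eq using ddf_slots_ge[OF \<rho> r h, of "blen c"] by simp
qed

text \<open>The schedule alone forces the outage, however well the relays decode: with both
  source-relay exponents at most \<open>\<alpha>\<close> each relay waits for the fraction
  \<open>r / \<alpha>\<close>, and the remaining fractions, at most
  \<open>2 * (1 - r / \<alpha>)\<close> in total, cannot carry \<open>r\<close> even over second
  hops of exponent 1.\<close>

lemma ddf_diversity:
  assumes a: "achieves c r d" and ddf: "ddf r c" and r: "0 < r" "r \<le> 1"
    and \<alpha>: "r < \<alpha>" "\<alpha> \<le> 1" "2 * (1 - r / \<alpha>) < r"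
  shows "d \<le> 2 * (1 - \<alpha>)"
proof -
  define \<delta> where "\<delta> = r - 2 * (1 - r / \<alpha>)"
  have "r / \<alpha> \<le> 1" using \<alpha> r by simp
  then have \<delta>: "0 < \<delta>" "\<delta> \<le> r" using \<alpha> by (auto simp: \<delta>_def)
  have "\<forall>\<^sub>F \<rho> in at_top. (r - \<delta> / 4) * ln \<rho> \<le> rate (c \<rho>)"
    using \<delta> by (intro eventually_rate[OF achieves_admissible[OF a]]) simp
  with eventually_snr_large[OF \<delta>(1)]
  have "\<forall>\<^sub>F \<rho> in at_top. (\<delta> / 648) * \<rho> powr (- (2 * (1 - \<alpha>))) \<le> err_prob \<rho> (c \<rho>)"
  proof eventually_elim
    case (elim \<rho>)
    then have \<rho>: "\<rho> > 1" by simp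
    have c: "valid_code (c \<rho>)" using a by (simp add: achieves_def)
    let ?x = "\<rho> powr (\<alpha> - 1)"
    have x: "0 \<le> ?x" "?x \<le> 1" using \<rho> \<alpha> powr_mono[of "\<alpha> - 1" 0 \<rho>] by auto
    let ?G = "{h. \<forall>i::relay. (cmod (h i))\<^sup>2 \<le> ?x}" and ?H = "{h. \<forall>i::relay. (cmod (h i))\<^sup>2 \<le> 1}"
    have "\<delta> / 8 * (?x * ?x / 9) * (1 / 9) \<le> err_prob \<rho> (c \<rho>)"
    proof (rule err_prob_ge[OF c, where G="?G" and H="\<lambda>_. ?H"])
      show "?G \<in> sets fading" "ennreal (?x * ?x / 9) \<le> emeasure fading ?G"
        using fading_box[of "\<lambda>_. ?x"] x by simp_all
      show "?H \<in> sets fading" "ennreal (1 / 9) \<le> emeasure fading ?H"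
        using fading_box[of "\<lambda>_. 1"] by simp_all
      fix hs hr :: "relay \<Rightarrow> complex" assume h: "hs \<in> ?G" "hr \<in> ?H"
      have t: "r / \<alpha> \<le> mean_listen \<rho> (c \<rho>) i (hs i)" for i
        by (rule ddf_mean_listen[OF c, where M="msgs (c \<rho>)"]) (use ddf \<rho> r \<alpha> h in \<open>auto simp: ddf_def\<close>)
      show "correct_given \<rho> (c \<rho>) hs hr \<le> ennreal (1 - \<delta> / 8)"
      proof (rule correct_given_outage[OF c \<rho> \<delta> r(2), where b="\<lambda>_. False" and \<beta>="\<lambda>_. 1"
            and t="\<lambda>i. mean_listen \<rho> (c \<rho>) i (hs i)"])
        show "(if False then mean_listen \<rho> (c \<rho>) R1 (hs R1) else (1 - mean_listen \<rho> (c \<rho>) R1 (hs R1)) * 1) +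
          (if False then mean_listen \<rho> (c \<rho>) R2 (hs R2) else (1 - mean_listen \<rho> (c \<rho>) R2 (hs R2)) * 1) \<le> r - \<delta>"
          using t[of R1] t[of R2] by (simp add: \<delta>_def)
        show "(cmod (hs i))\<^sup>2 \<le> 1" for i using h(1)[THEN CollectD, THEN spec, of i] x(2) by linarith
      qed (use elim h \<rho> in auto)
    qed (use \<delta> x r in auto)
    moreover have "?x * ?x = \<rho> powr (- (2 * (1 - \<alpha>)))" by (simp add: powr_add[symmetric])
    ultimately show ?case by simp
  qed
  then show ?thesis using diversity_le[OF a, of "\<delta> / 648"] \<delta> by simp
qed

text \<open>Failure of one stream is enough. With stream 2 revealed, path 2 carries a constant
  signal and costs nothing, so stream 1 of gain \<open>r / 2\<close> has to pass through relay 1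
  alone; a fade of one coefficient, of exponent \<open>1 - \<alpha>\<close>, prevents this.\<close>

lemma split_ddf_diversity:
  assumes a: "achieves c r d" and ddf: "split_ddf r c" and r: "0 < r" "r \<le> 1"
    and \<alpha>: "r / 2 < \<alpha>" "\<alpha> \<le> 1" "1 - (r / 2) / \<alpha> < r / 2"
  shows "d \<le> 1 - \<alpha>"
proof -
  define \<delta> where "\<delta> = r / 2 - (1 - (r / 2) / \<alpha>)"
  have ra: "(r / 2) / \<alpha> \<le> 1" using \<alpha> r by simp
  then have \<delta>: "0 < \<delta>" "\<delta> \<le> r / 2" using \<alpha> by (auto simp: \<delta>_def)
  from ddf obtain M where
    M: "\<forall>i. ((\<lambda>\<rho>. ln (real (M \<rho> i)) / real (blen (c \<rho>)) / ln \<rho>) \<longlongrightarrow> r / 2) at_top" and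
    M': "\<forall>\<rho>>1. msgs (c \<rho>) = M \<rho> R1 * M \<rho> R2 \<and>
       (\<forall>i. (\<forall>u k. \<forall>w<msgs (c \<rho>). \<forall>w'<msgs (c \<rho>).
           stream (M \<rho> R2) i w = stream (M \<rho> R2) i w' \<longrightarrow> enc (c \<rho>) i u w k = enc (c \<rho>) i u w' k) \<and>
         ddf_relay \<rho> (r / 2) (M \<rho> i) i (c \<rho>))"
    unfolding split_ddf_def by (elim exE conjE)
  have "\<forall>\<^sub>F \<rho> in at_top. r / 2 - \<delta> / 4 < ln (real (M \<rho> R1)) / real (blen (c \<rho>)) / ln \<rho>"
    using \<delta> by (intro order_tendstoD(1)[OF M[rule_format]]) simp
  with eventually_snr_large[OF \<delta>(1)]
  have "\<forall>\<^sub>F \<rho> in at_top. (\<delta> / 648) * \<rho> powr (- (1 - \<alpha>)) \<le> err_prob \<rho> (c \<rho>)"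
  proof eventually_elim
    case (elim \<rho>)
    then have \<rho>: "\<rho> > 1" by simp
    have c: "valid_code (c \<rho>)" using a by (simp add: achieves_def)
    let ?M1 = "M \<rho> R1" and ?M2 = "M \<rho> R2"
    have msgs: "msgs (c \<rho>) = ?M1 * ?M2" using M' \<rho> by blast
    have pos: "?M1 > 0" "?M2 > 0" using valid_codeD(2)[OF c] msgs by auto
    have T: "blen (c \<rho>) \<ge> 1" using valid_codeD(1)[OF c] by simp
    have rate: "(r / 2 - \<delta>/4) * ln \<rho> * real (blen (c \<rho>)) \<le> ln (real ?M1)"
      using elim T \<rho> by (simp add: pos_less_divide_eq mult_ac)
    let ?x = "\<rho> powr (\<alpha> - 1)"
    have x: "0 \<le> ?x" "?x \<le> 1" using \<rho> \<alpha> powr_mono[of "\<alpha> - 1" 0 \<rho>] by auto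
    let ?G = "{h. \<forall>i::relay. (cmod (h i))\<^sup>2 \<le> case_relay ?x 1 i}" and ?H = "{h. \<forall>i::relay. (cmod (h i))\<^sup>2 \<le> 1}"
    have "\<delta> / 8 * (?x / 9) * (1 / 9) \<le> err_prob \<rho> (c \<rho>)"
    proof (rule err_prob_ge[OF c, where G="?G" and H="\<lambda>_. ?H"])
      show "?G \<in> sets fading" by (rule fading_box)
      show "ennreal (?x / 9) \<le> emeasure fading ?G"
        using fading_box(2)[of "case_relay ?x 1"] x by (simp split: relay.split)
      show "?H \<in> sets fading" "ennreal (1 / 9) \<le> emeasure fading ?H"
        using fading_box[of "\<lambda>_. 1"] by simp_all
      fix hs hr :: "relay \<Rightarrow> complex" assume h: "hs \<in> ?G" "hr \<in> ?H"
      have h1: "(cmod (hs R1))\<^sup>2 \<le> ?x" "(cmod (hr R1))\<^sup>2 \<le> 1"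
        using h(1)[THEN CollectD, THEN spec, of R1] h(2) by auto
      let ?t = "mean_listen \<rho> (c \<rho>) R1 (hs R1)"
      have t: "(r / 2) / \<alpha> \<le> ?t"
        using r \<alpha> h1 M' \<rho> by (intro ddf_mean_listen[OF c _ \<rho>, where M="M \<rho> R1"]) auto
      define \<sigma> where "\<sigma> = sqrt (1 + (if False then \<rho> else \<rho> powr 1))"
      have s: "\<sigma> \<ge> 1" using \<rho> by (simp add: \<sigma>_def)
      define R where "R = cut_rate False 1 \<sigma> ?t ((cmod (hs R1))\<^sup>2 * \<rho>) ((cmod (hr R1))\<^sup>2 * \<rho>)"
      have "R \<le> (if False then ?t else (1 - ?t) * 1) * ln \<rho> + 8"
        unfolding R_def \<sigma>_def using \<rho> mean_listen_sums(3,4)[OF c] h1(2)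
        by (intro cut_rate_le) (auto intro: mult_left_le_one_le)
      also have "\<dots> \<le> (r / 2 - \<delta>) * ln \<rho> + 8"
        using t \<rho> by (simp add: \<delta>_def mult_right_mono)
      finally have R: "R \<le> (r / 2 - \<delta>) * ln \<rho> + 16" by simp
      have R0: "0 \<le> R" unfolding R_def
        using s \<rho> mean_listen_sums(3,4)[OF c] by (intro cut_rate_nonneg[OF c]) auto
      have "real ?M1 > 0" using pos by simp
      from outage_threshold[OF \<delta> _ T this rate R R0] elim r
      obtain \<gamma> where \<gamma>: "\<gamma> > 0" "exp \<gamma> / real ?M1 + real (blen (c \<rho>)) * R / \<gamma> \<le> 1 - \<delta> / 8"
        by auto
      have "correct_given \<rho> (c \<rho>) hs hr \<le> ennreal (real ?M2 * exp \<gamma> / real (msgs (c \<rho>)) +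
          real (blen (c \<rho>)) * (case_relay R 0 R1 + case_relay R 0 R2) / \<gamma>)"
      proof (rule correct_given_le[OF c \<gamma>(1), where \<phi>="\<lambda>w. w div ?M2" and \<psi>="\<lambda>w. w mod ?M2" and R="case_relay R 0"
            and K="\<lambda>i w p. case i of R1 \<Rightarrow> cut_cost False 1 \<sigma> \<rho> (c \<rho>) R1 w (fst p) (snd p R1) (hs R1) (hr R1) | R2 \<Rightarrow> 0"])
        show "w mod ?M2 < ?M2" for w using pos by simp
        \<comment> \<open>Quotient and remainder determine the message; given stream 2, only the
          quotient, which is stream 1, is left to decode.\<close>
        show "inj_on (\<lambda>w. w div ?M2) {w. w < msgs (c \<rho>) \<and> w mod ?M2 = j}" for j
          by (rule inj_onI) (metis (mono_tags, lifting) div_mult_mod_eq mem_Collect_eq)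
        show "cuttable \<rho> (c \<rho>) i u (v i) (hs i) (hr i) {w. w < msgs (c \<rho>) \<and> w mod ?M2 = j}
          (\<lambda>w. case i of R1 \<Rightarrow> cut_cost False 1 \<sigma> \<rho> (c \<rho>) R1 w (fst (u, v)) (snd (u, v) R1) (hs R1) (hr R1) | R2 \<Rightarrow> 0)" for i u v j
        proof (cases i)
          case R1
          then show ?thesis using cuttable_cut_cost[OF c, of \<rho> 1 \<sigma> "{w. w < msgs (c \<rho>) \<and> w mod ?M2 = j}" R1 u "v R1" "hs R1" "hr R1" False] s \<rho>
            by auto
        next
          case R2
          have "cuttable \<rho> (c \<rho>) R2 u (v R2) (hs R2) (hr R2) {w. w < msgs (c \<rho>) \<and> w mod ?M2 = j} (\<lambda>_. 0)"
            by (rule cuttable_const[OF c]) (use M' \<rho> in \<open>auto simp del: stream.simps simp: stream.simps(2)[symmetric]\<close>)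
          then show ?thesis using R2 by simp
        qed
        show "(\<lambda>p. case i of R1 \<Rightarrow> cut_cost False 1 \<sigma> \<rho> (c \<rho>) R1 w (fst p) (snd p R1) (hs R1) (hr R1) | R2 \<Rightarrow> 0)
          \<in> borel_measurable (cseed (c \<rho>) \<Otimes>\<^sub>M rseeds (c \<rho>))" for i w
          by (cases i) (simp_all add: cut_cost_measurable[OF c])
        show "(\<Sum>w<msgs (c \<rho>). \<integral>\<^sup>+p. (case i of R1 \<Rightarrow> cut_cost False 1 \<sigma> \<rho> (c \<rho>) R1 w (fst p) (snd p R1) (hs R1) (hr R1) | R2 \<Rightarrow> 0)
            \<partial>(cseed (c \<rho>) \<Otimes>\<^sub>M rseeds (c \<rho>))) \<le> ennreal (real (msgs (c \<rho>)) * real (blen (c \<rho>)) * case_relay R 0 i)" for i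
          using s \<rho> by (cases i) (simp_all add: sum_cut_cost[OF c] R_def)
        show "0 \<le> case_relay R 0 i" for i using R0 by (simp split: relay.split)
      qed
      also have "real ?M2 * exp \<gamma> / real (msgs (c \<rho>)) + real (blen (c \<rho>)) * (case_relay R 0 R1 + case_relay R 0 R2) / \<gamma>
          = exp \<gamma> / real ?M1 + real (blen (c \<rho>)) * R / \<gamma>"
        using pos by (simp add: msgs)
      also have "ennreal \<dots> \<le> ennreal (1 - \<delta> / 8)" using \<gamma>(2) by (rule ennreal_leI)
      finally show "correct_given \<rho> (c \<rho>) hs hr \<le> ennreal (1 - \<delta> / 8)" .
    qed (use \<delta> r x in auto)
    then show ?case by simp
  qed
  then show ?thesis using diversity_le[OF a, of "\<delta> / 648"] \<delta> by simp
qed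

text \<open>For \<open>r < 1/2\<close> this is \<open>r / (1 - r) \<le> 2 * r\<close>. It is enough
  to separate DDF from the line \<open>2 * (1 - r)\<close> in both regimes.\<close>

lemma dmt_curve_ge: "0 \<le> r \<Longrightarrow> 2 * (1 - r) \<le> dmt_curve r"
proof (cases "r < 1/2")
  case True
  assume "0 \<le> r"
  have "r / (1 - r) \<le> 2 * r"
  proof -
    have "r * 1 \<le> r * (2 * (1 - r))" using True \<open>0 \<le> r\<close> by (intro mult_left_mono) auto
    then show ?thesis using True by (simp add: pos_divide_le_eq algebra_simps)
  qed
  then show ?thesis using True by (simp add: dmt_curve_def)
qed (simp add: dmt_curve_def)

lemma dmt_over_less:
  assumes "\<And>c d. P c \<Longrightarrow> achieves c r d \<Longrightarrow> d \<le> e" "e < dmt_curve r"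
  shows "dmt_over P r < ereal (dmt_curve r)"
proof -
  have "dmt_over P r \<le> ereal e"
    unfolding dmt_over_def using assms(1) by (intro Sup_least) auto
  also have "\<dots> < ereal (dmt_curve r)" using assms(2) by simp
  finally show ?thesis .
qed

text \<open>An outage occurs for \<open>r < \<alpha> < 2 * r / (2 - r)\<close> with
  \<open>\<alpha> \<le> 1\<close>, and \<open>\<alpha> > r\<close> puts the exponent
  \<open>2 * (1 - \<alpha>)\<close> strictly below the line. The interval is nonempty because
  \<open>r > 0\<close>.\<close>

theorem ddf_suboptimal:
  assumes r: "0 < r" "r < 1"
  shows "dmt_over (ddf r) r < ereal (dmt_curve r)"
proof -
  define m where "m = min 1 (2 * r / (2 - r))"
  define \<alpha> where "\<alpha> = (r + m) / 2"
  have "r < 2 * r / (2 - r)" using r by (simp add: pos_less_divide_eq)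
  then have "r < m" "m \<le> 1" "m \<le> 2 * r / (2 - r)" using r by (simp_all add: m_def)
  note m = this
  have "r < \<alpha>" "\<alpha> < m" using m(1) by (simp_all add: \<alpha>_def)
  then have \<alpha>: "r < \<alpha>" "\<alpha> < 1" "\<alpha> < 2 * r / (2 - r)" using m by simp_all
  have "\<alpha> * (2 - r) < 2 * r" using \<alpha>(3) r by (simp add: pos_less_divide_eq)
  then have "2 * (1 - r / \<alpha>) < r" using \<alpha>(1) r by (simp add: field_simps)
  then show ?thesis
    using ddf_diversity[of _ r _ \<alpha>] \<alpha> r dmt_curve_ge[of r]
    by (intro dmt_over_less[of _ _ "2 * (1 - \<alpha>)"]) auto
qed

text \<open>Falling below the line requires \<open>\<alpha> > 2 * r - 1\<close>, an outage requires
  \<open>\<alpha> < r / (2 - r)\<close>; the square \<open>2 * (r - 1)\<^sup>2\<close> shows that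
  these are compatible for \<open>r < 1\<close>.\<close>

theorem split_ddf_suboptimal:
  assumes r: "0 < r" "r < 1"
  shows "dmt_over (split_ddf r) r < ereal (dmt_curve r)"
proof -
  define l where "l = max (2 * r - 1) (r / 2)"
  define q where "q = r / (2 - r)"
  define \<alpha> where "\<alpha> = (l + q) / 2"
  have "(2 * r - 1) * (2 - r) < r"
  proof -
    have "r - (2 * r - 1) * (2 - r) = 2 * (r - 1)\<^sup>2" by (simp add: power2_eq_square algebra_simps)
    also have "\<dots> > 0" using r by simp
    finally show ?thesis by simp
  qed
  then have "l < q" using r by (auto simp: l_def q_def pos_less_divide_eq)
  then have "l < \<alpha>" "\<alpha> < q" by (simp_all add: \<alpha>_def)
  moreover have "2 * r - 1 \<le> l" "r / 2 \<le> l" by (simp_all add: l_def)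
  ultimately have \<alpha>: "2 * r - 1 < \<alpha>" "r / 2 < \<alpha>" "\<alpha> < r / (2 - r)" by (simp_all add: q_def)
  have "r / (2 - r) \<le> 1" using r by simp
  then have \<alpha>1: "\<alpha> \<le> 1" using \<alpha> by simp
  have "\<alpha> * (2 - r) < r" using \<alpha>(3) r by (simp add: pos_less_divide_eq)
  then have "1 - (r / 2) / \<alpha> < r / 2" using \<alpha>(2) r by (simp add: field_simps)
  then show ?thesis
    using split_ddf_diversity[of _ r _ \<alpha>] \<alpha> \<alpha>1 r dmt_curve_ge[of r]
    by (intro dmt_over_less[of _ _ "1 - \<alpha>"]) auto
qed

section \<open>A random quantize-map-forward code\<close>

text \<open>Bounded symbols rather than Gaussian ones, because \<open>valid_code\<close> imposes the
  power constraint on every single block.\<close>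

definition disc :: "complex measure" where
  "disc = uniform_measure lborel (cball 0 1)"

abbreviation discM :: "cseq measure" where
  "discM \<equiv> Pi\<^sub>M UNIV (\<lambda>_. disc)"

lemma sets_disc [simp, measurable_cong]: "sets disc = sets borel"
  and space_disc [simp]: "space disc = UNIV"
  by (simp_all add: disc_def)

lemma prob_space_disc [simp]: "prob_space disc"
  unfolding disc_def
proof (rule prob_space_uniform_measure)
  have "emeasure lborel (cball (0::complex) 1) = ennreal pi"
    using emeasure_lborel_disc[of 1 0] by simp
  then show "emeasure lborel (cball (0::complex) 1) \<noteq> 0" "emeasure lborel (cball (0::complex) 1) \<noteq> \<infinity>"
    by (simp_all add: less_imp_neq[OF pi_gt_zero, symmetric])
qed

lemma sets_discM [simp, measurable_cong]: "sets discM = sets seqM"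
  unfolding seqM_def by (rule sets_PiM_cong) simp_all

lemma space_discM [simp]: "space discM = UNIV"
  by (simp add: space_PiM)

lemma prob_space_discM [simp]: "prob_space discM"
  by (intro prob_space_PiM) simp

text \<open>Symbols outside the unit disc have probability 0 under \<open>disc\<close>, but
  \<open>valid_code\<close> quantifies over all seeds; clipping makes the power bound hold
  surely.\<close>

definition clip :: "complex \<Rightarrow> complex" where
  "clip z = (if cmod z \<le> 1 then z else 0)"

lemma cmod_clip [simp]: "cmod (clip z) \<le> 1"
  by (simp add: clip_def)

lemma measurable_clip [measurable]: "clip \<in> borel_measurable borel"
  unfolding clip_def by measurable

text \<open>Unit squares of the integer grid, represented by their lower left corner. The squared
  error is at most 2 whatever the SNR, which gives the distortion \<open>\<Delta> = 2\<close> of the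
  scheme.\<close>

definition cell :: "complex \<Rightarrow> int \<times> int" where
  "cell z = (\<lfloor>Re z\<rfloor>, \<lfloor>Im z\<rfloor>)"

definition center :: "int \<times> int \<Rightarrow> complex" where
  "center p = Complex (real_of_int (fst p)) (real_of_int (snd p))"

lemma center_cell: "(cmod (z - center (cell z)))\<^sup>2 \<le> 2"
proof -
  have "\<bar>frac (Re z)\<bar> \<le> 1" "\<bar>frac (Im z)\<bar> \<le> 1"
    using frac_lt_1[of "Re z"] frac_lt_1[of "Im z"] frac_ge_0[of "Re z"] frac_ge_0[of "Im z"] by linarith+
  then have "(frac (Re z))\<^sup>2 \<le> 1" "(frac (Im z))\<^sup>2 \<le> 1"
    by (simp_all add: abs_square_le_1)
  then show ?thesis by (simp add: cmod_power2 center_def cell_def frac_def)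
qed

definition cells :: "nat \<Rightarrow> cseq \<Rightarrow> (int \<times> int) list" where
  "cells n y = map (\<lambda>k. cell (y k)) [0..<n]"

lemma length_cells [simp]: "length (cells n y) = n"
  by (simp add: cells_def)

lemma nth_cells [simp]: "k < n \<Longrightarrow> cells n y ! k = cell (y k)"
  by (simp add: cells_def)

lemma cells_prefix [simp]: "cells n (prefix n y) = cells n y"
  by (simp add: cells_def prefix_def)

lemma measurable_cell [measurable]: "cell \<in> borel \<rightarrow>\<^sub>M count_space UNIV"
proof -
  have 1: "(\<lambda>z::complex. \<lfloor>Re z\<rfloor>) \<in> borel \<rightarrow>\<^sub>M count_space UNIV" "(\<lambda>z::complex. \<lfloor>Im z\<rfloor>) \<in> borel \<rightarrow>\<^sub>M count_space UNIV"
    by (rule measurable_compose[OF _ measurable_real_floor]; simp)+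
  have "(\<lambda>z. (a, \<lfloor>Im z\<rfloor>)) \<in> borel \<rightarrow>\<^sub>M count_space UNIV" for a :: int
    by (rule measurable_compose[OF 1(2)]) simp
  then show ?thesis unfolding cell_def
    by (rule measurable_compose_countable[OF _ 1(1)])
qed

lemma measurable_cells [measurable]: "cells n \<in> seqM \<rightarrow>\<^sub>M count_space UNIV"
proof (induction n)
  case 0
  then show ?case by (simp add: cells_def)
next
  case (Suc n)
  have y: "(\<lambda>y. cell (y n)) \<in> seqM \<rightarrow>\<^sub>M count_space UNIV"
    by (rule measurable_compose[OF measurable_seqM_apply measurable_cell])
  have "(\<lambda>y. l @ [cell (y n)]) \<in> seqM \<rightarrow>\<^sub>M count_space UNIV" for l
    by (rule measurable_compose[OF y]) simp
  then have "(\<lambda>y. cells n y @ [cell (y n)]) \<in> seqM \<rightarrow>\<^sub>M count_space UNIV"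
    by (rule measurable_compose_countable[OF _ Suc])
  then show ?case by (simp add: cells_def)
qed

text \<open>One seed sequence contains all codebooks. The tags \<open>Inl\<close> and
  \<open>Inr\<close> put relay and source symbols on disjoint coordinates, from which their
  independence follows by resampling.\<close>

definition cb_idx :: "relay \<times> nat \<times> nat \<times> nat \<Rightarrow> nat" where
  "cb_idx a = to_nat (Inl a :: (relay \<times> nat \<times> nat \<times> nat) + (relay \<times> nat \<times> nat))"

definition src_idx :: "relay \<times> nat \<times> nat \<Rightarrow> nat" where
  "src_idx a = to_nat (Inr a :: (relay \<times> nat \<times> nat \<times> nat) + (relay \<times> nat \<times> nat))"

lemma idx_eq [simp]: "cb_idx a = cb_idx b \<longleftrightarrow> a = b" "src_idx a' = src_idx b' \<longleftrightarrow> a' = b'"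
  "cb_idx a \<noteq> src_idx b'" "src_idx b' \<noteq> cb_idx a"
  by (simp_all add: cb_idx_def src_idx_def)

definition code_cb :: "relay \<Rightarrow> nat \<Rightarrow> nat \<Rightarrow> nat \<Rightarrow> cseq \<Rightarrow> complex" where
  "code_cb i n j k u = clip (u (cb_idx (i, n, j, k)))"

definition code_src :: "relay \<Rightarrow> cseq \<Rightarrow> nat \<Rightarrow> nat \<Rightarrow> complex" where
  "code_src i u w k = clip (u (src_idx (i, w, k)))"

lemma measurable_code_cb [measurable (raw)]:
  "u \<in> M \<rightarrow>\<^sub>M seqM \<Longrightarrow> (\<lambda>x. code_cb i n j k (u x)) \<in> borel_measurable M"
  unfolding code_cb_def by (rule measurable_compose[OF measurable_seqM_component measurable_clip])

lemma measurable_code_src [measurable (raw)]: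
  "u \<in> M \<rightarrow>\<^sub>M seqM \<Longrightarrow> (\<lambda>x. code_src i (u x) w k) \<in> borel_measurable M"
  unfolding code_src_def by (rule measurable_compose[OF measurable_seqM_component measurable_clip])

text \<open>
  The decoder looks for a message such that, on both paths, some quantization index is compatible
  up to the noise level with the source codeword and with the block received from the relay.
\<close>

definition consistent :: "real \<Rightarrow> real \<Rightarrow> nat \<Rightarrow> nat \<Rightarrow> relay \<Rightarrow> nat \<Rightarrow> complex \<Rightarrow> complex \<Rightarrow> cseq \<Rightarrow> cseq \<Rightarrow> bool" where
  "consistent \<rho> \<kappa> T n i w hs hr u y \<longleftrightarrow> (\<exists>l. length l = n \<and>
     (\<forall>k<n. cmod (center (l ! k) - hs * of_real (sqrt \<rho>) * code_src i u w k) \<le> \<kappa> + 2) \<and>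
     (\<forall>k<T. n \<le> k \<longrightarrow> cmod (y k - hr * of_real (sqrt \<rho>) * code_cb i n (to_nat l) k u) \<le> \<kappa>))"

definition listen_slots :: "nat \<Rightarrow> (relay \<Rightarrow> complex \<Rightarrow> real) \<Rightarrow> relay \<Rightarrow> complex \<Rightarrow> nat" where
  "listen_slots T t i h = nat \<lfloor>t i h * real T\<rfloor>"

text \<open>The quantization index is the whole list of grid squares, encoded by
  \<open>to_nat\<close>. There are countably many codewords per relay, so no quantization rate has
  to be fixed in advance. The decision 0 when no message is consistent is an arbitrary
  default.\<close>

definition qmf_scheme :: "real \<Rightarrow> real \<Rightarrow> (relay \<Rightarrow> complex \<Rightarrow> real) \<Rightarrow> nat \<Rightarrow> nat \<Rightarrow> code" where
  "qmf_scheme \<rho> \<kappa> t T M = \<lparr>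
     blen = T, msgs = M, cseed = discM, rseed = \<lambda>_. discM,
     enc = code_src,
     listens = \<lambda>i h u v k y. k < listen_slots T t i h,
     tx = \<lambda>i h u v k y. code_cb i (listen_slots T t i h) (to_nat (cells (listen_slots T t i h) y)) k u,
     dec = \<lambda>hs hr u y.
       (if \<exists>w<M. \<forall>i. consistent \<rho> \<kappa> T (listen_slots T t i (hs i)) i w (hs i) (hr i) u (y i)
        then LEAST w. w < M \<and> (\<forall>i. consistent \<rho> \<kappa> T (listen_slots T t i (hs i)) i w (hs i) (hr i) u (y i))
        else 0) \<rparr>"

lemma qmf_scheme_sel [simp]:
  "blen (qmf_scheme \<rho> \<kappa> t T M) = T" "msgs (qmf_scheme \<rho> \<kappa> t T M) = M"
  "cseed (qmf_scheme \<rho> \<kappa> t T M) = discM" "rseed (qmf_scheme \<rho> \<kappa> t T M) = (\<lambda>_. discM)"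
  "enc (qmf_scheme \<rho> \<kappa> t T M) = code_src"
  "listens (qmf_scheme \<rho> \<kappa> t T M) i h u v k y \<longleftrightarrow> k < listen_slots T t i h"
  "tx (qmf_scheme \<rho> \<kappa> t T M) i h u v k y =
     code_cb i (listen_slots T t i h) (to_nat (cells (listen_slots T t i h) y)) k u"
  by (simp_all add: qmf_scheme_def)

lemma measurable_listen_slots:
  assumes "t i \<in> borel_measurable borel"
  shows "listen_slots T t i \<in> borel \<rightarrow>\<^sub>M count_space UNIV"
  unfolding listen_slots_def
proof (rule measurable_compose[of _ _ "count_space UNIV" nat])
  show "(\<lambda>h. \<lfloor>t i h * real T\<rfloor>) \<in> borel \<rightarrow>\<^sub>M count_space UNIV"
    by (rule measurable_compose[OF _ measurable_real_floor]) (use assms in simp)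
qed simp

lemma measurable_consistent:
  assumes [measurable]: "hs \<in> borel_measurable M" "hr \<in> borel_measurable M" "u \<in> M \<rightarrow>\<^sub>M seqM" "y \<in> M \<rightarrow>\<^sub>M seqM"
  shows "Measurable.pred M (\<lambda>x. consistent \<rho> \<kappa> T n i w (hs x) (hr x) (u x) (y x))"
proof -
  have [measurable]: "(\<lambda>x. y x k) \<in> borel_measurable M" for k
    by (rule measurable_seqM_component) simp
  show ?thesis unfolding consistent_def by measurable
qed

lemma all_relay: "(\<forall>i. P i) \<longleftrightarrow> P R1 \<and> P R2"
  by (metis relay.exhaust)

lemma valid_qmf_scheme:
  assumes T: "T > 0" and M: "M > 0" and t: "\<And>i. t i \<in> borel_measurable borel"
  shows "valid_code (qmf_scheme \<rho> \<kappa> t T M)"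
  unfolding valid_code_def Let_def qmf_scheme_sel
proof (intro conjI allI impI)
  let ?N = "borel \<Otimes>\<^sub>M seqM \<Otimes>\<^sub>M seqM \<Otimes>\<^sub>M seqM :: (complex \<times> cseq \<times> cseq \<times> cseq) measure"
  have N: "(\<lambda>x. listen_slots T t i (fst x)) \<in> ?N \<rightarrow>\<^sub>M count_space UNIV" for i
    by (rule measurable_compose[OF measurable_fst measurable_listen_slots[where t=t, OF t]])
  show "(\<lambda>(h, u, v, y). k < listen_slots T t i h) \<in> ?N \<rightarrow>\<^sub>M count_space UNIV" for i k
    unfolding case_prod_unfold by (rule measurable_compose[OF N]) simp
  have y: "(\<lambda>x. snd (snd (snd x))) \<in> ?N \<rightarrow>\<^sub>M seqM" and u: "(\<lambda>x. fst (snd x)) \<in> ?N \<rightarrow>\<^sub>M seqM" by measurable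
  \<comment> \<open>The index ranges over countably many lists, so measurability reduces to a fixed
    list.\<close>
  have cb: "(\<lambda>x. code_cb i n (to_nat (cells n (snd (snd (snd x))))) k (fst (snd x))) \<in> borel_measurable ?N" for i n k
  proof (rule measurable_compose_countable[where f="\<lambda>l x. code_cb i n (to_nat l) k (fst (snd x))"])
    show "(\<lambda>x. code_cb i n (to_nat l) k (fst (snd x))) \<in> borel_measurable ?N" for l :: "(int \<times> int) list"
      by (rule measurable_code_cb[OF u])
    show "(\<lambda>x. cells n (snd (snd (snd x)))) \<in> ?N \<rightarrow>\<^sub>M count_space UNIV"
      by (rule measurable_compose[OF y measurable_cells])
  qed
  show "(\<lambda>(h, u, v, y). code_cb i (listen_slots T t i h) (to_nat (cells (listen_slots T t i h) y)) k u)
      \<in> borel_measurable ?N" for i k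
    unfolding case_prod_unfold
    by (rule measurable_compose_countable[OF cb N])
  show "(\<lambda>u. code_src i u w k) \<in> borel_measurable seqM" for i w k
    by (rule measurable_code_src) simp
  let ?D = "Pi\<^sub>M UNIV (\<lambda>_. borel) \<Otimes>\<^sub>M Pi\<^sub>M UNIV (\<lambda>_. borel) \<Otimes>\<^sub>M seqM \<Otimes>\<^sub>M Pi\<^sub>M UNIV (\<lambda>_. seqM)
     :: ((relay \<Rightarrow> complex) \<times> (relay \<Rightarrow> complex) \<times> cseq \<times> (relay \<Rightarrow> cseq)) measure"
  have proj: "(\<lambda>x. fst x) \<in> ?D \<rightarrow>\<^sub>M Pi\<^sub>M UNIV (\<lambda>_. borel)" "(\<lambda>x. fst (snd x)) \<in> ?D \<rightarrow>\<^sub>M Pi\<^sub>M UNIV (\<lambda>_. borel)"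
    "(\<lambda>x. fst (snd (snd x))) \<in> ?D \<rightarrow>\<^sub>M seqM" "(\<lambda>x. snd (snd (snd x))) \<in> ?D \<rightarrow>\<^sub>M Pi\<^sub>M UNIV (\<lambda>_. seqM)"
    by measurable
  have comp: "(\<lambda>x. fst x i) \<in> borel_measurable ?D" "(\<lambda>x. fst (snd x) i) \<in> borel_measurable ?D"
    "(\<lambda>x. fst (snd (snd x))) \<in> ?D \<rightarrow>\<^sub>M seqM" "(\<lambda>x. snd (snd (snd x)) i) \<in> ?D \<rightarrow>\<^sub>M seqM" for i
    by (rule proj(1,2,4)[THEN measurable_PiM_UNIV_component] proj(3))+
  have cons[measurable]: "Measurable.pred ?D (\<lambda>x. consistent \<rho> \<kappa> T (listen_slots T t i (fst x i)) i w (fst x i) (fst (snd x) i)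
      (fst (snd (snd x))) (snd (snd (snd x)) i))" for i w
    by (rule measurable_compose_countable[where f="\<lambda>n x. consistent \<rho> \<kappa> T n i w (fst x i) (fst (snd x) i)
      (fst (snd (snd x))) (snd (snd (snd x)) i)"])
      (rule measurable_consistent comp measurable_compose[OF comp(1) measurable_listen_slots[where t=t, OF t]])+
  have "(\<lambda>x. dec (qmf_scheme \<rho> \<kappa> t T M) (fst x) (fst (snd x)) (fst (snd (snd x))) (snd (snd (snd x)))) \<in> ?D \<rightarrow>\<^sub>M count_space UNIV"
    unfolding qmf_scheme_def by (simp add: all_relay)
  then show "(\<lambda>(hs, hr, u, y). dec (qmf_scheme \<rho> \<kappa> t T M) hs hr u y) \<in> ?D \<rightarrow>\<^sub>M count_space UNIV"
    by (simp add: case_prod_unfold)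
  have pow: "(\<Sum>k\<in>A. (cmod (f k))\<^sup>2) \<le> real T" if "A \<subseteq> {..<T}" "\<And>k. cmod (f k) \<le> 1" for A and f :: "nat \<Rightarrow> complex"
  proof -
    have "(\<Sum>k\<in>A. (cmod (f k))\<^sup>2) \<le> (\<Sum>k\<in>A. 1)" using that(2) by (intro sum_mono) (simp add: power_le_one)
    also have "\<dots> \<le> real T" using card_mono[OF finite_lessThan that(1)] by simp
    finally show ?thesis .
  qed
  show "(\<Sum>k<T. (cmod (code_src i u w k))\<^sup>2) \<le> real T" for i u w
    by (rule pow) (simp_all add: code_src_def)
  fix i h u v s
  show "(\<Sum>k | k < T \<and> \<not> k < listen_slots T t i h. (cmod (code_cb i (listen_slots T t i h)
      (to_nat (cells (listen_slots T t i h) (relay_rx (\<lambda>k y. k < listen_slots T t i h) s k))) k u))\<^sup>2) \<le> real T"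
    by (rule pow) (auto simp: code_cb_def)
qed (use T M in simp_all)

text \<open>\<open>A\<close> reads only coordinates in \<open>J\<close> and \<open>B\<close> only
  those outside; resampling \<open>J\<close> separates the two events.\<close>

lemma resample_indep:
  assumes A: "Measurable.pred discM A" and B: "Measurable.pred discM B"
    and inA: "\<And>u u'. A (\<lambda>s. if s \<in> J then u' s else u s) = A u'"
    and inB: "\<And>u u'. B (\<lambda>s. if s \<in> J then u' s else u s) = B u"
  shows "emeasure discM {u. A u \<and> B u} = emeasure discM {u. A u} * emeasure discM {u. B u}"
proof -
  have sA: "{u. A u} \<in> sets discM" and sB: "{u. B u} \<in> sets discM"
    using A B by (simp_all add: pred_def)
  then have sAB: "{u. A u \<and> B u} \<in> sets discM" by (simp add: Collect_conj_eq sets.Int)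
  have "emeasure discM {u. A u \<and> B u} = (\<integral>\<^sup>+u. indicator {u. A u \<and> B u} u \<partial>discM)"
    using sAB by simp
  also have "\<dots> = (\<integral>\<^sup>+u. \<integral>\<^sup>+u'. indicator {u. A u \<and> B u} (\<lambda>s. if s \<in> J then u' s else u s) \<partial>discM \<partial>discM)"
    using sAB by (intro nn_integral_PiM_resample) simp_all
  also have "\<dots> = (\<integral>\<^sup>+u. indicator {u. B u} u * (\<integral>\<^sup>+u'. indicator {u. A u} u' \<partial>discM) \<partial>discM)"
    using sA by (intro nn_integral_cong, subst nn_integral_cmult[symmetric])
      (auto intro!: nn_integral_cong simp: inA inB indicator_def)
  also have "\<dots> = emeasure discM {u. A u} * emeasure discM {u. B u}"
    using sA sB by (simp add: nn_integral_multc mult.commute)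
  finally show ?thesis .
qed

lemma qmf_code_qmf_scheme:
  "qmf_code 2 t (qmf_scheme \<rho> \<kappa> t T M)"
  unfolding qmf_code_def qmf_scheme_sel
proof (intro exI conjI)
  interpret P: prob_space discM by simp
  define rc where "rc = (\<lambda>(i::relay) (n::nat) j k. let l = from_nat j :: (int \<times> int) list in if k < length l then center (l ! k) else 0)"
  show "\<forall>(i::relay) n. (\<lambda>y. to_nat (cells n y)) \<in> seqM \<rightarrow>\<^sub>M count_space UNIV"
    by (intro allI measurable_compose[OF measurable_cells]) simp
  show "\<forall>(i::relay) n y. (\<Sum>k<n. (cmod (y k - rc i n (to_nat (cells n (prefix n y))) k))\<^sup>2) \<le> 2 * real n"
  proof (intro allI)
    fix i :: relay and n and y :: cseq
    have "(\<Sum>k<n. (cmod (y k - rc i n (to_nat (cells n (prefix n y))) k))\<^sup>2) \<le> (\<Sum>k<n. 2)"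
      by (rule sum_mono) (simp add: rc_def center_cell)
    then show "(\<Sum>k<n. (cmod (y k - rc i n (to_nat (cells n (prefix n y))) k))\<^sup>2) \<le> 2 * real n" by simp
  qed
  have "P.indep_vars (\<lambda>_. disc) (\<lambda>a u. u (cb_idx a)) UNIV"
  proof (subst P.indep_vars_iff_distr_eq_PiM)
    show "P.random_variable disc (\<lambda>u. u (cb_idx a))" for a by simp
    have "distr discM disc (\<lambda>u. u (cb_idx a)) = disc" for a
      by (rule distr_PiM_component) simp_all
    moreover have "distr discM (Pi\<^sub>M UNIV (\<lambda>_. disc)) (\<lambda>u. \<lambda>a\<in>UNIV. u (cb_idx a)) = Pi\<^sub>M UNIV (\<lambda>_. disc)"
      by (rule distr_PiM_reindex) (auto simp: inj_on_def)
    ultimately show "distr discM (Pi\<^sub>M UNIV (\<lambda>_. disc)) (\<lambda>u. \<lambda>a\<in>UNIV. u (cb_idx a)) =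
        Pi\<^sub>M UNIV (\<lambda>a. distr discM disc (\<lambda>u. u (cb_idx a)))" by simp
  qed simp
  then have "P.indep_vars (\<lambda>_. borel) (\<lambda>a u. clip (u (cb_idx a))) UNIV"
    by (rule P.indep_vars_compose2) simp
  then show "P.indep_vars (\<lambda>_. borel) (\<lambda>(i, n, j, k). code_cb i n j k) UNIV"
    by (simp add: code_cb_def[abs_def] case_prod_unfold)
  show "\<forall>i n j k. distr discM borel (code_cb i n j k) = distr disc borel clip"
  proof (intro allI)
    fix i n j k
    have "distr discM borel (code_cb i n j k) = distr (distr discM disc (\<lambda>u. u (cb_idx (i, n, j, k)))) borel clip"
      by (subst distr_distr) (simp_all add: code_cb_def[abs_def] comp_def)
    also have "distr discM disc (\<lambda>u. u (cb_idx (i, n, j, k))) = disc"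
      by (rule distr_PiM_component) simp_all
    finally show "distr discM borel (code_cb i n j k) = distr disc borel clip" .
  qed
  let ?F = "\<lambda>u (i, n, j, k). code_cb i n j k u" and ?G = "\<lambda>u (i, w, k). code_src i u w k"
  have F: "?F \<in> discM \<rightarrow>\<^sub>M Pi\<^sub>M UNIV (\<lambda>_. borel)"
    by (rule measurable_PiM_single') (auto simp: space_PiM case_prod_unfold intro!: measurable_code_cb)
  have G: "?G \<in> discM \<rightarrow>\<^sub>M Pi\<^sub>M UNIV (\<lambda>_. borel)"
    by (rule measurable_PiM_single') (auto simp: space_PiM case_prod_unfold intro!: measurable_code_src)
  show "P.indep_set (sets (vimage_algebra (space discM) ?F (Pi\<^sub>M UNIV (\<lambda>_. borel))))
     (sets (vimage_algebra (space discM) ?G (Pi\<^sub>M UNIV (\<lambda>_. borel))))"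
    unfolding P.indep_sets2_eq
  proof (intro conjI ballI subsetI)
    fix a assume "a \<in> sets (vimage_algebra (space discM) ?F (Pi\<^sub>M UNIV (\<lambda>_. borel)))"
    then obtain S where S: "S \<in> sets (Pi\<^sub>M UNIV (\<lambda>_. borel))" "a = ?F -` S \<inter> space discM"
      by (subst (asm) sets_vimage_algebra2) (auto simp: space_PiM)
    show ea: "a \<in> P.events" unfolding S(2) by (rule measurable_sets[OF F S(1)])
    fix b assume "b \<in> sets (vimage_algebra (space discM) ?G (Pi\<^sub>M UNIV (\<lambda>_. borel)))"
    then obtain S' where S': "S' \<in> sets (Pi\<^sub>M UNIV (\<lambda>_. borel))" "b = ?G -` S' \<inter> space discM"
      by (subst (asm) sets_vimage_algebra2) (auto simp: space_PiM)
    have eb: "b \<in> P.events" unfolding S'(2) by (rule measurable_sets[OF G S'(1)])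
    have "emeasure discM {u. ?F u \<in> S \<and> ?G u \<in> S'} = emeasure discM {u. ?F u \<in> S} * emeasure discM {u. ?G u \<in> S'}"
    \<comment> \<open>The relay codebooks read only coordinates in this range, the source codebook
      none of them.\<close>
    proof (rule resample_indep[where J="range cb_idx"])
      show "Measurable.pred discM (\<lambda>u. ?F u \<in> S)" "Measurable.pred discM (\<lambda>u. ?G u \<in> S')"
        using ea eb unfolding S(2) S'(2) by (simp_all add: pred_def vimage_def)
    qed (simp_all add: code_cb_def code_src_def image_iff)
    then have "emeasure discM (a \<inter> b) = emeasure discM a * emeasure discM b"
      unfolding S(2) S'(2) by (simp add: vimage_def Collect_conj_eq)
    then show "P.prob (a \<inter> b) = P.prob a * P.prob b"
      by (simp add: P.emeasure_eq_measure ennreal_mult'[symmetric])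
  next
    fix b assume "b \<in> sets (vimage_algebra (space discM) ?G (Pi\<^sub>M UNIV (\<lambda>_. borel)))"
    then obtain S' where S': "S' \<in> sets (Pi\<^sub>M UNIV (\<lambda>_. borel))" "b = ?G -` S' \<inter> space discM"
      by (subst (asm) sets_vimage_algebra2) (auto simp: space_PiM)
    show "b \<in> P.events" unfolding S'(2) by (rule measurable_sets[OF G S'(1)])
  qed
  show "\<forall>i h u v k y. let n = nat \<lfloor>t i h * real T\<rfloor> in
     (k < listen_slots T t i h \<longleftrightarrow> k < n) \<and>
     (n \<le> k \<longrightarrow> code_cb i (listen_slots T t i h) (to_nat (cells (listen_slots T t i h) y)) k u =
        code_cb i n (to_nat (cells n (prefix n y))) k u)"
    by (simp add: listen_slots_def)
qed

section \<open>Random coding\<close>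

text \<open>The share of a disc of radius \<open>cmod g\<close> that a disc of radius
  \<open>r\<close> can cover. It bounds the probability that a random symbol, seen through the gain
  \<open>g\<close>, comes within distance \<open>r\<close> of a fixed target.\<close>

definition hit_prob :: "real \<Rightarrow> complex \<Rightarrow> real" where
  "hit_prob r g = (if cmod g \<le> r then 1 else (r / cmod g)\<^sup>2)"

lemma hit_prob_nonneg [simp]: "0 \<le> hit_prob r g"
  by (simp add: hit_prob_def)

lemma disc_hit:
  assumes r: "r \<ge> 0"
  shows "emeasure disc {x. cmod (a - g * clip x) \<le> r} \<le> ennreal (hit_prob r g)"
proof (cases "cmod g \<le> r")
  case True
  then show ?thesis
    using prob_space.emeasure_le_1[OF prob_space_disc] by (simp add: hit_prob_def)
next
  case False
  then have g: "cmod g > r" "g \<noteq> 0" using r by auto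
  have v: "emeasure lborel (cball (0::complex) 1) = ennreal pi" using emeasure_lborel_disc[of 1 0] by simp
  have sub: "cball 0 1 \<inter> {x. cmod (a - g * clip x) \<le> r} \<subseteq> cball (a / g) (r / cmod g)"
  proof
    fix x assume "x \<in> cball 0 1 \<inter> {x. cmod (a - g * clip x) \<le> r}"
    then have x: "clip x = x" "cmod (a - g * x) \<le> r" by (auto simp: clip_def)
    have "a / g - x = (a - g * x) / g" using g by (simp add: field_simps)
    then have "cmod (a / g - x) = cmod (a - g * x) / cmod g" by (simp add: norm_divide)
    also have "\<dots> \<le> r / cmod g" using x g by (intro divide_right_mono) auto
    finally show "x \<in> cball (a / g) (r / cmod g)" by (simp add: dist_norm)
  qed
  have "emeasure disc {x. cmod (a - g * clip x) \<le> r} =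
      emeasure lborel (cball 0 1 \<inter> {x. cmod (a - g * clip x) \<le> r}) / ennreal pi"
    unfolding disc_def by (subst emeasure_uniform_measure) (auto simp: v)
  also have "\<dots> \<le> emeasure lborel (cball (a / g) (r / cmod g)) / ennreal pi"
    by (intro divide_right_mono_ennreal emeasure_mono sub) simp
  also have "\<dots> = ennreal (hit_prob r g)"
    using r g by (simp add: emeasure_lborel_disc divide_ennreal hit_prob_def)
  finally show ?thesis .
qed

lemma disc_product:
  assumes r: "r \<ge> 0" and K: "finite K" "inj_on s K"
  shows "emeasure discM {u. \<forall>k\<in>K. cmod (a k - g * clip (u (s k))) \<le> r} \<le> ennreal (hit_prob r g ^ card K)"
proof -
  define A where "A m = {x. cmod (a (the_inv_into K s m) - g * clip x) \<le> r}" for m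
  have "{u. \<forall>k\<in>K. cmod (a k - g * clip (u (s k))) \<le> r} = prod_emb UNIV (\<lambda>_. disc) (s ` K) (Pi\<^sub>E (s ` K) A)"
    using K(2) by (auto simp: prod_emb_def PiE_iff A_def the_inv_into_f_f)
  then have "emeasure discM {u. \<forall>k\<in>K. cmod (a k - g * clip (u (s k))) \<le> r} = (\<Prod>m\<in>s ` K. emeasure disc (A m))"
    using K emeasure_PiM_emb[of UNIV "\<lambda>_. disc" "s ` K" A] by (simp add: A_def)
  also have "\<dots> \<le> (\<Prod>m\<in>s ` K. ennreal (hit_prob r g))"
    unfolding A_def by (intro prod_mono_ennreal disc_hit r)
  also have "\<dots> = ennreal (hit_prob r g ^ card K)"
    using K by (simp add: card_image ennreal_power)
  finally show ?thesis .
qed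

text \<open>A probability bound conditional on the coordinates outside \<open>J\<close>. The
  indicator of \<open>C\<close> is kept and not bounded by 1, so that a sum over many events
  \<open>P\<close> can be controlled by the sum over their \<open>C\<close>.\<close>

lemma resample_bound:
  assumes P: "Measurable.pred discM P" and C: "Measurable.pred discM C"
    and bound: "\<And>u. emeasure discM {u'. P (\<lambda>s. if s \<in> J then u' s else u s)} \<le> b * indicator {u. C u} u"
  shows "emeasure discM {u. P u} \<le> b * emeasure discM {u. C u}"
proof -
  have sP: "{u. P u} \<in> sets discM" and sC: "{u. C u} \<in> sets discM"
    using P C by (simp_all add: pred_def)
  have "emeasure discM {u. P u} = (\<integral>\<^sup>+u. indicator {u. P u} u \<partial>discM)"
    using sP by simp
  also have "\<dots> = (\<integral>\<^sup>+u. \<integral>\<^sup>+u'. indicator {u. P u} (\<lambda>s. if s \<in> J then u' s else u s) \<partial>discM \<partial>discM)"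
    using sP by (intro nn_integral_PiM_resample) simp_all
  also have "\<dots> \<le> (\<integral>\<^sup>+u. b * indicator {u. C u} u \<partial>discM)"
  proof (rule nn_integral_mono)
    fix u
    have t: "(\<lambda>u'. \<lambda>s. if s \<in> J then u' s else u s) \<in> discM \<rightarrow>\<^sub>M discM"
      using measurable_compose[OF measurable_Pair1' measurable_merge_UNIV[of J "\<lambda>_. disc"], of u] by simp
    have m: "{u'. P (\<lambda>s. if s \<in> J then u' s else u s)} \<in> sets discM"
      using measurable_sets[OF t sP] by (simp add: vimage_def)
    have "(\<integral>\<^sup>+u'. indicator {u. P u} (\<lambda>s. if s \<in> J then u' s else u s) \<partial>discM) =
        (\<integral>\<^sup>+u'. indicator {u'. P (\<lambda>s. if s \<in> J then u' s else u s)} u' \<partial>discM)"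
      by (intro nn_integral_cong) (simp add: indicator_def)
    then show "(\<integral>\<^sup>+u'. indicator {u. P u} (\<lambda>s. if s \<in> J then u' s else u s) \<partial>discM) \<le> b * indicator {u. C u} u"
      using m bound[of u] by simp
  qed
  also have "\<dots> = b * emeasure discM {u. C u}" using sC by (rule nn_integral_cmult_indicator)
  finally show ?thesis .
qed

section \<open>Counting grid points near a given point\<close>

lemma card_int_near:
  assumes "R \<ge> 0"
  shows "finite {a::int. \<bar>of_int a - x\<bar> \<le> R}" "real (card {a::int. \<bar>of_int a - x\<bar> \<le> R}) \<le> 2 * R + 1"
proof -
  have eq: "{a::int. \<bar>of_int a - x\<bar> \<le> R} = {\<lceil>x - R\<rceil>..\<lfloor>x + R\<rfloor>}"
    by (auto simp: ceiling_le_iff le_floor_iff abs_le_iff)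
  show "finite {a::int. \<bar>of_int a - x\<bar> \<le> R}" unfolding eq by simp
  have "real_of_int \<lfloor>x + R\<rfloor> - real_of_int \<lceil>x - R\<rceil> \<le> 2 * R" by linarith
  then show "real (card {a::int. \<bar>of_int a - x\<bar> \<le> R}) \<le> 2 * R + 1"
    unfolding eq card_atLeastAtMost_int using assms
    by (cases "0 \<le> \<lfloor>x + R\<rfloor> + 1 - \<lceil>x - R\<rceil>") (simp_all add: of_nat_nat)
qed

lemma card_center_near:
  assumes "R \<ge> 0"
  shows "finite {p. cmod (center p - z) \<le> R}" "real (card {p. cmod (center p - z) \<le> R}) \<le> (2 * R + 1)\<^sup>2"
proof -
  let ?A = "{a::int. \<bar>of_int a - Re z\<bar> \<le> R}" and ?B = "{a::int. \<bar>of_int a - Im z\<bar> \<le> R}"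
  have sub: "{p. cmod (center p - z) \<le> R} \<subseteq> ?A \<times> ?B"
  proof
    fix p assume "p \<in> {p. cmod (center p - z) \<le> R}"
    then have "\<bar>Re (center p - z)\<bar> \<le> R" "\<bar>Im (center p - z)\<bar> \<le> R"
      using abs_Re_le_cmod[of "center p - z"] abs_Im_le_cmod[of "center p - z"] by auto
    then show "p \<in> ?A \<times> ?B" by (cases p) (simp add: center_def)
  qed
  have fin: "finite (?A \<times> ?B)" using card_int_near(1)[OF assms] by simp
  then show "finite {p. cmod (center p - z) \<le> R}" by (rule finite_subset[OF sub])
  have "real (card {p. cmod (center p - z) \<le> R}) \<le> real (card (?A \<times> ?B))"
    using card_mono[OF fin sub] by simp
  also have "\<dots> = real (card ?A) * real (card ?B)" by (simp add: card_cartesian_product)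
  also have "\<dots> \<le> (2 * R + 1) * (2 * R + 1)"
    using assms by (intro mult_mono card_int_near) auto
  finally show "real (card {p. cmod (center p - z) \<le> R}) \<le> (2 * R + 1)\<^sup>2" by (simp add: power2_eq_square)
qed

lemma card_lists_near:
  assumes fin: "\<And>k. k < n \<Longrightarrow> finite (A k)" and card: "\<And>k. k < n \<Longrightarrow> real (card (A k)) \<le> b"
  shows "real (card {l. length l = n \<and> (\<forall>k<n. l ! k \<in> A k)}) \<le> b ^ n"
proof -
  let ?L = "{l. length l = n \<and> (\<forall>k<n. l ! k \<in> A k)}" and ?f = "\<lambda>l. restrict ((!) l) {..<n}"
  have inj: "inj_on ?f ?L"
    by (rule inj_onI, rule nth_equalityI) (auto simp: fun_eq_iff restrict_def split: if_splits)
  have "card ?L \<le> card (PiE {..<n} A)"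
  proof (rule card_inj_on_le[OF inj])
    show "?f ` ?L \<subseteq> PiE {..<n} A" by (auto simp: PiE_iff split: if_splits)
    show "finite (PiE {..<n} A)" by (intro finite_PiE) (auto simp: fin)
  qed
  then have "real (card ?L) \<le> real (card (PiE {..<n} A))" by simp
  also have "\<dots> = (\<Prod>k<n. real (card (A k)))" by (simp add: card_PiE)
  also have "\<dots> \<le> (\<Prod>k<n. b)" by (intro prod_mono) (auto simp: card)
  finally show ?thesis by simp
qed

text \<open>
  The wrong message \<open>w'\<close> passes the test on path \<open>i\<close> for some quantization index \<open>l\<close>, while the relay has
  sent the codeword of \<open>l0\<close>. If \<open>l = l0\<close>, the source codewords collide in the listening phase; otherwise
  the independent relay codewords of \<open>l\<close> and \<open>l0\<close> collide in the transmit phase.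
\<close>

definition path_hit :: "real \<Rightarrow> real \<Rightarrow> nat \<Rightarrow> nat \<Rightarrow> relay \<Rightarrow> nat \<Rightarrow> nat \<Rightarrow> complex \<Rightarrow> complex \<Rightarrow> cseq \<Rightarrow> cseq \<Rightarrow> bool" where
  "path_hit \<rho> \<kappa> T n i w w' hs hr z u \<longleftrightarrow>
     (\<exists>l0 l. cells n (\<lambda>k. hs * of_real (sqrt \<rho>) * code_src i u w k + z k) = l0 \<and> length l = n \<and>
       (\<forall>k<n. cmod (center (l ! k) - hs * of_real (sqrt \<rho>) * code_src i u w' k) \<le> \<kappa> + 2) \<and>
       (\<forall>k<T. n \<le> k \<longrightarrow> cmod (hr * of_real (sqrt \<rho>) * code_cb i n (to_nat l0) k u -
          hr * of_real (sqrt \<rho>) * code_cb i n (to_nat l) k u) \<le> 2 * \<kappa>))"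

lemma measurable_relay_cells:
  "(\<lambda>u. cells n (\<lambda>k. g * code_src i u w k + z k)) \<in> discM \<rightarrow>\<^sub>M count_space UNIV"
proof (rule measurable_compose[OF _ measurable_cells], rule measurable_seqM_fun)
  have [measurable]: "(\<lambda>u. code_src i u w k) \<in> borel_measurable discM" for k
    by (rule measurable_code_src) simp
  show "(\<lambda>u. g * code_src i u w k + z k) \<in> borel_measurable discM" for k by measurable
qed

lemma pred_relay_cells [measurable]:
  "Measurable.pred discM (\<lambda>u. cells n (\<lambda>k. g * code_src i u w k + z k) = l)"
  by (rule measurable_compose[OF measurable_relay_cells]) simp

lemma measurable_path_hit: "Measurable.pred discM (\<lambda>u. path_hit \<rho> \<kappa> T n i w w' hs hr z u)"
  unfolding path_hit_def by measurable

text \<open>A union bound over the two ways in which \<open>path_hit\<close> occurs. Infinitely many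
  lists are possible, so in the second way each list keeps the condition of being near the codeword
  of \<open>w'\<close>. The expected number of such lists is at most
  \<open>((2 * \<kappa> + 5)\<^sup>2) ^ n\<close>, where
  \<open>2 * \<kappa> + 5 = 2 * (\<kappa> + 2) + 1\<close> bounds the number of integers within
  \<open>\<kappa> + 2\<close> of a point on each axis.\<close>

lemma path_hit_prob:
  fixes hs hr :: complex and \<rho> :: real
  assumes \<kappa>: "\<kappa> \<ge> 0" and w: "w \<noteq> w'" and n: "n \<le> T"
  defines "g \<equiv> hs * of_real (sqrt \<rho>)" and "gr \<equiv> hr * of_real (sqrt \<rho>)"
  shows "emeasure discM {u. path_hit \<rho> \<kappa> T n i w w' hs hr z u} \<le>
    ennreal (hit_prob (\<kappa> + 2) g ^ n + ((2 * \<kappa> + 5)\<^sup>2) ^ n * hit_prob (2 * \<kappa>) gr ^ (T - n))"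
proof -
  define l0 where "l0 u = cells n (\<lambda>k. g * code_src i u w k + z k)" for u
  define near where "near l u \<longleftrightarrow> (\<forall>k<n. cmod (center (l ! k) - g * code_src i u w' k) \<le> \<kappa> + 2)" for l u
  define F where "F u \<longleftrightarrow> near (l0 u) u" for u
  define S where "S l u \<longleftrightarrow> l0 u \<noteq> l \<and> near l u \<and>
     (\<forall>k<T. n \<le> k \<longrightarrow> cmod (gr * code_cb i n (to_nat (l0 u)) k u - gr * code_cb i n (to_nat l) k u) \<le> 2 * \<kappa>)" for l u
  \<comment> \<open>Since symbols have modulus at most 1, this box contains every near list; it
    makes the union over lists finite.\<close>
  define B where "B = \<lceil>cmod g + \<kappa> + 2\<rceil>"
  define Lf where "Lf = {l. set l \<subseteq> {-B..B} \<times> {-B..B} \<and> length l = n}"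
  have finL: "finite Lf" unfolding Lf_def by (intro finite_lists_length_eq) simp
  have [measurable]: "Measurable.pred discM (near l)" for l unfolding near_def[abs_def] by measurable
  have [measurable]: "Measurable.pred discM (\<lambda>u. l0 u = l)" for l unfolding l0_def by measurable
  have mF: "Measurable.pred discM F"
  proof -
    have "F = (\<lambda>u. \<exists>l. l0 u = l \<and> near l u)" by (auto simp: F_def)
    then show ?thesis by (simp only:) measurable
  qed
  have mS: "Measurable.pred discM (S l)" for l
  proof -
    have "S l = (\<lambda>u. \<exists>l'. l0 u = l' \<and> l' \<noteq> l \<and> near l u \<and>
     (\<forall>k<T. n \<le> k \<longrightarrow> cmod (gr * code_cb i n (to_nat l') k u - gr * code_cb i n (to_nat l) k u) \<le> 2 * \<kappa>))"
      by (auto simp: S_def)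
    then show ?thesis by (simp only:) measurable
  qed
  have LfI: "l \<in> Lf" if "length l = n" "near l u" for l u
  proof -
    have "p \<in> {-B..B} \<times> {-B..B}" if "p \<in> set l" for p
    proof -
      from \<open>p \<in> set l\<close> obtain k where k: "k < n" "p = l ! k" using \<open>length l = n\<close> by (metis in_set_conv_nth)
      have "cmod (center p) \<le> cmod (center p - g * code_src i u w' k) + cmod (g * code_src i u w' k)"
        by (metis diff_add_cancel norm_triangle_ineq)
      also have "\<dots> \<le> (\<kappa> + 2) + cmod g * 1"
        using \<open>near l u\<close> k by (intro add_mono) (auto simp: near_def norm_mult code_src_def intro!: mult_left_le)
      finally have "cmod (center p) \<le> of_int B" unfolding B_def by linarith
      then have "\<bar>Re (center p)\<bar> \<le> of_int B" "\<bar>Im (center p)\<bar> \<le> of_int B"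
        using abs_Re_le_cmod[of "center p"] abs_Im_le_cmod[of "center p"] by linarith+
      then have "\<bar>fst p\<bar> \<le> B" "\<bar>snd p\<bar> \<le> B" by (simp_all add: center_def flip: of_int_abs)
      then show ?thesis by (simp add: mem_Times_iff abs_le_iff)
    qed
    then show ?thesis using that unfolding Lf_def by blast
  qed
  have sF: "{u. F u} \<in> sets discM" and sS: "{u. S l u} \<in> sets discM" for l
    using mF mS by (simp_all add: pred_def)
  have "{u. path_hit \<rho> \<kappa> T n i w w' hs hr z u} \<subseteq> {u. F u} \<union> (\<Union>l\<in>Lf. {u. S l u})"
  proof
    fix u assume "u \<in> {u. path_hit \<rho> \<kappa> T n i w w' hs hr z u}"
    then obtain l where l: "length l = n" "near l u"
      "\<forall>k<T. n \<le> k \<longrightarrow> cmod (gr * code_cb i n (to_nat (l0 u)) k u - gr * code_cb i n (to_nat l) k u) \<le> 2 * \<kappa>"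
      by (auto simp: path_hit_def l0_def near_def g_def gr_def)
    show "u \<in> {u. F u} \<union> (\<Union>l\<in>Lf. {u. S l u})"
    proof (cases "l0 u = l")
      case True
      then show ?thesis using l by (simp add: F_def)
    next
      case False
      then show ?thesis using l LfI[OF l(1,2)] by (auto simp: S_def)
    qed
  qed
  then have "emeasure discM {u. path_hit \<rho> \<kappa> T n i w w' hs hr z u} \<le> emeasure discM ({u. F u} \<union> (\<Union>l\<in>Lf. {u. S l u}))"
    using sF sS finL by (intro emeasure_mono) auto
  also have "\<dots> \<le> emeasure discM {u. F u} + emeasure discM (\<Union>l\<in>Lf. {u. S l u})"
    using sF sS finL by (intro emeasure_subadditive) auto
  finally have union: "emeasure discM {u. path_hit \<rho> \<kappa> T n i w w' hs hr z u} \<le>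
    emeasure discM {u. F u} + emeasure discM (\<Union>l\<in>Lf. {u. S l u})" .
  have first: "emeasure discM {u. F u} \<le> ennreal (hit_prob (\<kappa> + 2) g ^ n)"
  proof -
    \<comment> \<open>The codeword of the wrong message is redrawn. As \<open>w \<noteq> w'\<close>,
      the list \<open>l0 u\<close> stays fixed, and every slot is an independent attempt to hit a
      fixed target.\<close>
    let ?J = "range (\<lambda>k. src_idx (i, w', k))"
    have "emeasure discM {u. F u} \<le> ennreal (hit_prob (\<kappa> + 2) g ^ n) * emeasure discM {u. True}"
    proof (rule resample_bound[OF mF, where J="?J"])
      fix u :: cseq
      let ?m = "\<lambda>u' s. if s \<in> ?J then u' s else u s"
      have "code_src i (?m u') w k = code_src i u w k" "code_src i (?m u') w' k = clip (u' (src_idx (i, w', k)))" for u' k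
        using w by (auto simp: code_src_def image_iff)
      then have "{u'. F (?m u')} = {u'. \<forall>k\<in>{..<n}. cmod (center (l0 u ! k) - g * clip (u' (src_idx (i, w', k)))) \<le> \<kappa> + 2}"
        by (auto simp: F_def near_def l0_def)
      moreover have "emeasure discM {u'. \<forall>k\<in>{..<n}. cmod (center (l0 u ! k) - g * clip (u' (src_idx (i, w', k)))) \<le> \<kappa> + 2}
          \<le> ennreal (hit_prob (\<kappa> + 2) g ^ card {..<n})"
        using \<kappa> by (intro disc_product) (auto simp: inj_on_def)
      ultimately show "emeasure discM {u'. F (?m u')} \<le> ennreal (hit_prob (\<kappa> + 2) g ^ n) * indicator {u. True} u"
        by simp
    qed simp
    then show ?thesis using prob_space.emeasure_space_1[OF prob_space_discM] by simp
  qed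
  have "emeasure discM (\<Union>l\<in>Lf. {u. S l u}) \<le> (\<Sum>l\<in>Lf. emeasure discM {u. S l u})"
    using sS finL by (intro emeasure_subadditive_finite) auto
  also have "(\<Sum>l\<in>Lf. emeasure discM {u. S l u}) \<le> (\<Sum>l\<in>Lf. ennreal (hit_prob (2 * \<kappa>) gr ^ (T - n)) * emeasure discM {u. near l u})"
  proof (rule sum_mono)
    fix l assume "l \<in> Lf"
    \<comment> \<open>Only the relay codeword of \<open>l\<close> is redrawn; the codeword of
      \<open>l0 u\<close>, a different list, and the source codebook stay fixed.\<close>
    let ?J = "range (\<lambda>k. cb_idx (i, n, to_nat l, k))"
    show "emeasure discM {u. S l u} \<le> ennreal (hit_prob (2 * \<kappa>) gr ^ (T - n)) * emeasure discM {u. near l u}"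
    proof (rule resample_bound[OF mS, where J="?J"])
      fix u :: cseq
      let ?m = "\<lambda>u' s. if s \<in> ?J then u' s else u s"
      have src: "code_src i (?m u') w'' k = code_src i u w'' k" for u' w'' k
        by (auto simp: code_src_def image_iff)
      then have same: "l0 (?m u') = l0 u" "near l (?m u') = near l u" for u'
        by (simp_all add: l0_def near_def)
      have cb: "code_cb i n (to_nat l) k (?m u') = clip (u' (cb_idx (i, n, to_nat l, k)))" for u' k
        by (auto simp: code_cb_def image_iff)
      have cb': "code_cb i n (to_nat (l0 u)) k (?m u') = code_cb i n (to_nat (l0 u)) k u" if "l0 u \<noteq> l" for u' k
        using that by (auto simp: code_cb_def image_iff)
      show "emeasure discM {u'. S l (?m u')} \<le> ennreal (hit_prob (2 * \<kappa>) gr ^ (T - n)) * indicator {u. near l u} u"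
      proof (cases "l0 u \<noteq> l \<and> near l u")
        case True
        then have "{u'. S l (?m u')} = {u'. \<forall>k\<in>{n..<T}. cmod (gr * code_cb i n (to_nat (l0 u)) k u -
            gr * clip (u' (cb_idx (i, n, to_nat l, k)))) \<le> 2 * \<kappa>}"
          by (auto simp: S_def same cb cb')
        moreover have "emeasure discM {u'. \<forall>k\<in>{n..<T}. cmod (gr * code_cb i n (to_nat (l0 u)) k u -
            gr * clip (u' (cb_idx (i, n, to_nat l, k)))) \<le> 2 * \<kappa>} \<le> ennreal (hit_prob (2 * \<kappa>) gr ^ card {n..<T})"
          using \<kappa> by (intro disc_product) (auto simp: inj_on_def)
        ultimately show ?thesis using True by simp
      next
        case False
        then have "{u'. S l (?m u')} = {}" by (auto simp: S_def same)
        then show ?thesis by simp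
      qed
    qed simp
  qed
  also have "\<dots> = ennreal (hit_prob (2 * \<kappa>) gr ^ (T - n)) * (\<Sum>l\<in>Lf. emeasure discM {u. near l u})"
    by (simp add: sum_distrib_left)
  also have "\<dots> \<le> ennreal (hit_prob (2 * \<kappa>) gr ^ (T - n)) * ennreal (((2 * \<kappa> + 5)\<^sup>2) ^ n)"
  proof (rule mult_left_mono)
    show "(\<Sum>l\<in>Lf. emeasure discM {u. near l u}) \<le> ennreal (((2 * \<kappa> + 5)\<^sup>2) ^ n)"
  proof -
    have sN: "{u. near l u} \<in> sets discM" for l
      using \<open>\<And>l. Measurable.pred discM (near l)\<close> by (simp add: pred_def)
    have "(\<Sum>l\<in>Lf. emeasure discM {u. near l u}) = (\<Sum>l\<in>Lf. \<integral>\<^sup>+u. indicator {u. near l u} u \<partial>discM)"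
      using sN by simp
    \<comment> \<open>Exchanging sum and expectation leaves, for each codebook, a count of the lists
      near one given codeword.\<close>
    also have "\<dots> = (\<integral>\<^sup>+u. (\<Sum>l\<in>Lf. indicator {u. near l u} u) \<partial>discM)"
      using sN by (intro nn_integral_sum[symmetric]) auto
    also have "\<dots> \<le> (\<integral>\<^sup>+u. ennreal (((2 * \<kappa> + 5)\<^sup>2) ^ n) \<partial>discM)"
    proof (rule nn_integral_mono)
      fix u
      let ?A = "\<lambda>k. {p. cmod (center p - g * code_src i u w' k) \<le> \<kappa> + 2}"
      have "(\<Sum>l\<in>Lf. indicator {u. near l u} u :: ennreal) = of_nat (card {l\<in>Lf. near l u})"
        using finL by (simp add: indicator_def sum.If_cases Int_def)
      also have "{l\<in>Lf. near l u} = {l. length l = n \<and> (\<forall>k<n. l ! k \<in> ?A k)}"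
        using LfI[of _ u] by (auto simp: near_def Lf_def)
      also have "of_nat (card \<dots>) \<le> ennreal (((2 * \<kappa> + 5)\<^sup>2) ^ n)"
      proof -
        have "real (card (?A k)) \<le> (2 * \<kappa> + 5)\<^sup>2" for k
          using card_center_near(2)[of "\<kappa> + 2" "g * code_src i u w' k"] \<kappa> by (simp add: algebra_simps)
        then have "real (card {l. length l = n \<and> (\<forall>k<n. l ! k \<in> ?A k)}) \<le> ((2 * \<kappa> + 5)\<^sup>2) ^ n"
          using \<kappa> by (intro card_lists_near card_center_near(1)) auto
        then show ?thesis by (simp add: ennreal_of_nat_eq_real_of_nat ennreal_leI)
      qed
      finally show "(\<Sum>l\<in>Lf. indicator {u. near l u} u) \<le> ennreal (((2 * \<kappa> + 5)\<^sup>2) ^ n)" .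
    qed
    also have "\<dots> = ennreal (((2 * \<kappa> + 5)\<^sup>2) ^ n)"
      using prob_space.emeasure_space_1[OF prob_space_discM] by simp
    finally show ?thesis .
  qed
  qed simp
  finally have "emeasure discM (\<Union>l\<in>Lf. {u. S l u}) \<le>
    ennreal (hit_prob (2 * \<kappa>) gr ^ (T - n)) * ennreal (((2 * \<kappa> + 5)\<^sup>2) ^ n)" .
  from order_trans[OF union add_mono[OF first this]]
  have "emeasure discM {u. path_hit \<rho> \<kappa> T n i w w' hs hr z u} \<le>
    ennreal (hit_prob (\<kappa> + 2) g ^ n) + ennreal (hit_prob (2 * \<kappa>) gr ^ (T - n)) * ennreal (((2 * \<kappa> + 5)\<^sup>2) ^ n)"
    .
  also have "\<dots> = ennreal (hit_prob (\<kappa> + 2) g ^ n + ((2 * \<kappa> + 5)\<^sup>2) ^ n * hit_prob (2 * \<kappa>) gr ^ (T - n))"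
    by (simp add: ennreal_mult'[symmetric] mult.commute flip: ennreal_plus)
  finally show ?thesis .
qed

section \<open>Decoding when the noise is small, and the average error probability\<close>

definition quiet :: "real \<Rightarrow> nat \<Rightarrow> (relay \<Rightarrow> cseq) \<times> (relay \<Rightarrow> cseq) \<Rightarrow> bool" where
  "quiet \<kappa> T z \<longleftrightarrow> (\<forall>i. \<forall>k<T. cmod (fst z i k) \<le> \<kappa> \<and> cmod (snd z i k) \<le> \<kappa>)"

lemma relay_rx_initial: "relay_rx (\<lambda>k _. k < n) s k = (\<lambda>j. if j < k \<and> j < n then s j else 0)"
  by (induction k) (auto simp: fun_eq_iff less_Suc_eq)

lemma qmf_scheme_listens: "listens (qmf_scheme \<rho> \<kappa> t T M) i h u v = (\<lambda>k _. k < listen_slots T t i h)"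
  by (simp add: fun_eq_iff)

lemma dest_obs_qmf_scheme:
  assumes "listen_slots T t i hs \<le> k" "k < T"
  defines "n \<equiv> listen_slots T t i hs"
  shows "dest_obs \<rho> (qmf_scheme \<rho> \<kappa> t T M) i w u v hs hr zr zd k =
    hr * of_real (sqrt \<rho>) * code_cb i n (to_nat (cells n (\<lambda>k. hs * of_real (sqrt \<rho>) * code_src i u w k + zr k))) k u + zd k"
proof -
  let ?c = "qmf_scheme \<rho> \<kappa> t T M"
  have "cells n (relay_obs \<rho> ?c i w u v hs zr k) = cells n (\<lambda>k. hs * of_real (sqrt \<rho>) * code_src i u w k + zr k)"
    using assms by (auto simp: relay_obs_def qmf_scheme_listens relay_rx_initial cells_def relay_in_def n_def)
  then show ?thesis using assms
    by (simp add: dest_obs_def relay_listens_def relay_tx_def n_def)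
qed

lemma qmf_scheme_dec: "dec (qmf_scheme \<rho> \<kappa> t T M) hs hr u y =
    (if \<exists>w<M. \<forall>i. consistent \<rho> \<kappa> T (listen_slots T t i (hs i)) i w (hs i) (hr i) u (y i)
     then LEAST w. w < M \<and> (\<forall>i. consistent \<rho> \<kappa> T (listen_slots T t i (hs i)) i w (hs i) (hr i) u (y i))
     else 0)"
  by (simp add: qmf_scheme_def)

lemma listen_slots_le: "t i h \<le> 1 \<Longrightarrow> listen_slots T t i h \<le> T"
proof -
  assume "t i h \<le> 1"
  then have "t i h * real T \<le> real T" using mult_right_mono[of "t i h" 1 "real T"] by simp
  then show ?thesis by (simp add: listen_slots_def nat_le_iff floor_le_iff)
qed

lemma cmod_center_cell: "cmod (center (cell x) - x) \<le> 2"
proof (rule power2_le_imp_le)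
  have "(cmod (center (cell x) - x))\<^sup>2 \<le> 2"
    using center_cell[of x] by (simp only: norm_minus_commute)
  then show "(cmod (center (cell x) - x))\<^sup>2 \<le> 2\<^sup>2" by simp
qed simp

text \<open>If the noise is within \<open>\<kappa>\<close>, the true message passes the test with
  the list that the relay has actually formed, so an error means that another message passes too.
  Eliminating the destination noise by the triangle inequality turns the radius
  \<open>\<kappa>\<close> into \<open>2 * \<kappa>\<close>.\<close>

lemma decoding_error:
  assumes t: "\<And>i h. t i h \<le> 1" and w: "w < M" and q: "quiet \<kappa> T z"
    and err: "decided \<rho> (qmf_scheme \<rho> \<kappa> t T M) w u v hs hr z \<noteq> w"
  shows "\<exists>w'<M. w' \<noteq> w \<and> (\<forall>i. path_hit \<rho> \<kappa> T (listen_slots T t i (hs i)) i w w' (hs i) (hr i) (fst z i) u)"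
proof -
  let ?c = "qmf_scheme \<rho> \<kappa> t T M"
  define n where "n i = listen_slots T t i (hs i)" for i
  define g gr where "g i = hs i * of_real (sqrt \<rho>)" and "gr i = hr i * of_real (sqrt \<rho>)" for i
  define y where "y i = dest_rx \<rho> ?c w u v hs hr (fst z) (snd z) i" for i
  define l0 where "l0 i = cells (n i) (\<lambda>k. g i * code_src i u w k + fst z i k)" for i
  define Q where "Q w' \<longleftrightarrow> w' < M \<and> (\<forall>i. consistent \<rho> \<kappa> T (n i) i w' (hs i) (hr i) u (y i))" for w'
  have y: "y i k = gr i * code_cb i (n i) (to_nat (l0 i)) k u + snd z i k" if "k < T" "n i \<le> k" for i k
    using dest_obs_qmf_scheme[of T t i "hs i" k \<rho> \<kappa> M w u "v i" "hr i" "fst z i" "snd z i"] that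
    by (simp add: y_def dest_rx_eq gr_def n_def l0_def g_def)
  have dec: "decided \<rho> ?c w u v hs hr z = (if \<exists>w'. Q w' then LEAST w'. Q w' else 0)"
    unfolding decided_def qmf_scheme_dec Q_def y_def n_def ..
  have "cmod (center (l0 i ! k) - g i * code_src i u w k) \<le> 2 + \<kappa>" if k: "k < n i" "k < T" for i k
  proof -
    let ?x = "g i * code_src i u w k + fst z i k"
    have "cmod (center (cell ?x) - ?x) \<le> 2" by (rule cmod_center_cell)
    moreover have "cmod (fst z i k) \<le> \<kappa>" using q k by (simp add: quiet_def)
    moreover have "center (cell ?x) - g i * code_src i u w k = (center (cell ?x) - ?x) + fst z i k" by simp
    ultimately have "cmod (center (cell ?x) - g i * code_src i u w k) \<le> 2 + \<kappa>"
      by (simp only:) (rule norm_triangle_mono)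
    then show ?thesis using k by (simp only: l0_def nth_cells)
  qed note near = this
  show ?thesis
  proof -
    have nT: "n i \<le> T" for i by (simp add: n_def listen_slots_le t)
    have "consistent \<rho> \<kappa> T (n i) i w (hs i) (hr i) u (y i)" for i
      unfolding consistent_def
    proof (intro exI[of _ "l0 i"] conjI allI impI)
      show "length (l0 i) = n i" by (simp add: l0_def)
      show "cmod (center (l0 i ! k) - hs i * of_real (sqrt \<rho>) * code_src i u w k) \<le> \<kappa> + 2" if "k < n i" for k
        using near[OF that less_le_trans[OF that nT]] by (simp only: g_def add.commute[of \<kappa> 2])
      show "cmod (y i k - hr i * of_real (sqrt \<rho>) * code_cb i (n i) (to_nat (l0 i)) k u) \<le> \<kappa>" if "k < T" "n i \<le> k" for k
        using y[OF that] q that by (simp add: gr_def quiet_def)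
    qed
    then have "Q w" using w by (simp add: Q_def)
    define w' where "w' = (LEAST w'. Q w')"
    have "Q w'" unfolding w'_def using \<open>Q w\<close> by (rule LeastI)
    moreover have "decided \<rho> ?c w u v hs hr z = w'" unfolding dec w'_def using \<open>Q w\<close> by (metis (full_types))
    then have "w' \<noteq> w" using err by simp
    moreover have "path_hit \<rho> \<kappa> T (n i) i w w' (hs i) (hr i) (fst z i) u" for i
    proof -
      obtain l where l: "length l = n i"
        "\<forall>k<n i. cmod (center (l ! k) - hs i * of_real (sqrt \<rho>) * code_src i u w' k) \<le> \<kappa> + 2"
        "\<forall>k<T. n i \<le> k \<longrightarrow> cmod (y i k - hr i * of_real (sqrt \<rho>) * code_cb i (n i) (to_nat l) k u) \<le> \<kappa>"
        using \<open>Q w'\<close> unfolding Q_def consistent_def by metis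
      show ?thesis unfolding path_hit_def
      proof (rule exI[of _ "l0 i"], rule exI[of _ l], intro conjI allI impI)
        show "cells (n i) (\<lambda>k. hs i * of_real (sqrt \<rho>) * code_src i u w k + fst z i k) = l0 i"
          by (simp add: l0_def g_def)
        fix k assume k: "k < T" "n i \<le> k"
        let ?a = "hr i * of_real (sqrt \<rho>) * code_cb i (n i) (to_nat (l0 i)) k u"
        let ?b = "hr i * of_real (sqrt \<rho>) * code_cb i (n i) (to_nat l) k u"
        have "?a - ?b = (y i k - ?b) - snd z i k" using y[OF k] by (simp add: gr_def)
        then have "cmod (?a - ?b) = cmod ((y i k - ?b) - snd z i k)" by (rule arg_cong)
        also have "\<dots> \<le> cmod (y i k - ?b) + cmod (snd z i k)" by (rule norm_triangle_ineq4)
        also have "\<dots> \<le> \<kappa> + \<kappa>" using l(3) k q by (intro add_mono) (auto simp: quiet_def)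
        finally show "cmod (?a - ?b) \<le> 2 * \<kappa>" by simp
      qed (use l in auto)
    qed
    ultimately show ?thesis unfolding Q_def n_def by blast
  qed
qed

definition path_bound :: "real \<Rightarrow> real \<Rightarrow> nat \<Rightarrow> nat \<Rightarrow> complex \<Rightarrow> complex \<Rightarrow> real" where
  "path_bound \<rho> \<kappa> T n hs hr = hit_prob (\<kappa> + 2) (hs * of_real (sqrt \<rho>)) ^ n +
     ((2 * \<kappa> + 5)\<^sup>2) ^ n * hit_prob (2 * \<kappa>) (hr * of_real (sqrt \<rho>)) ^ (T - n)"

text \<open>The codebooks used on the two paths live on disjoint coordinates of the seed, so the hit
  probabilities multiply; this is why the path rates add in the exponent.\<close>

lemma both_paths_hit:
  assumes \<kappa>: "\<kappa> \<ge> 0" and w: "w \<noteq> w'" and n: "\<And>i. n i \<le> T"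
  shows "emeasure discM {u. \<forall>i. path_hit \<rho> \<kappa> T (n i) i w w' (hs i) (hr i) (z i) u} \<le>
    ennreal (path_bound \<rho> \<kappa> T (n R1) (hs R1) (hr R1) * path_bound \<rho> \<kappa> T (n R2) (hs R2) (hr R2))"
proof -
  let ?H = "\<lambda>i u. path_hit \<rho> \<kappa> T (n i) i w w' (hs i) (hr i) (z i) u"
  have b: "emeasure discM {u. ?H i u} \<le> ennreal (path_bound \<rho> \<kappa> T (n i) (hs i) (hr i))" for i
    unfolding path_bound_def by (rule path_hit_prob[OF \<kappa> w n])
  have "emeasure discM {u. ?H R1 u \<and> ?H R2 u} = emeasure discM {u. ?H R1 u} * emeasure discM {u. ?H R2 u}"
  proof (rule resample_indep[where J="{s. (\<exists>a. s = cb_idx (R1, a)) \<or> (\<exists>a. s = src_idx (R1, a))}"])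
    show "Measurable.pred discM (?H R1)" "Measurable.pred discM (?H R2)" by (rule measurable_path_hit)+
  qed (simp_all add: path_hit_def code_cb_def code_src_def)
  also have "\<dots> \<le> ennreal (path_bound \<rho> \<kappa> T (n R1) (hs R1) (hr R1)) * ennreal (path_bound \<rho> \<kappa> T (n R2) (hs R2) (hr R2))"
    by (intro mult_mono b) simp_all
  also have "\<dots> = ennreal (path_bound \<rho> \<kappa> T (n R1) (hs R1) (hr R1) * path_bound \<rho> \<kappa> T (n R2) (hs R2) (hr R2))"
    by (rule ennreal_mult'[symmetric]) (simp add: path_bound_def hit_prob_def)
  finally show ?thesis by (simp add: all_relay)
qed

lemma decoding_error_prob:
  fixes hs :: "relay \<Rightarrow> complex"
  assumes t: "\<And>i h. t i h \<le> 1" and w: "w < M" and q: "quiet \<kappa> T z" and \<kappa>: "\<kappa> \<ge> 0"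
  defines "n \<equiv> \<lambda>i. listen_slots T t i (hs i)"
  shows "(\<integral>\<^sup>+u. indicator (- {w}) (decided \<rho> (qmf_scheme \<rho> \<kappa> t T M) w u v hs hr z) \<partial>discM) \<le>
    ennreal (real M * (path_bound \<rho> \<kappa> T (n R1) (hs R1) (hr R1) * path_bound \<rho> \<kappa> T (n R2) (hs R2) (hr R2)))"
    (is "_ \<le> ennreal (real M * ?b)")
proof -
  let ?E = "\<lambda>w'. {u. \<forall>i. path_hit \<rho> \<kappa> T (n i) i w w' (hs i) (hr i) (fst z i) u}"
  have sE: "?E w' \<in> sets discM" for w'
  proof -
    have "?E w' = {u. path_hit \<rho> \<kappa> T (n R1) R1 w w' (hs R1) (hr R1) (fst z R1) u} \<inter>
        {u. path_hit \<rho> \<kappa> T (n R2) R2 w w' (hs R2) (hr R2) (fst z R2) u}" by (auto simp: all_relay)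
    also have "\<dots> \<in> sets discM" by (intro sets.Int) (use measurable_path_hit in \<open>simp add: pred_def\<close>)+
    finally show ?thesis .
  qed
  have "(\<integral>\<^sup>+u. indicator (- {w}) (decided \<rho> (qmf_scheme \<rho> \<kappa> t T M) w u v hs hr z) \<partial>discM) \<le>
      (\<integral>\<^sup>+u. indicator (\<Union>w'\<in>{..<M} - {w}. ?E w') u \<partial>discM)"
  proof (rule nn_integral_mono)
    fix u
    show "indicator (- {w}) (decided \<rho> (qmf_scheme \<rho> \<kappa> t T M) w u v hs hr z) \<le>
        (indicator (\<Union>w'\<in>{..<M} - {w}. ?E w') u :: ennreal)"
      using decoding_error[where \<rho>=\<rho> and u=u and v=v and hs=hs and hr=hr, OF t w q] by (force simp: indicator_def n_def)
  qed
  also have "\<dots> = emeasure discM (\<Union>w'\<in>{..<M} - {w}. ?E w')" using sE by (intro nn_integral_indicator) auto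
  also have "\<dots> \<le> (\<Sum>w'\<in>{..<M} - {w}. emeasure discM (?E w'))"
    using sE by (intro emeasure_subadditive_finite) auto
  also have "\<dots> \<le> (\<Sum>w'\<in>{..<M} - {w}. ennreal ?b)"
    by (intro sum_mono both_paths_hit \<kappa>) (auto simp: n_def listen_slots_le t)
  also have "\<dots> \<le> (\<Sum>w'<M. ennreal ?b)" by (intro sum_mono2) auto
  also have "\<dots> = ennreal (real M * ?b)" by (simp add: ennreal_mult' ennreal_of_nat_eq_real_of_nat)
  finally show ?thesis .
qed

text \<open>Chernoff's bound with \<open>nn_integral_CN01_exp\<close>. When \<open>\<kappa>\<close>
  is a positive power of \<open>\<rho>\<close>, it decays faster than every power of
  \<open>\<rho>\<close>, so loud noise never determines the diversity.\<close>

lemma CN01_tail: "emeasure CN01 {z. \<kappa> < cmod z} \<le> ennreal (2 * exp (- (\<kappa>\<^sup>2 / 2)))" if "\<kappa> \<ge> 0"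
proof -
  have m: "{z. \<kappa> < cmod z} \<in> sets CN01" by simp
  have "emeasure CN01 {z. \<kappa> < cmod z} = (\<integral>\<^sup>+z. indicator {z. \<kappa> < cmod z} z \<partial>CN01)" using m by simp
  also have "\<dots> \<le> (\<integral>\<^sup>+z. ennreal (exp (- (\<kappa>\<^sup>2 / 2))) * ennreal (exp ((cmod z)\<^sup>2 / 2)) \<partial>CN01)"
  proof (rule nn_integral_mono)
    fix z
    have "\<kappa>\<^sup>2 \<le> (cmod z)\<^sup>2" if "\<kappa> < cmod z" using that \<open>\<kappa> \<ge> 0\<close> by (intro power_mono) auto
    then show "indicator {z. \<kappa> < cmod z} z \<le> ennreal (exp (- (\<kappa>\<^sup>2 / 2))) * ennreal (exp ((cmod z)\<^sup>2 / 2))"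
      by (auto simp: indicator_def ennreal_mult'[symmetric] exp_add[symmetric] mult_exp_exp)
  qed
  also have "\<dots> = ennreal (exp (- (\<kappa>\<^sup>2 / 2))) * 2" by (simp add: nn_integral_cmult nn_integral_CN01_exp)
  also have "\<dots> = ennreal (2 * exp (- (\<kappa>\<^sup>2 / 2)))" by (simp add: ennreal_mult' mult.commute)
  finally show ?thesis .
qed

lemma nn_integral_noise_component:
  assumes f[measurable]: "f \<in> borel_measurable CN01"
  shows "(\<integral>\<^sup>+z. f (z i k) \<partial>noise) = (\<integral>\<^sup>+x. f x \<partial>CN01)"
proof -
  have [measurable]: "(\<lambda>y. f (y k)) \<in> borel_measurable cnM" by measurable
  have "(\<integral>\<^sup>+z. f (z i k) \<partial>noise) = (\<integral>\<^sup>+y. f (y k) \<partial>cnM)"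
    unfolding noise_def by (rule nn_integral_PiM_component[where N="\<lambda>_. cnM" and f="\<lambda>y. f (y k)"]) simp_all
  also have "\<dots> = (\<integral>\<^sup>+x. f x \<partial>CN01)"
    by (rule nn_integral_PiM_component[where N="\<lambda>_. CN01"]) simp_all
  finally show ?thesis .
qed

lemma measurable_noise_component: "(\<lambda>z. z i k) \<in> borel_measurable noise"
proof (rule measurable_compose[OF _ measurable_seqM_apply])
  show "(\<lambda>z. z i) \<in> noise \<rightarrow>\<^sub>M seqM"
    by (rule measurable_PiM_UNIV_component[where f="\<lambda>z. z"]) (rule measurable_ident_sets[OF sets_noise])
qed

lemma not_quiet_prob:
  assumes \<kappa>: "\<kappa> \<ge> 0"
  shows "(\<integral>\<^sup>+z. indicator {z. \<not> quiet \<kappa> T z} z \<partial>noise2) \<le> ennreal (8 * real T * exp (- (\<kappa>\<^sup>2 / 2)))"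
proof -
  interpret noi: prob_space noise by simp
  interpret q: pair_sigma_finite noise noise ..
  let ?A = "{z::complex. \<kappa> < cmod z}"
  have A[measurable]: "(indicator ?A :: complex \<Rightarrow> ennreal) \<in> borel_measurable CN01" by measurable
  have A'[measurable]: "(indicator ?A :: complex \<Rightarrow> ennreal) \<in> borel_measurable borel" by measurable
  have c: "(\<lambda>z. indicator ?A (z i k) :: ennreal) \<in> borel_measurable noise" for i k
    by (rule measurable_compose[OF measurable_noise_component A'])
  have c1: "(\<lambda>z. indicator ?A (fst z i k) :: ennreal) \<in> borel_measurable noise2" for i k
    by (rule measurable_compose[OF measurable_fst c])
  have c2: "(\<lambda>z. indicator ?A (snd z i k) :: ennreal) \<in> borel_measurable noise2" for i k
    by (rule measurable_compose[OF measurable_snd c])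
  have comp: "(\<integral>\<^sup>+z. indicator ?A (z i k) \<partial>noise) \<le> ennreal (2 * exp (- (\<kappa>\<^sup>2 / 2)))" for i k
    using CN01_tail[OF \<kappa>] by (subst nn_integral_noise_component[OF A]) simp
  have 1: "(\<integral>\<^sup>+z. indicator ?A (fst z i k) \<partial>noise2) \<le> ennreal (2 * exp (- (\<kappa>\<^sup>2 / 2)))" for i k
  proof -
    have "(\<integral>\<^sup>+z. indicator ?A (fst z i k) \<partial>noise2) = (\<integral>\<^sup>+a. \<integral>\<^sup>+b. indicator ?A (a i k) \<partial>noise \<partial>noise)"
      by (subst noi.nn_integral_fst[symmetric]) (simp_all add: c1 c2)
    then show ?thesis using comp noi.emeasure_space_1 by simp
  qed
  have 2: "(\<integral>\<^sup>+z. indicator ?A (snd z i k) \<partial>noise2) \<le> ennreal (2 * exp (- (\<kappa>\<^sup>2 / 2)))" for i k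
  proof -
    have "(\<integral>\<^sup>+z. indicator ?A (snd z i k) \<partial>noise2) = (\<integral>\<^sup>+a. \<integral>\<^sup>+b. indicator ?A (b i k) \<partial>noise \<partial>noise)"
      by (subst noi.nn_integral_fst[symmetric]) (simp_all add: c1 c2)
    then show ?thesis using comp noi.emeasure_space_1 by simp
  qed
  have "(\<integral>\<^sup>+z. indicator {z. \<not> quiet \<kappa> T z} z \<partial>noise2) \<le>
    (\<integral>\<^sup>+z. (\<Sum>i\<in>UNIV. \<Sum>k<T. indicator ?A (fst z i k) + indicator ?A (snd z i k)) \<partial>noise2)"
  proof (rule nn_integral_mono)
    fix z
    show "indicator {z. \<not> quiet \<kappa> T z} z \<le> (\<Sum>i\<in>UNIV. \<Sum>k<T. indicator ?A (fst z i k) + indicator ?A (snd z i k) :: ennreal)"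
    proof (cases "quiet \<kappa> T z")
      case False
      then obtain i k where k: "k < T" "\<kappa> < cmod (fst z i k) \<or> \<kappa> < cmod (snd z i k)"
        by (auto simp: quiet_def not_le)
      have "1 \<le> (indicator ?A (fst z i k) + indicator ?A (snd z i k) :: ennreal)"
        using k(2) by (auto simp: indicator_def)
      also have "\<dots> \<le> (\<Sum>k<T. indicator ?A (fst z i k) + indicator ?A (snd z i k))"
        using k(1) by (intro member_le_sum) auto
      also have "\<dots> \<le> (\<Sum>i\<in>UNIV. \<Sum>k<T. indicator ?A (fst z i k) + indicator ?A (snd z i k))"
        by (intro member_le_sum) auto
      finally show ?thesis using False by simp
    qed simp
  qed
  also have "\<dots> = (\<Sum>i\<in>UNIV. \<Sum>k<T. (\<integral>\<^sup>+z. indicator ?A (fst z i k) \<partial>noise2) + (\<integral>\<^sup>+z. indicator ?A (snd z i k) \<partial>noise2))"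
    by (subst nn_integral_sum, use c1 c2 in measurable, intro sum.cong refl, subst nn_integral_sum, use c1 c2 in measurable)
      (intro sum.cong refl nn_integral_add c1 c2)
  also have "\<dots> \<le> (\<Sum>i\<in>(UNIV::relay set). \<Sum>k<T. ennreal (2 * exp (- (\<kappa>\<^sup>2 / 2))) + ennreal (2 * exp (- (\<kappa>\<^sup>2 / 2))))"
    by (intro sum_mono add_mono 1 2)
  also have "\<dots> = (\<Sum>i\<in>(UNIV::relay set). \<Sum>k<T. ennreal (4 * exp (- (\<kappa>\<^sup>2 / 2))))"
    by (simp flip: ennreal_plus)
  also have "\<dots> = ennreal (8 * real T * exp (- (\<kappa>\<^sup>2 / 2)))"
    by (simp add: UNIV_relay ennreal_of_nat_eq_real_of_nat mult_2 algebra_simps flip: ennreal_plus ennreal_mult')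
  finally show ?thesis .
qed

text \<open>An error requires loud noise, an outage, or a confusion of codewords without outage. The
  event \<open>outage\<close> is left open: any measurable event will do off which the union bound
  is at most \<open>\<delta>\<close>.\<close>

lemma qmf_scheme_error:
  assumes T: "T > 0" and M: "M > 0" and tm: "\<And>i. t i \<in> borel_measurable borel"
    and t: "\<And>i h. t i h \<le> 1" and \<kappa>: "\<kappa> \<ge> 0" and \<delta>: "\<delta> \<ge> 0"
    and outage: "Measurable.pred (fading \<Otimes>\<^sub>M fading) outage"
    and reliable: "\<And>hs hr. \<not> outage (hs, hr) \<Longrightarrow>
      real M * (path_bound \<rho> \<kappa> T (listen_slots T t R1 (hs R1)) (hs R1) (hr R1) *
        path_bound \<rho> \<kappa> T (listen_slots T t R2 (hs R2)) (hs R2) (hr R2)) \<le> \<delta>"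
  shows "ennreal (err_prob \<rho> (qmf_scheme \<rho> \<kappa> t T M)) \<le>
    ennreal (8 * real T * exp (- (\<kappa>\<^sup>2 / 2)) + \<delta>) + emeasure (fading \<Otimes>\<^sub>M fading) {h. outage h}"
proof -
  let ?c = "qmf_scheme \<rho> \<kappa> t T M"
  let ?q = "\<integral>\<^sup>+z. indicator {z. \<not> quiet \<kappa> T z} z \<partial>noise2"
  have c: "valid_code ?c" by (rule valid_qmf_scheme[OF T M tm])
  define F :: "nat \<Rightarrow> cseq \<times> (relay \<Rightarrow> cseq) \<times> (relay \<Rightarrow> complex) \<times> (relay \<Rightarrow> complex) \<times> (relay \<Rightarrow> cseq) \<times> (relay \<Rightarrow> cseq) \<Rightarrow> ennreal"
    where "F w = (\<lambda>(u, v, hs, hr, z). indicator (- {w}) (decided \<rho> ?c w u v hs hr z))" for w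
  interpret fad: prob_space fading by simp
  interpret noi: prob_space noise2 by (rule prob_space_noise2)
  interpret V: prob_space "rseeds ?c" by (rule space_seeds[OF c])
  interpret U: prob_space discM by simp
  have mo: "{h. outage h} \<in> sets (fading \<Otimes>\<^sub>M fading)"
    using outage by (simp add: pred_def space_pair_measure)
  have mq: "{z. \<not> quiet \<kappa> T z} \<in> sets noise2"
  proof -
    have [measurable]: "(\<lambda>z. cmod (fst z i k)) \<in> borel_measurable noise2" "(\<lambda>z. cmod (snd z i k)) \<in> borel_measurable noise2" for i k
      by (rule measurable_compose[OF measurable_compose[OF measurable_fst measurable_noise_component]]
        measurable_compose[OF measurable_compose[OF measurable_snd measurable_noise_component]]; simp)+
    have "Measurable.pred noise2 (\<lambda>z. \<not> quiet \<kappa> T z)" unfolding quiet_def all_relay by measurable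
    then show ?thesis by (simp add: pred_def space_pair_measure)
  qed
  have each: "(\<integral>\<^sup>+p. F w p \<partial>(cseed ?c \<Otimes>\<^sub>M rseeds ?c \<Otimes>\<^sub>M fading \<Otimes>\<^sub>M fading \<Otimes>\<^sub>M noise2)) \<le>
      ?q + ennreal \<delta> + emeasure (fading \<Otimes>\<^sub>M fading) {h. outage h}" if w: "w < M" for w
  proof -
    have "(\<integral>\<^sup>+p. F w p \<partial>(cseed ?c \<Otimes>\<^sub>M rseeds ?c \<Otimes>\<^sub>M fading \<Otimes>\<^sub>M fading \<Otimes>\<^sub>M noise2)) =
        (\<integral>\<^sup>+hs. \<integral>\<^sup>+hr. \<integral>\<^sup>+v. \<integral>\<^sup>+z. \<integral>\<^sup>+u. F w (u, v, hs, hr, z) \<partial>cseed ?c \<partial>noise2 \<partial>rseeds ?c \<partial>fading \<partial>fading)"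
      unfolding F_def
      by (subst nn_integral_five_seed_last[OF _ _ _ _ _ _ _ _ _ _ emeasure_error(2)[OF c]])
        (simp_all del: qmf_scheme_sel add: space_seeds[OF c] valid_codeD[OF c] prob_space_noise2 space_pair_measure)
    also have "\<dots> \<le> (\<integral>\<^sup>+hs. \<integral>\<^sup>+hr. \<integral>\<^sup>+v. \<integral>\<^sup>+z. indicator {z. \<not> quiet \<kappa> T z} z +
        (ennreal \<delta> + indicator {h. outage h} (hs, hr)) \<partial>noise2 \<partial>rseeds ?c \<partial>fading \<partial>fading)"
    proof (intro nn_integral_mono)
      fix hs hr v z
      have le1: "(\<integral>\<^sup>+u. F w (u, v, hs, hr, z) \<partial>cseed ?c) \<le> 1"
      proof -
        have "(\<integral>\<^sup>+u. F w (u, v, hs, hr, z) \<partial>cseed ?c) \<le> (\<integral>\<^sup>+u. 1 \<partial>cseed ?c)"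
          by (intro nn_integral_mono) (simp add: F_def indicator_def)
        then show ?thesis using U.emeasure_space_1 by simp
      qed
      show "(\<integral>\<^sup>+u. F w (u, v, hs, hr, z) \<partial>cseed ?c) \<le>
          indicator {z. \<not> quiet \<kappa> T z} z + (ennreal \<delta> + indicator {h. outage h} (hs, hr))"
      proof (cases "quiet \<kappa> T z \<and> \<not> outage (hs, hr)")
        case True
        then have "(\<integral>\<^sup>+u. F w (u, v, hs, hr, z) \<partial>cseed ?c) \<le> ennreal \<delta>"
          using order_trans[OF decoding_error_prob[where z=z and hs=hs and \<rho>=\<rho> and v=v and hr=hr, OF t w _ \<kappa>] ennreal_leI[OF reliable]] by (simp add: F_def)
        then show ?thesis by (simp add: add_increasing add_increasing2)
      next
        case False
        then have "1 \<le> indicator {z. \<not> quiet \<kappa> T z} z + (ennreal \<delta> + indicator {h. outage h} (hs, hr))"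
          by (auto simp: indicator_def add_increasing add_increasing2)
        with le1 show ?thesis by (rule order_trans)
      qed
    qed
    also have "\<dots> = (\<integral>\<^sup>+hs. \<integral>\<^sup>+hr. (?q + ennreal \<delta>) + indicator {h. outage h} (hs, hr) \<partial>fading \<partial>fading)"
      using mq noi.emeasure_space_1 V.emeasure_space_1 by (simp add: nn_integral_add add.assoc)
    also have "\<dots> = (\<integral>\<^sup>+h. (?q + ennreal \<delta>) + indicator {h. outage h} h \<partial>(fading \<Otimes>\<^sub>M fading))"
      using mo by (subst fad.nn_integral_fst[symmetric]) simp_all
    also have "\<dots> = ?q + ennreal \<delta> + emeasure (fading \<Otimes>\<^sub>M fading) {h. outage h}"
    proof -
      interpret ff: pair_prob_space fading fading ..
      show ?thesis using mo ff.emeasure_space_1 by (simp add: nn_integral_add)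
    qed
    finally show ?thesis .
  qed
  have "ennreal (err_prob \<rho> ?c) = (\<Sum>w<M. \<integral>\<^sup>+p. F w p \<partial>(cseed ?c \<Otimes>\<^sub>M rseeds ?c \<Otimes>\<^sub>M fading \<Otimes>\<^sub>M fading \<Otimes>\<^sub>M noise2)) / of_nat M"
    using emeasure_error(1)[OF c, of \<rho>] by (simp add: F_def)
  also have "\<dots> \<le> (\<Sum>w<M. ?q + ennreal \<delta> + emeasure (fading \<Otimes>\<^sub>M fading) {h. outage h}) / of_nat M"
    by (intro divide_right_mono_ennreal sum_mono each) simp
  also have "\<dots> = ?q + ennreal \<delta> + emeasure (fading \<Otimes>\<^sub>M fading) {h. outage h}"
    using M by (simp only: sum_constant card_lessThan mult.commute[of "of_nat M"]) (rule ennreal_mult_divide_eq, auto)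
  also have "\<dots> \<le> ennreal (8 * real T * exp (- (\<kappa>\<^sup>2 / 2))) + ennreal \<delta> + emeasure (fading \<Otimes>\<^sub>M fading) {h. outage h}"
    by (intro add_right_mono not_quiet_prob \<kappa>)
  finally show ?thesis using \<delta> by simp
qed

section \<open>Outage of the quantize-map-forward scheme\<close>

text \<open>The cut-off loses nothing in the exponent: squared gains above 1 have constant
  probability, and a link with negative exponent carries nothing on the scale of
  \<open>ln \<rho>\<close>. A zero coefficient has exponent 0 because
  \<open>ln 0 = 0\<close>.\<close>

definition exponent :: "real \<Rightarrow> complex \<Rightarrow> real" where
  "exponent \<rho> h = max 0 (min 1 (ln ((cmod h)\<^sup>2 * \<rho>) / ln \<rho>))"

lemma exponent_bounds [simp]: "0 \<le> exponent \<rho> h" "exponent \<rho> h \<le> 1"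
  by (simp_all add: exponent_def)

lemma measurable_exponent [measurable]: "exponent \<rho> \<in> borel_measurable borel"
  unfolding exponent_def by measurable

lemma powr_exponent_le:
  assumes "\<rho> > 1" "exponent \<rho> h > 0"
  shows "h \<noteq> 0" "\<rho> powr exponent \<rho> h \<le> (cmod h)\<^sup>2 * \<rho>"
proof -
  show h: "h \<noteq> 0" using assms(2) by (auto simp: exponent_def)
  then have pos: "(cmod h)\<^sup>2 * \<rho> > 0" using assms(1) by simp
  have "exponent \<rho> h \<le> ln ((cmod h)\<^sup>2 * \<rho>) / ln \<rho>" using assms(2) by (simp add: exponent_def max_def split: if_splits)
  then have "exponent \<rho> h * ln \<rho> \<le> ln ((cmod h)\<^sup>2 * \<rho>)" using assms(1) by (simp add: pos_le_divide_eq)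
  then have "exp (exponent \<rho> h * ln \<rho>) \<le> (cmod h)\<^sup>2 * \<rho>" using pos by (metis exp_le_cancel_iff exp_ln)
  then show "\<rho> powr exponent \<rho> h \<le> (cmod h)\<^sup>2 * \<rho>" using assms(1) by (simp add: powr_def)
qed

lemma powr_deficit_large:
  assumes \<rho>: "\<rho> > 1" and y: "1 < y" "y \<le> \<rho> powr (1 - exponent \<rho> h)"
  shows "(cmod h)\<^sup>2 \<le> 1 / y"
proof (cases "h = 0")
  case False
  then have pos: "(cmod h)\<^sup>2 * \<rho> > 0" using \<rho> by simp
  \<comment> \<open>\<open>1 < y\<close> excludes the cap at 1, where \<open>exponent\<close> would
    no longer bound the gain from above.\<close>
  have "exponent \<rho> h < 1"
    using y \<rho> exponent_bounds(2)[of \<rho> h] by (cases "exponent \<rho> h = 1") (auto simp del: exponent_bounds simp: less_le)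
  then have "ln ((cmod h)\<^sup>2 * \<rho>) / ln \<rho> \<le> exponent \<rho> h" by (simp add: exponent_def max_def min_def split: if_splits)
  then have "ln ((cmod h)\<^sup>2 * \<rho>) \<le> exponent \<rho> h * ln \<rho>" using \<rho> by (simp add: pos_divide_le_eq)
  then have "(cmod h)\<^sup>2 * \<rho> \<le> exp (exponent \<rho> h * ln \<rho>)" using pos by (metis exp_le_cancel_iff exp_ln)
  then have "(cmod h)\<^sup>2 * \<rho> \<le> \<rho> powr exponent \<rho> h" using \<rho> by (simp add: powr_def)
  moreover have "y * \<rho> powr exponent \<rho> h \<le> \<rho>"
    using y(2) \<rho> by (simp add: powr_diff pos_le_divide_eq)
  ultimately have "y * ((cmod h)\<^sup>2 * \<rho>) \<le> \<rho>"
    using y(1) by (meson mult_left_mono order_trans less_imp_le zero_less_one less_trans)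
  then have "y * (cmod h)\<^sup>2 * \<rho> \<le> 1 * \<rho>" by simp
  then have "y * (cmod h)\<^sup>2 \<le> 1" using \<rho> by (simp only: mult_le_cancel_right_pos)
  then show ?thesis using y(1) by (simp add: pos_le_divide_eq mult.commute)
qed (use y in simp)

text \<open>1 plus all powers of 2 that are at most \<open>y\<close> add up to more than
  \<open>y\<close> for \<open>y \<ge> 1\<close>; truncation at level \<open>m\<close> caps both
  sides.\<close>

lemma dyadic_layers: "min (2 ^ m) y \<le> 1 + (\<Sum>k<m. 2 ^ k * (of_bool (2 ^ k \<le> y) :: real))"
proof (induction m)
  case (Suc m)
  have "min (2 ^ Suc m) y \<le> min (2 ^ m) y + 2 ^ m * of_bool (2 ^ m \<le> y)"
    by (auto simp: min_def)
  with Suc show ?case by simp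
qed (simp add: min_def)

text \<open>The variable reaches \<open>y\<close> with probability at most \<open>1 / y\<close> and
  never exceeds \<open>\<rho>\<close>. Such a tail has a mean that grows only logarithmically: each
  of the about \<open>log 2 \<rho>\<close> dyadic layers contributes at most 1.\<close>

lemma deficit_moment:
  assumes \<rho>: "\<rho> > 1"
  shows "(\<integral>\<^sup>+h. ennreal (\<rho> powr (1 - exponent \<rho> h)) \<partial>CN01) \<le> ennreal (2 + log 2 \<rho>)"
proof -
  define m where "m = nat \<lceil>log 2 \<rho>\<rceil>"
  have lm: "log 2 \<rho> \<le> real m" unfolding m_def by (rule real_nat_ceiling_ge)
  have "log 2 \<rho> > 0" using \<rho> by simp
  then have mu: "real m \<le> log 2 \<rho> + 1" unfolding m_def using ceiling_correct[of "log 2 \<rho>"] by simp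
  have \<rho>m: "\<rho> \<le> 2 ^ m" using lm \<rho> by (simp add: log_le_iff powr_realpow)
  interpret CN: prob_space CN01 by simp
  define S where "S k = {h. 2 ^ k \<le> \<rho> powr (1 - exponent \<rho> h)}" for k :: nat
  have [measurable]: "S k \<in> sets CN01" for k unfolding S_def by measurable
  have eS: "emeasure CN01 (S k) \<le> ennreal (1 / 2 ^ k)" for k
  proof (cases "k = 0")
    case True
    then show ?thesis using CN.emeasure_le_1 by simp
  next
    case False
    have "emeasure CN01 (S k) \<le> emeasure CN01 {h. (cmod h)\<^sup>2 \<le> 1 / 2 ^ k}"
      using False by (intro emeasure_mono) (auto simp: S_def intro!: powr_deficit_large[OF \<rho>])
    also have "\<dots> \<le> ennreal (1 / 2 ^ k)" by (rule CN01_disc_le) simp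
    finally show ?thesis .
  qed
  have "(\<integral>\<^sup>+h. ennreal (\<rho> powr (1 - exponent \<rho> h)) \<partial>CN01) \<le>
      (\<integral>\<^sup>+h. 1 + (\<Sum>k<m. ennreal (2 ^ k) * indicator (S k) h) \<partial>CN01)"
  proof (rule nn_integral_mono)
    fix h
    have "\<rho> powr (1 - exponent \<rho> h) \<le> \<rho> powr 1" using \<rho> by (intro powr_mono) auto
    then have "\<rho> powr (1 - exponent \<rho> h) \<le> 2 ^ m" using \<rho> \<rho>m by simp
    then have "\<rho> powr (1 - exponent \<rho> h) \<le> 1 + (\<Sum>k<m. 2 ^ k * indicat_real (S k) h)"
      using dyadic_layers[of m "\<rho> powr (1 - exponent \<rho> h)"] by (simp only: S_def indicator_def mem_Collect_eq min_absorb2)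
    then have "ennreal (\<rho> powr (1 - exponent \<rho> h)) \<le> ennreal (1 + (\<Sum>k<m. 2 ^ k * indicat_real (S k) h))" by (rule ennreal_leI)
    also have "\<dots> = 1 + (\<Sum>k<m. ennreal (2 ^ k) * indicator (S k) h)"
      by (simp add: sum_nonneg ennreal_plus ennreal_mult' ennreal_indicator flip: sum_ennreal)
    finally show "ennreal (\<rho> powr (1 - exponent \<rho> h)) \<le> 1 + (\<Sum>k<m. ennreal (2 ^ k) * indicator (S k) h)" .
  qed
  also have "\<dots> = 1 + (\<Sum>k<m. ennreal (2 ^ k) * emeasure CN01 (S k))"
  proof -
    have "(\<integral>\<^sup>+h. (\<Sum>k<m. ennreal (2 ^ k) * indicator (S k) h) \<partial>CN01) = (\<Sum>k<m. ennreal (2 ^ k) * emeasure CN01 (S k))"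
      by (subst nn_integral_sum, simp) (intro sum.cong refl nn_integral_cmult_indicator, measurable)
    moreover have "(\<lambda>h. \<Sum>k<m. ennreal (2 ^ k) * indicator (S k) h) \<in> borel_measurable CN01" by measurable
    ultimately show ?thesis using CN.emeasure_space_1 by (subst nn_integral_add) simp_all
  qed
  also have "\<dots> \<le> 1 + (\<Sum>k<m. ennreal (2 ^ k) * ennreal (1 / 2 ^ k))"
    by (intro add_mono sum_mono mult_left_mono eS) auto
  also have "\<dots> = 1 + (\<Sum>k<m. 1)"
    by (intro arg_cong[where f="\<lambda>x. 1 + x"] sum.cong) (simp_all flip: ennreal_mult')
  also have "\<dots> = ennreal (1 + real m)" by (simp add: ennreal_of_nat_eq_real_of_nat ennreal_plus)
  also have "\<dots> \<le> ennreal (2 + log 2 \<rho>)" using mu by (intro ennreal_leI) simp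
  finally show ?thesis .
qed

definition deficit :: "real \<Rightarrow> (relay \<Rightarrow> complex) \<times> (relay \<Rightarrow> complex) \<Rightarrow> real" where
  "deficit \<rho> h = (1 - exponent \<rho> (fst h R1)) + (1 - exponent \<rho> (fst h R2)) +
     ((1 - exponent \<rho> (snd h R1)) + (1 - exponent \<rho> (snd h R2)))"

lemma measurable_fading_component: "(\<lambda>h. h i) \<in> borel_measurable fading"
  by (rule measurable_PiM_UNIV_component[where f="\<lambda>h. h"]) (rule measurable_ident_sets[OF sets_fading])

lemma measurable_deficit [measurable]: "deficit \<rho> \<in> borel_measurable (fading \<Otimes>\<^sub>M fading)"
  unfolding deficit_def[abs_def] by measurable

text \<open>Markov's inequality for \<open>\<rho> powr deficit \<rho> h\<close>, whose mean factors
  into four independent moments. The outage exponent is obtained without describing the outage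
  region, and the logarithms disappear in the exponent.\<close>

lemma outage_prob:
  assumes \<rho>: "\<rho> > 1"
  shows "emeasure (fading \<Otimes>\<^sub>M fading) {h. d \<le> deficit \<rho> h} \<le> ennreal (\<rho> powr (- d) * (2 + log 2 \<rho>) ^ 4)"
proof -
  interpret fad: prob_space fading by simp
  interpret CN: prob_space CN01 by simp
  let ?f = "\<lambda>h. ennreal (\<rho> powr (1 - exponent \<rho> h))"
  let ?g = "\<lambda>h. ?f (h R1) * ?f (h R2)"
  let ?I = "\<integral>\<^sup>+h. ?f h \<partial>CN01"
  have f[measurable]: "?f \<in> borel_measurable CN01" by measurable
  have fi: "(\<lambda>h. ?f (h i)) \<in> borel_measurable fading" for i
    using f by (intro measurable_compose[OF measurable_fading_component]) simp
  have g: "?g \<in> borel_measurable fading"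
    by (rule borel_measurable_times_ennreal[OF fi fi])
  have g1: "(\<lambda>h. ?g (fst h)) \<in> borel_measurable (fading \<Otimes>\<^sub>M fading)"
    and g2: "(\<lambda>h. ?g (snd h)) \<in> borel_measurable (fading \<Otimes>\<^sub>M fading)"
    by (rule measurable_compose[OF measurable_fst g] measurable_compose[OF measurable_snd g])+
  have Ig: "(\<integral>\<^sup>+h. ?g h \<partial>fading) = ?I * ?I"
    unfolding fading_def
    by (subst nn_integral_PiM_relay) (use g in \<open>simp_all add: fading_def nn_integral_cmult nn_integral_multc\<close>)
  have sd: "{h. d \<le> deficit \<rho> h} \<in> sets (fading \<Otimes>\<^sub>M fading)"
  proof -
    have "{h \<in> space (fading \<Otimes>\<^sub>M fading). d \<le> deficit \<rho> h} \<in> sets (fading \<Otimes>\<^sub>M fading)" by measurable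
    then show ?thesis by (simp add: space_pair_measure)
  qed
  have "emeasure (fading \<Otimes>\<^sub>M fading) {h. d \<le> deficit \<rho> h} =
      (\<integral>\<^sup>+h. indicator {h. d \<le> deficit \<rho> h} h \<partial>(fading \<Otimes>\<^sub>M fading))" using sd by simp
  also have "\<dots> \<le> (\<integral>\<^sup>+h. ennreal (\<rho> powr (- d)) * (?g (fst h) * ?g (snd h)) \<partial>(fading \<Otimes>\<^sub>M fading))"
  proof (rule nn_integral_mono)
    fix h
    have "ennreal (\<rho> powr (- d)) * (?g (fst h) * ?g (snd h)) = ennreal (\<rho> powr (deficit \<rho> h - d))"
      using \<rho> by (simp add: deficit_def ennreal_mult'[symmetric] powr_add[symmetric] algebra_simps)
    moreover have "1 \<le> \<rho> powr (deficit \<rho> h - d)" if "d \<le> deficit \<rho> h"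
      using \<rho> that by (simp add: ge_one_powr_ge_zero)
    ultimately show "indicator {h. d \<le> deficit \<rho> h} h \<le> ennreal (\<rho> powr (- d)) * (?g (fst h) * ?g (snd h))"
      by (auto simp: indicator_def)
  qed
  also have "\<dots> = ennreal (\<rho> powr (- d)) * (\<integral>\<^sup>+a. \<integral>\<^sup>+b. ?g a * ?g b \<partial>fading \<partial>fading)"
    using g1 g2 by (subst fad.nn_integral_fst[symmetric]) (auto simp: nn_integral_cmult intro!: borel_measurable_times_ennreal)
  also have "\<dots> = ennreal (\<rho> powr (- d)) * (?I * ?I * (?I * ?I))"
    using g by (simp add: nn_integral_cmult nn_integral_multc Ig)
  also have "\<dots> \<le> ennreal (\<rho> powr (- d)) * (ennreal (2 + log 2 \<rho>) * ennreal (2 + log 2 \<rho>) *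
      (ennreal (2 + log 2 \<rho>) * ennreal (2 + log 2 \<rho>)))"
    by (intro mult_mono deficit_moment \<rho>) auto
  also have "\<dots> = ennreal (\<rho> powr (- d) * (2 + log 2 \<rho>) ^ 4)"
  proof -
    have "ennreal a * (ennreal l * ennreal l * (ennreal l * ennreal l)) = ennreal (a * l ^ 4)" if "a \<ge> 0" "l \<ge> 0" for a l
      using that by (simp add: power4_eq_xxxx mult.assoc flip: ennreal_mult)
    moreover have "0 \<le> 2 + log 2 \<rho>" using \<rho> by (simp add: add_nonneg_nonneg)
    ultimately show ?thesis by simp
  qed
  finally show ?thesis .
qed

text \<open>For a positive exponent the area ratio applies, and for exponent 0 the trivial bound 1,
  which \<open>e \<ge> 0\<close> covers.\<close>

lemma hit_prob_le_powr:
  assumes \<rho>: "\<rho> > 1" and x: "x \<ge> 0" "x\<^sup>2 \<le> \<rho> powr e" and e: "e \<ge> 0"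
  shows "hit_prob x (h * of_real (sqrt \<rho>)) \<le> \<rho> powr (e - exponent \<rho> h)"
proof (cases "exponent \<rho> h > 0")
  case True
  note h = powr_exponent_le[OF \<rho> True]
  have n: "(cmod (h * of_real (sqrt \<rho>)))\<^sup>2 = (cmod h)\<^sup>2 * \<rho>" using \<rho> by (simp add: norm_mult power_mult_distrib)
  have pos: "(cmod h)\<^sup>2 * \<rho> > 0" using h \<rho> by simp
  have "hit_prob x (h * of_real (sqrt \<rho>)) \<le> x\<^sup>2 / ((cmod h)\<^sup>2 * \<rho>)"
  proof (cases "cmod (h * of_real (sqrt \<rho>)) \<le> x")
    case True
    then have "(cmod h)\<^sup>2 * \<rho> \<le> x\<^sup>2" unfolding n[symmetric] by (intro power_mono) auto
    then show ?thesis using True pos by (simp add: hit_prob_def)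
  next
    case False
    then show ?thesis unfolding hit_prob_def power_divide n by simp
  qed
  also have "\<dots> \<le> \<rho> powr e / \<rho> powr exponent \<rho> h"
    using x h(2) \<rho> by (intro frac_le) auto
  finally show ?thesis by (simp add: powr_diff)
next
  case False
  then have "exponent \<rho> h = 0" using exponent_bounds(1)[of \<rho> h] by linarith
  moreover have "hit_prob x (h * of_real (sqrt \<rho>)) \<le> 1"
    using x by (auto simp: hit_prob_def power_le_one_iff divide_le_eq_1)
  moreover have "1 \<le> \<rho> powr e" using \<rho> e by (simp add: ge_one_powr_ge_zero)
  ultimately show ?thesis by simp
qed

text \<open>The two kinds of confusion decay with exponents \<open>t * exponent \<rho> hs\<close>
  and \<open>(1 - t) * exponent \<rho> hr\<close> per slot of the block, so the smaller one,
  \<open>f\<close>, governs the path; \<open>e\<close> pays for the noise radius and for the number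
  of lists. The additive 1 pays for rounding \<open>t * real T\<close> down to whole slots.\<close>

lemma path_bound_le:
  fixes t :: real and T :: nat and hs hr :: complex
  assumes \<rho>: "\<rho> > 1" and \<kappa>: "\<kappa> \<ge> 0" "(2 * \<kappa> + 5)\<^sup>2 \<le> \<rho> powr e" and e: "e \<ge> 0"
    and t: "0 \<le> t" "t \<le> 1"
  defines "n \<equiv> nat \<lfloor>t * real T\<rfloor>" and "f \<equiv> min (t * exponent \<rho> hs) ((1 - t) * exponent \<rho> hr)"
  shows "path_bound \<rho> \<kappa> T n hs hr \<le> 2 * \<rho> powr ((e - f) * real T + 1)"
proof -
  let ?a = "exponent \<rho> hs" and ?b = "exponent \<rho> hr"
  have tT: "0 \<le> t * real T" "t * real T \<le> real T" using t by (simp_all add: mult_left_le_one_le)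
  have nt: "real n \<le> t * real T" "t * real T - 1 \<le> real n" using tT(1) unfolding n_def by linarith+
  then have nT: "n \<le> T" using tT by linarith
  have fa: "f \<le> t * ?a" and fb: "f \<le> (1 - t) * ?b" by (simp_all add: f_def)
  have x: "(\<kappa> + 2)\<^sup>2 \<le> \<rho> powr e" "(2 * \<kappa>)\<^sup>2 \<le> \<rho> powr e"
    by (rule order_trans[OF power_mono \<kappa>(2)]; use \<kappa>(1) in simp)+
  have "hit_prob (\<kappa> + 2) (hs * of_real (sqrt \<rho>)) ^ n \<le> (\<rho> powr (e - ?a)) ^ n"
    by (intro power_mono hit_prob_le_powr \<rho> x e) (use \<kappa> in auto)
  also have "\<dots> = \<rho> powr ((e - ?a) * real n)" using \<rho> by (simp add: powr_powr[symmetric] powr_realpow)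
  also have "\<dots> \<le> \<rho> powr ((e - f) * real T + 1)"
  proof (rule powr_mono)
    have "e * real n \<le> e * real T" using nT e by (intro mult_left_mono) auto
    moreover have "f * real T \<le> t * ?a * real T" by (intro mult_right_mono fa) simp
    moreover have "?a * (t * real T - 1) \<le> ?a * real n" by (intro mult_left_mono nt) simp
    moreover have "?a \<le> 1" by simp
    ultimately show "(e - ?a) * real n \<le> (e - f) * real T + 1"
      by (simp add: algebra_simps del: exponent_bounds)
  qed (use \<rho> in simp)
  finally have 1: "hit_prob (\<kappa> + 2) (hs * of_real (sqrt \<rho>)) ^ n \<le> \<rho> powr ((e - f) * real T + 1)" .
  have "((2 * \<kappa> + 5)\<^sup>2) ^ n * hit_prob (2 * \<kappa>) (hr * of_real (sqrt \<rho>)) ^ (T - n) \<le>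
      (\<rho> powr e) ^ n * (\<rho> powr (e - ?b)) ^ (T - n)"
    by (intro mult_mono power_mono hit_prob_le_powr \<rho> x \<kappa>(2) e) (use \<kappa> in auto)
  also have "\<dots> = \<rho> powr (e * real n + (e - ?b) * real (T - n))"
    using \<rho> by (simp add: powr_powr[symmetric] powr_realpow powr_add)
  also have "\<dots> \<le> \<rho> powr ((e - f) * real T + 1)"
  proof (rule powr_mono)
    have "f * real T \<le> (1 - t) * ?b * real T" by (intro mult_right_mono fb) simp
    moreover have "?b * ((1 - t) * real T) \<le> ?b * (real T - real n)"
      using nt by (intro mult_left_mono) (auto simp: algebra_simps)
    ultimately show "e * real n + (e - ?b) * real (T - n) \<le> (e - f) * real T + 1"
      using nT by (simp add: of_nat_diff algebra_simps)
  qed (use \<rho> in simp)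
  finally show ?thesis using 1 unfolding path_bound_def by linarith
qed

section \<open>Schedules and the exponents that they protect\<close>

definition schedule_rate :: "(real \<Rightarrow> real) \<Rightarrow> real \<Rightarrow> real \<Rightarrow> real" where
  "schedule_rate t \<alpha> \<beta> = min (t \<alpha> * \<alpha>) ((1 - t \<alpha>) * \<beta>)"

text \<open>
  A schedule \<open>t\<close>, a function of the exponent of the source-relay channel, protects a multiplexing gain
  \<open>s\<close> up to a total exponent deficit \<open>d\<close> of the four channels.
\<close>

definition protects :: "(real \<Rightarrow> real) \<Rightarrow> real \<Rightarrow> real \<Rightarrow> bool" where
  "protects t s d \<longleftrightarrow> t \<in> borel_measurable borel \<and> (\<forall>\<alpha>\<in>{0..1}. t \<alpha> \<in> {0..1}) \<and>
     (\<forall>\<alpha>\<in>{0..1}. \<forall>\<beta>\<in>{0..1}. \<forall>\<alpha>'\<in>{0..1}. \<forall>\<beta>'\<in>{0..1}.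
        schedule_rate t \<alpha> \<beta> + schedule_rate t \<alpha>' \<beta>' < s \<longrightarrow> d \<le> (1 - \<alpha>) + (1 - \<alpha>') + ((1 - \<beta>) + (1 - \<beta>')))"

text \<open>With equal halves a path has rate \<open>min \<alpha> \<beta> / 2\<close>, which is at
  least \<open>(\<alpha> + \<beta> - 1) / 2\<close> because both exponents are at most 1. An outage
  thus forces the four exponents to sum to less than \<open>2 + 2 * s\<close>.\<close>

lemma protects_static: "protects (\<lambda>_. 1/2) s (2 * (1 - s))"
  by (auto simp: protects_def schedule_rate_def min_def split: if_splits)

text \<open>
  The fraction \<open>s / \<alpha>\<close> is the least with which the first hop carries \<open>s\<close>. It is capped where it
  reaches \<open>1 - s\<close>, since the second hop has to retain the fraction \<open>s\<close>.
\<close>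

definition dynamic_schedule :: "real \<Rightarrow> real \<Rightarrow> real" where
  "dynamic_schedule s \<alpha> = (if \<alpha> \<le> s / (1 - s) then 1 - s else s / \<alpha>)"

text \<open>A minorant that is linear in \<open>\<alpha> + \<beta>\<close>, with slope
  \<open>1 - s\<close>, up to the cap \<open>s\<close>. Two nonnegative path rates with sum below
  \<open>s\<close> both stay off the cap, so the linear bounds can be added.\<close>

lemma schedule_rate_dynamic:
  assumes s: "0 < s" "s < 1/2" and a: "\<alpha> \<in> {0..1}" "\<beta> \<in> {0..1}"
  shows "min s ((1 - s) * (\<alpha> + \<beta> - 1)) \<le> schedule_rate (dynamic_schedule s) \<alpha> \<beta>"
proof (cases "\<alpha> \<le> s / (1 - s)")
  case True
  then have as: "(1 - s) * \<alpha> \<le> s" using s by (simp add: pos_le_divide_eq mult.commute)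
  have "(1 - s) * (\<alpha> + \<beta> - 1) \<le> (1 - s) * \<alpha>" using s a by (intro mult_left_mono) auto
  moreover have "(1 - 2 * s) * \<beta> \<le> (1 - 2 * s) * 1" using s a by (intro mult_left_mono) auto
  then have "(1 - s) * (\<alpha> + \<beta> - 1) \<le> s * \<beta>" using as by (simp add: algebra_simps)
  ultimately show ?thesis using True by (simp add: schedule_rate_def dynamic_schedule_def min_def)
next
  case False
  then have as: "s < (1 - s) * \<alpha>" using s by (simp add: pos_divide_less_eq mult.commute not_le)
  then have "0 < (1 - s) * \<alpha>" using s by linarith
  then have \<alpha>: "\<alpha> > 0" using s by (simp add: zero_less_mult_iff)
  \<comment> \<open>A certificate: both products are nonnegative in this case, and their sum is
    \<open>\<alpha>\<close> times the slack of the inequality for the second hop.\<close>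
  have "0 \<le> ((1 - s) * \<alpha> - s) * (1 - \<alpha>) + (1 - \<beta>) * (s - s * \<alpha>)"
    using as a s by (intro add_nonneg_nonneg mult_nonneg_nonneg) (auto simp: mult_left_le)
  also have "\<dots> = \<alpha> * (\<beta> - (1 - s) * (\<alpha> + \<beta> - 1)) - s * \<beta>" by (simp add: algebra_simps)
  finally have "s * \<beta> / \<alpha> \<le> \<beta> - (1 - s) * (\<alpha> + \<beta> - 1)" using \<alpha> by (simp add: pos_divide_le_eq mult.commute)
  then have "(1 - s) * (\<alpha> + \<beta> - 1) \<le> (1 - s / \<alpha>) * \<beta>" by (simp add: algebra_simps)
  then show ?thesis using False \<alpha> by (simp add: schedule_rate_def dynamic_schedule_def min_def)
qed

lemma protects_dynamic:
  assumes s: "0 < s" "s < 1/2"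
  shows "protects (dynamic_schedule s) s (2 - s / (1 - s))"
  unfolding protects_def
proof (intro conjI ballI impI)
  show "dynamic_schedule s \<in> borel_measurable borel" unfolding dynamic_schedule_def by measurable
  show range: "dynamic_schedule s \<alpha> \<in> {0..1}" if "\<alpha> \<in> {0..1}" for \<alpha>
  proof (cases "\<alpha> \<le> s / (1 - s)")
    case False
    then have "s < (1 - s) * \<alpha>" using s by (simp add: pos_divide_less_eq mult.commute not_le)
    also have "\<dots> \<le> \<alpha>" using s that by (simp add: mult_left_le_one_le)
    finally show ?thesis using False s by (simp add: dynamic_schedule_def)
  qed (use s in \<open>simp add: dynamic_schedule_def\<close>)
  fix \<alpha> \<beta> \<alpha>' \<beta>' :: real
  assume a: "\<alpha> \<in> {0..1}" "\<beta> \<in> {0..1}" "\<alpha>' \<in> {0..1}" "\<beta>' \<in> {0..1}"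
    and less: "schedule_rate (dynamic_schedule s) \<alpha> \<beta> + schedule_rate (dynamic_schedule s) \<alpha>' \<beta>' < s"
  have "0 \<le> schedule_rate (dynamic_schedule s) \<alpha> \<beta>" "0 \<le> schedule_rate (dynamic_schedule s) \<alpha>' \<beta>'"
    using range[OF a(1)] range[OF a(3)] a by (auto simp: schedule_rate_def)
  then have "(1 - s) * (\<alpha> + \<beta> - 1) + (1 - s) * (\<alpha>' + \<beta>' - 1) < s"
    using schedule_rate_dynamic[OF s a(1,2)] schedule_rate_dynamic[OF s a(3,4)] less
    by (auto simp: min_def split: if_splits)
  then have "((\<alpha> + \<beta> - 1) + (\<alpha>' + \<beta>' - 1)) * (1 - s) < s"
    by (simp add: algebra_simps)
  then have "(\<alpha> + \<beta> - 1) + (\<alpha>' + \<beta>' - 1) < s / (1 - s)"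
    using s by (simp only: pos_less_divide_eq)
  then show "2 - s / (1 - s) \<le> (1 - \<alpha>) + (1 - \<alpha>') + ((1 - \<beta>) + (1 - \<beta>'))" by simp
qed

lemma scheduled_error:
  assumes \<rho>: "\<rho> > 1" and \<kappa>: "\<kappa> \<ge> 0" "(2 * \<kappa> + 5)\<^sup>2 \<le> \<rho> powr e" and e: "e \<ge> 0"
    and t: "protects t s d" and T: "T > 0" and M: "M > 0" "real M \<le> 2 * \<rho> powr (r * real T)"
    and s: "(r + 2 * e) * real T + 5 \<le> s * real T"
  shows "err_prob \<rho> (qmf_scheme \<rho> \<kappa> (\<lambda>_ h. t (exponent \<rho> h)) T M) \<le>
    8 * real T * exp (- (\<kappa>\<^sup>2 / 2)) + 8 * \<rho> powr (-3) + \<rho> powr (- d) * (2 + log 2 \<rho>) ^ 4"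
proof -
  let ?t = "\<lambda>(_::relay) h. t (exponent \<rho> h)"
  have t01: "0 \<le> t (exponent \<rho> h)" "t (exponent \<rho> h) \<le> 1" for h
    using t by (simp_all add: protects_def)
  have tm: "t \<in> borel_measurable borel" using t by (simp add: protects_def)
  have "ennreal (err_prob \<rho> (qmf_scheme \<rho> \<kappa> ?t T M)) \<le>
    ennreal (8 * real T * exp (- (\<kappa>\<^sup>2 / 2)) + 8 * \<rho> powr (-3)) + emeasure (fading \<Otimes>\<^sub>M fading) {h. d \<le> deficit \<rho> h}"
  proof (rule qmf_scheme_error[OF T M(1) _ _ \<kappa>(1)])
    show "?t i \<in> borel_measurable borel" for i
      by (rule measurable_compose[OF measurable_exponent tm])
    show "Measurable.pred (fading \<Otimes>\<^sub>M fading) (\<lambda>h. d \<le> deficit \<rho> h)" by measurable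
    fix hs hr :: "relay \<Rightarrow> complex"
    assume "\<not> d \<le> deficit \<rho> (hs, hr)"
    define f where "f i = schedule_rate t (exponent \<rho> (hs i)) (exponent \<rho> (hr i))" for i
    have "s \<le> f R1 + f R2"
    proof (rule ccontr)
      assume "\<not> s \<le> f R1 + f R2"
      then have "d \<le> deficit \<rho> (hs, hr)"
        using t unfolding protects_def deficit_def f_def by (simp add: not_le)
      with \<open>\<not> d \<le> deficit \<rho> (hs, hr)\<close> show False by simp
    qed
    then have fT: "s * real T \<le> (f R1 + f R2) * real T" by (intro mult_right_mono) auto
    let ?p = "\<lambda>i. path_bound \<rho> \<kappa> T (listen_slots T ?t i (hs i)) (hs i) (hr i)"
    have p: "?p i \<le> 2 * \<rho> powr ((e - f i) * real T + 1)" for i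
      using path_bound_le[OF \<rho> \<kappa> e t01(1)[of "hs i"] t01(2)[of "hs i"], of T "hs i" "hr i"]
      by (simp add: listen_slots_def f_def schedule_rate_def)
    have alg: "(2 * a) * ((2 * b) * (2 * c)) = 8 * (a * b * c)" for a b c :: real by simp
    have pos: "0 \<le> ?p i" for i by (simp add: path_bound_def)
    have "real M * (?p R1 * ?p R2) \<le> (2 * \<rho> powr (r * real T)) *
        ((2 * \<rho> powr ((e - f R1) * real T + 1)) * (2 * \<rho> powr ((e - f R2) * real T + 1)))"
      by (intro mult_mono M(2) p pos mult_nonneg_nonneg) auto
    \<comment> \<open>The exponents add up to \<open>(r + 2 * e - f R1 - f R2) * real T + 2\<close>,
      which is at most -3 by \<open>s\<close> and \<open>fT\<close>.\<close>
    also have "\<dots> = 8 * \<rho> powr (r * real T + ((e - f R1) * real T + 1) + ((e - f R2) * real T + 1))"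
      by (simp only: alg powr_add[symmetric])
    also have "\<dots> \<le> 8 * \<rho> powr (-3)"
      using s fT \<rho> by (intro mult_left_mono powr_mono) (auto simp: algebra_simps)
    finally show "real M * (?p R1 * ?p R2) \<le> 8 * \<rho> powr (-3)" .
  qed (use t01 in auto)
  also have "\<dots> \<le> ennreal (8 * real T * exp (- (\<kappa>\<^sup>2 / 2)) + 8 * \<rho> powr (-3)) + ennreal (\<rho> powr (- d) * (2 + log 2 \<rho>) ^ 4)"
    by (intro add_left_mono outage_prob \<rho>)
  also have "\<dots> = ennreal (8 * real T * exp (- (\<kappa>\<^sup>2 / 2)) + 8 * \<rho> powr (-3) + \<rho> powr (- d) * (2 + log 2 \<rho>) ^ 4)"
    using \<rho> by (intro ennreal_plus[symmetric]) auto
  finally show ?thesis using \<rho> by (subst (asm) ennreal_le_iff) auto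
qed

section \<open>Families of codes\<close>

text \<open>
  The gap \<open>g\<close> is split as follows: the rate takes \<open>g / 2\<close>. The noise threshold \<open>\<kappa> = \<rho> powr (g / 24)\<close>
  satisfies \<open>(2 * \<kappa> + 5)\<^sup>2 \<le> \<kappa> ^ 3 = \<rho> powr (g / 8)\<close>, which on two paths costs \<open>g / 4\<close>. Rounding of slots and the
  margin \<open>\<rho> powr (-3)\<close> cost at most \<open>5 / T \<le> g / 4\<close>.
\<close>

definition scheduled_code :: "(real \<Rightarrow> real) \<Rightarrow> real \<Rightarrow> real \<Rightarrow> real \<Rightarrow> code" where
  "scheduled_code t r g \<rho> = (let T = nat \<lceil>20 / g\<rceil> in
     qmf_scheme \<rho> (\<rho> powr (g / 24)) (\<lambda>_ h. t (exponent \<rho> h)) T (nat \<lfloor>\<rho> powr ((r + g / 2) * real T)\<rfloor> + 1))"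

lemma blen_scheduled_code:
  assumes "g > 0"
  shows "blen (scheduled_code t r g \<rho>) > 0" "20 / g \<le> real (blen (scheduled_code t r g \<rho>))"
  using assms by (simp_all add: scheduled_code_def Let_def real_nat_ceiling_ge)

lemma msgs_scheduled_code:
  fixes t r g \<rho>
  assumes "\<rho> > 1" "r \<ge> 0" "g > 0"
  defines "c \<equiv> scheduled_code t r g \<rho>"
  shows "\<rho> powr ((r + g / 2) * real (blen c)) \<le> real (msgs c)"
    "real (msgs c) \<le> 2 * \<rho> powr ((r + g / 2) * real (blen c))"
proof -
  let ?x = "\<rho> powr ((r + g / 2) * real (blen c))"
  have m: "real (msgs c) = real (nat \<lfloor>?x\<rfloor>) + 1" by (simp add: c_def scheduled_code_def Let_def)
  have "1 \<le> ?x" using assms by (intro ge_one_powr_ge_zero) auto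
  then show "?x \<le> real (msgs c)" "real (msgs c) \<le> 2 * ?x" unfolding m by linarith+
qed

lemma rate_scheduled_code:
  assumes "\<rho> > 1" "r \<ge> 0" "g > 0"
  shows "(r + g / 2) * ln \<rho> \<le> rate (scheduled_code t r g \<rho>)"
    "rate (scheduled_code t r g \<rho>) \<le> (r + g / 2) * ln \<rho> + 1"
proof -
  let ?c = "scheduled_code t r g \<rho>"
  have T: "real (blen ?c) \<ge> 1" using blen_scheduled_code(1)[OF assms(3)] by (simp add: Suc_le_eq)
  let ?x = "\<rho> powr ((r + g / 2) * real (blen ?c))"
  have x: "ln ?x = (r + g / 2) * ln \<rho> * real (blen ?c)" using assms by (simp add: ln_powr)
  have xp: "?x > 0" using assms by simp
  have m: "?x \<le> real (msgs ?c)" "real (msgs ?c) \<le> 2 * ?x" by (rule msgs_scheduled_code[OF assms])+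
  have "ln ?x \<le> ln (real (msgs ?c))" using m xp by (subst ln_le_cancel_iff) linarith+
  then show "(r + g / 2) * ln \<rho> \<le> rate ?c" using T unfolding rate_def x by (simp add: pos_le_divide_eq)
  have "ln (real (msgs ?c)) \<le> ln (2 * ?x)" using m xp by (subst ln_le_cancel_iff) linarith+
  also have "\<dots> = ln 2 + ln ?x" using xp by (subst ln_mult) auto
  also have "ln (2::real) \<le> 1 * real (blen ?c)" using ln_2_less_1 T by linarith
  finally have "ln (real (msgs ?c)) \<le> ((r + g / 2) * ln \<rho> + 1) * real (blen ?c)" unfolding x by (simp add: algebra_simps)
  then show "rate ?c \<le> (r + g / 2) * ln \<rho> + 1" using T unfolding rate_def by (simp add: pos_divide_le_eq)
qed

lemma valid_scheduled_code:
  assumes "g > 0" "t \<in> borel_measurable borel"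
  shows "valid_code (scheduled_code t r g \<rho>)"
  unfolding scheduled_code_def Let_def
  using assms by (intro valid_qmf_scheme measurable_compose[OF measurable_exponent]) auto

lemma eventually_error_terms:
  assumes "g > 0"
  shows "\<forall>\<^sub>F \<rho> in at_top. 8 * a * exp (- ((\<rho> powr (g / 24))\<^sup>2 / 2)) * \<rho>\<^sup>2 + 8 / \<rho> + (2 + log 2 \<rho>) ^ 4 \<le> \<rho> powr g"
proof -
  have "\<forall>\<^sub>F \<rho> in at_top. 8 * a * exp (- ((\<rho> powr (g / 24))\<^sup>2 / 2)) * \<rho>\<^sup>2 \<le> 1"
    using assms by real_asymp
  moreover have "\<forall>\<^sub>F \<rho>::real in at_top. 8 / \<rho> \<le> 1" by real_asymp
  moreover have "\<forall>\<^sub>F \<rho>::real in at_top. 2 + (2 + log 2 \<rho>) ^ 4 \<le> \<rho> powr g"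
    using assms by real_asymp
  ultimately show ?thesis by eventually_elim linarith
qed

lemma scheduled_code_error:
  assumes t: "protects t (r + g) d" and g: "g > 0" and r: "r \<ge> 0" and d: "d \<le> 2"
  shows "\<forall>\<^sub>F \<rho> in at_top. err_prob \<rho> (scheduled_code t r g \<rho>) \<le> \<rho> powr (g - d)"
proof -
  define T where "T = nat \<lceil>20 / g\<rceil>"
  have T: "T > 0" "20 / g \<le> real T" using blen_scheduled_code[OF g, of t r 1]
    by (simp_all add: scheduled_code_def Let_def T_def)
  have gT: "20 \<le> g * real T" using T(2) g by (simp add: pos_divide_le_eq mult.commute)
  have "\<forall>\<^sub>F \<rho>::real in at_top. 9 \<le> \<rho> powr (g / 24)" using g by real_asymp
  with eventually_error_terms[OF g, of "real T"] eventually_gt_at_top[of 1] show ?thesis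
  proof eventually_elim
    case (elim \<rho>)
    let ?\<kappa> = "\<rho> powr (g / 24)" and ?c = "scheduled_code t r g \<rho>"
    have "(2 * ?\<kappa> + 5)\<^sup>2 \<le> (3 * ?\<kappa>)\<^sup>2" using elim by (intro power_mono) auto
    also have "\<dots> = 9 * ?\<kappa>\<^sup>2" by (simp add: power_mult_distrib)
    also have "\<dots> \<le> ?\<kappa> * ?\<kappa>\<^sup>2" using elim by (intro mult_right_mono) auto
    also have "\<dots> = ?\<kappa> ^ 3" by (simp add: power3_eq_cube power2_eq_square)
    also have "\<dots> = \<rho> powr (g / 8)" using elim by (subst powr_power) auto
    finally have \<kappa>: "(2 * ?\<kappa> + 5)\<^sup>2 \<le> \<rho> powr (g / 8)" .
    have c: "?c = qmf_scheme \<rho> ?\<kappa> (\<lambda>_ h. t (exponent \<rho> h)) T (nat \<lfloor>\<rho> powr ((r + g / 2) * real T)\<rfloor> + 1)"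
      by (simp add: scheduled_code_def T_def Let_def)
    have M: "real (nat \<lfloor>\<rho> powr ((r + g / 2) * real T)\<rfloor> + 1) \<le> 2 * \<rho> powr ((r + g / 2) * real T)"
      using msgs_scheduled_code(2)[of \<rho> r g t] elim r g unfolding c by simp
    have "err_prob \<rho> ?c \<le> 8 * real T * exp (- (?\<kappa>\<^sup>2 / 2)) + 8 * \<rho> powr (-3) + \<rho> powr (- d) * (2 + log 2 \<rho>) ^ 4"
      unfolding c
    proof (rule scheduled_error[OF _ _ \<kappa> _ t T(1) _ M])
      show "(r + g / 2 + 2 * (g / 8)) * real T + 5 \<le> (r + g) * real T" using gT by (simp add: algebra_simps)
    qed (use elim g in auto)
    \<comment> \<open>Every term is brought to the factor \<open>\<rho> powr (- d)\<close>;
      \<open>d \<le> 2\<close> makes \<open>\<rho> powr (- d) * \<rho>\<^sup>2\<close> at least 1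
      and leaves a factor \<open>1 / \<rho>\<close> in \<open>\<rho> powr (-3)\<close>.\<close>
    also have "\<dots> \<le> 8 * real T * exp (- (?\<kappa>\<^sup>2 / 2)) * (\<rho> powr (- d) * \<rho>\<^sup>2) + 8 * (\<rho> powr (- d) / \<rho>) + \<rho> powr (- d) * (2 + log 2 \<rho>) ^ 4"
    proof (intro add_mono order_refl)
      have "1 \<le> \<rho> powr (2 - d)" using elim d by (intro ge_one_powr_ge_zero) auto
      then have 1: "1 \<le> \<rho> powr (- d) * \<rho>\<^sup>2" using elim by (simp add: powr_diff powr_minus_divide powr_numeral)
      then show "8 * real T * exp (- (?\<kappa>\<^sup>2 / 2)) \<le> 8 * real T * exp (- (?\<kappa>\<^sup>2 / 2)) * (\<rho> powr (- d) * \<rho>\<^sup>2)"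
        using mult_left_mono[OF 1, of "8 * real T * exp (- (?\<kappa>\<^sup>2 / 2))"] by simp
      have "\<rho> powr (-3) \<le> \<rho> powr (- d - 1)" using elim d by (intro powr_mono) auto
      also have "\<dots> = \<rho> powr (- d) / \<rho>" using elim by (simp add: powr_diff)
      finally show "8 * \<rho> powr (-3) \<le> 8 * (\<rho> powr (- d) / \<rho>)" by simp
    qed
    also have "\<dots> = \<rho> powr (- d) * (8 * real T * exp (- (?\<kappa>\<^sup>2 / 2)) * \<rho>\<^sup>2 + 8 / \<rho> + (2 + log 2 \<rho>) ^ 4)"
      by (simp add: algebra_simps)
    also have "\<dots> \<le> \<rho> powr (- d) * \<rho> powr g" using elim by (intro mult_left_mono) auto
    also have "\<dots> = \<rho> powr (g - d)" by (simp add: powr_add[symmetric])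
    finally show ?case .
  qed
qed

text \<open>Among the indices whose threshold \<open>N m\<close> has been passed, the largest is
  taken. The condition \<open>real m \<le> \<rho>\<close> makes these finitely many, and every fixed
  index is eventually available, so the choice tends to infinity.\<close>

lemma diagonal_index:
  fixes P :: "nat \<Rightarrow> real \<Rightarrow> bool"
  assumes "\<And>m. \<forall>\<^sub>F \<rho> in at_top. P m \<rho>"
  shows "\<exists>\<mu>. filterlim \<mu> at_top at_top \<and> (\<forall>\<^sub>F \<rho> in at_top. P (\<mu> \<rho>) \<rho>)"
proof -
  obtain N where N: "\<And>m \<rho>. \<rho> \<ge> N m \<Longrightarrow> P m \<rho>"
    using assms unfolding eventually_at_top_linorder by metis
  define A where "A \<rho> = {m. real m \<le> \<rho> \<and> N m \<le> \<rho>}" for \<rho>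
  have fin: "finite (A \<rho>)" for \<rho>
    by (rule finite_subset[of _ "{..nat \<lfloor>\<rho>\<rfloor>}"]) (auto simp: A_def le_nat_floor)
  show ?thesis
  proof (intro exI[of _ "\<lambda>\<rho>. Max (A \<rho>)"] conjI)
    show "filterlim (\<lambda>\<rho>. Max (A \<rho>)) at_top at_top"
      unfolding filterlim_at_top
    proof
      fix k
      show "\<forall>\<^sub>F \<rho> in at_top. k \<le> Max (A \<rho>)"
        using eventually_ge_at_top[of "real k"] eventually_ge_at_top[of "N k"]
        by eventually_elim (rule Max_ge[OF fin], simp add: A_def)
    qed
    show "\<forall>\<^sub>F \<rho> in at_top. P (Max (A \<rho>)) \<rho>"
      using eventually_ge_at_top[of "0"] eventually_ge_at_top[of "N 0"]
    proof eventually_elim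
      case (elim \<rho>)
      then have "A \<rho> \<noteq> {}" by (auto simp: A_def intro!: exI[of _ 0])
      then have "Max (A \<rho>) \<in> A \<rho>" using fin by (rule Max_in[rotated])
      then show ?case by (simp add: A_def N)
    qed
  qed
qed

text \<open>The bound \<open>1 \<le> rate\<close> is carried through the diagonalization: for
  \<open>r = 0\<close> the gap tends to 0, and the limit of the normalized rate alone would not keep
  the rate away from 0.\<close>

lemma scheduled_family:
  assumes t: "\<And>m. protects (t m) (r + g m) (d m)" and g: "\<And>m. g m > 0" "g \<longlonglongrightarrow> 0"
    and d: "\<And>m. d m \<le> 2" "d \<longlonglongrightarrow> d0" and r: "r \<ge> 0"
  shows "\<exists>\<mu>. admissible (\<lambda>\<rho>. scheduled_code (t (\<mu> \<rho>)) r (g (\<mu> \<rho>)) \<rho>) r \<and>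
    (\<forall>e>0. \<forall>\<^sub>F \<rho> in at_top. err_prob \<rho> (scheduled_code (t (\<mu> \<rho>)) r (g (\<mu> \<rho>)) \<rho>) \<le> \<rho> powr (e - d0))"
proof -
  let ?P = "\<lambda>m \<rho>. err_prob \<rho> (scheduled_code (t m) r (g m) \<rho>) \<le> \<rho> powr (g m - d m) \<and> 1 \<le> rate (scheduled_code (t m) r (g m) \<rho>)"
  have "\<forall>\<^sub>F \<rho> in at_top. ?P m \<rho>" for m
  proof (rule eventually_conj)
    show "\<forall>\<^sub>F \<rho> in at_top. err_prob \<rho> (scheduled_code (t m) r (g m) \<rho>) \<le> \<rho> powr (g m - d m)"
      by (rule scheduled_code_error[OF t g(1) r d(1)])
    have "r + g m / 2 > 0" using r g(1)[of m] by simp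
    then have "\<forall>\<^sub>F \<rho> in at_top. 1 \<le> (r + g m / 2) * ln \<rho>" by real_asymp
    then show "\<forall>\<^sub>F \<rho> in at_top. 1 \<le> rate (scheduled_code (t m) r (g m) \<rho>)"
      using eventually_gt_at_top[of 1]
    proof eventually_elim
      case (elim \<rho>)
      then show ?case using rate_scheduled_code(1)[where t="t m", OF elim(2) r g(1)[of m]] by linarith
    qed
  qed
  from diagonal_index[of ?P, OF this] obtain \<mu> where \<mu>: "filterlim \<mu> at_top at_top" "\<forall>\<^sub>F \<rho> in at_top. ?P (\<mu> \<rho>) \<rho>"
    by blast
  let ?c = "\<lambda>\<rho>. scheduled_code (t (\<mu> \<rho>)) r (g (\<mu> \<rho>)) \<rho>"
  have g\<mu>: "((\<lambda>\<rho>. g (\<mu> \<rho>)) \<longlongrightarrow> 0) at_top" and d\<mu>: "((\<lambda>\<rho>. d (\<mu> \<rho>)) \<longlongrightarrow> d0) at_top"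
    by (rule filterlim_compose[OF g(2) \<mu>(1)] filterlim_compose[OF d(2) \<mu>(1)])+
  have "admissible ?c r"
    unfolding admissible_def
  proof (intro conjI allI exI[of _ 1])
    show "valid_code (?c \<rho>)" for \<rho>
      using t[of "\<mu> \<rho>"] by (intro valid_scheduled_code g) (simp add: protects_def)
    have lo: "((\<lambda>\<rho>. r + g (\<mu> \<rho>) / 2) \<longlongrightarrow> r) at_top"
      using tendsto_add[OF tendsto_const tendsto_divide[OF g\<mu> tendsto_const[of 2]], of r] by simp
    have "((\<lambda>\<rho>::real. 1 / ln \<rho>) \<longlongrightarrow> 0) at_top" by real_asymp
    from tendsto_add[OF lo this] have hi: "((\<lambda>\<rho>. r + g (\<mu> \<rho>) / 2 + 1 / ln \<rho>) \<longlongrightarrow> r) at_top" by simp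
    show "((\<lambda>\<rho>. rate (?c \<rho>) / ln \<rho>) \<longlongrightarrow> r) at_top"
    proof (rule tendsto_sandwich[OF _ _ lo hi])
      show "\<forall>\<^sub>F \<rho> in at_top. r + g (\<mu> \<rho>) / 2 \<le> rate (?c \<rho>) / ln \<rho>"
        using eventually_gt_at_top[of 1]
        by eventually_elim (use rate_scheduled_code(1)[OF _ r g(1)] in \<open>simp add: pos_le_divide_eq\<close>)
      show "\<forall>\<^sub>F \<rho> in at_top. rate (?c \<rho>) / ln \<rho> \<le> r + g (\<mu> \<rho>) / 2 + 1 / ln \<rho>"
        using eventually_gt_at_top[of 1]
      proof eventually_elim
        case (elim \<rho>)
        then show ?case using rate_scheduled_code(2)[where t="t (\<mu> \<rho>)", OF elim r g(1)[of "\<mu> \<rho>"]]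
          by (simp add: pos_divide_le_eq distrib_right)
      qed
    qed
    show "\<forall>\<^sub>F \<rho> in at_top. 1 \<le> rate (?c \<rho>)" using \<mu>(2) by eventually_elim simp
  qed simp
  moreover have "\<forall>\<^sub>F \<rho> in at_top. err_prob \<rho> (?c \<rho>) \<le> \<rho> powr (e - d0)" if "e > 0" for e
  proof -
    have "((\<lambda>\<rho>. g (\<mu> \<rho>) - d (\<mu> \<rho>)) \<longlongrightarrow> 0 - d0) at_top" by (rule tendsto_diff[OF g\<mu> d\<mu>])
    then have "\<forall>\<^sub>F \<rho> in at_top. g (\<mu> \<rho>) - d (\<mu> \<rho>) < e - d0" using that by (intro order_tendstoD) auto
    with \<mu>(2) eventually_gt_at_top[of 1] show ?thesis
    proof eventually_elim
      case (elim \<rho>)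
      then have "\<rho> powr (g (\<mu> \<rho>) - d (\<mu> \<rho>)) \<le> \<rho> powr (e - d0)" by (intro powr_mono) auto
      with elim show ?case by linarith
    qed
  qed
  ultimately show ?thesis by blast
qed

text \<open>\<open>achieves\<close> asks for a limit and a positive error probability, and an upper
  bound on the error gives neither. Both come from the converse, applied to this very
  family.\<close>

lemma achieves_dmt_curve:
  assumes a: "admissible c r" and r: "0 \<le> r" "r \<le> 1"
    and up: "\<And>e. e > 0 \<Longrightarrow> \<forall>\<^sub>F \<rho> in at_top. err_prob \<rho> (c \<rho>) \<le> \<rho> powr (e - dmt_curve r)"
  shows "achieves c r (dmt_curve r)"
proof -
  let ?D = "dmt_curve r"
  have pos: "\<forall>\<^sub>F \<rho> in at_top. 0 < err_prob \<rho> (c \<rho>)"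
  proof -
    obtain K where "K > 0" "\<forall>\<^sub>F \<rho> in at_top. K * \<rho> powr (- (?D + 1)) \<le> err_prob \<rho> (c \<rho>)"
      using err_prob_lower[OF a r zero_less_one] by blast
    then show ?thesis using eventually_gt_at_top[of 0]
    proof (elim eventually_elim2)
      fix \<rho> :: real assume \<rho>: "K * \<rho> powr (- (?D + 1)) \<le> err_prob \<rho> (c \<rho>)" "0 < \<rho>"
      have "0 < K * \<rho> powr (- (?D + 1))" using \<open>K > 0\<close> \<rho>(2) by simp
      with \<rho>(1) show "0 < err_prob \<rho> (c \<rho>)" by linarith
    qed
  qed
  have "((\<lambda>\<rho>. ln (err_prob \<rho> (c \<rho>)) / ln \<rho>) \<longlongrightarrow> - ?D) at_top"
  proof (rule order_tendstoI)
    fix x assume x: "x < - ?D"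
    define e where "e = (- ?D - x) / 2"
    have e: "e > 0" using x by (simp add: e_def)
    obtain K where K: "K > 0" "\<forall>\<^sub>F \<rho> in at_top. K * \<rho> powr (- (?D + e)) \<le> err_prob \<rho> (c \<rho>)"
      using err_prob_lower[OF a r e] by blast
    have "\<forall>\<^sub>F \<rho> in at_top. - ln K / e < ln \<rho>" by real_asymp
    with K(2) eventually_gt_at_top[of 1] show "\<forall>\<^sub>F \<rho> in at_top. x < ln (err_prob \<rho> (c \<rho>)) / ln \<rho>"
    proof eventually_elim
      case (elim \<rho>)
      have "0 < K * \<rho> powr (- (?D + e))" using K(1) elim by simp
      then have "ln (K * \<rho> powr (- (?D + e))) \<le> ln (err_prob \<rho> (c \<rho>))" using elim by (subst ln_le_cancel_iff) auto
      moreover have "ln (K * \<rho> powr (- (?D + e))) = ln K - (?D + e) * ln \<rho>"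
        using K(1) elim by (subst ln_mult) (auto simp: ln_powr algebra_simps)
      moreover have "- ln K < e * ln \<rho>" using elim(3) unfolding pos_divide_less_eq[OF e] by (simp only: mult.commute)
      moreover have "- ?D - e = x + e" by (simp add: e_def field_simps)
      then have "- (?D + e) * ln \<rho> = x * ln \<rho> + e * ln \<rho>" by (simp add: algebra_simps)
      ultimately have "x * ln \<rho> < ln (err_prob \<rho> (c \<rho>))" by linarith
      then show ?case using elim by (simp add: pos_less_divide_eq)
    qed
  next
    fix x assume x: "- ?D < x"
    define e where "e = (x + ?D) / 2"
    have e: "e > 0" "e - ?D < x" using x by (simp_all add: e_def)
    from up[OF e(1)] pos eventually_gt_at_top[of 1] show "\<forall>\<^sub>F \<rho> in at_top. ln (err_prob \<rho> (c \<rho>)) / ln \<rho> < x"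
    proof eventually_elim
      case (elim \<rho>)
      have "ln (err_prob \<rho> (c \<rho>)) \<le> ln (\<rho> powr (e - ?D))" using elim by (subst ln_le_cancel_iff) auto
      also have "\<dots> = (e - ?D) * ln \<rho>" using elim by (simp add: ln_powr)
      also have "\<dots> < x * ln \<rho>" using e elim by (intro mult_strict_right_mono) auto
      finally show ?case using elim by (simp add: pos_divide_less_eq)
    qed
  qed
  then show ?thesis using a pos by (simp add: achieves_def admissible_def)
qed

lemma dynamic_achieves:
  assumes r: "0 \<le> r" "r < 1/2"
  shows "\<exists>c. dynamic_qmf c \<and> achieves c r (dmt_curve r)"
proof -
  \<comment> \<open>Positive, also for \<open>r = 0\<close>, and so small that
    \<open>r + g m\<close> stays in the range between 0 and 1/2 of the dynamic schedule; the 2 in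
    the denominator makes the upper bound strict.\<close>
  define g where "g m = (1/2 - r) / real (m + 2)" for m
  have g: "g m > 0" "r + g m < 1/2" for m
  proof -
    show "g m > 0" using r by (simp add: g_def)
    have "(1/2 - r) / real (m + 2) < (1/2 - r) / 1" using r by (intro divide_strict_left_mono) auto
    then have "g m < 1/2 - r" by (simp only: g_def div_by_1)
    then show "r + g m < 1/2" by linarith
  qed
  have g0: "g \<longlonglongrightarrow> 0" unfolding g_def by real_asymp
  define t where "t m = dynamic_schedule (r + g m)" for m
  define d where "d m = 2 - (r + g m) / (1 - (r + g m))" for m
  have t: "protects (t m) (r + g m) (d m)" for m
    unfolding t_def d_def by (rule protects_dynamic) (use g[of m] r in auto)
  have d2: "d m \<le> 2" for m using g[of m] r by (simp add: d_def)
  have "d \<longlonglongrightarrow> 2 - (r + 0) / (1 - (r + 0))" unfolding d_def by (intro tendsto_intros g0) (use r in auto)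
  then have "d \<longlonglongrightarrow> dmt_curve r" using r by (simp add: dmt_curve_def)
  from scheduled_family[OF t g(1) g0 d2 this r(1)] obtain \<mu> where
    \<mu>: "admissible (\<lambda>\<rho>. scheduled_code (t (\<mu> \<rho>)) r (g (\<mu> \<rho>)) \<rho>) r"
      "\<And>e. e > 0 \<Longrightarrow> \<forall>\<^sub>F \<rho> in at_top. err_prob \<rho> (scheduled_code (t (\<mu> \<rho>)) r (g (\<mu> \<rho>)) \<rho>) \<le> \<rho> powr (e - dmt_curve r)"
    by blast
  have "dynamic_qmf (\<lambda>\<rho>. scheduled_code (t (\<mu> \<rho>)) r (g (\<mu> \<rho>)) \<rho>)"
    unfolding dynamic_qmf_def
  proof (intro exI[of _ 2] exI[of _ "\<lambda>\<rho> _ h. t (\<mu> \<rho>) (exponent \<rho> h)"] conjI allI)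
    fix \<rho> h
    show "(\<lambda>h. t (\<mu> \<rho>) (exponent \<rho> h)) \<in> borel_measurable borel"
      using t[of "\<mu> \<rho>"] by (intro measurable_compose[OF measurable_exponent]) (simp add: protects_def)
    show "t (\<mu> \<rho>) (exponent \<rho> h) \<in> {0..1}"
      using t[of "\<mu> \<rho>"] by (simp add: protects_def)
    show "qmf_code 2 (\<lambda>_ h. t (\<mu> \<rho>) (exponent \<rho> h)) (scheduled_code (t (\<mu> \<rho>)) r (g (\<mu> \<rho>)) \<rho>)"
      unfolding scheduled_code_def Let_def by (rule qmf_code_qmf_scheme)
  qed
  then show ?thesis using achieves_dmt_curve[OF \<mu>(1) r(1) _ \<mu>(2)] r by auto
qed

lemma static_achieves:
  assumes r: "1/2 \<le> r" "r \<le> 1"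
  shows "\<exists>c. static_half_qmf c \<and> achieves c r (dmt_curve r)"
proof -
  define g where "g m = 1 / real (m + 1)" for m
  have g: "g m > 0" for m by (simp add: g_def)
  have g0: "g \<longlonglongrightarrow> 0" unfolding g_def by real_asymp
  define d where "d m = 2 * (1 - (r + g m))" for m
  have t: "protects (\<lambda>_. 1/2) (r + g m) (d m)" for m
    unfolding d_def by (rule protects_static)
  have d2: "d m \<le> 2" for m using g[of m] r by (simp add: d_def)
  have "d \<longlonglongrightarrow> 2 * (1 - (r + 0))" unfolding d_def by (intro tendsto_intros g0)
  then have "d \<longlonglongrightarrow> dmt_curve r" using r by (simp add: dmt_curve_def)
  from scheduled_family[where t="\<lambda>_ _. 1/2", OF t g g0 d2 this] r obtain \<mu> where
    \<mu>: "admissible (\<lambda>\<rho>. scheduled_code (\<lambda>_. 1/2) r (g (\<mu> \<rho>)) \<rho>) r"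
      "\<And>e. e > 0 \<Longrightarrow> \<forall>\<^sub>F \<rho> in at_top. err_prob \<rho> (scheduled_code (\<lambda>_. 1/2) r (g (\<mu> \<rho>)) \<rho>) \<le> \<rho> powr (e - dmt_curve r)"
    by auto
  have "static_half_qmf (\<lambda>\<rho>. scheduled_code (\<lambda>_. 1/2) r (g (\<mu> \<rho>)) \<rho>)"
    unfolding static_half_qmf_def scheduled_code_def Let_def
    by (intro exI[of _ 2] allI qmf_code_qmf_scheme)
  then show ?thesis using achieves_dmt_curve[OF \<mu>(1) _ r(2) \<mu>(2)] r by auto
qed

lemma dmt_eq:
  assumes r: "0 \<le> r" "r \<le> 1"
  shows "dmt r = ereal (dmt_curve r)"
proof (rule antisym)
  show "dmt r \<le> ereal (dmt_curve r)"
    unfolding dmt_def dmt_over_def by (rule Sup_least) (use dmt_converse r in auto)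
  obtain c where "achieves c r (dmt_curve r)"
    using dynamic_achieves[of r] static_achieves[of r] r by (cases "r < 1/2") auto
  then show "ereal (dmt_curve r) \<le> dmt r"
    unfolding dmt_def dmt_over_def by (intro Sup_upper) auto
qed

theorem theorem2:
  fixes r :: real
  assumes "0 \<le> r" and "r \<le> 1"
  shows "dmt r = ereal (if r < 1/2 then 2 - r / (1 - r) else 2 * (1 - r)) \<and>
    (r < 1/2 \<longrightarrow> (\<exists>c. dynamic_qmf c \<and> achieves c r (2 - r / (1 - r)))) \<and>
    (1/2 \<le> r \<longrightarrow> (\<exists>c. static_half_qmf c \<and> achieves c r (2 * (1 - r)))) \<and>
    (0 < r \<and> r < 1 \<longrightarrow> dmt_over (ddf r) r < dmt r \<and> dmt_over (split_ddf r) r < dmt r)"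
proof (intro conjI impI)
  show "dmt r = ereal (if r < 1/2 then 2 - r / (1 - r) else 2 * (1 - r))"
    using dmt_eq[OF assms] by (simp add: dmt_curve_def)
  show "\<exists>c. dynamic_qmf c \<and> achieves c r (2 - r / (1 - r))" if "r < 1/2"
    using dynamic_achieves[OF assms(1) that] that by (simp add: dmt_curve_def)
  show "\<exists>c. static_half_qmf c \<and> achieves c r (2 * (1 - r))" if "1/2 \<le> r"
    using static_achieves[OF that assms(2)] that by (simp add: dmt_curve_def)
  assume "0 < r \<and> r < 1"
  then show "dmt_over (ddf r) r < dmt r" "dmt_over (split_ddf r) r < dmt r"
    unfolding dmt_eq[OF assms] using ddf_suboptimal split_ddf_suboptimal by auto
qed

end
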